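(* Let $\mathsf A$ be a locally discrete $\mathscr F$-sketch (whose marked cones are all inert) and let $M:\mathsf A\to\mathsf{Set}$ be a strict, set-valued model of $\mathsf A$. Let $\pi_M:\mathcal{E}\mathsf l(M)\to\mathsf A$ be the category of elements of $M$, and equip $\mathcal{E}\mathsf l(M)$ with the $\mathscr F$-sketch structure in which the inert 1-cells are those whose underlying 1-cell in $\mathsf A$ is inert, and the marked cones are those mapped by $\pi_M$ to marked cones in $\mathsf A$. Then, regarding $M$ as a (discrete) pseudo-model in $\mathcal{C}\mathsf{at}$, there is an equivalence of 2-categories $$\mathcal{P}\mathsf{sMod}^{\mathsf p}_{\mathscr F}(\mathsf A,\mathcal{C}\mathsf{at})\downarrow M\;\simeq\;\mathcal{P}\mathsf{sMod}^{\mathsf p}_{\mathscr F}(\mathcal{E}\mathsf l(M),\mathcal{C}\mathsf{at}).$$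
   Context: An $\mathscr F$-category $\mathcal A$ is a 2-category with a class of 1-cells called *inert*, containing identities and closed under composition; $\mathcal A_{\mathsf{inert}}$ is the locally full sub-2-category spanned by the inerts. It is *chordate* if all 1-cells are inert, and *locally discrete* if all 2-cells are identities (so it is a category with a wide subcategory of inerts). A *cone* in $\mathcal A$ with vertex $a$ is a strict 2-functor $S:\mathcal J\to a\downarrow\mathcal A_{\mathsf{inert}}$ into the coslice. An $\mathscr F$-sketch is an $\mathscr F$-category with a collection of cones called *marked*. A pseudo-$\mathscr F$-functor $F:\mathcal A\to\mathcal B$ is a pseudofunctor between underlying 2-categories which preserves inerts, whose unitors $1_{Fx}\Rightarrow F(1_x)$ are identities, and whose compositors $Fg\,Ff\Rightarrow F(gf)$ are identities whenever $f$ or $g$ is inert. A pseudo-$\mathscr F$-transformation is a pseudonatural transformation whose naturality 2-cells at inert 1-cells are identities. Regard $\mathcal{C}\mathsf{at}$ (the 2-category of small categories) as a chordate $\mathscr F$-category. A pseudo-model of an $\mathscr F$-sketch $\mathcal A$ in $\mathcal{C}\mathsf{at}$ is a pseudo-$\mathscr F$-functor $M:\mathcal A\to\mathcal{C}\mathsf{at}$ sending each marked cone $S:\mathcal J\to a\downarrow\mathcal A_{\mathsf{inert}}$ to a limit cone (vertex $Ma$, legs $M(S_j)$). $\mathcal{P}\mathsf{sMod}^{\mathsf p}_{\mathscr F}(\mathcal A,\mathcal{C}\mathsf{at})$ is the 2-category of pseudo-models, pseudo-$\mathscr F$-transformations and modifications. A strict set-valued model is a functor $\mathsf A\to\mathsf{Set}$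 sending marked cones to limit cones; it becomes a pseudo-model in $\mathcal{C}\mathsf{at}$ by regarding sets as discrete categories. A cone $S:\mathsf J\to e\downarrow\mathcal{E}\mathsf l(M)_{\mathsf{inert}}$ is mapped by $\pi_M$ to its composite with $e\downarrow\mathcal{E}\mathsf l(M)_{\mathsf{inert}}\to\pi_M(e)\downarrow\mathsf A_{\mathsf{inert}}$. The symbol $\mathcal K\downarrow M$ denotes the strict slice 2-category (objects 1-cells into $M$, 1-cells strictly commuting triangles, 2-cells those whose whiskering with the 1-cell to $M$ is an identity). *)

theory Defs
  imports Main "HOL-Library.FuncSet"
begin

section \<open>2-categories\<close>

text \<open>
  Strict 2-categories, with carriers for the 0-cells, 1-cells and 2-cells.
  Compositions are written in applicative order: \<open>g \<cdot> f\<close> is \<open>g\<close> after \<open>f\<close>, \<open>\<delta> \<bullet> \<gamma>\<close> is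
  vertical and \<open>\<delta> \<star> \<gamma>\<close> is horizontal composition. Whiskering is horizontal composition
  with an identity 2-cell \<open>Idc f\<close>.
\<close>

record ('o, 'm, 'c) twocat =
  Obj :: "'o set"
  Mor :: "'m set"
  Cell :: "'c set"
  Dom :: "'m \<Rightarrow> 'o"
  Cod :: "'m \<Rightarrow> 'o"
  Src :: "'c \<Rightarrow> 'm"
  Tgt :: "'c \<Rightarrow> 'm"
  Idm :: "'o \<Rightarrow> 'm"
  Idc :: "'m \<Rightarrow> 'c"
  Cmp :: "'m \<Rightarrow> 'm \<Rightarrow> 'm"  (infixl "\<cdot>\<index>" 75)
  Vcm :: "'c \<Rightarrow> 'c \<Rightarrow> 'c"  (infixl "\<bullet>\<index>" 70)
  Hcm :: "'c \<Rightarrow> 'c \<Rightarrow> 'c"  (infixl "\<star>\<index>" 75)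

definition hom :: "('o, 'm, 'c, 'z) twocat_scheme \<Rightarrow> 'o \<Rightarrow> 'o \<Rightarrow> 'm set" where
  "hom K x y = {f \<in> Mor K. Dom K f = x \<and> Cod K f = y}"

definition cells :: "('o, 'm, 'c, 'z) twocat_scheme \<Rightarrow> 'm \<Rightarrow> 'm \<Rightarrow> 'c set" where
  "cells K f g = {\<gamma> \<in> Cell K. Src K \<gamma> = f \<and> Tgt K \<gamma> = g}"

locale two_category =
  fixes K :: "('o, 'm, 'c, 'z) twocat_scheme" (structure)
  assumes Dom_closed: "f \<in> Mor K \<Longrightarrow> Dom K f \<in> Obj K"
    and Cod_closed: "f \<in> Mor K \<Longrightarrow> Cod K f \<in> Obj K"
    and Src_closed: "\<gamma> \<in> Cell K \<Longrightarrow> Src K \<gamma> \<in> Mor K"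
    and Tgt_closed: "\<gamma> \<in> Cell K \<Longrightarrow> Tgt K \<gamma> \<in> Mor K"
    and Dom_parallel: "\<gamma> \<in> Cell K \<Longrightarrow> Dom K (Src K \<gamma>) = Dom K (Tgt K \<gamma>)"
    and Cod_parallel: "\<gamma> \<in> Cell K \<Longrightarrow> Cod K (Src K \<gamma>) = Cod K (Tgt K \<gamma>)"
    and Idm_hom: "x \<in> Obj K \<Longrightarrow> Idm K x \<in> hom K x x"
    and Cmp_hom: "\<lbrakk>f \<in> hom K x y; g \<in> hom K y z\<rbrakk> \<Longrightarrow> g \<cdot> f \<in> hom K x z"
    and Cmp_Idm_right: "f \<in> hom K x y \<Longrightarrow> f \<cdot> Idm K x = f"
    and Cmp_Idm_left: "f \<in> hom K x y \<Longrightarrow> Idm K y \<cdot> f = f"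
    and Cmp_assoc:
      "\<lbrakk>f \<in> hom K w x; g \<in> hom K x y; h \<in> hom K y z\<rbrakk> \<Longrightarrow> h \<cdot> (g \<cdot> f) = (h \<cdot> g) \<cdot> f"
    and Idc_cells: "f \<in> Mor K \<Longrightarrow> Idc K f \<in> cells K f f"
    and Vcm_cells: "\<lbrakk>\<alpha> \<in> cells K f g; \<beta> \<in> cells K g h\<rbrakk> \<Longrightarrow> \<beta> \<bullet> \<alpha> \<in> cells K f h"
    and Vcm_Idc_right: "\<alpha> \<in> cells K f g \<Longrightarrow> \<alpha> \<bullet> Idc K f = \<alpha>"
    and Vcm_Idc_left: "\<alpha> \<in> cells K f g \<Longrightarrow> Idc K g \<bullet> \<alpha> = \<alpha>"
    and Vcm_assoc:
      "\<lbrakk>\<alpha> \<in> cells K e f; \<beta> \<in> cells K f g; \<gamma> \<in> cells K g h\<rbrakk>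
        \<Longrightarrow> \<gamma> \<bullet> (\<beta> \<bullet> \<alpha>) = (\<gamma> \<bullet> \<beta>) \<bullet> \<alpha>"
    and Hcm_cells:
      "\<lbrakk>\<alpha> \<in> cells K f f'; \<beta> \<in> cells K g g'; Cod K f = Dom K g\<rbrakk>
        \<Longrightarrow> \<beta> \<star> \<alpha> \<in> cells K (g \<cdot> f) (g' \<cdot> f')"
    and Hcm_Idm_right:
      "\<lbrakk>\<alpha> \<in> cells K f g; Dom K f = x\<rbrakk> \<Longrightarrow> \<alpha> \<star> Idc K (Idm K x) = \<alpha>"
    and Hcm_Idm_left:
      "\<lbrakk>\<alpha> \<in> cells K f g; Cod K f = y\<rbrakk> \<Longrightarrow> Idc K (Idm K y) \<star> \<alpha> = \<alpha>"
    and Hcm_assoc: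
      "\<lbrakk>\<alpha> \<in> cells K f f'; \<beta> \<in> cells K g g'; \<gamma> \<in> cells K h h'; Cod K f = Dom K g; Cod K g = Dom K h\<rbrakk>
        \<Longrightarrow> \<gamma> \<star> (\<beta> \<star> \<alpha>) = (\<gamma> \<star> \<beta>) \<star> \<alpha>"
    and Hcm_Idc: "\<lbrakk>f \<in> hom K x y; g \<in> hom K y z\<rbrakk> \<Longrightarrow> Idc K g \<star> Idc K f = Idc K (g \<cdot> f)"
    and interchange:
      "\<lbrakk>\<alpha> \<in> cells K f f'; \<alpha>' \<in> cells K f' f''; \<beta> \<in> cells K g g'; \<beta>' \<in> cells K g' g'';
        Cod K f = Dom K g\<rbrakk>
        \<Longrightarrow> (\<beta>' \<bullet> \<beta>) \<star> (\<alpha>' \<bullet> \<alpha>) = (\<beta>' \<star> \<alpha>') \<bullet> (\<beta> \<star> \<alpha>)"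

definition invertible_cell :: "('o, 'm, 'c, 'z) twocat_scheme \<Rightarrow> 'c \<Rightarrow> bool" where
  "invertible_cell K \<gamma> \<longleftrightarrow> \<gamma> \<in> Cell K \<and>
     (\<exists>\<delta> \<in> cells K (Tgt K \<gamma>) (Src K \<gamma>).
        \<delta> \<bullet>\<^bsub>K\<^esub> \<gamma> = Idc K (Src K \<gamma>) \<and> \<gamma> \<bullet>\<^bsub>K\<^esub> \<delta> = Idc K (Tgt K \<gamma>))"

definition locally_discrete :: "('o, 'm, 'c, 'z) twocat_scheme \<Rightarrow> bool" where
  "locally_discrete K \<longleftrightarrow> (\<forall>\<gamma> \<in> Cell K. \<gamma> = Idc K (Src K \<gamma>))"

text \<open>
  Strict slice over, and strict coslice under, an object. A 1-cell \<open>p \<rightarrow> q\<close> is stored as the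
  triple \<open>(p, h, q)\<close> so that it determines its domain and codomain; likewise for 2-cells. The
  middle entry, the underlying cell of the ambient 2-category, is extracted by \<open>triangle\<close>.
\<close>

definition triangle :: "'p \<times> 'm \<times> 'q \<Rightarrow> 'm" where
  "triangle t = fst (snd t)"

definition slice ::
  "('o, 'm, 'c, 'z) twocat_scheme \<Rightarrow> 'o \<Rightarrow> ('m, 'm \<times> 'm \<times> 'm, 'm \<times> 'c \<times> 'm) twocat" where
  "slice K x =
     (let ob = {p \<in> Mor K. Cod K p = x};
          mo = {(p, h, q). p \<in> ob \<and> q \<in> ob \<and> h \<in> hom K (Dom K p) (Dom K q) \<and> q \<cdot>\<^bsub>K\<^esub> h = p}
      in \<lparr>Obj = ob,
          Mor = mo,
          Cell = {(p, \<gamma>, q). \<gamma> \<in> Cell K \<and> (p, Src K \<gamma>, q) \<in> mo \<and> (p, Tgt K \<gamma>, q) \<in> mo \<and>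
                    Idc K q \<star>\<^bsub>K\<^esub> \<gamma> = Idc K p},
          Dom = (\<lambda>(p, h, q). p),
          Cod = (\<lambda>(p, h, q). q),
          Src = (\<lambda>(p, \<gamma>, q). (p, Src K \<gamma>, q)),
          Tgt = (\<lambda>(p, \<gamma>, q). (p, Tgt K \<gamma>, q)),
          Idm = (\<lambda>p. (p, Idm K (Dom K p), p)),
          Idc = (\<lambda>(p, h, q). (p, Idc K h, q)),
          Cmp = (\<lambda>(_, k, r) (p, h, _). (p, k \<cdot>\<^bsub>K\<^esub> h, r)),
          Vcm = (\<lambda>(_, \<delta>, _) (p, \<gamma>, q). (p, \<delta> \<bullet>\<^bsub>K\<^esub> \<gamma>, q)),
          Hcm = (\<lambda>(_, \<delta>, r) (p, \<gamma>, _). (p, \<delta> \<star>\<^bsub>K\<^esub> \<gamma>, r))\<rparr>)"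

definition coslice ::
  "('o, 'm, 'c, 'z) twocat_scheme \<Rightarrow> 'o \<Rightarrow> ('m, 'm \<times> 'm \<times> 'm, 'm \<times> 'c \<times> 'm) twocat" where
  "coslice K x =
     (let ob = {f \<in> Mor K. Dom K f = x};
          mo = {(f, h, g). f \<in> ob \<and> g \<in> ob \<and> h \<in> hom K (Cod K f) (Cod K g) \<and> h \<cdot>\<^bsub>K\<^esub> f = g}
      in \<lparr>Obj = ob,
          Mor = mo,
          Cell = {(f, \<gamma>, g). \<gamma> \<in> Cell K \<and> (f, Src K \<gamma>, g) \<in> mo \<and> (f, Tgt K \<gamma>, g) \<in> mo \<and>
                    \<gamma> \<star>\<^bsub>K\<^esub> Idc K f = Idc K g},
          Dom = (\<lambda>(f, h, g). f),
          Cod = (\<lambda>(f, h, g). g),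
          Src = (\<lambda>(f, \<gamma>, g). (f, Src K \<gamma>, g)),
          Tgt = (\<lambda>(f, \<gamma>, g). (f, Tgt K \<gamma>, g)),
          Idm = (\<lambda>f. (f, Idm K (Cod K f), f)),
          Idc = (\<lambda>(f, h, g). (f, Idc K h, g)),
          Cmp = (\<lambda>(_, k, r) (f, h, _). (f, k \<cdot>\<^bsub>K\<^esub> h, r)),
          Vcm = (\<lambda>(_, \<delta>, _) (f, \<gamma>, g). (f, \<delta> \<bullet>\<^bsub>K\<^esub> \<gamma>, g)),
          Hcm = (\<lambda>(_, \<delta>, r) (f, \<gamma>, _). (f, \<delta> \<star>\<^bsub>K\<^esub> \<gamma>, r))\<rparr>)"


section \<open>Strict 2-functors and equivalence of 2-categories\<close>

record ('o, 'm, 'c, 'p, 'n, 'd) twofun =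
  ob :: "'o \<Rightarrow> 'p"
  mo :: "'m \<Rightarrow> 'n"
  ce :: "'c \<Rightarrow> 'd"

locale strict_twofunctor = A: two_category A + B: two_category B
  for A :: "('o, 'm, 'c, 'y) twocat_scheme"
    and B :: "('p, 'n, 'd, 'z) twocat_scheme"
    and F :: "('o, 'm, 'c, 'p, 'n, 'd, 'f) twofun_scheme" +
  assumes ob_closed: "x \<in> Obj A \<Longrightarrow> ob F x \<in> Obj B"
    and mo_hom: "f \<in> hom A x y \<Longrightarrow> mo F f \<in> hom B (ob F x) (ob F y)"
    and ce_cells: "\<gamma> \<in> cells A f g \<Longrightarrow> ce F \<gamma> \<in> cells B (mo F f) (mo F g)"
    and mo_Idm: "x \<in> Obj A \<Longrightarrow> mo F (Idm A x) = Idm B (ob F x)"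
    and mo_Cmp: "\<lbrakk>f \<in> hom A x y; g \<in> hom A y z\<rbrakk> \<Longrightarrow> mo F (g \<cdot>\<^bsub>A\<^esub> f) = mo F g \<cdot>\<^bsub>B\<^esub> mo F f"
    and ce_Idc: "f \<in> Mor A \<Longrightarrow> ce F (Idc A f) = Idc B (mo F f)"
    and ce_Vcm:
      "\<lbrakk>\<gamma> \<in> cells A f g; \<delta> \<in> cells A g h\<rbrakk> \<Longrightarrow> ce F (\<delta> \<bullet>\<^bsub>A\<^esub> \<gamma>) = ce F \<delta> \<bullet>\<^bsub>B\<^esub> ce F \<gamma>"
    and ce_Hcm:
      "\<lbrakk>\<gamma> \<in> cells A f f'; \<delta> \<in> cells A g g'; Cod A f = Dom A g\<rbrakk>
        \<Longrightarrow> ce F (\<delta> \<star>\<^bsub>A\<^esub> \<gamma>) = ce F \<delta> \<star>\<^bsub>B\<^esub> ce F \<gamma>"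

definition twofun_id :: "('o, 'm, 'c, 'o, 'm, 'c) twofun" where
  "twofun_id = \<lparr>ob = (\<lambda>x. x), mo = (\<lambda>f. f), ce = (\<lambda>\<gamma>. \<gamma>)\<rparr>"

definition twofun_comp ::
  "('p, 'n, 'd, 'q, 'k, 'e) twofun \<Rightarrow> ('o, 'm, 'c, 'p, 'n, 'd) twofun
    \<Rightarrow> ('o, 'm, 'c, 'q, 'k, 'e) twofun" where
  "twofun_comp G F = \<lparr>ob = ob G \<circ> ob F, mo = mo G \<circ> mo F, ce = ce G \<circ> ce F\<rparr>"

definition invertible_mor :: "('o, 'm, 'c, 'z) twocat_scheme \<Rightarrow> 'm \<Rightarrow> bool" where
  "invertible_mor K f \<longleftrightarrow> f \<in> Mor K \<and>
     (\<exists>g \<in> hom K (Cod K f) (Dom K f).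
        g \<cdot>\<^bsub>K\<^esub> f = Idm K (Dom K f) \<and> f \<cdot>\<^bsub>K\<^esub> g = Idm K (Cod K f))"

locale two_natural_iso = F: strict_twofunctor A B F + G: strict_twofunctor A B G
  for A :: "('o, 'm, 'c, 'y) twocat_scheme"
    and B :: "('p, 'n, 'd, 'z) twocat_scheme"
    and F :: "('o, 'm, 'c, 'p, 'n, 'd) twofun"
    and G :: "('o, 'm, 'c, 'p, 'n, 'd) twofun"
    and \<theta> :: "'o \<Rightarrow> 'n" +
  assumes component_hom: "x \<in> Obj A \<Longrightarrow> \<theta> x \<in> hom B (ob F x) (ob G x)"
    and component_iso: "x \<in> Obj A \<Longrightarrow> invertible_mor B (\<theta> x)"
    and natural_mor: "f \<in> hom A x y \<Longrightarrow> mo G f \<cdot>\<^bsub>B\<^esub> \<theta> x = \<theta> y \<cdot>\<^bsub>B\<^esub> mo F f"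
    and natural_cell:
      "\<lbrakk>\<gamma> \<in> cells A f g; f \<in> hom A x y\<rbrakk>
        \<Longrightarrow> ce G \<gamma> \<star>\<^bsub>B\<^esub> Idc B (\<theta> x) = Idc B (\<theta> y) \<star>\<^bsub>B\<^esub> ce F \<gamma>"

text \<open>
  Equivalence in the strict, i.e. \<open>\<C>at\<close>-enriched, sense: strict 2-functors in both directions,
  mutually inverse up to 2-natural isomorphism. In particular this implies biequivalence.
\<close>

definition equivalent_twocats ::
  "('o, 'm, 'c, 'y) twocat_scheme \<Rightarrow> ('p, 'n, 'd, 'z) twocat_scheme \<Rightarrow> bool" where
  "equivalent_twocats A B \<longleftrightarrow>
     (\<exists>(F :: ('o, 'm, 'c, 'p, 'n, 'd) twofun) (G :: ('p, 'n, 'd, 'o, 'm, 'c) twofun) \<eta> \<epsilon>.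
        strict_twofunctor A B F \<and> strict_twofunctor B A G \<and>
        two_natural_iso A A twofun_id (twofun_comp G F) \<eta> \<and>
        two_natural_iso B B (twofun_comp F G) twofun_id \<epsilon>)"


section \<open>Conical limits in a 2-category\<close>

definition limit_diagram_cone ::
  "('i, 'j, 'k, 'y) twocat_scheme \<Rightarrow> ('o, 'm, 'c, 'z) twocat_scheme
    \<Rightarrow> ('i, 'j, 'k, 'o, 'm, 'c, 'f) twofun_scheme \<Rightarrow> 'o \<Rightarrow> ('i \<Rightarrow> 'm) \<Rightarrow> bool" where
  "limit_diagram_cone J K D x \<mu> \<longleftrightarrow>
     x \<in> Obj K \<and>
     (\<forall>j \<in> Obj J. \<mu> j \<in> hom K x (ob D j)) \<and>
     (\<forall>u \<in> Mor J. mo D u \<cdot>\<^bsub>K\<^esub> \<mu> (Dom J u) = \<mu> (Cod J u)) \<and>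
     (\<forall>\<sigma> \<in> Cell J. ce D \<sigma> \<star>\<^bsub>K\<^esub> Idc K (\<mu> (Dom J (Src J \<sigma>))) = Idc K (\<mu> (Cod J (Src J \<sigma>))))"

text \<open>
  The universal property of a conical 2-limit: composition with the legs is an isomorphism from
  the hom-category \<open>K(x, v)\<close> to the category of cones with vertex \<open>x\<close> and their modifications.
\<close>

definition limit_cone ::
  "('i, 'j, 'k, 'y) twocat_scheme \<Rightarrow> ('o, 'm, 'c, 'z) twocat_scheme
    \<Rightarrow> ('i, 'j, 'k, 'o, 'm, 'c, 'f) twofun_scheme \<Rightarrow> 'o \<Rightarrow> ('i \<Rightarrow> 'm) \<Rightarrow> bool" where
  "limit_cone J K D v leg \<longleftrightarrow>
     limit_diagram_cone J K D v leg \<and>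
     (\<forall>x \<mu>. limit_diagram_cone J K D x \<mu> \<longrightarrow>
        (\<exists>!h. h \<in> hom K x v \<and> (\<forall>j \<in> Obj J. leg j \<cdot>\<^bsub>K\<^esub> h = \<mu> j))) \<and>
     (\<forall>x h h' \<Gamma>. h \<in> hom K x v \<and> h' \<in> hom K x v \<and>
        (\<forall>j \<in> Obj J. \<Gamma> j \<in> cells K (leg j \<cdot>\<^bsub>K\<^esub> h) (leg j \<cdot>\<^bsub>K\<^esub> h')) \<and>
        (\<forall>u \<in> Mor J. Idc K (mo D u) \<star>\<^bsub>K\<^esub> \<Gamma> (Dom J u) = \<Gamma> (Cod J u)) \<longrightarrow>
        (\<exists>!\<gamma>. \<gamma> \<in> cells K h h' \<and> (\<forall>j \<in> Obj J. Idc K (leg j) \<star>\<^bsub>K\<^esub> \<gamma> = \<Gamma> j)))"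


section \<open>\<open>\<F>\<close>-categories and \<open>\<F>\<close>-sketches\<close>

record ('o, 'm, 'c) fcat = "('o, 'm, 'c) twocat" +
  inert :: "'m set"

locale f_category = two_category A
  for A :: "('o, 'm, 'c, 'z) fcat_scheme" (structure) +
  assumes inert_Mor: "inert A \<subseteq> Mor A"
    and inert_Idm: "x \<in> Obj A \<Longrightarrow> Idm A x \<in> inert A"
    and inert_Cmp: "\<lbrakk>f \<in> inert A; g \<in> inert A; Cod A f = Dom A g\<rbrakk> \<Longrightarrow> g \<cdot> f \<in> inert A"

definition inert_part :: "('o, 'm, 'c, 'z) fcat_scheme \<Rightarrow> ('o, 'm, 'c, 'z) fcat_scheme" where
  "inert_part A = A\<lparr>Mor := inert A, Cell := {\<gamma> \<in> Cell A. Src A \<gamma> \<in> inert A \<and> Tgt A \<gamma> \<in> inert A}\<rparr>"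

text \<open>
  A cone consists of its vertex \<open>a\<close>, its indexing 2-category and a strict 2-functor \<open>legs\<close> into the
  coslice; for an object \<open>j\<close> of the indexing 2-category, \<open>ob (legs S) j\<close> is the leg at \<open>j\<close>.
  The 2-functor is required to be \<open>undefined\<close> off the carriers, so that equality of cones
  is equality of the 2-functors.
\<close>

record ('o, 'm, 'c, 'i, 'j, 'k) cone =
  vertex :: 'o
  shape :: "('i, 'j, 'k) twocat"
  legs :: "('i, 'j, 'k, 'm, 'm \<times> 'm \<times> 'm, 'm \<times> 'c \<times> 'm) twofun"

definition is_cone :: "('o, 'm, 'c, 'z) fcat_scheme \<Rightarrow> ('o, 'm, 'c, 'i, 'j, 'k) cone \<Rightarrow> bool" where
  "is_cone A S \<longleftrightarrow>
     vertex S \<in> Obj A \<and>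
     strict_twofunctor (shape S) (coslice (inert_part A) (vertex S)) (legs S) \<and>
     ob (legs S) \<in> extensional (Obj (shape S)) \<and>
     mo (legs S) \<in> extensional (Mor (shape S)) \<and>
     ce (legs S) \<in> extensional (Cell (shape S))"

record ('o, 'm, 'c, 'i, 'j, 'k) fsketch = "('o, 'm, 'c) fcat" +
  marked :: "('o, 'm, 'c, 'i, 'j, 'k) cone set"

locale f_sketch = f_category A
  for A :: "('o, 'm, 'c, 'i, 'j, 'k, 'z) fsketch_scheme" (structure) +
  assumes marked_cone: "S \<in> marked A \<Longrightarrow> is_cone A S"


section \<open>Pseudo-\<open>\<F>\<close>-functors, pseudo-\<open>\<F>\<close>-transformations, modifications\<close>

text \<open>
  \<open>un F x : 1 \<Rightarrow> F 1\<close> are the unitors and \<open>cp F g f : F g F f \<Rightarrow> F (g f)\<close> the compositors.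
  All components are \<open>undefined\<close> off the relevant carriers, so that equality in HOL is equality of
  pseudofunctors. The same convention is used for transformations and modifications.
\<close>

record ('o, 'm, 'c, 'p, 'n, 'd) psfun = "('o, 'm, 'c, 'p, 'n, 'd) twofun" +
  un :: "'o \<Rightarrow> 'd"
  cp :: "'m \<Rightarrow> 'm \<Rightarrow> 'd"

locale pseudofunctor = A: two_category A + B: two_category B
  for A :: "('o, 'm, 'c, 'y) twocat_scheme"
    and B :: "('p, 'n, 'd, 'z) twocat_scheme"
    and F :: "('o, 'm, 'c, 'p, 'n, 'd) psfun" +
  assumes ob_closed: "x \<in> Obj A \<Longrightarrow> ob F x \<in> Obj B"
    and mo_hom: "f \<in> hom A x y \<Longrightarrow> mo F f \<in> hom B (ob F x) (ob F y)"
    and ce_cells: "\<gamma> \<in> cells A f g \<Longrightarrow> ce F \<gamma> \<in> cells B (mo F f) (mo F g)"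
    and ce_Idc: "f \<in> Mor A \<Longrightarrow> ce F (Idc A f) = Idc B (mo F f)"
    and ce_Vcm:
      "\<lbrakk>\<gamma> \<in> cells A f g; \<delta> \<in> cells A g h\<rbrakk> \<Longrightarrow> ce F (\<delta> \<bullet>\<^bsub>A\<^esub> \<gamma>) = ce F \<delta> \<bullet>\<^bsub>B\<^esub> ce F \<gamma>"
    and un_cells: "x \<in> Obj A \<Longrightarrow> un F x \<in> cells B (Idm B (ob F x)) (mo F (Idm A x))"
    and un_invertible: "x \<in> Obj A \<Longrightarrow> invertible_cell B (un F x)"
    and cp_cells:
      "\<lbrakk>f \<in> hom A x y; g \<in> hom A y z\<rbrakk>
        \<Longrightarrow> cp F g f \<in> cells B (mo F g \<cdot>\<^bsub>B\<^esub> mo F f) (mo F (g \<cdot>\<^bsub>A\<^esub> f))"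
    and cp_invertible:
      "\<lbrakk>f \<in> hom A x y; g \<in> hom A y z\<rbrakk> \<Longrightarrow> invertible_cell B (cp F g f)"
    and cp_natural:
      "\<lbrakk>\<gamma> \<in> cells A f f'; \<delta> \<in> cells A g g'; Cod A f = Dom A g\<rbrakk>
        \<Longrightarrow> cp F g' f' \<bullet>\<^bsub>B\<^esub> (ce F \<delta> \<star>\<^bsub>B\<^esub> ce F \<gamma>) = ce F (\<delta> \<star>\<^bsub>A\<^esub> \<gamma>) \<bullet>\<^bsub>B\<^esub> cp F g f"
    and cp_assoc:
      "\<lbrakk>f \<in> hom A w x; g \<in> hom A x y; h \<in> hom A y z\<rbrakk>
        \<Longrightarrow> cp F h (g \<cdot>\<^bsub>A\<^esub> f) \<bullet>\<^bsub>B\<^esub> (Idc B (mo F h) \<star>\<^bsub>B\<^esub> cp F g f)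
          = cp F (h \<cdot>\<^bsub>A\<^esub> g) f \<bullet>\<^bsub>B\<^esub> (cp F h g \<star>\<^bsub>B\<^esub> Idc B (mo F f))"
    and cp_un_right:
      "f \<in> hom A x y
        \<Longrightarrow> cp F f (Idm A x) \<bullet>\<^bsub>B\<^esub> (Idc B (mo F f) \<star>\<^bsub>B\<^esub> un F x) = Idc B (mo F f)"
    and cp_un_left:
      "f \<in> hom A x y
        \<Longrightarrow> cp F (Idm A y) f \<bullet>\<^bsub>B\<^esub> (un F y \<star>\<^bsub>B\<^esub> Idc B (mo F f)) = Idc B (mo F f)"
    and ob_extensional: "ob F \<in> extensional (Obj A)"
    and mo_extensional: "mo F \<in> extensional (Mor A)"
    and ce_extensional: "ce F \<in> extensional (Cell A)"
    and un_extensional: "un F \<in> extensional (Obj A)"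
    and cp_extensional:
      "\<not> (f \<in> Mor A \<and> g \<in> Mor A \<and> Cod A f = Dom A g) \<Longrightarrow> cp F g f = undefined"

locale pseudo_f_functor = A: f_category A + B: f_category B + pseudofunctor A B F
  for A :: "('o, 'm, 'c, 'y) fcat_scheme"
    and B :: "('p, 'n, 'd, 'z) fcat_scheme"
    and F :: "('o, 'm, 'c, 'p, 'n, 'd) psfun" +
  assumes mo_inert: "f \<in> inert A \<Longrightarrow> mo F f \<in> inert B"
    and un_identity: "x \<in> Obj A \<Longrightarrow> un F x = Idc B (Idm B (ob F x))"
    and cp_identity:
      "\<lbrakk>f \<in> hom A x y; g \<in> hom A y z; f \<in> inert A \<or> g \<in> inert A\<rbrakk>
        \<Longrightarrow> cp F g f = Idc B (mo F g \<cdot>\<^bsub>B\<^esub> mo F f)"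

text \<open>
  The naturality 2-cell of \<open>\<alpha> : F \<Rightarrow> G\<close> at \<open>f : x \<rightarrow> y\<close> is
  \<open>tnat \<alpha> f : G f \<cdot> \<alpha>\<^sub>x \<Rightarrow> \<alpha>\<^sub>y \<cdot> F f\<close>; being invertible, its direction is a matter of convention.
\<close>

record ('o, 'm, 'c, 'p, 'n, 'd) pstrans =
  tdom :: "('o, 'm, 'c, 'p, 'n, 'd) psfun"
  tcod :: "('o, 'm, 'c, 'p, 'n, 'd) psfun"
  tcomp :: "'o \<Rightarrow> 'n"
  tnat :: "'m \<Rightarrow> 'd"

locale pseudonatural =
  F: pseudofunctor A B "tdom \<alpha>" + G: pseudofunctor A B "tcod \<alpha>"
  for A :: "('o, 'm, 'c, 'y) twocat_scheme"
    and B :: "('p, 'n, 'd, 'z) twocat_scheme"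
    and \<alpha> :: "('o, 'm, 'c, 'p, 'n, 'd) pstrans" +
  assumes tcomp_hom: "x \<in> Obj A \<Longrightarrow> tcomp \<alpha> x \<in> hom B (ob (tdom \<alpha>) x) (ob (tcod \<alpha>) x)"
    and tnat_cells:
      "f \<in> hom A x y
        \<Longrightarrow> tnat \<alpha> f \<in> cells B (mo (tcod \<alpha>) f \<cdot>\<^bsub>B\<^esub> tcomp \<alpha> x) (tcomp \<alpha> y \<cdot>\<^bsub>B\<^esub> mo (tdom \<alpha>) f)"
    and tnat_invertible: "f \<in> Mor A \<Longrightarrow> invertible_cell B (tnat \<alpha> f)"
    and tnat_natural:
      "\<lbrakk>f \<in> hom A x y; \<gamma> \<in> cells A f g\<rbrakk>
        \<Longrightarrow> tnat \<alpha> g \<bullet>\<^bsub>B\<^esub> (ce (tcod \<alpha>) \<gamma> \<star>\<^bsub>B\<^esub> Idc B (tcomp \<alpha> x))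
          = (Idc B (tcomp \<alpha> y) \<star>\<^bsub>B\<^esub> ce (tdom \<alpha>) \<gamma>) \<bullet>\<^bsub>B\<^esub> tnat \<alpha> f"
    and tnat_unit:
      "x \<in> Obj A
        \<Longrightarrow> tnat \<alpha> (Idm A x) \<bullet>\<^bsub>B\<^esub> (un (tcod \<alpha>) x \<star>\<^bsub>B\<^esub> Idc B (tcomp \<alpha> x))
          = Idc B (tcomp \<alpha> x) \<star>\<^bsub>B\<^esub> un (tdom \<alpha>) x"
    and tnat_comp:
      "\<lbrakk>f \<in> hom A x y; g \<in> hom A y z\<rbrakk>
        \<Longrightarrow> tnat \<alpha> (g \<cdot>\<^bsub>A\<^esub> f) \<bullet>\<^bsub>B\<^esub> (cp (tcod \<alpha>) g f \<star>\<^bsub>B\<^esub> Idc B (tcomp \<alpha> x))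
          = (Idc B (tcomp \<alpha> z) \<star>\<^bsub>B\<^esub> cp (tdom \<alpha>) g f) \<bullet>\<^bsub>B\<^esub>
            (tnat \<alpha> g \<star>\<^bsub>B\<^esub> Idc B (mo (tdom \<alpha>) f)) \<bullet>\<^bsub>B\<^esub>
            (Idc B (mo (tcod \<alpha>) g) \<star>\<^bsub>B\<^esub> tnat \<alpha> f)"
    and tcomp_extensional: "tcomp \<alpha> \<in> extensional (Obj A)"
    and tnat_extensional: "tnat \<alpha> \<in> extensional (Mor A)"

locale pseudo_f_transformation =
  F: pseudo_f_functor A B "tdom \<alpha>" + G: pseudo_f_functor A B "tcod \<alpha>" + pseudonatural A B \<alpha>
  for A :: "('o, 'm, 'c, 'y) fcat_scheme"
    and B :: "('p, 'n, 'd, 'z) fcat_scheme"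
    and \<alpha> :: "('o, 'm, 'c, 'p, 'n, 'd) pstrans" +
  assumes tnat_identity:
    "\<lbrakk>f \<in> hom A x y; f \<in> inert A\<rbrakk> \<Longrightarrow> tnat \<alpha> f = Idc B (mo (tcod \<alpha>) f \<cdot>\<^bsub>B\<^esub> tcomp \<alpha> x)"

record ('o, 'm, 'c, 'p, 'n, 'd) modif =
  mdom :: "('o, 'm, 'c, 'p, 'n, 'd) pstrans"
  mcod :: "('o, 'm, 'c, 'p, 'n, 'd) pstrans"
  mcomp :: "'o \<Rightarrow> 'd"

locale modification =
  S: pseudonatural A B "mdom \<Gamma>" + T: pseudonatural A B "mcod \<Gamma>"
  for A :: "('o, 'm, 'c, 'y) twocat_scheme"
    and B :: "('p, 'n, 'd, 'z) twocat_scheme"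
    and \<Gamma> :: "('o, 'm, 'c, 'p, 'n, 'd) modif" +
  assumes tdom_parallel: "tdom (mdom \<Gamma>) = tdom (mcod \<Gamma>)"
    and tcod_parallel: "tcod (mdom \<Gamma>) = tcod (mcod \<Gamma>)"
    and mcomp_cells: "x \<in> Obj A \<Longrightarrow> mcomp \<Gamma> x \<in> cells B (tcomp (mdom \<Gamma>) x) (tcomp (mcod \<Gamma>) x)"
    and mcomp_natural:
      "f \<in> hom A x y
        \<Longrightarrow> (mcomp \<Gamma> y \<star>\<^bsub>B\<^esub> Idc B (mo (tdom (mdom \<Gamma>)) f)) \<bullet>\<^bsub>B\<^esub> tnat (mdom \<Gamma>) f
          = tnat (mcod \<Gamma>) f \<bullet>\<^bsub>B\<^esub> (Idc B (mo (tcod (mdom \<Gamma>)) f) \<star>\<^bsub>B\<^esub> mcomp \<Gamma> x)"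
    and mcomp_extensional: "mcomp \<Gamma> \<in> extensional (Obj A)"


section \<open>The 2-category of pseudo-models\<close>

text \<open>
  A pseudo-\<open>\<F>\<close>-functor is strict on inert 1-cells, so composing the legs of a cone with it
  gives an honest strict 2-functor on the shape of the cone.
\<close>

definition image_diagram ::
  "('o, 'm, 'c, 'z) fcat_scheme \<Rightarrow> ('o, 'm, 'c, 'p, 'n, 'd) psfun
    \<Rightarrow> ('o, 'm, 'c, 'i, 'j, 'k) cone \<Rightarrow> ('i, 'j, 'k, 'p, 'n, 'd) twofun" where
  "image_diagram A F S =
     \<lparr>ob = (\<lambda>j. ob F (Cod A (ob (legs S) j))),
      mo = (\<lambda>u. mo F (triangle (mo (legs S) u))),
      ce = (\<lambda>\<sigma>. ce F (triangle (ce (legs S) \<sigma>)))\<rparr>"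

definition pseudo_model ::
  "('o, 'm, 'c, 'i, 'j, 'k) fsketch \<Rightarrow> ('p, 'n, 'd, 'z) fcat_scheme
    \<Rightarrow> ('o, 'm, 'c, 'p, 'n, 'd) psfun \<Rightarrow> bool" where
  "pseudo_model A B F \<longleftrightarrow>
     pseudo_f_functor A B F \<and>
     (\<forall>S \<in> marked A.
        limit_cone (shape S) B (image_diagram A F S) (ob F (vertex S)) (\<lambda>j. mo F (ob (legs S) j)))"

definition pstrans_comp ::
  "('o, 'm, 'c, 'y) twocat_scheme \<Rightarrow> ('p, 'n, 'd, 'z) twocat_scheme
    \<Rightarrow> ('o, 'm, 'c, 'p, 'n, 'd) pstrans \<Rightarrow> ('o, 'm, 'c, 'p, 'n, 'd) pstrans
    \<Rightarrow> ('o, 'm, 'c, 'p, 'n, 'd) pstrans" where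
  "pstrans_comp A B \<beta> \<alpha> =
     \<lparr>tdom = tdom \<alpha>, tcod = tcod \<beta>,
      tcomp = (\<lambda>x\<in>Obj A. tcomp \<beta> x \<cdot>\<^bsub>B\<^esub> tcomp \<alpha> x),
      tnat = (\<lambda>f\<in>Mor A. (Idc B (tcomp \<beta> (Cod A f)) \<star>\<^bsub>B\<^esub> tnat \<alpha> f) \<bullet>\<^bsub>B\<^esub>
                         (tnat \<beta> f \<star>\<^bsub>B\<^esub> Idc B (tcomp \<alpha> (Dom A f))))\<rparr>"

definition PsMod ::
  "('o, 'm, 'c, 'i, 'j, 'k) fsketch \<Rightarrow> ('p, 'n, 'd, 'z) fcat_scheme \<Rightarrow>
    (('o, 'm, 'c, 'p, 'n, 'd) psfun,
     ('o, 'm, 'c, 'p, 'n, 'd) pstrans,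
     ('o, 'm, 'c, 'p, 'n, 'd) modif) twocat" where
  "PsMod A B =
     (let mor = {\<alpha>. pseudo_f_transformation A B \<alpha> \<and>
                    pseudo_model A B (tdom \<alpha>) \<and> pseudo_model A B (tcod \<alpha>)}
      in \<lparr>Obj = {F. pseudo_model A B F},
          Mor = mor,
          Cell = {\<Gamma>. modification A B \<Gamma> \<and> mdom \<Gamma> \<in> mor \<and> mcod \<Gamma> \<in> mor},
          Dom = tdom,
          Cod = tcod,
          Src = mdom,
          Tgt = mcod,
          Idm = (\<lambda>F. \<lparr>tdom = F, tcod = F,
                      tcomp = (\<lambda>x\<in>Obj A. Idm B (ob F x)),
                      tnat = (\<lambda>f\<in>Mor A. Idc B (mo F f))\<rparr>),
          Idc = (\<lambda>\<alpha>. \<lparr>mdom = \<alpha>, mcod = \<alpha>, mcomp = (\<lambda>x\<in>Obj A. Idc B (tcomp \<alpha> x))\<rparr>),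
          Cmp = pstrans_comp A B,
          Vcm = (\<lambda>\<Delta> \<Gamma>. \<lparr>mdom = mdom \<Gamma>, mcod = mcod \<Delta>,
                        mcomp = (\<lambda>x\<in>Obj A. mcomp \<Delta> x \<bullet>\<^bsub>B\<^esub> mcomp \<Gamma> x)\<rparr>),
          Hcm = (\<lambda>\<Delta> \<Gamma>. \<lparr>mdom = pstrans_comp A B (mdom \<Delta>) (mdom \<Gamma>),
                        mcod = pstrans_comp A B (mcod \<Delta>) (mcod \<Gamma>),
                        mcomp = (\<lambda>x\<in>Obj A. mcomp \<Delta> x \<star>\<^bsub>B\<^esub> mcomp \<Gamma> x)\<rparr>)\<rparr>)"


section \<open>The 2-category of small categories\<close>

text \<open>
  A notion of smallness for sets of elements of the type \<open>'u\<close>. Every Grothendieck universe gives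
  an instance; closure under power sets is not required, so for infinite \<open>'u\<close> the predicate that
  holds of all sets is an instance as well. Small sets are automatically closed under binary
  products and small-indexed coproducts (up to bijection), since \<open>'u\<close> is infinite.
\<close>

locale universe =
  fixes small :: "'u set \<Rightarrow> bool"
  assumes small_infinite: "\<exists>X. small X \<and> infinite X"
    and small_subset: "\<lbrakk>small X; Y \<subseteq> X\<rbrakk> \<Longrightarrow> small Y"
    and small_image: "small X \<Longrightarrow> small (f ` X)"
    and small_Union: "\<lbrakk>small X; \<And>x. x \<in> X \<Longrightarrow> small (Z x)\<rbrakk> \<Longrightarrow> small (\<Union>x\<in>X. Z x)"

record 'u cat =
  cobj :: "'u set"
  carr :: "'u set"
  cdom :: "'u \<Rightarrow> 'u"
  ccod :: "'u \<Rightarrow> 'u"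
  cid :: "'u \<Rightarrow> 'u"
  ccmp :: "'u \<Rightarrow> 'u \<Rightarrow> 'u"

locale category =
  fixes C :: "'u cat"
  assumes cdom_closed: "f \<in> carr C \<Longrightarrow> cdom C f \<in> cobj C"
    and ccod_closed: "f \<in> carr C \<Longrightarrow> ccod C f \<in> cobj C"
    and cid_closed: "x \<in> cobj C \<Longrightarrow> cid C x \<in> carr C"
    and cdom_cid: "x \<in> cobj C \<Longrightarrow> cdom C (cid C x) = x"
    and ccod_cid: "x \<in> cobj C \<Longrightarrow> ccod C (cid C x) = x"
    and ccmp_closed:
      "\<lbrakk>f \<in> carr C; g \<in> carr C; ccod C f = cdom C g\<rbrakk> \<Longrightarrow> ccmp C g f \<in> carr C"
    and cdom_ccmp:
      "\<lbrakk>f \<in> carr C; g \<in> carr C; ccod C f = cdom C g\<rbrakk> \<Longrightarrow> cdom C (ccmp C g f) = cdom C f"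
    and ccod_ccmp:
      "\<lbrakk>f \<in> carr C; g \<in> carr C; ccod C f = cdom C g\<rbrakk> \<Longrightarrow> ccod C (ccmp C g f) = ccod C g"
    and ccmp_cid_right: "f \<in> carr C \<Longrightarrow> ccmp C f (cid C (cdom C f)) = f"
    and ccmp_cid_left: "f \<in> carr C \<Longrightarrow> ccmp C (cid C (ccod C f)) f = f"
    and ccmp_assoc:
      "\<lbrakk>f \<in> carr C; g \<in> carr C; h \<in> carr C; ccod C f = cdom C g; ccod C g = cdom C h\<rbrakk>
        \<Longrightarrow> ccmp C h (ccmp C g f) = ccmp C (ccmp C h g) f"
    and cdom_extensional: "cdom C \<in> extensional (carr C)"
    and ccod_extensional: "ccod C \<in> extensional (carr C)"
    and cid_extensional: "cid C \<in> extensional (cobj C)"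
    and ccmp_extensional:
      "\<not> (f \<in> carr C \<and> g \<in> carr C \<and> ccod C f = cdom C g) \<Longrightarrow> ccmp C g f = undefined"

record 'u func =
  fdom :: "'u cat"
  fcod :: "'u cat"
  fobj :: "'u \<Rightarrow> 'u"
  farr :: "'u \<Rightarrow> 'u"

locale cat_functor = C: category "fdom F" + D: category "fcod F"
  for F :: "'u func" +
  assumes fobj_closed: "x \<in> cobj (fdom F) \<Longrightarrow> fobj F x \<in> cobj (fcod F)"
    and farr_closed: "f \<in> carr (fdom F) \<Longrightarrow> farr F f \<in> carr (fcod F)"
    and cdom_farr: "f \<in> carr (fdom F) \<Longrightarrow> cdom (fcod F) (farr F f) = fobj F (cdom (fdom F) f)"
    and ccod_farr: "f \<in> carr (fdom F) \<Longrightarrow> ccod (fcod F) (farr F f) = fobj F (ccod (fdom F) f)"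
    and farr_cid: "x \<in> cobj (fdom F) \<Longrightarrow> farr F (cid (fdom F) x) = cid (fcod F) (fobj F x)"
    and farr_ccmp:
      "\<lbrakk>f \<in> carr (fdom F); g \<in> carr (fdom F); ccod (fdom F) f = cdom (fdom F) g\<rbrakk>
        \<Longrightarrow> farr F (ccmp (fdom F) g f) = ccmp (fcod F) (farr F g) (farr F f)"
    and fobj_extensional: "fobj F \<in> extensional (cobj (fdom F))"
    and farr_extensional: "farr F \<in> extensional (carr (fdom F))"

record 'u nattr =
  ndom :: "'u func"
  ncod :: "'u func"
  ncomp :: "'u \<Rightarrow> 'u"

locale natural_transformation = F: cat_functor "ndom \<alpha>" + G: cat_functor "ncod \<alpha>"
  for \<alpha> :: "'u nattr" +
  assumes fdom_parallel: "fdom (ndom \<alpha>) = fdom (ncod \<alpha>)"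
    and fcod_parallel: "fcod (ndom \<alpha>) = fcod (ncod \<alpha>)"
    and ncomp_closed: "x \<in> cobj (fdom (ndom \<alpha>)) \<Longrightarrow> ncomp \<alpha> x \<in> carr (fcod (ndom \<alpha>))"
    and cdom_ncomp:
      "x \<in> cobj (fdom (ndom \<alpha>)) \<Longrightarrow> cdom (fcod (ndom \<alpha>)) (ncomp \<alpha> x) = fobj (ndom \<alpha>) x"
    and ccod_ncomp:
      "x \<in> cobj (fdom (ndom \<alpha>)) \<Longrightarrow> ccod (fcod (ndom \<alpha>)) (ncomp \<alpha> x) = fobj (ncod \<alpha>) x"
    and naturality:
      "f \<in> carr (fdom (ndom \<alpha>))
        \<Longrightarrow> ccmp (fcod (ndom \<alpha>)) (farr (ncod \<alpha>) f) (ncomp \<alpha> (cdom (fdom (ndom \<alpha>)) f))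
          = ccmp (fcod (ndom \<alpha>)) (ncomp \<alpha> (ccod (fdom (ndom \<alpha>)) f)) (farr (ndom \<alpha>) f)"
    and ncomp_extensional: "ncomp \<alpha> \<in> extensional (cobj (fdom (ndom \<alpha>)))"

definition func_id :: "'u cat \<Rightarrow> 'u func" where
  "func_id C = \<lparr>fdom = C, fcod = C, fobj = (\<lambda>x\<in>cobj C. x), farr = (\<lambda>f\<in>carr C. f)\<rparr>"

definition func_comp :: "'u func \<Rightarrow> 'u func \<Rightarrow> 'u func" where
  "func_comp G F =
     \<lparr>fdom = fdom F, fcod = fcod G,
      fobj = (\<lambda>x\<in>cobj (fdom F). fobj G (fobj F x)),
      farr = (\<lambda>f\<in>carr (fdom F). farr G (farr F f))\<rparr>"

definition nattr_id :: "'u func \<Rightarrow> 'u nattr" where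
  "nattr_id F = \<lparr>ndom = F, ncod = F, ncomp = (\<lambda>x\<in>cobj (fdom F). cid (fcod F) (fobj F x))\<rparr>"

definition nattr_vcomp :: "'u nattr \<Rightarrow> 'u nattr \<Rightarrow> 'u nattr" where
  "nattr_vcomp \<beta> \<alpha> =
     \<lparr>ndom = ndom \<alpha>, ncod = ncod \<beta>,
      ncomp = (\<lambda>x\<in>cobj (fdom (ndom \<alpha>)). ccmp (fcod (ndom \<alpha>)) (ncomp \<beta> x) (ncomp \<alpha> x))\<rparr>"

definition nattr_hcomp :: "'u nattr \<Rightarrow> 'u nattr \<Rightarrow> 'u nattr" where
  "nattr_hcomp \<beta> \<alpha> =
     \<lparr>ndom = func_comp (ndom \<beta>) (ndom \<alpha>), ncod = func_comp (ncod \<beta>) (ncod \<alpha>),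
      ncomp = (\<lambda>x\<in>cobj (fdom (ndom \<alpha>)).
        ccmp (fcod (ndom \<beta>)) (ncomp \<beta> (fobj (ncod \<alpha>) x)) (farr (ndom \<beta>) (ncomp \<alpha> x)))\<rparr>"

text \<open>The 2-category of small categories as a chordate \<open>\<F>\<close>-category: all functors are inert.\<close>

definition CAT :: "('u set \<Rightarrow> bool) \<Rightarrow> ('u cat, 'u func, 'u nattr) fcat" where
  "CAT small =
     (let objs = {C. category C \<and> small (cobj C) \<and> small (carr C)};
          mors = {F. cat_functor F \<and> fdom F \<in> objs \<and> fcod F \<in> objs}
      in \<lparr>Obj = objs,
          Mor = mors,
          Cell = {\<alpha>. natural_transformation \<alpha> \<and> ndom \<alpha> \<in> mors \<and> ncod \<alpha> \<in> mors},
          Dom = fdom,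
          Cod = fcod,
          Src = ndom,
          Tgt = ncod,
          Idm = func_id,
          Idc = nattr_id,
          Cmp = func_comp,
          Vcm = nattr_vcomp,
          Hcm = nattr_hcomp,
          inert = mors\<rparr>)"


section \<open>Set-valued models and their categories of elements\<close>

record ('o, 'm, 'u) setfun =
  el :: "'o \<Rightarrow> 'u set"
  act :: "'m \<Rightarrow> 'u \<Rightarrow> 'u"

locale set_functor =
  fixes small :: "'u set \<Rightarrow> bool"
    and A :: "('o, 'm, 'c, 'z) twocat_scheme"
    and M :: "('o, 'm, 'u) setfun"
  assumes el_small: "x \<in> Obj A \<Longrightarrow> small (el M x)"
    and act_closed: "f \<in> hom A x y \<Longrightarrow> act M f \<in> el M x \<rightarrow> el M y"
    and act_Idm: "\<lbrakk>x \<in> Obj A; s \<in> el M x\<rbrakk> \<Longrightarrow> act M (Idm A x) s = s"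
    and act_Cmp:
      "\<lbrakk>f \<in> hom A x y; g \<in> hom A y z; s \<in> el M x\<rbrakk> \<Longrightarrow> act M (g \<cdot>\<^bsub>A\<^esub> f) s = act M g (act M f s)"

definition set_limit_cone ::
  "('u set \<Rightarrow> bool) \<Rightarrow> ('o, 'm, 'c, 'z) twocat_scheme \<Rightarrow> ('o, 'm, 'u) setfun
    \<Rightarrow> ('o, 'm, 'c, 'i, 'j, 'k) cone \<Rightarrow> bool" where
  "set_limit_cone small A M S \<longleftrightarrow>
     (\<forall>X \<mu>. small X \<and>
        (\<forall>j \<in> Obj (shape S). \<mu> j \<in> X \<rightarrow> el M (Cod A (ob (legs S) j))) \<and>
        (\<forall>u \<in> Mor (shape S). \<forall>t \<in> X.
           act M (triangle (mo (legs S) u)) (\<mu> (Dom (shape S) u) t) = \<mu> (Cod (shape S) u) t) \<longrightarrow>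
        (\<exists>!h. h \<in> X \<rightarrow>\<^sub>E el M (vertex S) \<and>
           (\<forall>j \<in> Obj (shape S). \<forall>t \<in> X. act M (ob (legs S) j) (h t) = \<mu> j t)))"

text \<open>
  For locally discrete \<open>A\<close>; a functor on \<open>A\<close> then has no further data on 2-cells.
\<close>

definition set_model ::
  "('u set \<Rightarrow> bool) \<Rightarrow> ('o, 'm, 'c, 'i, 'j, 'k) fsketch \<Rightarrow> ('o, 'm, 'u) setfun \<Rightarrow> bool" where
  "set_model small A M \<longleftrightarrow>
     set_functor small A M \<and> (\<forall>S \<in> marked A. set_limit_cone small A M S)"

definition disc_cat :: "'u set \<Rightarrow> 'u cat" where
  "disc_cat X =
     \<lparr>cobj = X, carr = X, cdom = (\<lambda>x\<in>X. x), ccod = (\<lambda>x\<in>X. x), cid = (\<lambda>x\<in>X. x),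
      ccmp = (\<lambda>y x. if x \<in> X \<and> y = x then x else undefined)\<rparr>"

definition disc_func :: "'u set \<Rightarrow> 'u set \<Rightarrow> ('u \<Rightarrow> 'u) \<Rightarrow> 'u func" where
  "disc_func X Y h =
     \<lparr>fdom = disc_cat X, fcod = disc_cat Y, fobj = restrict h X, farr = restrict h X\<rparr>"

text \<open>\<open>M\<close> regarded as a pseudofunctor into small categories, with identity coherence cells.\<close>

definition disc ::
  "('o, 'm, 'c, 'z) twocat_scheme \<Rightarrow> ('o, 'm, 'u) setfun
    \<Rightarrow> ('o, 'm, 'c, 'u cat, 'u func, 'u nattr) psfun" where
  "disc A M =
     (let mor = (\<lambda>f. disc_func (el M (Dom A f)) (el M (Cod A f)) (act M f))
      in \<lparr>ob = (\<lambda>x\<in>Obj A. disc_cat (el M x)),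
          mo = (\<lambda>f\<in>Mor A. mor f),
          ce = (\<lambda>\<gamma>\<in>Cell A. nattr_id (mor (Src A \<gamma>))),
          un = (\<lambda>x\<in>Obj A. nattr_id (func_id (disc_cat (el M x)))),
          cp = (\<lambda>g f. if f \<in> Mor A \<and> g \<in> Mor A \<and> Cod A f = Dom A g
                      then nattr_id (mor (g \<cdot>\<^bsub>A\<^esub> f)) else undefined)\<rparr>)"

text \<open>
  The category of elements, again as a locally discrete 2-category. Objects are pairs \<open>(x, s)\<close>
  with \<open>s \<in> M x\<close>; the pair \<open>(f, s)\<close> with \<open>s \<in> M (dom f)\<close> is the 1-cell \<open>(x, s) \<rightarrow> (y, M f s)\<close> over
  \<open>f : x \<rightarrow> y\<close>, and its identity 2-cell is stored as \<open>(Idc f, s)\<close>. The projection to \<open>A\<close> is \<open>fst\<close>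
  on all three kinds of cells.
\<close>

definition elements_fcat ::
  "('o, 'm, 'c, 'z) fcat_scheme \<Rightarrow> ('o, 'm, 'u) setfun \<Rightarrow> ('o \<times> 'u, 'm \<times> 'u, 'c \<times> 'u) fcat" where
  "elements_fcat A M =
     \<lparr>Obj = {(x, s). x \<in> Obj A \<and> s \<in> el M x},
      Mor = {(f, s). f \<in> Mor A \<and> s \<in> el M (Dom A f)},
      Cell = {(\<gamma>, s). \<gamma> \<in> Cell A \<and> s \<in> el M (Dom A (Src A \<gamma>))},
      Dom = (\<lambda>(f, s). (Dom A f, s)),
      Cod = (\<lambda>(f, s). (Cod A f, act M f s)),
      Src = (\<lambda>(\<gamma>, s). (Src A \<gamma>, s)),
      Tgt = (\<lambda>(\<gamma>, s). (Tgt A \<gamma>, s)),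
      Idm = (\<lambda>(x, s). (Idm A x, s)),
      Idc = (\<lambda>(f, s). (Idc A f, s)),
      Cmp = (\<lambda>(g, _) (f, s). (g \<cdot>\<^bsub>A\<^esub> f, s)),
      Vcm = (\<lambda>(\<delta>, _) (\<gamma>, s). (\<delta> \<bullet>\<^bsub>A\<^esub> \<gamma>, s)),
      Hcm = (\<lambda>(\<delta>, _) (\<gamma>, s). (\<delta> \<star>\<^bsub>A\<^esub> \<gamma>, s)),
      inert = {(f, s). f \<in> inert A \<and> s \<in> el M (Dom A f)}\<rparr>"

definition project_cone ::
  "('o \<times> 'u, 'm \<times> 'u, 'c \<times> 'u, 'i, 'j, 'k) cone \<Rightarrow> ('o, 'm, 'c, 'i, 'j, 'k) cone" where
  "project_cone S =
     \<lparr>vertex = fst (vertex S),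
      shape = shape S,
      legs =
        \<lparr>ob = (\<lambda>j\<in>Obj (shape S). fst (ob (legs S) j)),
         mo = (\<lambda>u\<in>Mor (shape S). map_prod fst (map_prod fst fst) (mo (legs S) u)),
         ce = (\<lambda>\<sigma>\<in>Cell (shape S). map_prod fst (map_prod fst fst) (ce (legs S) \<sigma>))\<rparr>\<rparr>"

definition elements ::
  "('o, 'm, 'c, 'i, 'j, 'k) fsketch \<Rightarrow> ('o, 'm, 'u) setfun
    \<Rightarrow> ('o \<times> 'u, 'm \<times> 'u, 'c \<times> 'u, 'i, 'j, 'k) fsketch" where
  "elements A M =
     fcat.extend (elements_fcat A M)
       (fsketch.fields {S. is_cone (elements_fcat A M) S \<and> project_cone S \<in> marked A})"

end

theory Submission
  imports Defs
begin

text \<open>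
  An object of the slice is a pseudo-model \<open>N\<close> of \<open>A\<close> with a 1-cell to the discrete pseudo-model
  of \<open>M\<close>. All cells of a discrete category are identities, so such a 1-cell is nothing but a
  grading of the objects of each category \<open>N x\<close> by the elements of \<open>M x\<close> that is constant along
  arrows and that the functors \<open>N f\<close> transform by \<open>M f\<close>. Sending \<open>(x, s)\<close> to the fibre of \<open>N x\<close>
  over \<open>s\<close> gives a family of categories indexed by the elements of \<open>M\<close>; conversely the
  coproducts of the categories \<open>F (x, s)\<close> over \<open>s \<in> M x\<close> turn a family \<open>F\<close> into a graded \<open>N\<close>.
  Functors, compositors and naturality cells restrict to fibres, and data given on all fibres
  glue, because an object determines the fibre that it lies in.

  That pseudo-models correspond to pseudo-models rests on two facts. A limit of categories is
  computed on arrows (\<open>limit_cone_CAT_iff\<close>): a cone is a limit cone if and only if every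
  compatible family of arrows lifts uniquely to the vertex. And \<open>M\<close> itself sends marked cones to
  limits. So the grades of a compatible family along a marked cone of \<open>A\<close> come from a unique
  element \<open>s\<close> over the vertex, and lifting the family in \<open>N\<close> is the same as lifting it in the
  fibres along the cone in the category of elements that lies over the given one and starts at
  \<open>s\<close>; these are exactly the marked cones there (\<open>pseudo_model_fibre\<close>, \<open>pseudo_model_total\<close>).

  The equivalence is obtained from a general criterion (\<open>equivalent_twocats_if_ff_eso\<close>): a
  strict 2-functor that is bijective on 1-cells and 2-cells between given ends, and surjective
  on objects up to isomorphism, is an equivalence. Taking fibres is a strict 2-functor
  (\<open>strict_twofunctor_fibre\<close>). Gluing shows that it is bijective on cells (\<open>fibre_tr_full\<close>,
  \<open>fibre_md_full\<close>), and every family is isomorphic to the fibres of its coproduct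
  (\<open>fibre_grading_iso\<close>). The calculations are elementwise: on a locally discrete domain,
  pseudofunctors to categories, their transformations and modifications amount to equations
  between arrows.
\<close>

section \<open>Calculating in a 2-category\<close>

context two_category
begin

lemma Mor_simps [simp]:
  "x \<in> Obj K \<Longrightarrow> Idm K x \<in> Mor K"
  "x \<in> Obj K \<Longrightarrow> Dom K (Idm K x) = x"
  "x \<in> Obj K \<Longrightarrow> Cod K (Idm K x) = x"
  "\<lbrakk>f \<in> Mor K; g \<in> Mor K; Cod K f = Dom K g\<rbrakk> \<Longrightarrow> g \<cdot> f \<in> Mor K"
  "\<lbrakk>f \<in> Mor K; g \<in> Mor K; Cod K f = Dom K g\<rbrakk> \<Longrightarrow> Dom K (g \<cdot> f) = Dom K f"
  "\<lbrakk>f \<in> Mor K; g \<in> Mor K; Cod K f = Dom K g\<rbrakk> \<Longrightarrow> Cod K (g \<cdot> f) = Cod K g"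
  using Idm_hom[of x] Cmp_hom[of f "Dom K f" "Cod K f" g "Cod K g"] by (auto simp: hom_def)

lemma Cell_simps [simp]:
  "f \<in> Mor K \<Longrightarrow> Idc K f \<in> Cell K"
  "f \<in> Mor K \<Longrightarrow> Src K (Idc K f) = f"
  "f \<in> Mor K \<Longrightarrow> Tgt K (Idc K f) = f"
  "\<lbrakk>\<alpha> \<in> Cell K; \<beta> \<in> Cell K; Tgt K \<alpha> = Src K \<beta>\<rbrakk> \<Longrightarrow> \<beta> \<bullet> \<alpha> \<in> Cell K"
  "\<lbrakk>\<alpha> \<in> Cell K; \<beta> \<in> Cell K; Tgt K \<alpha> = Src K \<beta>\<rbrakk> \<Longrightarrow> Src K (\<beta> \<bullet> \<alpha>) = Src K \<alpha>"
  "\<lbrakk>\<alpha> \<in> Cell K; \<beta> \<in> Cell K; Tgt K \<alpha> = Src K \<beta>\<rbrakk> \<Longrightarrow> Tgt K (\<beta> \<bullet> \<alpha>) = Tgt K \<beta>"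
  "\<lbrakk>\<alpha> \<in> Cell K; \<beta> \<in> Cell K; Cod K (Src K \<alpha>) = Dom K (Src K \<beta>)\<rbrakk> \<Longrightarrow> \<beta> \<star> \<alpha> \<in> Cell K"
  "\<lbrakk>\<alpha> \<in> Cell K; \<beta> \<in> Cell K; Cod K (Src K \<alpha>) = Dom K (Src K \<beta>)\<rbrakk>
    \<Longrightarrow> Src K (\<beta> \<star> \<alpha>) = Src K \<beta> \<cdot> Src K \<alpha>"
  "\<lbrakk>\<alpha> \<in> Cell K; \<beta> \<in> Cell K; Cod K (Src K \<alpha>) = Dom K (Src K \<beta>)\<rbrakk>
    \<Longrightarrow> Tgt K (\<beta> \<star> \<alpha>) = Tgt K \<beta> \<cdot> Tgt K \<alpha>"
  using Idc_cells[of f] Vcm_cells[of \<alpha> "Src K \<alpha>" "Tgt K \<alpha>" \<beta> "Tgt K \<beta>"]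
    Hcm_cells[of \<alpha> "Src K \<alpha>" "Tgt K \<alpha>" \<beta> "Src K \<beta>" "Tgt K \<beta>"] by (auto simp: cells_def)

declare Dom_closed [simp] Cod_closed [simp] Src_closed [simp] Tgt_closed [simp]

lemma parallel_simps [simp]:
  "\<gamma> \<in> Cell K \<Longrightarrow> Dom K (Tgt K \<gamma>) = Dom K (Src K \<gamma>)"
  "\<gamma> \<in> Cell K \<Longrightarrow> Cod K (Tgt K \<gamma>) = Cod K (Src K \<gamma>)"
  by (simp_all add: Dom_parallel Cod_parallel)

text \<open>
  Oriented as rewrite rules, the axioms bring every pasting into a normal form: vertical
  composites bracketed to the right, of cells whiskered by composite 1-cells. The side conditions
  are equations between sources and targets, which the simplifier settles by the rules above.
\<close>

lemma Cmp_simps [simp]: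
  "\<lbrakk>f \<in> Mor K; Dom K f = x\<rbrakk> \<Longrightarrow> f \<cdot> Idm K x = f"
  "\<lbrakk>f \<in> Mor K; Cod K f = x\<rbrakk> \<Longrightarrow> Idm K x \<cdot> f = f"
  "\<lbrakk>f \<in> Mor K; g \<in> Mor K; h \<in> Mor K; Cod K f = Dom K g; Cod K g = Dom K h\<rbrakk>
    \<Longrightarrow> (h \<cdot> g) \<cdot> f = h \<cdot> (g \<cdot> f)"
  using Cmp_Idm_right[of f x "Cod K f"] Cmp_Idm_left[of f "Dom K f" x]
    Cmp_assoc[of f "Dom K f" "Cod K f" g "Cod K g" h "Cod K h"] by (auto simp: hom_def)

lemma Vcm_simps [simp]:
  "\<lbrakk>\<alpha> \<in> Cell K; Src K \<alpha> = f\<rbrakk> \<Longrightarrow> \<alpha> \<bullet> Idc K f = \<alpha>"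
  "\<lbrakk>\<alpha> \<in> Cell K; Tgt K \<alpha> = f\<rbrakk> \<Longrightarrow> Idc K f \<bullet> \<alpha> = \<alpha>"
  "\<lbrakk>\<alpha> \<in> Cell K; \<beta> \<in> Cell K; \<gamma> \<in> Cell K; Tgt K \<alpha> = Src K \<beta>; Tgt K \<beta> = Src K \<gamma>\<rbrakk>
    \<Longrightarrow> (\<gamma> \<bullet> \<beta>) \<bullet> \<alpha> = \<gamma> \<bullet> (\<beta> \<bullet> \<alpha>)"
  using Vcm_Idc_right[of \<alpha> f "Tgt K \<alpha>"] Vcm_Idc_left[of \<alpha> "Src K \<alpha>" f]
    Vcm_assoc[of \<alpha> "Src K \<alpha>" "Tgt K \<alpha>" \<beta> "Tgt K \<beta>" \<gamma> "Tgt K \<gamma>"] by (auto simp: cells_def)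

lemma Hcm_assoc':
  "\<lbrakk>\<alpha> \<in> Cell K; \<beta> \<in> Cell K; \<gamma> \<in> Cell K; Cod K (Src K \<alpha>) = Dom K (Src K \<beta>);
    Cod K (Src K \<beta>) = Dom K (Src K \<gamma>)\<rbrakk> \<Longrightarrow> (\<gamma> \<star> \<beta>) \<star> \<alpha> = \<gamma> \<star> (\<beta> \<star> \<alpha>)"
  using Hcm_assoc[of \<alpha> "Src K \<alpha>" "Tgt K \<alpha>" \<beta> "Src K \<beta>" "Tgt K \<beta>" \<gamma> "Src K \<gamma>" "Tgt K \<gamma>"]
  by (auto simp: cells_def)

lemma Hcm_Idc':
  "\<lbrakk>f \<in> Mor K; g \<in> Mor K; Cod K f = Dom K g\<rbrakk> \<Longrightarrow> Idc K g \<star> Idc K f = Idc K (g \<cdot> f)"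
  using Hcm_Idc[of f "Dom K f" "Cod K f" g "Cod K g"] by (auto simp: hom_def)

lemma interchange':
  "\<lbrakk>\<alpha> \<in> Cell K; \<alpha>' \<in> Cell K; \<beta> \<in> Cell K; \<beta>' \<in> Cell K; Tgt K \<alpha> = Src K \<alpha>'; Tgt K \<beta> = Src K \<beta>';
    Cod K (Src K \<alpha>) = Dom K (Src K \<beta>)\<rbrakk>
    \<Longrightarrow> (\<beta>' \<bullet> \<beta>) \<star> (\<alpha>' \<bullet> \<alpha>) = (\<beta>' \<star> \<alpha>') \<bullet> (\<beta> \<star> \<alpha>)"
  using interchange[of \<alpha> "Src K \<alpha>" "Tgt K \<alpha>" \<alpha>' "Tgt K \<alpha>'" \<beta> "Src K \<beta>" "Tgt K \<beta>" \<beta>' "Tgt K \<beta>'"]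
  by (auto simp: cells_def)

lemma whisker_simps [simp]:
  "\<lbrakk>\<alpha> \<in> Cell K; Dom K (Src K \<alpha>) = x\<rbrakk> \<Longrightarrow> \<alpha> \<star> Idc K (Idm K x) = \<alpha>"
  "\<lbrakk>\<alpha> \<in> Cell K; Cod K (Src K \<alpha>) = x\<rbrakk> \<Longrightarrow> Idc K (Idm K x) \<star> \<alpha> = \<alpha>"
  "\<lbrakk>\<alpha> \<in> Cell K; g \<in> Mor K; h \<in> Mor K; Cod K (Src K \<alpha>) = Dom K g; Cod K g = Dom K h\<rbrakk>
    \<Longrightarrow> Idc K h \<star> (Idc K g \<star> \<alpha>) = Idc K (h \<cdot> g) \<star> \<alpha>"
  "\<lbrakk>\<alpha> \<in> Cell K; \<beta> \<in> Cell K; h \<in> Mor K; Tgt K \<alpha> = Src K \<beta>; Cod K (Src K \<alpha>) = Dom K h\<rbrakk>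
    \<Longrightarrow> Idc K h \<star> (\<beta> \<bullet> \<alpha>) = (Idc K h \<star> \<beta>) \<bullet> (Idc K h \<star> \<alpha>)"
  "\<lbrakk>\<alpha> \<in> Cell K; \<beta> \<in> Cell K; f \<in> Mor K; Tgt K \<alpha> = Src K \<beta>; Dom K (Src K \<alpha>) = Cod K f\<rbrakk>
    \<Longrightarrow> (\<beta> \<bullet> \<alpha>) \<star> Idc K f = (\<beta> \<star> Idc K f) \<bullet> (\<alpha> \<star> Idc K f)"
proof -
  show "\<lbrakk>\<alpha> \<in> Cell K; Dom K (Src K \<alpha>) = x\<rbrakk> \<Longrightarrow> \<alpha> \<star> Idc K (Idm K x) = \<alpha>"
    using Hcm_Idm_right[of \<alpha> "Src K \<alpha>" "Tgt K \<alpha>" x] by (auto simp: cells_def)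
  show "\<lbrakk>\<alpha> \<in> Cell K; Cod K (Src K \<alpha>) = x\<rbrakk> \<Longrightarrow> Idc K (Idm K x) \<star> \<alpha> = \<alpha>"
    using Hcm_Idm_left[of \<alpha> "Src K \<alpha>" "Tgt K \<alpha>" x] by (auto simp: cells_def)
  show "\<lbrakk>\<alpha> \<in> Cell K; g \<in> Mor K; h \<in> Mor K; Cod K (Src K \<alpha>) = Dom K g; Cod K g = Dom K h\<rbrakk>
    \<Longrightarrow> Idc K h \<star> (Idc K g \<star> \<alpha>) = Idc K (h \<cdot> g) \<star> \<alpha>"
    using Hcm_assoc'[of \<alpha> "Idc K g" "Idc K h"] Hcm_Idc'[of g h] by simp
  show "\<lbrakk>\<alpha> \<in> Cell K; \<beta> \<in> Cell K; h \<in> Mor K; Tgt K \<alpha> = Src K \<beta>; Cod K (Src K \<alpha>) = Dom K h\<rbrakk>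
    \<Longrightarrow> Idc K h \<star> (\<beta> \<bullet> \<alpha>) = (Idc K h \<star> \<beta>) \<bullet> (Idc K h \<star> \<alpha>)"
    using interchange'[of \<alpha> \<beta> "Idc K h" "Idc K h"] by simp
  show "\<lbrakk>\<alpha> \<in> Cell K; \<beta> \<in> Cell K; f \<in> Mor K; Tgt K \<alpha> = Src K \<beta>; Dom K (Src K \<alpha>) = Cod K f\<rbrakk>
    \<Longrightarrow> (\<beta> \<bullet> \<alpha>) \<star> Idc K f = (\<beta> \<star> Idc K f) \<bullet> (\<alpha> \<star> Idc K f)"
    using interchange'[of "Idc K f" "Idc K f" \<alpha> \<beta>] by simp
qed

declare Hcm_assoc' [simp] Hcm_Idc' [simp]

lemma Hcm_right_first:
  "\<lbrakk>\<alpha> \<in> Cell K; \<beta> \<in> Cell K; Cod K (Src K \<alpha>) = Dom K (Src K \<beta>)\<rbrakk>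
    \<Longrightarrow> \<beta> \<star> \<alpha> = (\<beta> \<star> Idc K (Tgt K \<alpha>)) \<bullet> (Idc K (Src K \<beta>) \<star> \<alpha>)"
  using interchange'[of \<alpha> "Idc K (Tgt K \<alpha>)" "Idc K (Src K \<beta>)" \<beta>] by simp

lemma Hcm_left_first:
  "\<lbrakk>\<alpha> \<in> Cell K; \<beta> \<in> Cell K; Cod K (Src K \<alpha>) = Dom K (Src K \<beta>)\<rbrakk>
    \<Longrightarrow> \<beta> \<star> \<alpha> = (Idc K (Tgt K \<beta>) \<star> \<alpha>) \<bullet> (\<beta> \<star> Idc K (Src K \<alpha>))"
  using interchange'[of "Idc K (Src K \<alpha>)" \<alpha> \<beta> "Idc K (Tgt K \<beta>)"] by simp

lemma whisker_exchange:
  "\<lbrakk>\<alpha> \<in> Cell K; \<beta> \<in> Cell K; Cod K (Src K \<alpha>) = Dom K (Src K \<beta>)\<rbrakk>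
    \<Longrightarrow> (\<beta> \<star> Idc K (Tgt K \<alpha>)) \<bullet> (Idc K (Src K \<beta>) \<star> \<alpha>)
      = (Idc K (Tgt K \<beta>) \<star> \<alpha>) \<bullet> (\<beta> \<star> Idc K (Src K \<alpha>))"
  using Hcm_right_first Hcm_left_first by metis

text \<open>
  An equation between two-fold composites, for use at the head of a composite bracketed to the
  right.
\<close>

lemma Vcm_cong_right:
  "\<lbrakk>\<beta> \<bullet> \<alpha> = \<delta> \<bullet> \<gamma>; \<alpha> \<in> Cell K; \<beta> \<in> Cell K; \<gamma> \<in> Cell K; \<delta> \<in> Cell K; \<zeta> \<in> Cell K;
    Tgt K \<alpha> = Src K \<beta>; Tgt K \<gamma> = Src K \<delta>; Tgt K \<zeta> = Src K \<alpha>; Tgt K \<zeta> = Src K \<gamma>\<rbrakk>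
    \<Longrightarrow> \<beta> \<bullet> (\<alpha> \<bullet> \<zeta>) = \<delta> \<bullet> (\<gamma> \<bullet> \<zeta>)"
  by (metis Vcm_simps(3))

lemma Cmp_cong_right:
  "\<lbrakk>r \<cdot> k = q; k \<in> Mor K; r \<in> Mor K; h \<in> Mor K; Cod K k = Dom K r; Cod K h = Dom K k\<rbrakk>
    \<Longrightarrow> r \<cdot> (k \<cdot> h) = q \<cdot> h"
  by (metis Cmp_simps(3))

lemma invertible_cellI:
  "\<lbrakk>\<gamma> \<in> Cell K; \<delta> \<in> Cell K; Src K \<delta> = Tgt K \<gamma>; Tgt K \<delta> = Src K \<gamma>;
    \<delta> \<bullet> \<gamma> = Idc K (Src K \<gamma>); \<gamma> \<bullet> \<delta> = Idc K (Tgt K \<gamma>)\<rbrakk> \<Longrightarrow> invertible_cell K \<gamma>"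
  by (auto simp: invertible_cell_def cells_def)

lemma invertible_Idc [simp]: "f \<in> Mor K \<Longrightarrow> invertible_cell K (Idc K f)"
  by (rule invertible_cellI[where \<delta> = "Idc K f"]) auto

lemma invertible_Vcm [simp]:
  assumes "invertible_cell K \<alpha>" "invertible_cell K \<beta>" "Tgt K \<alpha> = Src K \<beta>"
  shows "invertible_cell K (\<beta> \<bullet> \<alpha>)"
proof -
  obtain \<alpha>' \<beta>' where i: "\<alpha> \<in> Cell K" "\<alpha>' \<in> Cell K" "Src K \<alpha>' = Tgt K \<alpha>" "Tgt K \<alpha>' = Src K \<alpha>"
      "\<alpha>' \<bullet> \<alpha> = Idc K (Src K \<alpha>)" "\<alpha> \<bullet> \<alpha>' = Idc K (Tgt K \<alpha>)"
    and j: "\<beta> \<in> Cell K" "\<beta>' \<in> Cell K" "Src K \<beta>' = Tgt K \<beta>" "Tgt K \<beta>' = Src K \<beta>"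
      "\<beta>' \<bullet> \<beta> = Idc K (Src K \<beta>)" "\<beta> \<bullet> \<beta>' = Idc K (Tgt K \<beta>)"
    using assms by (auto simp: invertible_cell_def cells_def)
  have "\<beta>' \<bullet> (\<beta> \<bullet> \<alpha>) = \<alpha>" "\<alpha> \<bullet> (\<alpha>' \<bullet> \<beta>') = \<beta>'"
    using i j assms(3) Vcm_simps(3)[of \<alpha> \<beta> \<beta>'] Vcm_simps(3)[of \<beta>' \<alpha>' \<alpha>] by simp_all
  then show ?thesis
    using i j assms(3) by (intro invertible_cellI[where \<delta> = "\<alpha>' \<bullet> \<beta>'"]) simp_all
qed

lemma invertible_Hcm [simp]:
  assumes "invertible_cell K \<alpha>" "invertible_cell K \<beta>" "Cod K (Src K \<alpha>) = Dom K (Src K \<beta>)"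
  shows "invertible_cell K (\<beta> \<star> \<alpha>)"
proof -
  obtain \<alpha>' \<beta>' where i: "\<alpha> \<in> Cell K" "\<alpha>' \<in> Cell K" "Src K \<alpha>' = Tgt K \<alpha>" "Tgt K \<alpha>' = Src K \<alpha>"
      "\<alpha>' \<bullet> \<alpha> = Idc K (Src K \<alpha>)" "\<alpha> \<bullet> \<alpha>' = Idc K (Tgt K \<alpha>)"
    and j: "\<beta> \<in> Cell K" "\<beta>' \<in> Cell K" "Src K \<beta>' = Tgt K \<beta>" "Tgt K \<beta>' = Src K \<beta>"
      "\<beta>' \<bullet> \<beta> = Idc K (Src K \<beta>)" "\<beta> \<bullet> \<beta>' = Idc K (Tgt K \<beta>)"
    using assms by (auto simp: invertible_cell_def cells_def)
  then show ?thesis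
    using assms(3) interchange'[of \<alpha> \<alpha>' \<beta> \<beta>'] interchange'[of \<alpha>' \<alpha> \<beta>' \<beta>]
    by (intro invertible_cellI[where \<delta> = "\<beta>' \<star> \<alpha>'"]) simp_all
qed

end

section \<open>Slices, coslices and inert parts are 2-categories\<close>

lemma slice_sel:
  "Obj (slice K x) = {p \<in> Mor K. Cod K p = x}"
  "(p, h, q) \<in> Mor (slice K x) \<longleftrightarrow> p \<in> Mor K \<and> Cod K p = x \<and> q \<in> Mor K \<and> Cod K q = x \<and>
    h \<in> Mor K \<and> Dom K h = Dom K p \<and> Cod K h = Dom K q \<and> q \<cdot>\<^bsub>K\<^esub> h = p"
  "(p, \<gamma>, q) \<in> Cell (slice K x) \<longleftrightarrow> \<gamma> \<in> Cell K \<and> (p, Src K \<gamma>, q) \<in> Mor (slice K x) \<and>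
    (p, Tgt K \<gamma>, q) \<in> Mor (slice K x) \<and> Idc K q \<star>\<^bsub>K\<^esub> \<gamma> = Idc K p"
  "Dom (slice K x) (p, h, q) = p" "Cod (slice K x) (p, h, q) = q"
  "Src (slice K x) (p, \<gamma>, q) = (p, Src K \<gamma>, q)" "Tgt (slice K x) (p, \<gamma>, q) = (p, Tgt K \<gamma>, q)"
  "Idm (slice K x) p = (p, Idm K (Dom K p), p)" "Idc (slice K x) (p, h, q) = (p, Idc K h, q)"
  "(q', k, r) \<cdot>\<^bsub>slice K x\<^esub> (p, h, q) = (p, k \<cdot>\<^bsub>K\<^esub> h, r)"
  "(p', \<delta>, q') \<bullet>\<^bsub>slice K x\<^esub> (p, \<gamma>, q) = (p, \<delta> \<bullet>\<^bsub>K\<^esub> \<gamma>, q)"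
  "(q', \<delta>, r) \<star>\<^bsub>slice K x\<^esub> (p, \<gamma>, q) = (p, \<delta> \<star>\<^bsub>K\<^esub> \<gamma>, r)"
  by (auto simp: slice_def Let_def hom_def)

lemma coslice_sel:
  "Obj (coslice K x) = {p \<in> Mor K. Dom K p = x}"
  "(f, h, g) \<in> Mor (coslice K x) \<longleftrightarrow> f \<in> Mor K \<and> Dom K f = x \<and> g \<in> Mor K \<and> Dom K g = x \<and>
    h \<in> Mor K \<and> Dom K h = Cod K f \<and> Cod K h = Cod K g \<and> h \<cdot>\<^bsub>K\<^esub> f = g"
  "(f, \<gamma>, g) \<in> Cell (coslice K x) \<longleftrightarrow> \<gamma> \<in> Cell K \<and> (f, Src K \<gamma>, g) \<in> Mor (coslice K x) \<and>
    (f, Tgt K \<gamma>, g) \<in> Mor (coslice K x) \<and> \<gamma> \<star>\<^bsub>K\<^esub> Idc K f = Idc K g"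
  "Dom (coslice K x) (p, h, q) = p" "Cod (coslice K x) (p, h, q) = q"
  "Src (coslice K x) (p, \<gamma>, q) = (p, Src K \<gamma>, q)" "Tgt (coslice K x) (p, \<gamma>, q) = (p, Tgt K \<gamma>, q)"
  "Idm (coslice K x) p = (p, Idm K (Cod K p), p)" "Idc (coslice K x) (p, h, q) = (p, Idc K h, q)"
  "(q', k, r) \<cdot>\<^bsub>coslice K x\<^esub> (p, h, q) = (p, k \<cdot>\<^bsub>K\<^esub> h, r)"
  "(p', \<delta>, q') \<bullet>\<^bsub>coslice K x\<^esub> (p, \<gamma>, q) = (p, \<delta> \<bullet>\<^bsub>K\<^esub> \<gamma>, q)"
  "(q', \<delta>, r) \<star>\<^bsub>coslice K x\<^esub> (p, \<gamma>, q) = (p, \<delta> \<star>\<^bsub>K\<^esub> \<gamma>, r)"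
  by (auto simp: coslice_def Let_def hom_def)

text \<open>
  The axioms of a 2-category in the form in which side conditions are equations between sources
  and targets; convenient where the carriers are sets of tuples.
\<close>

lemma two_categoryI:
  fixes K :: "('o, 'm, 'c, 'z) twocat_scheme" (structure)
  assumes "\<And>f. f \<in> Mor K \<Longrightarrow> Dom K f \<in> Obj K \<and> Cod K f \<in> Obj K"
    and "\<And>\<gamma>. \<gamma> \<in> Cell K \<Longrightarrow> Src K \<gamma> \<in> Mor K \<and> Tgt K \<gamma> \<in> Mor K \<and>
      Dom K (Tgt K \<gamma>) = Dom K (Src K \<gamma>) \<and> Cod K (Tgt K \<gamma>) = Cod K (Src K \<gamma>)"
    and "\<And>x. x \<in> Obj K \<Longrightarrow> Idm K x \<in> Mor K \<and> Dom K (Idm K x) = x \<and> Cod K (Idm K x) = x"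
    and "\<And>f g. \<lbrakk>f \<in> Mor K; g \<in> Mor K; Cod K f = Dom K g\<rbrakk>
      \<Longrightarrow> g \<cdot> f \<in> Mor K \<and> Dom K (g \<cdot> f) = Dom K f \<and> Cod K (g \<cdot> f) = Cod K g"
    and "\<And>f. f \<in> Mor K \<Longrightarrow> f \<cdot> Idm K (Dom K f) = f \<and> Idm K (Cod K f) \<cdot> f = f"
    and "\<And>f g h. \<lbrakk>f \<in> Mor K; g \<in> Mor K; h \<in> Mor K; Cod K f = Dom K g; Cod K g = Dom K h\<rbrakk>
      \<Longrightarrow> h \<cdot> (g \<cdot> f) = (h \<cdot> g) \<cdot> f"
    and "\<And>f. f \<in> Mor K \<Longrightarrow> Idc K f \<in> Cell K \<and> Src K (Idc K f) = f \<and> Tgt K (Idc K f) = f"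
    and "\<And>\<alpha> \<beta>. \<lbrakk>\<alpha> \<in> Cell K; \<beta> \<in> Cell K; Tgt K \<alpha> = Src K \<beta>\<rbrakk>
      \<Longrightarrow> \<beta> \<bullet> \<alpha> \<in> Cell K \<and> Src K (\<beta> \<bullet> \<alpha>) = Src K \<alpha> \<and> Tgt K (\<beta> \<bullet> \<alpha>) = Tgt K \<beta>"
    and "\<And>\<alpha>. \<alpha> \<in> Cell K \<Longrightarrow> \<alpha> \<bullet> Idc K (Src K \<alpha>) = \<alpha> \<and> Idc K (Tgt K \<alpha>) \<bullet> \<alpha> = \<alpha>"
    and "\<And>\<alpha> \<beta> \<gamma>. \<lbrakk>\<alpha> \<in> Cell K; \<beta> \<in> Cell K; \<gamma> \<in> Cell K; Tgt K \<alpha> = Src K \<beta>; Tgt K \<beta> = Src K \<gamma>\<rbrakk>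
      \<Longrightarrow> \<gamma> \<bullet> (\<beta> \<bullet> \<alpha>) = (\<gamma> \<bullet> \<beta>) \<bullet> \<alpha>"
    and "\<And>\<alpha> \<beta>. \<lbrakk>\<alpha> \<in> Cell K; \<beta> \<in> Cell K; Cod K (Src K \<alpha>) = Dom K (Src K \<beta>)\<rbrakk>
      \<Longrightarrow> \<beta> \<star> \<alpha> \<in> Cell K \<and> Src K (\<beta> \<star> \<alpha>) = Src K \<beta> \<cdot> Src K \<alpha> \<and>
        Tgt K (\<beta> \<star> \<alpha>) = Tgt K \<beta> \<cdot> Tgt K \<alpha>"
    and "\<And>\<alpha>. \<alpha> \<in> Cell K \<Longrightarrow> \<alpha> \<star> Idc K (Idm K (Dom K (Src K \<alpha>))) = \<alpha> \<and>
        Idc K (Idm K (Cod K (Src K \<alpha>))) \<star> \<alpha> = \<alpha>"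
    and "\<And>\<alpha> \<beta> \<gamma>. \<lbrakk>\<alpha> \<in> Cell K; \<beta> \<in> Cell K; \<gamma> \<in> Cell K; Cod K (Src K \<alpha>) = Dom K (Src K \<beta>);
        Cod K (Src K \<beta>) = Dom K (Src K \<gamma>)\<rbrakk> \<Longrightarrow> \<gamma> \<star> (\<beta> \<star> \<alpha>) = (\<gamma> \<star> \<beta>) \<star> \<alpha>"
    and "\<And>f g. \<lbrakk>f \<in> Mor K; g \<in> Mor K; Cod K f = Dom K g\<rbrakk>
      \<Longrightarrow> Idc K g \<star> Idc K f = Idc K (g \<cdot> f)"
    and "\<And>\<alpha> \<alpha>' \<beta> \<beta>'. \<lbrakk>\<alpha> \<in> Cell K; \<alpha>' \<in> Cell K; \<beta> \<in> Cell K; \<beta>' \<in> Cell K; Tgt K \<alpha> = Src K \<alpha>';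
        Tgt K \<beta> = Src K \<beta>'; Cod K (Src K \<alpha>) = Dom K (Src K \<beta>)\<rbrakk>
        \<Longrightarrow> (\<beta>' \<bullet> \<beta>) \<star> (\<alpha>' \<bullet> \<alpha>) = (\<beta>' \<star> \<alpha>') \<bullet> (\<beta> \<star> \<alpha>)"
  shows "two_category K"
  using assms by (unfold_locales; clarsimp simp: hom_def cells_def)

lemma (in two_category) two_category_slice: "two_category (slice K x)"
proof (rule two_categoryI, unfold split_paired_all, goal_cases)
  case (4 p h q q' k r)
  then show ?case by (auto simp: slice_sel Cmp_cong_right)
next
  case (11 p \<alpha> q q' \<beta> r)
  then have "Idc K r \<star> (\<beta> \<star> \<alpha>) = Idc K p"
    using Hcm_assoc'[of \<alpha> \<beta> "Idc K r"] by (simp add: slice_sel)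
  with 11 show ?case by (auto simp: slice_sel Cmp_cong_right)
qed (auto simp: slice_sel interchange' simp del: Vcm_simps(3) Hcm_assoc' Cmp_simps(3)
    simp: Vcm_simps(3)[symmetric] Hcm_assoc'[symmetric] Cmp_simps(3)[symmetric])

lemma (in two_category) two_category_coslice: "two_category (coslice K x)"
proof (rule two_categoryI, unfold split_paired_all, goal_cases)
  case (11 p \<alpha> q q' \<beta> r)
  then show ?case by (auto simp: coslice_sel)
qed (auto simp: coslice_sel interchange')

lemma (in f_category) two_category_inert_part: "two_category (inert_part A)"
  by (rule two_categoryI; use inert_Mor in
     \<open>auto simp: inert_part_def inert_Idm inert_Cmp subset_iff interchange'\<close>)

section \<open>Fully faithful and essentially surjective 2-functors are equivalences\<close>

context strict_twofunctor
begin

lemma F_simps [simp]: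
  "x \<in> Obj A \<Longrightarrow> ob F x \<in> Obj B"
  "f \<in> Mor A \<Longrightarrow> mo F f \<in> Mor B"
  "f \<in> Mor A \<Longrightarrow> Dom B (mo F f) = ob F (Dom A f)"
  "f \<in> Mor A \<Longrightarrow> Cod B (mo F f) = ob F (Cod A f)"
  "\<gamma> \<in> Cell A \<Longrightarrow> ce F \<gamma> \<in> Cell B"
  "\<gamma> \<in> Cell A \<Longrightarrow> Src B (ce F \<gamma>) = mo F (Src A \<gamma>)"
  "\<gamma> \<in> Cell A \<Longrightarrow> Tgt B (ce F \<gamma>) = mo F (Tgt A \<gamma>)"
  "x \<in> Obj A \<Longrightarrow> mo F (Idm A x) = Idm B (ob F x)"
  "f \<in> Mor A \<Longrightarrow> ce F (Idc A f) = Idc B (mo F f)"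
  "\<lbrakk>f \<in> Mor A; g \<in> Mor A; Cod A f = Dom A g\<rbrakk> \<Longrightarrow> mo F (g \<cdot>\<^bsub>A\<^esub> f) = mo F g \<cdot>\<^bsub>B\<^esub> mo F f"
  "\<lbrakk>\<alpha> \<in> Cell A; \<beta> \<in> Cell A; Tgt A \<alpha> = Src A \<beta>\<rbrakk> \<Longrightarrow> ce F (\<beta> \<bullet>\<^bsub>A\<^esub> \<alpha>) = ce F \<beta> \<bullet>\<^bsub>B\<^esub> ce F \<alpha>"
  "\<lbrakk>\<alpha> \<in> Cell A; \<beta> \<in> Cell A; Cod A (Src A \<alpha>) = Dom A (Src A \<beta>)\<rbrakk>
    \<Longrightarrow> ce F (\<beta> \<star>\<^bsub>A\<^esub> \<alpha>) = ce F \<beta> \<star>\<^bsub>B\<^esub> ce F \<alpha>"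
  using ob_closed[of x] mo_hom[of f "Dom A f" "Cod A f"] ce_cells[of \<gamma> "Src A \<gamma>" "Tgt A \<gamma>"]
    mo_Idm[of x] ce_Idc[of f] mo_Cmp[of f "Dom A f" "Cod A f" g "Cod A g"]
    ce_Vcm[of \<alpha> "Src A \<alpha>" "Tgt A \<alpha>" \<beta> "Tgt A \<beta>"]
    ce_Hcm[of \<alpha> "Src A \<alpha>" "Tgt A \<alpha>" \<beta> "Src A \<beta>" "Tgt A \<beta>"]
  by (auto simp: hom_def cells_def)

end

lemma strict_twofunctorI:
  fixes A :: "('o, 'm, 'c, 'y) twocat_scheme" and B :: "('p, 'n, 'd, 'z) twocat_scheme"
    and F :: "('o, 'm, 'c, 'p, 'n, 'd, 'f) twofun_scheme"
  assumes "two_category A" and "two_category B"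
    and "\<And>x. x \<in> Obj A \<Longrightarrow> ob F x \<in> Obj B \<and> mo F (Idm A x) = Idm B (ob F x)"
    and "\<And>f. f \<in> Mor A \<Longrightarrow> mo F f \<in> Mor B \<and> Dom B (mo F f) = ob F (Dom A f) \<and>
      Cod B (mo F f) = ob F (Cod A f) \<and> ce F (Idc A f) = Idc B (mo F f)"
    and "\<And>\<gamma>. \<gamma> \<in> Cell A \<Longrightarrow> ce F \<gamma> \<in> Cell B \<and> Src B (ce F \<gamma>) = mo F (Src A \<gamma>) \<and>
      Tgt B (ce F \<gamma>) = mo F (Tgt A \<gamma>)"
    and "\<And>f g. \<lbrakk>f \<in> Mor A; g \<in> Mor A; Cod A f = Dom A g\<rbrakk>
      \<Longrightarrow> mo F (g \<cdot>\<^bsub>A\<^esub> f) = mo F g \<cdot>\<^bsub>B\<^esub> mo F f"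
    and "\<And>\<alpha> \<beta>. \<lbrakk>\<alpha> \<in> Cell A; \<beta> \<in> Cell A; Tgt A \<alpha> = Src A \<beta>\<rbrakk>
      \<Longrightarrow> ce F (\<beta> \<bullet>\<^bsub>A\<^esub> \<alpha>) = ce F \<beta> \<bullet>\<^bsub>B\<^esub> ce F \<alpha>"
    and "\<And>\<alpha> \<beta>. \<lbrakk>\<alpha> \<in> Cell A; \<beta> \<in> Cell A; Cod A (Src A \<alpha>) = Dom A (Src A \<beta>)\<rbrakk>
      \<Longrightarrow> ce F (\<beta> \<star>\<^bsub>A\<^esub> \<alpha>) = ce F \<beta> \<star>\<^bsub>B\<^esub> ce F \<alpha>"
  shows "strict_twofunctor A B F"
proof -
  interpret A: two_category A by fact
  interpret B: two_category B by fact
  show ?thesis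
    using assms(3-) by (unfold_locales; clarsimp simp: hom_def cells_def)
qed

lemma strict_twofunctor_id:
  assumes "two_category A"
  shows "strict_twofunctor A A twofun_id"
  by (rule strict_twofunctorI) (auto simp: twofun_id_def assms)

lemma strict_twofunctor_comp:
  assumes "strict_twofunctor A B F" and "strict_twofunctor B C G"
  shows "strict_twofunctor A C (twofun_comp G F)"
proof -
  interpret F: strict_twofunctor A B F by fact
  interpret G: strict_twofunctor B C G by fact
  show ?thesis
    by (rule strict_twofunctorI)
      (simp_all add: twofun_comp_def F.A.two_category_axioms G.B.two_category_axioms)
qed

text \<open>
  Choosing for every object \<open>b\<close> of the target an object \<open>g b\<close> with an isomorphism from its image to
  \<open>b\<close>, 1-cells and 2-cells of the target are conjugated by these isomorphisms and lifted uniquely;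
  uniqueness of lifts makes the result a strict 2-functor and both families of isomorphisms
  2-natural.
\<close>

theorem equivalent_twocats_if_ff_eso:
  fixes A :: "('o, 'm, 'c, 'y) twocat_scheme" and B :: "('p, 'n, 'd, 'z) twocat_scheme"
    and F :: "('o, 'm, 'c, 'p, 'n, 'd) twofun"
  assumes "strict_twofunctor A B F"
    and inj_mo: "\<And>f f'. \<lbrakk>f \<in> Mor A; f' \<in> Mor A; Dom A f = Dom A f'; Cod A f = Cod A f';
      mo F f = mo F f'\<rbrakk> \<Longrightarrow> f = f'"
    and full_mo: "\<And>x y k. \<lbrakk>x \<in> Obj A; y \<in> Obj A; k \<in> hom B (ob F x) (ob F y)\<rbrakk>
      \<Longrightarrow> \<exists>f \<in> hom A x y. mo F f = k"
    and inj_ce: "\<And>\<gamma> \<gamma>'. \<lbrakk>\<gamma> \<in> Cell A; \<gamma>' \<in> Cell A; Src A \<gamma> = Src A \<gamma>'; Tgt A \<gamma> = Tgt A \<gamma>';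
      ce F \<gamma> = ce F \<gamma>'\<rbrakk> \<Longrightarrow> \<gamma> = \<gamma>'"
    and full_ce: "\<And>f f' \<kappa>. \<lbrakk>f \<in> Mor A; f' \<in> Mor A; Dom A f = Dom A f'; Cod A f = Cod A f';
      \<kappa> \<in> cells B (mo F f) (mo F f')\<rbrakk> \<Longrightarrow> \<exists>\<gamma> \<in> cells A f f'. ce F \<gamma> = \<kappa>"
    and eso: "\<And>b. b \<in> Obj B \<Longrightarrow> \<exists>a \<in> Obj A. \<exists>e \<in> hom B (ob F a) b. invertible_mor B e"
  shows "equivalent_twocats A B"
proof -
  interpret F: strict_twofunctor A B F by fact
  have "\<forall>b. \<exists>a e e'. b \<in> Obj B \<longrightarrow> a \<in> Obj A \<and> e \<in> hom B (ob F a) b \<and> e' \<in> hom B b (ob F a) \<and>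
      e' \<cdot>\<^bsub>B\<^esub> e = Idm B (ob F a) \<and> e \<cdot>\<^bsub>B\<^esub> e' = Idm B b"
    using eso unfolding invertible_mor_def hom_def by fastforce
  then obtain g e e' where ge: "\<And>b. b \<in> Obj B \<Longrightarrow> g b \<in> Obj A \<and> e b \<in> hom B (ob F (g b)) b \<and>
      e' b \<in> hom B b (ob F (g b)) \<and> e' b \<cdot>\<^bsub>B\<^esub> e b = Idm B (ob F (g b)) \<and> e b \<cdot>\<^bsub>B\<^esub> e' b = Idm B b"
    by metis
  then have g [simp]: "\<And>b. b \<in> Obj B \<Longrightarrow> g b \<in> Obj A"
    and e [simp]: "\<And>b. b \<in> Obj B \<Longrightarrow> e b \<in> Mor B" "\<And>b. b \<in> Obj B \<Longrightarrow> Dom B (e b) = ob F (g b)"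
      "\<And>b. b \<in> Obj B \<Longrightarrow> Cod B (e b) = b"
    and e' [simp]: "\<And>b. b \<in> Obj B \<Longrightarrow> e' b \<in> Mor B" "\<And>b. b \<in> Obj B \<Longrightarrow> Cod B (e' b) = ob F (g b)"
      "\<And>b. b \<in> Obj B \<Longrightarrow> Dom B (e' b) = b"
    and ee' [simp]: "\<And>b. b \<in> Obj B \<Longrightarrow> e' b \<cdot>\<^bsub>B\<^esub> e b = Idm B (ob F (g b))"
      "\<And>b. b \<in> Obj B \<Longrightarrow> e b \<cdot>\<^bsub>B\<^esub> e' b = Idm B b"
    by (auto simp: hom_def)
  have ee'c [simp]: "\<And>b f. \<lbrakk>b \<in> Obj B; f \<in> Mor B; Cod B f = ob F (g b)\<rbrakk> \<Longrightarrow> e' b \<cdot>\<^bsub>B\<^esub> (e b \<cdot>\<^bsub>B\<^esub> f) = f"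
    "\<And>b f. \<lbrakk>b \<in> Obj B; f \<in> Mor B; Cod B f = b\<rbrakk> \<Longrightarrow> e b \<cdot>\<^bsub>B\<^esub> (e' b \<cdot>\<^bsub>B\<^esub> f) = f"
    by (simp_all flip: F.B.Cmp_simps(3))
  have "\<forall>f. \<exists>h. f \<in> Mor B \<longrightarrow> h \<in> hom A (g (Dom B f)) (g (Cod B f)) \<and>
      mo F h = e' (Cod B f) \<cdot>\<^bsub>B\<^esub> (f \<cdot>\<^bsub>B\<^esub> e (Dom B f))"
    using full_mo by (simp add: hom_def)
  then obtain Gm where Gm: "\<And>f. f \<in> Mor B \<Longrightarrow> Gm f \<in> hom A (g (Dom B f)) (g (Cod B f)) \<and>
      mo F (Gm f) = e' (Cod B f) \<cdot>\<^bsub>B\<^esub> (f \<cdot>\<^bsub>B\<^esub> e (Dom B f))"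
    by metis
  then have Gm_simps [simp]: "\<And>f. f \<in> Mor B \<Longrightarrow> Gm f \<in> Mor A"
      "\<And>f. f \<in> Mor B \<Longrightarrow> Dom A (Gm f) = g (Dom B f)"
      "\<And>f. f \<in> Mor B \<Longrightarrow> Cod A (Gm f) = g (Cod B f)"
      "\<And>f. f \<in> Mor B \<Longrightarrow> mo F (Gm f) = e' (Cod B f) \<cdot>\<^bsub>B\<^esub> (f \<cdot>\<^bsub>B\<^esub> e (Dom B f))"
    by (auto simp: hom_def)
  have "\<exists>\<kappa>. \<kappa> \<in> cells A (Gm (Src B \<gamma>)) (Gm (Tgt B \<gamma>)) \<and>
      ce F \<kappa> = Idc B (e' (Cod B (Src B \<gamma>))) \<star>\<^bsub>B\<^esub> (\<gamma> \<star>\<^bsub>B\<^esub> Idc B (e (Dom B (Src B \<gamma>))))"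
    if "\<gamma> \<in> Cell B" for \<gamma>
    using full_ce[of "Gm (Src B \<gamma>)" "Gm (Tgt B \<gamma>)"
        "Idc B (e' (Cod B (Src B \<gamma>))) \<star>\<^bsub>B\<^esub> (\<gamma> \<star>\<^bsub>B\<^esub> Idc B (e (Dom B (Src B \<gamma>))))"] that
    by (fastforce simp: cells_def)
  then obtain Gc where Gc: "\<And>\<gamma>. \<gamma> \<in> Cell B \<Longrightarrow> Gc \<gamma> \<in> cells A (Gm (Src B \<gamma>)) (Gm (Tgt B \<gamma>)) \<and>
      ce F (Gc \<gamma>) = Idc B (e' (Cod B (Src B \<gamma>))) \<star>\<^bsub>B\<^esub> (\<gamma> \<star>\<^bsub>B\<^esub> Idc B (e (Dom B (Src B \<gamma>))))"
    by metis
  then have Gc_simps [simp]: "\<And>\<gamma>. \<gamma> \<in> Cell B \<Longrightarrow> Gc \<gamma> \<in> Cell A"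
      "\<And>\<gamma>. \<gamma> \<in> Cell B \<Longrightarrow> Src A (Gc \<gamma>) = Gm (Src B \<gamma>)"
      "\<And>\<gamma>. \<gamma> \<in> Cell B \<Longrightarrow> Tgt A (Gc \<gamma>) = Gm (Tgt B \<gamma>)"
      "\<And>\<gamma>. \<gamma> \<in> Cell B \<Longrightarrow> ce F (Gc \<gamma>) =
        Idc B (e' (Cod B (Src B \<gamma>))) \<star>\<^bsub>B\<^esub> (\<gamma> \<star>\<^bsub>B\<^esub> Idc B (e (Dom B (Src B \<gamma>))))"
    by (auto simp: cells_def)
  \<comment> \<open>makes the lift of a horizontal composite agree with the composite of the lifts\<close>
  have whisker_ee' [simp]: "\<And>b \<gamma>. \<lbrakk>b \<in> Obj B; \<gamma> \<in> Cell B; Cod B (Src B \<gamma>) = b\<rbrakk>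
      \<Longrightarrow> Idc B (e b) \<star>\<^bsub>B\<^esub> (Idc B (e' b) \<star>\<^bsub>B\<^esub> \<gamma>) = \<gamma>"
    by simp
  define G where "G = \<lparr>ob = g, mo = Gm, ce = Gc\<rparr>"
  have G_sel [simp]: "ob G = g" "mo G = Gm" "ce G = Gc" by (simp_all add: G_def)
  have G: "strict_twofunctor B A G"
  proof (rule strict_twofunctorI, goal_cases)
    case (3 x)
    then show ?case by (auto intro!: inj_mo)
  next
    case (4 f)
    then show ?case by (auto intro!: inj_ce)
  next
    case (6 f k)
    then show ?case by (auto intro!: inj_mo)
  next
    case (7 \<alpha> \<beta>)
    moreover have "Dom B (Src B \<beta>) = Dom B (Src B \<alpha>)" "Cod B (Src B \<beta>) = Cod B (Src B \<alpha>)"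
      using 7 F.B.parallel_simps[of \<alpha>] by simp_all
    ultimately show ?case by (auto intro!: inj_ce)
  next
    case (8 \<alpha> \<beta>)
    then show ?case by (auto intro!: inj_ce inj_mo)
  qed (auto simp: F.A.two_category_axioms F.B.two_category_axioms)
  \<comment> \<open>the unit at \<open>x\<close> is the lift of the inverse of the chosen isomorphism at the image of \<open>x\<close>\<close>
  have "\<exists>h. h \<in> hom A x (g (ob F x)) \<and> mo F h = e' (ob F x)" if "x \<in> Obj A" for x
    using full_mo[of x "g (ob F x)" "e' (ob F x)"] that by (auto simp: hom_def)
  then obtain n where n: "\<And>x. x \<in> Obj A \<Longrightarrow> n x \<in> hom A x (g (ob F x)) \<and> mo F (n x) = e' (ob F x)"
    by metis
  then have n_simps [simp]: "\<And>x. x \<in> Obj A \<Longrightarrow> n x \<in> Mor A" "\<And>x. x \<in> Obj A \<Longrightarrow> Dom A (n x) = x"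
      "\<And>x. x \<in> Obj A \<Longrightarrow> Cod A (n x) = g (ob F x)" "\<And>x. x \<in> Obj A \<Longrightarrow> mo F (n x) = e' (ob F x)"
    by (auto simp: hom_def)
  have n_iso: "invertible_mor A (n x)" if x: "x \<in> Obj A" for x
  proof -
    obtain h where "h \<in> hom A (g (ob F x)) x" "mo F h = e (ob F x)"
      using full_mo[of "g (ob F x)" x "e (ob F x)"] x by (auto simp: hom_def)
    then show ?thesis
      using x unfolding invertible_mor_def
      by (auto simp: hom_def intro!: bexI[where x = h] inj_mo)
  qed
  have e_iso: "invertible_mor B (e b)" if "b \<in> Obj B" for b
    using that unfolding invertible_mor_def hom_def by (simp, intro exI[where x = "e' b"]) simp
  note sel = twofun_id_def twofun_comp_def
  have "two_natural_iso A A twofun_id (twofun_comp G F) n"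
    by (intro two_natural_iso.intro two_natural_iso_axioms.intro strict_twofunctor_id
        strict_twofunctor_comp[OF F.strict_twofunctor_axioms G] F.A.two_category_axioms)
      (auto simp: sel hom_def cells_def n_iso intro!: inj_mo inj_ce)
  moreover have "two_natural_iso B B (twofun_comp F G) twofun_id e"
    by (intro two_natural_iso.intro two_natural_iso_axioms.intro strict_twofunctor_id
        strict_twofunctor_comp[OF G F.strict_twofunctor_axioms] F.B.two_category_axioms)
      (auto simp: sel hom_def cells_def e_iso)
  ultimately show ?thesis
    unfolding equivalent_twocats_def using F.strict_twofunctor_axioms G by blast
qed

section \<open>Pseudo-models form a 2-category\<close>

context pseudofunctor
begin

lemma pf_simps [simp]:
  "x \<in> Obj A \<Longrightarrow> ob F x \<in> Obj B"
  "f \<in> Mor A \<Longrightarrow> mo F f \<in> Mor B"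
  "f \<in> Mor A \<Longrightarrow> Dom B (mo F f) = ob F (Dom A f)"
  "f \<in> Mor A \<Longrightarrow> Cod B (mo F f) = ob F (Cod A f)"
  "\<gamma> \<in> Cell A \<Longrightarrow> ce F \<gamma> \<in> Cell B"
  "\<gamma> \<in> Cell A \<Longrightarrow> Src B (ce F \<gamma>) = mo F (Src A \<gamma>)"
  "\<gamma> \<in> Cell A \<Longrightarrow> Tgt B (ce F \<gamma>) = mo F (Tgt A \<gamma>)"
  "x \<in> Obj A \<Longrightarrow> un F x \<in> Cell B"
  "x \<in> Obj A \<Longrightarrow> Src B (un F x) = Idm B (ob F x)"
  "x \<in> Obj A \<Longrightarrow> Tgt B (un F x) = mo F (Idm A x)"
  "\<lbrakk>f \<in> Mor A; g \<in> Mor A; Cod A f = Dom A g\<rbrakk> \<Longrightarrow> cp F g f \<in> Cell B"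
  "\<lbrakk>f \<in> Mor A; g \<in> Mor A; Cod A f = Dom A g\<rbrakk> \<Longrightarrow> Src B (cp F g f) = mo F g \<cdot>\<^bsub>B\<^esub> mo F f"
  "\<lbrakk>f \<in> Mor A; g \<in> Mor A; Cod A f = Dom A g\<rbrakk> \<Longrightarrow> Tgt B (cp F g f) = mo F (g \<cdot>\<^bsub>A\<^esub> f)"
  using ob_closed[of x] mo_hom[of f "Dom A f" "Cod A f"] ce_cells[of \<gamma> "Src A \<gamma>" "Tgt A \<gamma>"]
    un_cells[of x] cp_cells[of f "Dom A f" "Cod A f" g "Cod A g"]
  by (auto simp: hom_def cells_def)

end

context pseudonatural
begin

lemma pn_simps [simp]:
  "x \<in> Obj A \<Longrightarrow> tcomp \<alpha> x \<in> Mor B"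
  "x \<in> Obj A \<Longrightarrow> Dom B (tcomp \<alpha> x) = ob (tdom \<alpha>) x"
  "x \<in> Obj A \<Longrightarrow> Cod B (tcomp \<alpha> x) = ob (tcod \<alpha>) x"
  "f \<in> Mor A \<Longrightarrow> tnat \<alpha> f \<in> Cell B"
  "f \<in> Mor A \<Longrightarrow> Src B (tnat \<alpha> f) = mo (tcod \<alpha>) f \<cdot>\<^bsub>B\<^esub> tcomp \<alpha> (Dom A f)"
  "f \<in> Mor A \<Longrightarrow> Tgt B (tnat \<alpha> f) = tcomp \<alpha> (Cod A f) \<cdot>\<^bsub>B\<^esub> mo (tdom \<alpha>) f"
  "f \<in> Mor A \<Longrightarrow> invertible_cell B (tnat \<alpha> f)"
  using tcomp_hom[of x] tnat_cells[of f "Dom A f" "Cod A f"] tnat_invertible[of f]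
  by (auto simp: hom_def cells_def)

lemma tnat_natural':
  "\<gamma> \<in> Cell A \<Longrightarrow>
    tnat \<alpha> (Tgt A \<gamma>) \<bullet>\<^bsub>B\<^esub> (ce (tcod \<alpha>) \<gamma> \<star>\<^bsub>B\<^esub> Idc B (tcomp \<alpha> (Dom A (Src A \<gamma>))))
      = (Idc B (tcomp \<alpha> (Cod A (Src A \<gamma>))) \<star>\<^bsub>B\<^esub> ce (tdom \<alpha>) \<gamma>) \<bullet>\<^bsub>B\<^esub> tnat \<alpha> (Src A \<gamma>)"
  using tnat_natural[of "Src A \<gamma>" "Dom A (Src A \<gamma>)" "Cod A (Src A \<gamma>)" \<gamma> "Tgt A \<gamma>"]
  by (auto simp: hom_def cells_def)

lemma tnat_comp':
  "\<lbrakk>f \<in> Mor A; g \<in> Mor A; Cod A f = Dom A g\<rbrakk>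
    \<Longrightarrow> tnat \<alpha> (g \<cdot>\<^bsub>A\<^esub> f) \<bullet>\<^bsub>B\<^esub> (cp (tcod \<alpha>) g f \<star>\<^bsub>B\<^esub> Idc B (tcomp \<alpha> (Dom A f)))
      = (Idc B (tcomp \<alpha> (Cod A g)) \<star>\<^bsub>B\<^esub> cp (tdom \<alpha>) g f) \<bullet>\<^bsub>B\<^esub>
        ((tnat \<alpha> g \<star>\<^bsub>B\<^esub> Idc B (mo (tdom \<alpha>) f)) \<bullet>\<^bsub>B\<^esub> (Idc B (mo (tcod \<alpha>) g) \<star>\<^bsub>B\<^esub> tnat \<alpha> f))"
  using tnat_comp[of f "Dom A f" "Cod A f" g "Cod A g"] by (simp add: hom_def)

end

context modification
begin

lemma md_simps [simp]:
  "x \<in> Obj A \<Longrightarrow> mcomp \<Gamma> x \<in> Cell B"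
  "x \<in> Obj A \<Longrightarrow> Src B (mcomp \<Gamma> x) = tcomp (mdom \<Gamma>) x"
  "x \<in> Obj A \<Longrightarrow> Tgt B (mcomp \<Gamma> x) = tcomp (mcod \<Gamma>) x"
  using mcomp_cells[of x] by (auto simp: cells_def)

lemma mcomp_natural':
  "f \<in> Mor A \<Longrightarrow>
    (mcomp \<Gamma> (Cod A f) \<star>\<^bsub>B\<^esub> Idc B (mo (tdom (mdom \<Gamma>)) f)) \<bullet>\<^bsub>B\<^esub> tnat (mdom \<Gamma>) f
      = tnat (mcod \<Gamma>) f \<bullet>\<^bsub>B\<^esub> (Idc B (mo (tcod (mdom \<Gamma>)) f) \<star>\<^bsub>B\<^esub> mcomp \<Gamma> (Dom A f))"
  using mcomp_natural[of f "Dom A f" "Cod A f"] by (auto simp: hom_def)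

end

lemma pstrans_eqI:
  fixes \<alpha> \<beta> :: "('o, 'm, 'c, 'p, 'n, 'd) pstrans"
  assumes "tdom \<alpha> = tdom \<beta>" and "tcod \<alpha> = tcod \<beta>"
    and "tcomp \<alpha> \<in> extensional X" and "tcomp \<beta> \<in> extensional X"
    and "tnat \<alpha> \<in> extensional Y" and "tnat \<beta> \<in> extensional Y"
    and "\<And>x. x \<in> X \<Longrightarrow> tcomp \<alpha> x = tcomp \<beta> x" and "\<And>f. f \<in> Y \<Longrightarrow> tnat \<alpha> f = tnat \<beta> f"
  shows "\<alpha> = \<beta>"
  using assms extensionalityI[of "tcomp \<alpha>" X "tcomp \<beta>"] extensionalityI[of "tnat \<alpha>" Y "tnat \<beta>"]
  by (cases \<alpha>; cases \<beta>) auto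

lemma modif_eqI:
  fixes \<Gamma> \<Delta> :: "('o, 'm, 'c, 'p, 'n, 'd) modif"
  assumes "mdom \<Gamma> = mdom \<Delta>" and "mcod \<Gamma> = mcod \<Delta>"
    and "mcomp \<Gamma> \<in> extensional X" and "mcomp \<Delta> \<in> extensional X"
    and "\<And>x. x \<in> X \<Longrightarrow> mcomp \<Gamma> x = mcomp \<Delta> x"
  shows "\<Gamma> = \<Delta>"
  using assms extensionalityI[of "mcomp \<Gamma>" X "mcomp \<Delta>"] by (cases \<Gamma>; cases \<Delta>) auto

lemma pstrans_comp_sel [simp]:
  "tdom (pstrans_comp A B \<beta> \<alpha>) = tdom \<alpha>"
  "tcod (pstrans_comp A B \<beta> \<alpha>) = tcod \<beta>"
  "tcomp (pstrans_comp A B \<beta> \<alpha>) = (\<lambda>x\<in>Obj A. tcomp \<beta> x \<cdot>\<^bsub>B\<^esub> tcomp \<alpha> x)"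
  "tnat (pstrans_comp A B \<beta> \<alpha>) = (\<lambda>f\<in>Mor A.
    (Idc B (tcomp \<beta> (Cod A f)) \<star>\<^bsub>B\<^esub> tnat \<alpha> f) \<bullet>\<^bsub>B\<^esub> (tnat \<beta> f \<star>\<^bsub>B\<^esub> Idc B (tcomp \<alpha> (Dom A f))))"
  by (simp_all add: pstrans_comp_def)

text \<open>
  The naturality cell of a composite pastes the cells of the two factors, so each axiom holds by
  whiskering the corresponding axioms of the factors. For compatibility with composition, the cell
  of \<open>\<beta>\<close> at \<open>g\<close> has moreover to be slid past the cell of \<open>\<alpha>\<close> at \<open>f\<close>, by the interchange law.
\<close>

lemma pseudonatural_comp:
  assumes "pseudonatural A B \<alpha>" and "pseudonatural A B \<beta>" and [simp]: "tcod \<alpha> = tdom \<beta>"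
  shows "pseudonatural A B (pstrans_comp A B \<beta> \<alpha>)"
proof -
  interpret \<alpha>: pseudonatural A B \<alpha> by fact
  interpret \<beta>: pseudonatural A B \<beta> by fact
  note pf = \<alpha>.F.pseudofunctor_axioms \<beta>.G.pseudofunctor_axioms
  let ?\<alpha> = "tcomp \<alpha>" and ?\<beta> = "tcomp \<beta>"
  let ?F = "tdom \<alpha>" and ?G = "tdom \<beta>" and ?H = "tcod \<beta>"
  show ?thesis
  proof (intro pseudonatural.intro pseudonatural_axioms.intro; (simp only: pstrans_comp_sel)?)
    fix f x g \<gamma> y assume "f \<in> hom A x y" "\<gamma> \<in> cells A f g"
    then have c: "\<gamma> \<in> Cell A" "Src A \<gamma> = f" "Tgt A \<gamma> = g" "Dom A f = x" "Cod A f = y"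
      by (auto simp: hom_def cells_def)
    have "f \<in> Mor A" "g \<in> Mor A" "Dom A g = x" "Cod A g = y"
      using \<alpha>.F.A.Src_closed[OF c(1)] \<alpha>.F.A.Tgt_closed[OF c(1)] \<alpha>.F.A.parallel_simps[OF c(1)]
      by (simp_all only: c)
    moreover from this c have "x \<in> Obj A" "y \<in> Obj A"
      using \<alpha>.F.A.Dom_closed \<alpha>.F.A.Cod_closed by blast+
    moreover note c
    ultimately have [simp]: "\<gamma> \<in> Cell A" "Src A \<gamma> = f" "Tgt A \<gamma> = g" "f \<in> Mor A" "g \<in> Mor A"
      "Dom A f = x" "Cod A f = y" "Dom A g = x" "Cod A g = y" "x \<in> Obj A" "y \<in> Obj A" by blast+
    have 1: "(tnat \<beta> g \<star>\<^bsub>B\<^esub> Idc B (?\<alpha> x)) \<bullet>\<^bsub>B\<^esub> (ce ?H \<gamma> \<star>\<^bsub>B\<^esub> Idc B (?\<beta> x \<cdot>\<^bsub>B\<^esub> ?\<alpha> x))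
       = (Idc B (?\<beta> y) \<star>\<^bsub>B\<^esub> (ce ?G \<gamma> \<star>\<^bsub>B\<^esub> Idc B (?\<alpha> x))) \<bullet>\<^bsub>B\<^esub> (tnat \<beta> f \<star>\<^bsub>B\<^esub> Idc B (?\<alpha> x))"
      using arg_cong[OF \<beta>.tnat_natural'[OF c(1)], of "\<lambda>\<zeta>. \<zeta> \<star>\<^bsub>B\<^esub> Idc B (?\<alpha> x)"] by simp
    have 2: "(Idc B (?\<beta> y) \<star>\<^bsub>B\<^esub> tnat \<alpha> g) \<bullet>\<^bsub>B\<^esub> (Idc B (?\<beta> y) \<star>\<^bsub>B\<^esub> (ce ?G \<gamma> \<star>\<^bsub>B\<^esub> Idc B (?\<alpha> x)))
       = (Idc B (?\<beta> y \<cdot>\<^bsub>B\<^esub> ?\<alpha> y) \<star>\<^bsub>B\<^esub> ce ?F \<gamma>) \<bullet>\<^bsub>B\<^esub> (Idc B (?\<beta> y) \<star>\<^bsub>B\<^esub> tnat \<alpha> f)"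
      using arg_cong[OF \<alpha>.tnat_natural'[OF c(1)], of "\<lambda>\<zeta>. Idc B (?\<beta> y) \<star>\<^bsub>B\<^esub> \<zeta>"] by simp
    show "(\<lambda>f\<in>Mor A. (Idc B (?\<beta> (Cod A f)) \<star>\<^bsub>B\<^esub> tnat \<alpha> f) \<bullet>\<^bsub>B\<^esub>
             (tnat \<beta> f \<star>\<^bsub>B\<^esub> Idc B (?\<alpha> (Dom A f)))) g \<bullet>\<^bsub>B\<^esub>
         (ce ?H \<gamma> \<star>\<^bsub>B\<^esub> Idc B ((\<lambda>x\<in>Obj A. ?\<beta> x \<cdot>\<^bsub>B\<^esub> ?\<alpha> x) x))
       = (Idc B ((\<lambda>x\<in>Obj A. ?\<beta> x \<cdot>\<^bsub>B\<^esub> ?\<alpha> x) y) \<star>\<^bsub>B\<^esub> ce ?F \<gamma>) \<bullet>\<^bsub>B\<^esub>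
         (\<lambda>f\<in>Mor A. (Idc B (?\<beta> (Cod A f)) \<star>\<^bsub>B\<^esub> tnat \<alpha> f) \<bullet>\<^bsub>B\<^esub>
             (tnat \<beta> f \<star>\<^bsub>B\<^esub> Idc B (?\<alpha> (Dom A f)))) f"
      by (simp add: 1 \<alpha>.F.B.Vcm_cong_right[OF 2])
  next
    fix f x y g z assume "f \<in> hom A x y" "g \<in> hom A y z"
    then have c [simp]: "f \<in> Mor A" "g \<in> Mor A" "Dom A f = x" "Cod A f = y" "Dom A g = y"
      "Cod A g = z" by (auto simp: hom_def)
    have "Dom A f \<in> Obj A" "Cod A f \<in> Obj A" "Cod A g \<in> Obj A"
      using c(1,2) \<alpha>.F.A.Dom_closed \<alpha>.F.A.Cod_closed by blast+
    then have o [simp]: "x \<in> Obj A" "y \<in> Obj A" "z \<in> Obj A" by auto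
    have 1: "(tnat \<beta> (g \<cdot>\<^bsub>A\<^esub> f) \<star>\<^bsub>B\<^esub> Idc B (?\<alpha> x)) \<bullet>\<^bsub>B\<^esub> (cp ?H g f \<star>\<^bsub>B\<^esub> Idc B (?\<beta> x \<cdot>\<^bsub>B\<^esub> ?\<alpha> x))
       = (Idc B (?\<beta> z) \<star>\<^bsub>B\<^esub> (cp ?G g f \<star>\<^bsub>B\<^esub> Idc B (?\<alpha> x))) \<bullet>\<^bsub>B\<^esub>
         ((tnat \<beta> g \<star>\<^bsub>B\<^esub> Idc B (mo ?G f \<cdot>\<^bsub>B\<^esub> ?\<alpha> x)) \<bullet>\<^bsub>B\<^esub>
          (Idc B (mo ?H g) \<star>\<^bsub>B\<^esub> (tnat \<beta> f \<star>\<^bsub>B\<^esub> Idc B (?\<alpha> x))))"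
      using arg_cong[OF \<beta>.tnat_comp'[of f g], of "\<lambda>\<zeta>. \<zeta> \<star>\<^bsub>B\<^esub> Idc B (?\<alpha> x)"] by simp
    have 2: "(Idc B (?\<beta> z) \<star>\<^bsub>B\<^esub> tnat \<alpha> (g \<cdot>\<^bsub>A\<^esub> f)) \<bullet>\<^bsub>B\<^esub> (Idc B (?\<beta> z) \<star>\<^bsub>B\<^esub> (cp ?G g f \<star>\<^bsub>B\<^esub> Idc B (?\<alpha> x)))
       = (Idc B (?\<beta> z \<cdot>\<^bsub>B\<^esub> ?\<alpha> z) \<star>\<^bsub>B\<^esub> cp ?F g f) \<bullet>\<^bsub>B\<^esub>
         ((Idc B (?\<beta> z) \<star>\<^bsub>B\<^esub> (tnat \<alpha> g \<star>\<^bsub>B\<^esub> Idc B (mo ?F f))) \<bullet>\<^bsub>B\<^esub>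
          (Idc B (?\<beta> z \<cdot>\<^bsub>B\<^esub> mo ?G g) \<star>\<^bsub>B\<^esub> tnat \<alpha> f))"
      using arg_cong[OF \<alpha>.tnat_comp'[of f g], of "\<lambda>\<zeta>. Idc B (?\<beta> z) \<star>\<^bsub>B\<^esub> \<zeta>"] by simp
    have 3: "(tnat \<beta> g \<star>\<^bsub>B\<^esub> Idc B (?\<alpha> y \<cdot>\<^bsub>B\<^esub> mo ?F f)) \<bullet>\<^bsub>B\<^esub> (Idc B (mo ?H g \<cdot>\<^bsub>B\<^esub> ?\<beta> y) \<star>\<^bsub>B\<^esub> tnat \<alpha> f)
       = (Idc B (?\<beta> z \<cdot>\<^bsub>B\<^esub> mo ?G g) \<star>\<^bsub>B\<^esub> tnat \<alpha> f) \<bullet>\<^bsub>B\<^esub> (tnat \<beta> g \<star>\<^bsub>B\<^esub> Idc B (mo ?G f \<cdot>\<^bsub>B\<^esub> ?\<alpha> x))"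
      using \<alpha>.F.B.whisker_exchange[of "tnat \<alpha> f" "tnat \<beta> g"] by simp
    have 4: "(Idc B (?\<beta> z) \<star>\<^bsub>B\<^esub> tnat \<alpha> (g \<cdot>\<^bsub>A\<^esub> f)) \<bullet>\<^bsub>B\<^esub>
        ((Idc B (?\<beta> z) \<star>\<^bsub>B\<^esub> (cp ?G g f \<star>\<^bsub>B\<^esub> Idc B (?\<alpha> x))) \<bullet>\<^bsub>B\<^esub> \<zeta>)
       = (Idc B (?\<beta> z \<cdot>\<^bsub>B\<^esub> ?\<alpha> z) \<star>\<^bsub>B\<^esub> cp ?F g f) \<bullet>\<^bsub>B\<^esub>
         ((Idc B (?\<beta> z) \<star>\<^bsub>B\<^esub> (tnat \<alpha> g \<star>\<^bsub>B\<^esub> Idc B (mo ?F f))) \<bullet>\<^bsub>B\<^esub>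
          ((Idc B (?\<beta> z \<cdot>\<^bsub>B\<^esub> mo ?G g) \<star>\<^bsub>B\<^esub> tnat \<alpha> f) \<bullet>\<^bsub>B\<^esub> \<zeta>))"
      if "\<zeta> \<in> Cell B" "Tgt B \<zeta> = ?\<beta> z \<cdot>\<^bsub>B\<^esub> (mo ?G g \<cdot>\<^bsub>B\<^esub> (mo ?G f \<cdot>\<^bsub>B\<^esub> ?\<alpha> x))" for \<zeta>
      using \<alpha>.F.B.Vcm_cong_right[OF 2, of \<zeta>] that by simp
    show "(\<lambda>f\<in>Mor A. (Idc B (?\<beta> (Cod A f)) \<star>\<^bsub>B\<^esub> tnat \<alpha> f) \<bullet>\<^bsub>B\<^esub>
             (tnat \<beta> f \<star>\<^bsub>B\<^esub> Idc B (?\<alpha> (Dom A f)))) (g \<cdot>\<^bsub>A\<^esub> f) \<bullet>\<^bsub>B\<^esub>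
         (cp ?H g f \<star>\<^bsub>B\<^esub> Idc B ((\<lambda>x\<in>Obj A. ?\<beta> x \<cdot>\<^bsub>B\<^esub> ?\<alpha> x) x))
       = (Idc B ((\<lambda>x\<in>Obj A. ?\<beta> x \<cdot>\<^bsub>B\<^esub> ?\<alpha> x) z) \<star>\<^bsub>B\<^esub> cp ?F g f) \<bullet>\<^bsub>B\<^esub>
         ((\<lambda>f\<in>Mor A. (Idc B (?\<beta> (Cod A f)) \<star>\<^bsub>B\<^esub> tnat \<alpha> f) \<bullet>\<^bsub>B\<^esub>
             (tnat \<beta> f \<star>\<^bsub>B\<^esub> Idc B (?\<alpha> (Dom A f)))) g \<star>\<^bsub>B\<^esub> Idc B (mo ?F f)) \<bullet>\<^bsub>B\<^esub>
         (Idc B (mo ?H g) \<star>\<^bsub>B\<^esub> (\<lambda>f\<in>Mor A. (Idc B (?\<beta> (Cod A f)) \<star>\<^bsub>B\<^esub> tnat \<alpha> f) \<bullet>\<^bsub>B\<^esub>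
             (tnat \<beta> f \<star>\<^bsub>B\<^esub> Idc B (?\<alpha> (Dom A f)))) f)"
      by (simp add: 1 4 \<alpha>.F.B.Vcm_cong_right[OF 3])
  next
    fix x assume o [simp]: "x \<in> Obj A"
    have 1: "(tnat \<beta> (Idm A x) \<star>\<^bsub>B\<^esub> Idc B (?\<alpha> x)) \<bullet>\<^bsub>B\<^esub> (un ?H x \<star>\<^bsub>B\<^esub> Idc B (?\<beta> x \<cdot>\<^bsub>B\<^esub> ?\<alpha> x))
       = Idc B (?\<beta> x) \<star>\<^bsub>B\<^esub> (un ?G x \<star>\<^bsub>B\<^esub> Idc B (?\<alpha> x))"
      using arg_cong[OF \<beta>.tnat_unit[of x], of "\<lambda>\<zeta>. \<zeta> \<star>\<^bsub>B\<^esub> Idc B (?\<alpha> x)"] by simp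
    have 2: "(Idc B (?\<beta> x) \<star>\<^bsub>B\<^esub> tnat \<alpha> (Idm A x)) \<bullet>\<^bsub>B\<^esub> (Idc B (?\<beta> x) \<star>\<^bsub>B\<^esub> (un ?G x \<star>\<^bsub>B\<^esub> Idc B (?\<alpha> x)))
       = Idc B (?\<beta> x \<cdot>\<^bsub>B\<^esub> ?\<alpha> x) \<star>\<^bsub>B\<^esub> un ?F x"
      using arg_cong[OF \<alpha>.tnat_unit[of x], of "\<lambda>\<zeta>. Idc B (?\<beta> x) \<star>\<^bsub>B\<^esub> \<zeta>"] by simp
    show "(\<lambda>f\<in>Mor A. (Idc B (?\<beta> (Cod A f)) \<star>\<^bsub>B\<^esub> tnat \<alpha> f) \<bullet>\<^bsub>B\<^esub>
             (tnat \<beta> f \<star>\<^bsub>B\<^esub> Idc B (?\<alpha> (Dom A f)))) (Idm A x) \<bullet>\<^bsub>B\<^esub>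
         (un ?H x \<star>\<^bsub>B\<^esub> Idc B ((\<lambda>x\<in>Obj A. ?\<beta> x \<cdot>\<^bsub>B\<^esub> ?\<alpha> x) x))
       = Idc B ((\<lambda>x\<in>Obj A. ?\<beta> x \<cdot>\<^bsub>B\<^esub> ?\<alpha> x) x) \<star>\<^bsub>B\<^esub> un ?F x"
      by (simp add: 1 2)
  qed (use pf in \<open>auto simp: hom_def cells_def\<close>)
qed

lemma pseudo_f_transformation_comp:
  assumes "pseudo_f_transformation A B \<alpha>" and "pseudo_f_transformation A B \<beta>"
    and [simp]: "tcod \<alpha> = tdom \<beta>"
  shows "pseudo_f_transformation A B (pstrans_comp A B \<beta> \<alpha>)"
proof -
  interpret \<alpha>: pseudo_f_transformation A B \<alpha> by fact
  interpret \<beta>: pseudo_f_transformation A B \<beta> by fact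
  have comp: "pseudonatural A B (pstrans_comp A B \<beta> \<alpha>)"
    by (intro pseudonatural_comp \<alpha>.pseudonatural_axioms \<beta>.pseudonatural_axioms) simp
  have "(Idc B (tcomp \<beta> (Cod A f)) \<star>\<^bsub>B\<^esub> tnat \<alpha> f) \<bullet>\<^bsub>B\<^esub> (tnat \<beta> f \<star>\<^bsub>B\<^esub> Idc B (tcomp \<alpha> (Dom A f)))
    = Idc B (mo (tcod \<beta>) f \<cdot>\<^bsub>B\<^esub> (tcomp \<beta> (Dom A f) \<cdot>\<^bsub>B\<^esub> tcomp \<alpha> (Dom A f)))"
    if f: "f \<in> Mor A" "f \<in> inert A" for f
  proof -
    have ea: "tnat \<alpha> f = Idc B (mo (tcod \<alpha>) f \<cdot>\<^bsub>B\<^esub> tcomp \<alpha> (Dom A f))"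
      and eb: "tnat \<beta> f = Idc B (mo (tcod \<beta>) f \<cdot>\<^bsub>B\<^esub> tcomp \<beta> (Dom A f))"
      using f \<alpha>.tnat_identity[of f "Dom A f" "Cod A f"] \<beta>.tnat_identity[of f "Dom A f" "Cod A f"]
      by (auto simp: hom_def)
    have e: "mo (tcod \<beta>) f \<cdot>\<^bsub>B\<^esub> tcomp \<beta> (Dom A f) = tcomp \<beta> (Cod A f) \<cdot>\<^bsub>B\<^esub> mo (tdom \<beta>) f"
      using \<beta>.pn_simps(6)[OF f(1)] f(1) by (simp add: eb)
    have "mo (tcod \<beta>) f \<cdot>\<^bsub>B\<^esub> (tcomp \<beta> (Dom A f) \<cdot>\<^bsub>B\<^esub> tcomp \<alpha> (Dom A f))
        = (tcomp \<beta> (Cod A f) \<cdot>\<^bsub>B\<^esub> mo (tdom \<beta>) f) \<cdot>\<^bsub>B\<^esub> tcomp \<alpha> (Dom A f)"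
      by (rule \<alpha>.F.B.Cmp_cong_right[OF e]) (use f(1) in simp_all)
    then show ?thesis
      using f(1) by (simp add: ea eb)
  qed
  note identity = this
  show ?thesis
  proof (intro pseudo_f_transformation.intro pseudo_f_transformation_axioms.intro
      comp)
    fix f x y assume f: "f \<in> hom A x y" "f \<in> inert A"
    then have "f \<in> Mor A" "Dom A f = x" "x \<in> Obj A"
      using \<alpha>.F.A.Dom_closed by (auto simp: hom_def)
    with identity[of f] f(2) show "tnat (pstrans_comp A B \<beta> \<alpha>) f
        = Idc B (mo (tcod (pstrans_comp A B \<beta> \<alpha>)) f \<cdot>\<^bsub>B\<^esub> tcomp (pstrans_comp A B \<beta> \<alpha>) x)"
      by simp
  qed (simp_all only: pstrans_comp_sel \<alpha>.F.pseudo_f_functor_axioms \<beta>.G.pseudo_f_functor_axioms)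
qed

lemma pseudo_f_transformation_id:
  assumes "pseudo_f_functor A B F"
  shows "pseudo_f_transformation A B \<lparr>tdom = F, tcod = F, tcomp = (\<lambda>x\<in>Obj A. Idm B (ob F x)),
    tnat = (\<lambda>f\<in>Mor A. Idc B (mo F f))\<rparr>"
proof -
  interpret F: pseudo_f_functor A B F by fact
  show ?thesis
  proof (intro pseudo_f_transformation.intro pseudonatural.intro pseudonatural_axioms.intro
        pseudo_f_transformation_axioms.intro, goal_cases)
    case (8 f x y \<gamma> g)
    then have \<gamma>: "\<gamma> \<in> Cell A" "Src A \<gamma> = f" "Tgt A \<gamma> = g" "f \<in> Mor A" "Dom A f = x" "Cod A f = y"
      by (auto simp: hom_def cells_def)
    have [simp]: "f \<in> Mor A" "g \<in> Mor A" "Dom A g = x" "Cod A g = y" "x \<in> Obj A" "y \<in> Obj A"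
      using F.A.Src_closed[OF \<gamma>(1)] F.A.Tgt_closed[OF \<gamma>(1)] F.A.parallel_simps[OF \<gamma>(1)]
        F.A.Dom_closed[OF \<gamma>(4)] F.A.Cod_closed[OF \<gamma>(4)] by (simp_all only: \<gamma>)
    show ?case using \<gamma> by simp
  next
    case (10 f x y g z)
    then have [simp]: "f \<in> Mor A" "g \<in> Mor A" "Dom A f = x" "Cod A f = y" "Dom A g = y" "Cod A g =
        z"
      by (simp_all add: hom_def)
    then have [simp]: "x \<in> Obj A" "y \<in> Obj A" "z \<in> Obj A"
      using F.A.Dom_closed[of f] F.A.Cod_closed[of f] F.A.Cod_closed[of g] by simp_all
    show ?case by simp
  qed (auto simp: hom_def cells_def F.pseudo_f_functor_axioms F.pseudofunctor_axioms F.A.Dom_closed)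
qed

lemma modification_id:
  assumes "pseudonatural A B \<alpha>"
  shows "modification A B \<lparr>mdom = \<alpha>, mcod = \<alpha>, mcomp = (\<lambda>x\<in>Obj A. Idc B (tcomp \<alpha> x))\<rparr>"
proof -
  interpret pseudonatural A B \<alpha> by fact
  show ?thesis
    by (intro modification.intro modification_axioms.intro)
      (auto simp: hom_def cells_def pseudonatural_axioms)
qed

lemma modification_Vcm:
  assumes "modification A B \<Gamma>" and "modification A B \<Delta>" and [simp]: "mcod \<Gamma> = mdom \<Delta>"
  shows "modification A B \<lparr>mdom = mdom \<Gamma>, mcod = mcod \<Delta>,
    mcomp = (\<lambda>x\<in>Obj A. mcomp \<Delta> x \<bullet>\<^bsub>B\<^esub> mcomp \<Gamma> x)\<rparr>"
proof -
  interpret \<Gamma>: modification A B \<Gamma> by fact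
  interpret \<Delta>: modification A B \<Delta> by fact
  have [simp]: "tdom (mdom \<Gamma>) = tdom (mdom \<Delta>)" "tcod (mdom \<Gamma>) = tcod (mdom \<Delta>)"
    "tdom (mcod \<Delta>) = tdom (mdom \<Delta>)" "tcod (mcod \<Delta>) = tcod (mdom \<Delta>)"
    using \<Gamma>.tdom_parallel \<Gamma>.tcod_parallel \<Delta>.tdom_parallel \<Delta>.tcod_parallel by simp_all
  let ?F = "tdom (mdom \<Delta>)" and ?G = "tcod (mdom \<Delta>)"
  have "((mcomp \<Delta> (Cod A f) \<bullet>\<^bsub>B\<^esub> mcomp \<Gamma> (Cod A f)) \<star>\<^bsub>B\<^esub> Idc B (mo ?F f)) \<bullet>\<^bsub>B\<^esub> tnat (mdom \<Gamma>) f
      = tnat (mcod \<Delta>) f \<bullet>\<^bsub>B\<^esub>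
        (Idc B (mo ?G f) \<star>\<^bsub>B\<^esub> (mcomp \<Delta> (Dom A f) \<bullet>\<^bsub>B\<^esub> mcomp \<Gamma> (Dom A f)))"
    if f: "f \<in> Mor A" for f
  proof -
    note 1 = \<Gamma>.mcomp_natural'[OF f] and 2 = \<Delta>.mcomp_natural'[OF f]
    have "(mcomp \<Delta> (Cod A f) \<star>\<^bsub>B\<^esub> Idc B (mo ?F f)) \<bullet>\<^bsub>B\<^esub> (tnat (mdom \<Delta>) f \<bullet>\<^bsub>B\<^esub> \<zeta>)
      = tnat (mcod \<Delta>) f \<bullet>\<^bsub>B\<^esub> ((Idc B (mo ?G f) \<star>\<^bsub>B\<^esub> mcomp \<Delta> (Dom A f)) \<bullet>\<^bsub>B\<^esub> \<zeta>)"
      if "\<zeta> \<in> Cell B" "Tgt B \<zeta> = mo ?G f \<cdot>\<^bsub>B\<^esub> tcomp (mdom \<Delta>) (Dom A f)" for \<zeta>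
      using \<Gamma>.S.F.B.Vcm_cong_right[OF 2, of \<zeta>] that f by simp
    then show ?thesis using f 1 by simp
  qed
  then show ?thesis
    by (intro modification.intro modification_axioms.intro)
      (auto simp: hom_def cells_def \<Gamma>.S.pseudonatural_axioms \<Delta>.T.pseudonatural_axioms)
qed

text \<open>
  Moving \<open>\<Delta>\<close> and then \<open>\<Gamma>\<close> across the pasting of the naturality cells takes the modification
  axioms of both and two interchanges: of \<open>\<Delta>\<close> with the cell of the first transformation, and of
  \<open>\<Gamma>\<close> with the cell of the second.
\<close>

lemma modification_Hcm:
  assumes "modification A B \<Gamma>" and "modification A B \<Delta>" and "tcod (mdom \<Gamma>) = tdom (mdom \<Delta>)"
  shows "modification A B \<lparr>mdom = pstrans_comp A B (mdom \<Delta>) (mdom \<Gamma>),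
    mcod = pstrans_comp A B (mcod \<Delta>) (mcod \<Gamma>), mcomp = (\<lambda>x\<in>Obj A. mcomp \<Delta> x \<star>\<^bsub>B\<^esub> mcomp \<Gamma> x)\<rparr>"
proof -
  interpret \<Gamma>: modification A B \<Gamma> by fact
  interpret \<Delta>: modification A B \<Delta> by fact
  let ?F = "tdom (mdom \<Gamma>)" and ?G = "tdom (mdom \<Delta>)" and ?H = "tcod (mdom \<Delta>)"
  have [simp]: "tcod (mdom \<Gamma>) = ?G" "tcod (mcod \<Gamma>) = ?G" "tdom (mcod \<Gamma>) = ?F"
    "tdom (mcod \<Delta>) = ?G" "tcod (mcod \<Delta>) = ?H"
    using \<Gamma>.tdom_parallel \<Gamma>.tcod_parallel \<Delta>.tdom_parallel \<Delta>.tcod_parallel assms(3) by simp_all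
  have d: "pseudonatural A B (pstrans_comp A B (mdom \<Delta>) (mdom \<Gamma>))"
    "pseudonatural A B (pstrans_comp A B (mcod \<Delta>) (mcod \<Gamma>))"
    using \<Gamma>.S.pseudonatural_axioms \<Gamma>.T.pseudonatural_axioms
      \<Delta>.S.pseudonatural_axioms \<Delta>.T.pseudonatural_axioms by (auto intro!: pseudonatural_comp)
  note B = \<Gamma>.S.F.B.two_category_axioms
  let ?\<alpha> = "tcomp (mdom \<Gamma>)" and ?\<alpha>' = "tcomp (mcod \<Gamma>)" and ?\<beta> = "tcomp (mdom \<Delta>)"
    and ?\<beta>' = "tcomp (mcod \<Delta>)"
  have nat: "((mcomp \<Delta> (Cod A f) \<star>\<^bsub>B\<^esub> mcomp \<Gamma> (Cod A f)) \<star>\<^bsub>B\<^esub> Idc B (mo ?F f)) \<bullet>\<^bsub>B\<^esub>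
      ((Idc B (?\<beta> (Cod A f)) \<star>\<^bsub>B\<^esub> tnat (mdom \<Gamma>) f) \<bullet>\<^bsub>B\<^esub>
       (tnat (mdom \<Delta>) f \<star>\<^bsub>B\<^esub> Idc B (?\<alpha> (Dom A f))))
    = ((Idc B (?\<beta>' (Cod A f)) \<star>\<^bsub>B\<^esub> tnat (mcod \<Gamma>) f) \<bullet>\<^bsub>B\<^esub>
       (tnat (mcod \<Delta>) f \<star>\<^bsub>B\<^esub> Idc B (?\<alpha>' (Dom A f)))) \<bullet>\<^bsub>B\<^esub>
      (Idc B (mo ?H f) \<star>\<^bsub>B\<^esub> (mcomp \<Delta> (Dom A f) \<star>\<^bsub>B\<^esub> mcomp \<Gamma> (Dom A f)))"
    if f [simp]: "f \<in> Mor A" for f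
  proof -
    obtain x y where xy: "Dom A f = x" "Cod A f = y" by blast
    with f have o [simp]: "x \<in> Obj A" "y \<in> Obj A" "Dom A f = x" "Cod A f = y"
      using \<Gamma>.S.F.A.Dom_closed \<Gamma>.S.F.A.Cod_closed by blast+
    have split_y: "mcomp \<Delta> y \<star>\<^bsub>B\<^esub> mcomp \<Gamma> y
        = (Idc B (?\<beta>' y) \<star>\<^bsub>B\<^esub> mcomp \<Gamma> y) \<bullet>\<^bsub>B\<^esub> (mcomp \<Delta> y \<star>\<^bsub>B\<^esub> Idc B (?\<alpha> y))"
      using two_category.Hcm_left_first[OF B, of "mcomp \<Gamma> y" "mcomp \<Delta> y"] by simp
    have split_x: "mcomp \<Delta> x \<star>\<^bsub>B\<^esub> mcomp \<Gamma> x
        = (Idc B (?\<beta>' x) \<star>\<^bsub>B\<^esub> mcomp \<Gamma> x) \<bullet>\<^bsub>B\<^esub> (mcomp \<Delta> x \<star>\<^bsub>B\<^esub> Idc B (?\<alpha> x))"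
      using two_category.Hcm_left_first[OF B, of "mcomp \<Gamma> x" "mcomp \<Delta> x"] by simp
    have 1: "(mcomp \<Delta> y \<star>\<^bsub>B\<^esub> Idc B (?\<alpha> y \<cdot>\<^bsub>B\<^esub> mo ?F f)) \<bullet>\<^bsub>B\<^esub> (Idc B (?\<beta> y) \<star>\<^bsub>B\<^esub> tnat (mdom \<Gamma>) f)
      = (Idc B (?\<beta>' y) \<star>\<^bsub>B\<^esub> tnat (mdom \<Gamma>) f) \<bullet>\<^bsub>B\<^esub> (mcomp \<Delta> y \<star>\<^bsub>B\<^esub> Idc B (mo ?G f \<cdot>\<^bsub>B\<^esub> ?\<alpha> x))"
      using two_category.whisker_exchange[OF B, of "tnat (mdom \<Gamma>) f" "mcomp \<Delta> y"] by simp
    have 2: "(Idc B (?\<beta>' y) \<star>\<^bsub>B\<^esub> (mcomp \<Gamma> y \<star>\<^bsub>B\<^esub> Idc B (mo ?F f))) \<bullet>\<^bsub>B\<^esub>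
        (Idc B (?\<beta>' y) \<star>\<^bsub>B\<^esub> tnat (mdom \<Gamma>) f)
      = (Idc B (?\<beta>' y) \<star>\<^bsub>B\<^esub> tnat (mcod \<Gamma>) f) \<bullet>\<^bsub>B\<^esub> (Idc B (?\<beta>' y \<cdot>\<^bsub>B\<^esub> mo ?G f) \<star>\<^bsub>B\<^esub> mcomp \<Gamma> x)"
      using arg_cong[OF \<Gamma>.mcomp_natural'[OF f], of "\<lambda>\<zeta>. Idc B (?\<beta>' y) \<star>\<^bsub>B\<^esub> \<zeta>"] by simp
    have 3: "(mcomp \<Delta> y \<star>\<^bsub>B\<^esub> Idc B (mo ?G f \<cdot>\<^bsub>B\<^esub> ?\<alpha> x)) \<bullet>\<^bsub>B\<^esub> (tnat (mdom \<Delta>) f \<star>\<^bsub>B\<^esub> Idc B (?\<alpha> x))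
      = (tnat (mcod \<Delta>) f \<star>\<^bsub>B\<^esub> Idc B (?\<alpha> x)) \<bullet>\<^bsub>B\<^esub>
        (Idc B (mo ?H f) \<star>\<^bsub>B\<^esub> (mcomp \<Delta> x \<star>\<^bsub>B\<^esub> Idc B (?\<alpha> x)))"
      using arg_cong[OF \<Delta>.mcomp_natural'[OF f], of "\<lambda>\<zeta>. \<zeta> \<star>\<^bsub>B\<^esub> Idc B (?\<alpha> x)"] by simp
    have 4: "(tnat (mcod \<Delta>) f \<star>\<^bsub>B\<^esub> Idc B (?\<alpha>' x)) \<bullet>\<^bsub>B\<^esub> (Idc B (mo ?H f \<cdot>\<^bsub>B\<^esub> ?\<beta>' x) \<star>\<^bsub>B\<^esub> mcomp \<Gamma> x)
      = (Idc B (?\<beta>' y \<cdot>\<^bsub>B\<^esub> mo ?G f) \<star>\<^bsub>B\<^esub> mcomp \<Gamma> x) \<bullet>\<^bsub>B\<^esub> (tnat (mcod \<Delta>) f \<star>\<^bsub>B\<^esub> Idc B (?\<alpha> x))"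
      using two_category.whisker_exchange[OF B, of "mcomp \<Gamma> x" "tnat (mcod \<Delta>) f"] by simp
    note c = two_category.Vcm_cong_right[OF B]
    show ?thesis
      by (simp add: split_x split_y c[OF 1] c[OF 2] 3 c[OF 4])
  qed
  show ?thesis
  proof (intro modification.intro modification_axioms.intro d, goal_cases)
    case (6 f x y)
    then show ?case using nat[of f] \<Gamma>.S.F.A.Dom_closed[of f] \<Gamma>.S.F.A.Cod_closed[of f]
      by (auto simp: hom_def)
  qed (auto simp: cells_def d)
qed

lemma PsMod_sel:
  "Obj (PsMod A B) = {F. pseudo_model A B F}"
  "Mor (PsMod A B) = {\<alpha>. pseudo_f_transformation A B \<alpha> \<and> pseudo_model A B (tdom \<alpha>) \<and>
    pseudo_model A B (tcod \<alpha>)}"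
  "Cell (PsMod A B) = {\<Gamma>. modification A B \<Gamma> \<and> mdom \<Gamma> \<in> Mor (PsMod A B) \<and>
    mcod \<Gamma> \<in> Mor (PsMod A B)}"
  "Dom (PsMod A B) = tdom" "Cod (PsMod A B) = tcod"
  "Src (PsMod A B) = mdom" "Tgt (PsMod A B) = mcod"
  "Idm (PsMod A B) F = \<lparr>tdom = F, tcod = F, tcomp = (\<lambda>x\<in>Obj A. Idm B (ob F x)),
    tnat = (\<lambda>f\<in>Mor A. Idc B (mo F f))\<rparr>"
  "Idc (PsMod A B) \<alpha> = \<lparr>mdom = \<alpha>, mcod = \<alpha>, mcomp = (\<lambda>x\<in>Obj A. Idc B (tcomp \<alpha> x))\<rparr>"
  "\<beta> \<cdot>\<^bsub>PsMod A B\<^esub> \<alpha> = pstrans_comp A B \<beta> \<alpha>"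
  "\<Delta> \<bullet>\<^bsub>PsMod A B\<^esub> \<Gamma> = \<lparr>mdom = mdom \<Gamma>, mcod = mcod \<Delta>,
    mcomp = (\<lambda>x\<in>Obj A. mcomp \<Delta> x \<bullet>\<^bsub>B\<^esub> mcomp \<Gamma> x)\<rparr>"
  "\<Delta> \<star>\<^bsub>PsMod A B\<^esub> \<Gamma> = \<lparr>mdom = pstrans_comp A B (mdom \<Delta>) (mdom \<Gamma>),
    mcod = pstrans_comp A B (mcod \<Delta>) (mcod \<Gamma>), mcomp = (\<lambda>x\<in>Obj A. mcomp \<Delta> x \<star>\<^bsub>B\<^esub> mcomp \<Gamma> x)\<rparr>"
  by (simp_all add: PsMod_def)

lemma PsMod_MorD:
  "\<alpha> \<in> Mor (PsMod A B) \<Longrightarrow> pseudonatural A B \<alpha>"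
  by (simp add: PsMod_sel pseudo_f_transformation.axioms)

lemma PsMod_CellD:
  "\<Gamma> \<in> Cell (PsMod A B) \<Longrightarrow> modification A B \<Gamma>"
  by (simp add: PsMod_sel)

lemma PsMod_unit:
  assumes "pseudonatural A B \<alpha>"
  shows "pstrans_comp A B \<alpha> (Idm (PsMod A B) (tdom \<alpha>)) = \<alpha>"
    and "pstrans_comp A B (Idm (PsMod A B) (tcod \<alpha>)) \<alpha> = \<alpha>"
proof -
  interpret pseudonatural A B \<alpha> by fact
  show "pstrans_comp A B \<alpha> (Idm (PsMod A B) (tdom \<alpha>)) = \<alpha>"
    "pstrans_comp A B (Idm (PsMod A B) (tcod \<alpha>)) \<alpha> = \<alpha>"
    by (rule pstrans_eqI[where X = "Obj A" and Y = "Mor A"];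
      use tcomp_extensional tnat_extensional in \<open>simp add: PsMod_sel\<close>)+
qed

lemma pstrans_comp_assoc:
  assumes "pseudonatural A B \<alpha>" and "pseudonatural A B \<beta>" and "pseudonatural A B \<gamma>"
    and [simp]: "tcod \<alpha> = tdom \<beta>" "tcod \<beta> = tdom \<gamma>"
  shows "pstrans_comp A B \<gamma> (pstrans_comp A B \<beta> \<alpha>) = pstrans_comp A B (pstrans_comp A B \<gamma> \<beta>) \<alpha>"
proof -
  interpret \<alpha>: pseudonatural A B \<alpha> by fact
  interpret \<beta>: pseudonatural A B \<beta> by fact
  interpret \<gamma>: pseudonatural A B \<gamma> by fact
  show ?thesis
    by (rule pstrans_eqI[where X = "Obj A" and Y = "Mor A"]) auto
qed

text \<open>
  The laws hold strictly since they hold in the target: all compositions are computed componentwise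
  there, and components off the carriers are \<open>undefined\<close> on both sides.
\<close>

theorem two_category_PsMod: "two_category (PsMod A B)"
proof (rule two_categoryI, goal_cases)
  case (1 f)
  then show ?case by (simp add: PsMod_sel)
next
  case (2 \<gamma>)
  then show ?case using PsMod_CellD[OF 2]
    by (simp add: PsMod_sel modification.tdom_parallel modification.tcod_parallel)
next
  case (3 x)
  then show ?case by (simp add: PsMod_sel pseudo_f_transformation_id pseudo_model_def)
next
  case (4 f g)
  then show ?case by (simp add: PsMod_sel pseudo_f_transformation_comp)
next
  case (5 f)
  then show ?case using PsMod_unit[OF PsMod_MorD[OF 5]] by (simp add: PsMod_sel(4,5,10))
next
  case (6 f g h)
  then show ?case using pstrans_comp_assoc[of A B f g h] PsMod_MorD[of _ A B] by (simp add:
      PsMod_sel(4,5,10))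
next
  case (7 f)
  then show ?case using modification_id[OF PsMod_MorD[OF 7]] by (simp add: PsMod_sel)
next
  case (8 \<alpha> \<beta>)
  then show ?case using modification_Vcm[of A B \<alpha> \<beta>] by (simp add: PsMod_sel)
next
  case (9 \<alpha>)
  interpret modification A B \<alpha> using PsMod_CellD[OF 9] .
  show ?case
    by (intro conjI; rule modif_eqI[where X = "Obj A"]; use mcomp_extensional in \<open>simp add:
        PsMod_sel\<close>)
next
  case (10 \<alpha> \<beta> \<gamma>)
  interpret \<alpha>: modification A B \<alpha> using 10 PsMod_CellD by blast
  interpret \<beta>: modification A B \<beta> using 10 PsMod_CellD by blast
  interpret \<gamma>: modification A B \<gamma> using 10 PsMod_CellD by blast
  have [simp]: "mcod \<alpha> = mdom \<beta>" "mcod \<beta> = mdom \<gamma>" using 10 by (simp_all add: PsMod_sel)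
  show ?case by (rule modif_eqI[where X = "Obj A"]) (simp_all add: PsMod_sel)
next
  case (11 \<alpha> \<beta>)
  interpret \<alpha>: modification A B \<alpha> using 11 PsMod_CellD by blast
  interpret \<beta>: modification A B \<beta> using 11 PsMod_CellD by blast
  show ?case
    using 11 modification_Hcm[of A B \<alpha> \<beta>]
    by (simp add: PsMod_sel pseudo_f_transformation_comp \<alpha>.tcod_parallel[symmetric]
        \<beta>.tdom_parallel[symmetric])
next
  case (12 \<alpha>)
  interpret modification A B \<alpha> using PsMod_CellD[OF 12] .
  have u: "pstrans_comp A B (mdom \<alpha>) (Idm (PsMod A B) (tdom (mdom \<alpha>))) = mdom \<alpha>"
    "pstrans_comp A B (mcod \<alpha>) (Idm (PsMod A B) (tdom (mdom \<alpha>))) = mcod \<alpha>"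
    "pstrans_comp A B (Idm (PsMod A B) (tcod (mdom \<alpha>))) (mdom \<alpha>) = mdom \<alpha>"
    "pstrans_comp A B (Idm (PsMod A B) (tcod (mdom \<alpha>))) (mcod \<alpha>) = mcod \<alpha>"
    using PsMod_unit[OF S.pseudonatural_axioms] PsMod_unit[OF T.pseudonatural_axioms]
    by (simp_all only: tdom_parallel tcod_parallel)
  have i: "tcomp (Idm (PsMod A B) F) x = Idm B (ob F x)" if "x \<in> Obj A" for F x
    using that by (simp add: PsMod_sel)
  have "\<alpha> \<star>\<^bsub>PsMod A B\<^esub> Idc (PsMod A B) (Idm (PsMod A B) (tdom (mdom \<alpha>))) = \<alpha>"
    by (rule modif_eqI[where X = "Obj A"])
      (use mcomp_extensional in \<open>simp_all add: PsMod_sel(9,12) u i\<close>)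
  moreover have "Idc (PsMod A B) (Idm (PsMod A B) (tcod (mdom \<alpha>))) \<star>\<^bsub>PsMod A B\<^esub> \<alpha> = \<alpha>"
    by (rule modif_eqI[where X = "Obj A"])
      (use mcomp_extensional in \<open>simp_all add: PsMod_sel(9,12) u i\<close>)
  ultimately show ?case by (simp only: PsMod_sel(4,5,6))
next
  case (13 \<alpha> \<beta> \<gamma>)
  interpret \<alpha>: modification A B \<alpha> using 13 PsMod_CellD by blast
  interpret \<beta>: modification A B \<beta> using 13 PsMod_CellD by blast
  interpret \<gamma>: modification A B \<gamma> using 13 PsMod_CellD by blast
  have [simp]: "tcod (mdom \<alpha>) = tdom (mdom \<beta>)" "tcod (mdom \<beta>) = tdom (mdom \<gamma>)"
    "tcod (mcod \<alpha>) = tdom (mdom \<beta>)" "tcod (mcod \<beta>) = tdom (mdom \<gamma>)"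
    "tdom (mcod \<beta>) = tdom (mdom \<beta>)" "tdom (mcod \<gamma>) = tdom (mdom \<gamma>)"
    using 13 \<alpha>.tcod_parallel \<beta>.tcod_parallel \<beta>.tdom_parallel \<gamma>.tdom_parallel
    by (simp_all add: PsMod_sel)
  have "pstrans_comp A B (mdom \<gamma>) (pstrans_comp A B (mdom \<beta>) (mdom \<alpha>))
      = pstrans_comp A B (pstrans_comp A B (mdom \<gamma>) (mdom \<beta>)) (mdom \<alpha>)"
    "pstrans_comp A B (mcod \<gamma>) (pstrans_comp A B (mcod \<beta>) (mcod \<alpha>))
      = pstrans_comp A B (pstrans_comp A B (mcod \<gamma>) (mcod \<beta>)) (mcod \<alpha>)"
    by (intro pstrans_comp_assoc \<alpha>.S.pseudonatural_axioms \<alpha>.T.pseudonatural_axioms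
        \<beta>.S.pseudonatural_axioms \<beta>.T.pseudonatural_axioms
        \<gamma>.S.pseudonatural_axioms \<gamma>.T.pseudonatural_axioms; simp)+
  then show ?case by (intro modif_eqI[where X = "Obj A"]) (simp_all add: PsMod_sel)
next
  case (14 f g)
  interpret f: pseudonatural A B f using 14 PsMod_MorD by blast
  interpret g: pseudonatural A B g using 14 PsMod_MorD by blast
  have "tcod f = tdom g" using 14 by (simp add: PsMod_sel)
  then show ?case by (intro modif_eqI[where X = "Obj A"]) (simp_all add: PsMod_sel)
next
  case (15 \<alpha> \<alpha>' \<beta> \<beta>')
  interpret \<alpha>: modification A B \<alpha> using 15 PsMod_CellD by blast
  interpret \<alpha>': modification A B \<alpha>' using 15 PsMod_CellD by blast
  interpret \<beta>: modification A B \<beta> using 15 PsMod_CellD by blast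
  interpret \<beta>': modification A B \<beta>' using 15 PsMod_CellD by blast
  have [simp]: "mcod \<alpha> = mdom \<alpha>'" "mcod \<beta> = mdom \<beta>'" "tcod (mdom \<alpha>) = tdom (mdom \<beta>)"
    using 15 by (simp_all add: PsMod_sel)
  show ?case
    by (rule modif_eqI[where X = "Obj A"])
      (simp_all add: PsMod_sel two_category.interchange'[OF \<alpha>.S.F.B.two_category_axioms])
qed

section \<open>The 2-category of small categories\<close>

context category
begin

lemma cat_simps [simp]:
  "f \<in> carr C \<Longrightarrow> cdom C f \<in> cobj C"
  "f \<in> carr C \<Longrightarrow> ccod C f \<in> cobj C"
  "x \<in> cobj C \<Longrightarrow> cid C x \<in> carr C"
  "x \<in> cobj C \<Longrightarrow> cdom C (cid C x) = x"
  "x \<in> cobj C \<Longrightarrow> ccod C (cid C x) = x"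
  "\<lbrakk>f \<in> carr C; g \<in> carr C; ccod C f = cdom C g\<rbrakk> \<Longrightarrow> ccmp C g f \<in> carr C"
  "\<lbrakk>f \<in> carr C; g \<in> carr C; ccod C f = cdom C g\<rbrakk> \<Longrightarrow> cdom C (ccmp C g f) = cdom C f"
  "\<lbrakk>f \<in> carr C; g \<in> carr C; ccod C f = cdom C g\<rbrakk> \<Longrightarrow> ccod C (ccmp C g f) = ccod C g"
  "\<lbrakk>f \<in> carr C; cdom C f = x\<rbrakk> \<Longrightarrow> ccmp C f (cid C x) = f"
  "\<lbrakk>f \<in> carr C; ccod C f = x\<rbrakk> \<Longrightarrow> ccmp C (cid C x) f = f"
  "\<lbrakk>f \<in> carr C; g \<in> carr C; h \<in> carr C; ccod C f = cdom C g; ccod C g = cdom C h\<rbrakk>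
    \<Longrightarrow> ccmp C (ccmp C h g) f = ccmp C h (ccmp C g f)"
  using cdom_closed ccod_closed cid_closed cdom_cid ccod_cid ccmp_closed cdom_ccmp ccod_ccmp
    ccmp_cid_right[of f] ccmp_cid_left[of f] ccmp_assoc[of f g h] by simp_all

lemma ccmp_cong_right:
  "\<lbrakk>ccmp C b a = ccmp C d c; a \<in> carr C; b \<in> carr C; c \<in> carr C; d \<in> carr C; z \<in> carr C;
    ccod C a = cdom C b; ccod C c = cdom C d; ccod C z = cdom C a; ccod C z = cdom C c\<rbrakk>
    \<Longrightarrow> ccmp C b (ccmp C a z) = ccmp C d (ccmp C c z)"
  by (metis cat_simps(11))

end

context cat_functor
begin

lemma functor_simps [simp]:
  "x \<in> cobj (fdom F) \<Longrightarrow> fobj F x \<in> cobj (fcod F)"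
  "f \<in> carr (fdom F) \<Longrightarrow> farr F f \<in> carr (fcod F)"
  "f \<in> carr (fdom F) \<Longrightarrow> cdom (fcod F) (farr F f) = fobj F (cdom (fdom F) f)"
  "f \<in> carr (fdom F) \<Longrightarrow> ccod (fcod F) (farr F f) = fobj F (ccod (fdom F) f)"
  "x \<in> cobj (fdom F) \<Longrightarrow> farr F (cid (fdom F) x) = cid (fcod F) (fobj F x)"
  "\<lbrakk>f \<in> carr (fdom F); g \<in> carr (fdom F); ccod (fdom F) f = cdom (fdom F) g\<rbrakk>
    \<Longrightarrow> farr F (ccmp (fdom F) g f) = ccmp (fcod F) (farr F g) (farr F f)"
  by (simp_all add: fobj_closed farr_closed cdom_farr ccod_farr farr_cid farr_ccmp)

end

context natural_transformation
begin

lemma nattr_simps [simp]: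
  "fdom (ncod \<alpha>) = fdom (ndom \<alpha>)"
  "fcod (ncod \<alpha>) = fcod (ndom \<alpha>)"
  "x \<in> cobj (fdom (ndom \<alpha>)) \<Longrightarrow> ncomp \<alpha> x \<in> carr (fcod (ndom \<alpha>))"
  "x \<in> cobj (fdom (ndom \<alpha>)) \<Longrightarrow> cdom (fcod (ndom \<alpha>)) (ncomp \<alpha> x) = fobj (ndom \<alpha>) x"
  "x \<in> cobj (fdom (ndom \<alpha>)) \<Longrightarrow> ccod (fcod (ndom \<alpha>)) (ncomp \<alpha> x) = fobj (ncod \<alpha>) x"
  by (simp_all add: fdom_parallel[symmetric] fcod_parallel[symmetric] ncomp_closed cdom_ncomp
      ccod_ncomp)

end

lemma func_eqI:
  fixes F G :: "'u func"
  assumes "cat_functor F" and "cat_functor G" and "fdom F = fdom G" and "fcod F = fcod G"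
    and "\<And>x. x \<in> cobj (fdom F) \<Longrightarrow> fobj F x = fobj G x"
    and "\<And>f. f \<in> carr (fdom F) \<Longrightarrow> farr F f = farr G f"
  shows "F = G"
proof -
  have "fobj F = fobj G" "farr F = farr G"
    using assms cat_functor.fobj_extensional[of F] cat_functor.fobj_extensional[of G]
      cat_functor.farr_extensional[of F] cat_functor.farr_extensional[of G]
    by (metis extensionalityI)+
  then show ?thesis using assms(3,4) by simp
qed

lemma nattr_eqI:
  fixes \<alpha> \<beta> :: "'u nattr"
  assumes "ndom \<alpha> = ndom \<beta>" and "ncod \<alpha> = ncod \<beta>"
    and "ncomp \<alpha> \<in> extensional (cobj (fdom (ndom \<alpha>)))"
    and "ncomp \<beta> \<in> extensional (cobj (fdom (ndom \<alpha>)))"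
    and "\<And>x. x \<in> cobj (fdom (ndom \<alpha>)) \<Longrightarrow> ncomp \<alpha> x = ncomp \<beta> x"
  shows "\<alpha> = \<beta>"
  using assms extensionalityI[of "ncomp \<alpha>" _ "ncomp \<beta>"] by (cases \<alpha>; cases \<beta>) auto

lemma func_sel [simp]:
  "fdom (func_id C) = C" "fcod (func_id C) = C"
  "x \<in> cobj C \<Longrightarrow> fobj (func_id C) x = x" "f \<in> carr C \<Longrightarrow> farr (func_id C) f = f"
  "fdom (func_comp G F) = fdom F" "fcod (func_comp G F) = fcod G"
  "x \<in> cobj (fdom F) \<Longrightarrow> fobj (func_comp G F) x = fobj G (fobj F x)"
  "f \<in> carr (fdom F) \<Longrightarrow> farr (func_comp G F) f = farr G (farr F f)"
  by (simp_all add: func_id_def func_comp_def)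

lemma nattr_sel [simp]:
  "ndom (nattr_id F) = F" "ncod (nattr_id F) = F"
  "x \<in> cobj (fdom F) \<Longrightarrow> ncomp (nattr_id F) x = cid (fcod F) (fobj F x)"
  "cobj (fdom F) = X \<Longrightarrow> ncomp (nattr_id F) \<in> extensional X"
  "ndom (nattr_vcomp \<beta> \<alpha>) = ndom \<alpha>" "ncod (nattr_vcomp \<beta> \<alpha>) = ncod \<beta>"
  "x \<in> cobj (fdom (ndom \<alpha>)) \<Longrightarrow>
    ncomp (nattr_vcomp \<beta> \<alpha>) x = ccmp (fcod (ndom \<alpha>)) (ncomp \<beta> x) (ncomp \<alpha> x)"
  "cobj (fdom (ndom \<alpha>)) = X \<Longrightarrow> ncomp (nattr_vcomp \<beta> \<alpha>) \<in> extensional X"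
  "ndom (nattr_hcomp \<beta> \<alpha>) = func_comp (ndom \<beta>) (ndom \<alpha>)"
  "ncod (nattr_hcomp \<beta> \<alpha>) = func_comp (ncod \<beta>) (ncod \<alpha>)"
  "x \<in> cobj (fdom (ndom \<alpha>)) \<Longrightarrow> ncomp (nattr_hcomp \<beta> \<alpha>) x
    = ccmp (fcod (ndom \<beta>)) (ncomp \<beta> (fobj (ncod \<alpha>) x)) (farr (ndom \<beta>) (ncomp \<alpha> x))"
  "cobj (fdom (ndom \<alpha>)) = X \<Longrightarrow> ncomp (nattr_hcomp \<beta> \<alpha>) \<in> extensional X"
  by (auto simp: nattr_id_def nattr_vcomp_def nattr_hcomp_def)

lemma cat_functor_id: "category C \<Longrightarrow> cat_functor (func_id C)"
proof -
  assume "category C"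
  then interpret category C .
  show ?thesis
    by (intro cat_functor.intro cat_functor_axioms.intro)
      (auto simp: category_axioms, simp_all add: func_id_def)
qed

lemma cat_functor_comp:
  assumes "cat_functor F" and "cat_functor G" and [simp]: "fcod F = fdom G"
  shows "cat_functor (func_comp G F)"
proof -
  interpret F: cat_functor F by fact
  interpret G: cat_functor G by fact
  have [simp]: "x \<in> cobj (fdom F) \<Longrightarrow> fobj F x \<in> cobj (fdom G)"
    "f \<in> carr (fdom F) \<Longrightarrow> farr F f \<in> carr (fdom G)"
    "f \<in> carr (fdom F) \<Longrightarrow> cdom (fdom G) (farr F f) = fobj F (cdom (fdom F) f)"
    "f \<in> carr (fdom F) \<Longrightarrow> ccod (fdom G) (farr F f) = fobj F (ccod (fdom F) f)"
    "x \<in> cobj (fdom F) \<Longrightarrow> farr F (cid (fdom F) x) = cid (fdom G) (fobj F x)"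
    "\<lbrakk>f \<in> carr (fdom F); g \<in> carr (fdom F); ccod (fdom F) f = cdom (fdom F) g\<rbrakk>
    \<Longrightarrow> farr F (ccmp (fdom F) g f) = ccmp (fdom G) (farr F g) (farr F f)" for x f g
    using F.functor_simps by simp_all
  show ?thesis
    by (intro cat_functor.intro cat_functor_axioms.intro)
      (auto simp: F.C.category_axioms G.D.category_axioms, simp_all add: func_comp_def)
qed

lemma CAT_sel:
  "Obj (CAT small) = {C. category C \<and> small (cobj C) \<and> small (carr C)}"
  "Mor (CAT small) = {F. cat_functor F \<and> fdom F \<in> Obj (CAT small) \<and> fcod F \<in> Obj (CAT small)}"
  "Cell (CAT small) = {\<alpha>. natural_transformation \<alpha> \<and> ndom \<alpha> \<in> Mor (CAT small) \<and>
    ncod \<alpha> \<in> Mor (CAT small)}"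
  "Dom (CAT small) = fdom" "Cod (CAT small) = fcod"
  "Src (CAT small) = ndom" "Tgt (CAT small) = ncod"
  "Idm (CAT small) = func_id" "Idc (CAT small) = nattr_id"
  "Cmp (CAT small) = func_comp" "Vcm (CAT small) = nattr_vcomp" "Hcm (CAT small) = nattr_hcomp"
  "inert (CAT small) = Mor (CAT small)"
  by (simp_all add: CAT_def Let_def)

lemma natural_transformation_id:
  assumes "cat_functor F"
  shows "natural_transformation (nattr_id F)"
proof -
  interpret F: cat_functor F by fact
  show ?thesis
    by (intro natural_transformation.intro natural_transformation_axioms.intro)
      (auto simp: F.cat_functor_axioms)
qed

lemma natural_transformation_vcomp:
  assumes "natural_transformation \<alpha>" and "natural_transformation \<beta>" and [simp]: "ncod \<alpha> = ndom \<beta>"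
  shows "natural_transformation (nattr_vcomp \<beta> \<alpha>)"
proof -
  interpret \<alpha>: natural_transformation \<alpha> by fact
  interpret \<beta>: natural_transformation \<beta> by fact
  have [simp]: "fdom (ndom \<beta>) = fdom (ndom \<alpha>)" "fcod (ndom \<beta>) = fcod (ndom \<alpha>)"
    using \<alpha>.nattr_simps(1,2) by simp_all
  let ?C = "fdom (ndom \<alpha>)" and ?D = "fcod (ndom \<alpha>)"
  note [simp] = \<beta>.F.functor_simps[simplified] \<beta>.G.functor_simps[simplified]
      \<beta>.nattr_simps[simplified]
  have "ccmp ?D (farr (ncod \<beta>) f) (ccmp ?D (ncomp \<beta> (cdom ?C f)) (ncomp \<alpha> (cdom ?C f)))
      = ccmp ?D (ccmp ?D (ncomp \<beta> (ccod ?C f)) (ncomp \<alpha> (ccod ?C f))) (farr (ndom \<alpha>) f)"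
    if "f \<in> carr ?C" for f
    using \<alpha>.naturality[OF that] that
      \<alpha>.F.D.ccmp_cong_right[OF \<beta>.naturality[simplified, OF that], of "ncomp \<alpha> (cdom ?C f)"] by simp
  then show ?thesis
    by (intro natural_transformation.intro natural_transformation_axioms.intro)
      (auto simp: \<alpha>.F.cat_functor_axioms \<beta>.G.cat_functor_axioms)
qed

lemma natural_transformation_hcomp:
  assumes "natural_transformation \<alpha>" and "natural_transformation \<beta>"
    and fdg [simp]: "fcod (ndom \<alpha>) = fdom (ndom \<beta>)"
  shows "natural_transformation (nattr_hcomp \<beta> \<alpha>)"
proof -
  interpret \<alpha>: natural_transformation \<alpha> by fact
  interpret \<beta>: natural_transformation \<beta> by fact
  note [simp] = \<alpha>.F.functor_simps[simplified] \<alpha>.G.functor_simps[simplified]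
      \<alpha>.nattr_simps[simplified]
    \<beta>.F.functor_simps[simplified] \<beta>.G.functor_simps[simplified]
  let ?C = "fdom (ndom \<alpha>)" and ?D = "fdom (ndom \<beta>)" and ?E = "fcod (ndom \<beta>)"
  have "ccmp ?E (farr (ncod \<beta>) (farr (ncod \<alpha>) f)) (ccmp ?E (ncomp \<beta> (fobj (ncod \<alpha>) (cdom ?C f)))
        (farr (ndom \<beta>) (ncomp \<alpha> (cdom ?C f))))
      = ccmp ?E (ccmp ?E (ncomp \<beta> (fobj (ncod \<alpha>) (ccod ?C f))) (farr (ndom \<beta>) (ncomp \<alpha> (ccod ?C
          f))))
        (farr (ndom \<beta>) (farr (ndom \<alpha>) f))" if f: "f \<in> carr ?C" for f
  proof -
    have 1: "ccmp ?E (farr (ndom \<beta>) (farr (ncod \<alpha>) f)) (farr (ndom \<beta>) (ncomp \<alpha> (cdom ?C f)))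
        = ccmp ?E (farr (ndom \<beta>) (ncomp \<alpha> (ccod ?C f))) (farr (ndom \<beta>) (farr (ndom \<alpha>) f))"
      using arg_cong[OF \<alpha>.naturality[OF f], of "farr (ndom \<beta>)"] f by simp
    have 2: "ccmp ?E (farr (ncod \<beta>) (farr (ncod \<alpha>) f)) (ncomp \<beta> (fobj (ncod \<alpha>) (cdom ?C f)))
        = ccmp ?E (ncomp \<beta> (fobj (ncod \<alpha>) (ccod ?C f))) (farr (ndom \<beta>) (farr (ncod \<alpha>) f))"
      using \<beta>.naturality[of "farr (ncod \<alpha>) f"] f by simp
    show ?thesis
      using f 1 \<beta>.F.D.ccmp_cong_right[OF 2, of "farr (ndom \<beta>) (ncomp \<alpha> (cdom ?C f))"] by simp
  qed
  then show ?thesis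
    by (intro natural_transformation.intro natural_transformation_axioms.intro)
      (auto simp: \<alpha>.F.cat_functor_axioms \<alpha>.G.cat_functor_axioms \<beta>.F.cat_functor_axioms
        \<beta>.G.cat_functor_axioms cat_functor_comp)
qed

lemma CAT_CellD:
  assumes "\<alpha> \<in> Cell (CAT small)"
  shows "natural_transformation \<alpha>" and "ndom \<alpha> \<in> Mor (CAT small)" and "ncod \<alpha> \<in> Mor (CAT small)"
  using assms by (simp_all add: CAT_sel)

lemma two_category_CAT: "two_category (CAT small)"
proof (rule two_categoryI, goal_cases)
  case (1 f)
  then show ?case by (simp add: CAT_sel)
next
  case (2 \<gamma>)
  then interpret natural_transformation \<gamma> by (simp add: CAT_sel)
  show ?case using 2 by (simp add: CAT_sel)
next
  case (3 x)
  then show ?case by (simp add: CAT_sel cat_functor_id)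
next
  case (4 f g)
  then show ?case by (simp add: CAT_sel cat_functor_comp)
next
  case (5 f)
  then interpret cat_functor f by (simp add: CAT_sel)
  show ?case
    by (simp add: CAT_sel, intro conjI func_eqI)
      (simp_all add: cat_functor_axioms cat_functor_comp cat_functor_id C.category_axioms
        D.category_axioms)
next
  case (6 f g h)
  interpret f: cat_functor f using 6 by (simp add: CAT_sel)
  interpret g: cat_functor g using 6 by (simp add: CAT_sel)
  interpret h: cat_functor h using 6 by (simp add: CAT_sel)
  have [simp]: "fcod f = fdom g" "fcod g = fdom h" using 6 by (simp_all add: CAT_sel)
  note [simp] = f.functor_simps[simplified]
  show ?case
    by (simp add: CAT_sel, intro conjI func_eqI)
      (simp_all add: f.cat_functor_axioms g.cat_functor_axioms h.cat_functor_axioms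
          cat_functor_comp)
next
  case (7 f)
  then show ?case by (simp add: CAT_sel natural_transformation_id)
next
  case (8 \<alpha> \<beta>)
  then show ?case by (simp add: CAT_sel natural_transformation_vcomp)
next
  case (9 \<alpha>)
  then interpret natural_transformation \<alpha> by (simp add: CAT_sel)
  show ?case
    by (simp add: CAT_sel, intro conjI nattr_eqI) (simp_all add: ncomp_extensional nattr_vcomp_def)
next
  case (10 \<alpha> \<beta> \<gamma>)
  interpret \<alpha>: natural_transformation \<alpha> using 10 by (simp add: CAT_sel)
  interpret \<beta>: natural_transformation \<beta> using 10 by (simp add: CAT_sel)
  interpret \<gamma>: natural_transformation \<gamma> using 10 by (simp add: CAT_sel)
  have [simp]: "ncod \<alpha> = ndom \<beta>" "ncod \<beta> = ndom \<gamma>" using 10 by (simp_all add: CAT_sel)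
  have [simp]: "fdom (ndom \<beta>) = fdom (ndom \<alpha>)" "fcod (ndom \<beta>) = fcod (ndom \<alpha>)"
    "fdom (ndom \<gamma>) = fdom (ndom \<alpha>)" "fcod (ndom \<gamma>) = fcod (ndom \<alpha>)"
    using \<alpha>.nattr_simps(1,2) \<beta>.nattr_simps(1,2) by simp_all
  note [simp] = \<beta>.nattr_simps[simplified] \<gamma>.nattr_simps[simplified]
  show ?case
    by (simp add: CAT_sel, intro conjI nattr_eqI) (simp_all add: nattr_vcomp_def)
next
  case (11 \<alpha> \<beta>)
  interpret \<alpha>: natural_transformation \<alpha> using 11 by (simp add: CAT_sel)
  interpret \<beta>: natural_transformation \<beta> using 11 by (simp add: CAT_sel)
  from 11 show ?case by (simp add: CAT_sel natural_transformation_hcomp cat_functor_comp)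
next
  case (12 \<alpha>)
  then interpret natural_transformation \<alpha> by (simp add: CAT_sel)
  have "func_comp (ndom \<alpha>) (func_id (fdom (ndom \<alpha>))) = ndom \<alpha>"
    "func_comp (ncod \<alpha>) (func_id (fdom (ndom \<alpha>))) = ncod \<alpha>"
    "func_comp (func_id (fcod (ndom \<alpha>))) (ndom \<alpha>) = ndom \<alpha>"
    "func_comp (func_id (fcod (ndom \<alpha>))) (ncod \<alpha>) = ncod \<alpha>"
    using F.cat_functor_axioms G.cat_functor_axioms F.C.category_axioms F.D.category_axioms
      F.functor_simps G.functor_simps
    by (intro func_eqI; simp add: cat_functor_comp cat_functor_id)+
  then show ?case
    using F.functor_simps G.functor_simps
    by (simp add: CAT_sel, intro conjI nattr_eqI) (simp_all add: ncomp_extensional nattr_hcomp_def)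
next
  case (13 \<alpha> \<beta> \<gamma>)
  interpret \<alpha>: natural_transformation \<alpha> using 13 by (simp add: CAT_sel)
  interpret \<beta>: natural_transformation \<beta> using 13 by (simp add: CAT_sel)
  interpret \<gamma>: natural_transformation \<gamma> using 13 by (simp add: CAT_sel)
  have [simp]: "fcod (ndom \<alpha>) = fdom (ndom \<beta>)" "fcod (ndom \<beta>) = fdom (ndom \<gamma>)"
    using 13 by (simp_all add: CAT_sel)
  note [simp] = \<alpha>.F.functor_simps[simplified] \<alpha>.G.functor_simps[simplified]
      \<alpha>.nattr_simps[simplified]
    \<beta>.F.functor_simps[simplified] \<beta>.G.functor_simps[simplified] \<beta>.nattr_simps[simplified]
    \<gamma>.F.functor_simps[simplified] \<gamma>.G.functor_simps[simplified]
  have "func_comp (ndom \<gamma>) (func_comp (ndom \<beta>) (ndom \<alpha>)) = func_comp (func_comp (ndom \<gamma>) (ndom \<beta>))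
      (ndom \<alpha>)"
    "func_comp (ncod \<gamma>) (func_comp (ncod \<beta>) (ncod \<alpha>)) = func_comp (func_comp (ncod \<gamma>) (ncod \<beta>))
        (ncod \<alpha>)"
    using \<alpha>.F.cat_functor_axioms \<alpha>.G.cat_functor_axioms \<beta>.F.cat_functor_axioms
      \<beta>.G.cat_functor_axioms \<gamma>.F.cat_functor_axioms \<gamma>.G.cat_functor_axioms
    by (intro func_eqI; simp add: cat_functor_comp)+
  then show ?case
    by (simp add: CAT_sel, intro nattr_eqI) simp_all
next
  case (14 f g)
  interpret f: cat_functor f using 14 by (simp add: CAT_sel)
  interpret g: cat_functor g using 14 by (simp add: CAT_sel)
  have [simp]: "fcod f = fdom g" using 14 by (simp add: CAT_sel)
  note [simp] = f.functor_simps[simplified]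
  show ?case
    by (simp add: CAT_sel, intro nattr_eqI) simp_all
next
  case (15 \<alpha> \<alpha>' \<beta> \<beta>')
  interpret \<alpha>: natural_transformation \<alpha> using 15 by (simp add: CAT_sel)
  interpret \<beta>: natural_transformation \<beta> using 15 by (simp add: CAT_sel)
  interpret \<alpha>': natural_transformation \<alpha>' using 15 by (simp add: CAT_sel)
  interpret \<beta>': natural_transformation \<beta>' using 15 by (simp add: CAT_sel)
  have [simp]: "ncod \<alpha> = ndom \<alpha>'" "ncod \<beta> = ndom \<beta>'" "fcod (ndom \<alpha>) = fdom (ndom \<beta>)"
    using 15 by (simp_all add: CAT_sel)
  have [simp]: "fdom (ndom \<alpha>') = fdom (ndom \<alpha>)" "fcod (ndom \<alpha>') = fdom (ndom \<beta>)"
    "fdom (ndom \<beta>') = fdom (ndom \<beta>)" "fcod (ndom \<beta>') = fcod (ndom \<beta>)"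
    using \<alpha>.nattr_simps(1,2) \<beta>.nattr_simps(1,2) by simp_all
  note [simp] = \<alpha>.F.functor_simps[simplified] \<alpha>.nattr_simps[simplified]
    \<alpha>'.F.functor_simps[simplified] \<alpha>'.G.functor_simps[simplified] \<alpha>'.nattr_simps[simplified]
    \<beta>.F.functor_simps[simplified] \<beta>.nattr_simps[simplified]
    \<beta>'.F.functor_simps[simplified] \<beta>'.G.functor_simps[simplified] \<beta>'.nattr_simps[simplified]
  let ?E = "fcod (ndom \<beta>)"
  have "ccmp ?E (ncomp \<beta> (fobj (ncod \<alpha>') x)) (ccmp ?E (farr (ndom \<beta>) (ncomp \<alpha>' x))
        (farr (ndom \<beta>) (ncomp \<alpha> x)))
      = ccmp ?E (farr (ndom \<beta>') (ncomp \<alpha>' x)) (ccmp ?E (ncomp \<beta> (fobj (ndom \<alpha>') x))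
        (farr (ndom \<beta>) (ncomp \<alpha> x)))" if x: "x \<in> cobj (fdom (ndom \<alpha>))" for x
    by (rule \<beta>.F.D.ccmp_cong_right)
      (use x \<beta>.naturality[of "ncomp \<alpha>' x"] in simp_all)
  then show ?case
    by (simp add: CAT_sel, intro nattr_eqI) simp_all
qed

lemma f_category_CAT: "f_category (CAT small)"
  by (intro f_category.intro f_category_axioms.intro two_category_CAT)
    (auto simp: CAT_sel cat_functor_id cat_functor_comp)

section \<open>Limits of small categories are computed on arrows\<close>

text \<open>
  The arrows of a limit of categories are the compatible families of arrows. This covers objects
  too, since they correspond to their identity arrows.
\<close>

definition arrow_limit ::
  "('i, 'j, 'k, 'y) twocat_scheme \<Rightarrow> ('i \<Rightarrow> 'u cat) \<Rightarrow> ('j \<Rightarrow> 'u func) \<Rightarrow> 'u cat \<Rightarrow> ('i \<Rightarrow> 'u func)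
    \<Rightarrow> bool" where
  "arrow_limit J D U v leg \<longleftrightarrow>
     (\<forall>a. (\<forall>j\<in>Obj J. a j \<in> carr (D j)) \<and> (\<forall>u\<in>Mor J. farr (U u) (a (Dom J u)) = a (Cod J u))
        \<longrightarrow> (\<exists>!e. e \<in> carr v \<and> (\<forall>j\<in>Obj J. farr (leg j) e = a j)))"

lemma category_disc_cat: "category (disc_cat X)"
  by unfold_locales (auto simp: disc_cat_def)

lemma disc_cat_sel [simp]:
  "cobj (disc_cat X) = X" "carr (disc_cat X) = X"
  "x \<in> X \<Longrightarrow> cdom (disc_cat X) x = x" "x \<in> X \<Longrightarrow> ccod (disc_cat X) x = x"
  "x \<in> X \<Longrightarrow> cid (disc_cat X) x = x" "x \<in> X \<Longrightarrow> ccmp (disc_cat X) x x = x"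
  by (simp_all add: disc_cat_def)

text \<open>
  An object of a category, as a functor on the terminal category, whose only object is
  \<open>undefined\<close>.
\<close>

definition const_func :: "'u cat \<Rightarrow> 'u \<Rightarrow> 'u func" where
  "const_func C c = \<lparr>fdom = disc_cat {undefined}, fcod = C, fobj = (\<lambda>x\<in>{undefined}. c),
     farr = (\<lambda>x\<in>{undefined}. cid C c)\<rparr>"

lemma const_func_sel [simp]:
  "fdom (const_func C c) = disc_cat {undefined}" "fcod (const_func C c) = C"
  "fobj (const_func C c) undefined = c" "farr (const_func C c) undefined = cid C c"
  by (simp_all add: const_func_def)

lemma cat_functor_const:
  assumes "category C" and "c \<in> cobj C"
  shows "cat_functor (const_func C c)"
proof -
  interpret category C by fact
  show ?thesis
    using assms category_disc_cat
    by (intro cat_functor.intro cat_functor_axioms.intro) (auto, simp_all add: const_func_def)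
qed

lemma func_comp_const:
  assumes "cat_functor F" and "c \<in> cobj (fdom F)"
  shows "func_comp F (const_func (fdom F) c) = const_func (fcod F) (fobj F c)"
proof -
  interpret cat_functor F by fact
  show ?thesis
    using assms
    by (intro func_eqI cat_functor_comp cat_functor_const) (auto simp: C.category_axioms
        D.category_axioms)
qed

context universe
begin

lemma small_singleton: "small {x}"
proof -
  obtain X where X: "small X" "infinite X" using small_infinite by blast
  then obtain y where "y \<in> X" by (metis finite.emptyI ex_in_conv)
  then show ?thesis using small_image[OF small_subset[OF X(1), of "{y}"], of "\<lambda>_. x"] by simp
qed

lemma disc_cat_Obj [simp]: "small X \<Longrightarrow> disc_cat X \<in> Obj (CAT small)"
  by (simp add: CAT_sel category_disc_cat)

end

locale cat_cone = universe small
  for small :: "'u set \<Rightarrow> bool" +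
  fixes J :: "('i, 'j, 'k) twocat" and D :: "('i, 'j, 'k, 'u cat, 'u func, 'u nattr) twofun"
    and v :: "'u cat" and leg :: "'i \<Rightarrow> 'u func"
  assumes J: "two_category J"
    and D_hom: "u \<in> Mor J \<Longrightarrow> mo D u \<in> hom (CAT small) (ob D (Dom J u)) (ob D (Cod J u))"
    and D_cell: "\<sigma> \<in> Cell J \<Longrightarrow> ce D \<sigma> = nattr_id (mo D (Src J \<sigma>))"
    and v_Obj: "v \<in> Obj (CAT small)"
    and leg_hom: "j \<in> Obj J \<Longrightarrow> leg j \<in> hom (CAT small) v (ob D j)"
    and leg_commute: "u \<in> Mor J \<Longrightarrow> func_comp (mo D u) (leg (Dom J u)) = leg (Cod J u)"
begin

sublocale J: two_category J by (rule J)

sublocale CAT: two_category "CAT small" by (rule two_category_CAT)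

sublocale v: category v using v_Obj by (simp add: CAT_sel)

lemma leg_functor [simp]:
  "j \<in> Obj J \<Longrightarrow> cat_functor (leg j)" "j \<in> Obj J \<Longrightarrow> fdom (leg j) = v"
  "j \<in> Obj J \<Longrightarrow> fcod (leg j) = ob D j"
  using leg_hom[of j] by (simp_all add: hom_def CAT_sel)

lemma D_functor [simp]:
  "u \<in> Mor J \<Longrightarrow> cat_functor (mo D u)" "u \<in> Mor J \<Longrightarrow> fdom (mo D u) = ob D (Dom J u)"
  "u \<in> Mor J \<Longrightarrow> fcod (mo D u) = ob D (Cod J u)"
  using D_hom[of u] by (simp_all add: hom_def CAT_sel)

lemma D_category: "j \<in> Obj J \<Longrightarrow> category (ob D j)"
  using leg_functor[of j] cat_functor.axioms(2) by metis

lemma leg_simps [simp]: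
  assumes "j \<in> Obj J"
  shows "x \<in> cobj v \<Longrightarrow> fobj (leg j) x \<in> cobj (ob D j)"
    and "f \<in> carr v \<Longrightarrow> farr (leg j) f \<in> carr (ob D j)"
    and "f \<in> carr v \<Longrightarrow> cdom (ob D j) (farr (leg j) f) = fobj (leg j) (cdom v f)"
    and "f \<in> carr v \<Longrightarrow> ccod (ob D j) (farr (leg j) f) = fobj (leg j) (ccod v f)"
    and "x \<in> cobj v \<Longrightarrow> farr (leg j) (cid v x) = cid (ob D j) (fobj (leg j) x)"
    and "\<lbrakk>f \<in> carr v; g \<in> carr v; ccod v f = cdom v g\<rbrakk>
      \<Longrightarrow> farr (leg j) (ccmp v g f) = ccmp (ob D j) (farr (leg j) g) (farr (leg j) f)"
  using cat_functor.functor_simps[OF leg_functor(1)[OF assms]] assms by simp_all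

lemma D_leg [simp]:
  "\<lbrakk>u \<in> Mor J; x \<in> cobj v\<rbrakk> \<Longrightarrow> fobj (mo D u) (fobj (leg (Dom J u)) x) = fobj (leg (Cod J u)) x"
  "\<lbrakk>u \<in> Mor J; f \<in> carr v\<rbrakk> \<Longrightarrow> farr (mo D u) (farr (leg (Dom J u)) f) = farr (leg (Cod J u)) f"
  by (metis leg_commute func_sel(7,8) leg_functor(2) J.Dom_closed)+

text \<open>
  The diagram sends 2-cells to identities, so the condition of a cone on 2-cells follows from the
  one on 1-cells.
\<close>

lemma diagram_cone_iff:
  "limit_diagram_cone J (CAT small) D x \<mu> \<longleftrightarrow> x \<in> Obj (CAT small) \<and>
    (\<forall>j\<in>Obj J. \<mu> j \<in> hom (CAT small) x (ob D j)) \<and>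
    (\<forall>u\<in>Mor J. func_comp (mo D u) (\<mu> (Dom J u)) = \<mu> (Cod J u))"
proof -
  have "nattr_hcomp (ce D \<sigma>) (nattr_id (\<mu> (Dom J (Src J \<sigma>)))) = nattr_id (\<mu> (Cod J (Src J \<sigma>)))"
    if \<mu>: "\<forall>j\<in>Obj J. \<mu> j \<in> hom (CAT small) x (ob D j)"
      "\<forall>u\<in>Mor J. func_comp (mo D u) (\<mu> (Dom J u)) = \<mu> (Cod J u)" and \<sigma>: "\<sigma> \<in> Cell J" for \<sigma>
  proof -
    let ?u = "Src J \<sigma>"
    have u: "?u \<in> Mor J" using \<sigma> by simp
    have "nattr_hcomp (nattr_id (mo D ?u)) (nattr_id (\<mu> (Dom J ?u)))
        = nattr_id (func_comp (mo D ?u) (\<mu> (Dom J ?u)))"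
      using CAT.Hcm_Idc'[of "\<mu> (Dom J ?u)" "mo D ?u"] \<mu>(1) D_hom[OF u] u
      by (auto simp: hom_def CAT_sel(4-13))
    then show ?thesis using \<mu>(2) u D_cell[OF \<sigma>] by simp
  qed
  then show ?thesis unfolding limit_diagram_cone_def by (auto simp: CAT_sel(4-13))
qed

text \<open>
  A compatible family of objects is a cone whose vertex is the terminal category.
\<close>

lemma compatible_objects_if_limit:
  assumes lim: "limit_cone J (CAT small) D v leg"
    and c: "\<And>j. j \<in> Obj J \<Longrightarrow> c j \<in> cobj (ob D j)"
      "\<And>u. u \<in> Mor J \<Longrightarrow> fobj (mo D u) (c (Dom J u)) = c (Cod J u)"
  shows "\<exists>!x. x \<in> cobj v \<and> (\<forall>j\<in>Obj J. fobj (leg j) x = c j)"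
proof -
  let ?one = "disc_cat {undefined} :: 'u cat" and ?\<mu> = "\<lambda>j. const_func (ob D j) (c j)"
  have one: "?one \<in> Obj (CAT small)" by (simp add: small_singleton)
  have hom: "const_func C x \<in> hom (CAT small) ?one C" if "C \<in> Obj (CAT small)" "x \<in> cobj C" for C x
    using that one cat_functor_const[of C x] by (simp add: hom_def CAT_sel)
  have D_Obj: "ob D j \<in> Obj (CAT small)" if "j \<in> Obj J" for j
    using leg_hom[OF that] by (auto simp: hom_def CAT_sel)
  have "func_comp (mo D u) (?\<mu> (Dom J u)) = ?\<mu> (Cod J u)" if u: "u \<in> Mor J" for u
    using u c func_comp_const[of "mo D u" "c (Dom J u)"] by simp
  then have "limit_diagram_cone J (CAT small) D ?one ?\<mu>"
    unfolding diagram_cone_iff using one hom D_Obj c by blast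
  then have "\<exists>!h. h \<in> hom (CAT small) ?one v \<and> (\<forall>j\<in>Obj J. func_comp (leg j) h = ?\<mu> j)"
    using lim unfolding limit_cone_def by (simp add: CAT_sel(4-13))
  then obtain h where h: "h \<in> hom (CAT small) ?one v" "\<And>j. j \<in> Obj J \<Longrightarrow> func_comp (leg j) h = ?\<mu> j"
    and h_unique: "\<And>k. \<lbrakk>k \<in> hom (CAT small) ?one v; \<And>j. j \<in> Obj J \<Longrightarrow> func_comp (leg j) k = ?\<mu> j\<rbrakk> \<Longrightarrow> k
        = h"
    by metis
  from h(1) have hf: "cat_functor h" "fdom h = ?one" "fcod h = v" by (simp_all add: hom_def CAT_sel)
  show ?thesis
  proof (rule ex1I[where a = "fobj h undefined"], intro conjI ballI)
    show "fobj h undefined \<in> cobj v"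
      using cat_functor.functor_simps(1)[OF hf(1), of undefined] hf by simp
    show "fobj (leg j) (fobj h undefined) = c j" if "j \<in> Obj J" for j
      using arg_cong[OF h(2)[OF that], of "\<lambda>F. fobj F undefined"] hf by simp
  next
    fix x assume x: "x \<in> cobj v \<and> (\<forall>j\<in>Obj J. fobj (leg j) x = c j)"
    have "func_comp (leg j) (const_func v x) = ?\<mu> j" if "j \<in> Obj J" for j
      using that x func_comp_const[of "leg j" x] by simp
    with h_unique[of "const_func v x"] have "const_func v x = h"
      using hom[of v x] x v_Obj by blast
    then show "x = fobj h undefined" by (metis const_func_sel(3))
  qed
qed

text \<open>
  An arrow is a transformation between functors on the terminal category. Hence a compatible family
  of arrows is what the two-dimensional universal property lifts, once the families of its domains
  and of its codomains have been lifted to objects; and by uniqueness of the latter any two lifts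
  are parallel.
\<close>

lemma arrow_limit_if_limit:
  assumes lim: "limit_cone J (CAT small) D v leg"
  shows "arrow_limit J (ob D) (mo D) v leg"
  unfolding arrow_limit_def
proof (intro allI impI, elim conjE)
  fix a assume a: "\<forall>j\<in>Obj J. a j \<in> carr (ob D j)"
    and comp: "\<forall>u\<in>Mor J. farr (mo D u) (a (Dom J u)) = a (Cod J u)"
  let ?d = "\<lambda>j. cdom (ob D j) (a j)" and ?c = "\<lambda>j. ccod (ob D j) (a j)"
  have dc: "?d j \<in> cobj (ob D j)" "?c j \<in> cobj (ob D j)" if "j \<in> Obj J" for j
    using D_category[OF that] a that by (simp_all add: category.cat_simps)
  have dcu: "fobj (mo D u) (?d (Dom J u)) = ?d (Cod J u)" "fobj (mo D u) (?c (Dom J u)) = ?c (Cod J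
      u)"
    if u: "u \<in> Mor J" for u
    using cat_functor.functor_simps(3,4)[OF D_functor(1)[OF u], of "a (Dom J u)"] a comp u by
        simp_all
  have ex1d: "\<exists>!x. x \<in> cobj v \<and> (\<forall>j\<in>Obj J. fobj (leg j) x = ?d j)"
    and ex1c: "\<exists>!x. x \<in> cobj v \<and> (\<forall>j\<in>Obj J. fobj (leg j) x = ?c j)"
    by (rule compatible_objects_if_limit[OF lim]; use dc dcu in blast)+
  then obtain d c where d: "d \<in> cobj v" "\<And>j. j \<in> Obj J \<Longrightarrow> fobj (leg j) d = ?d j"
    and c: "c \<in> cobj v" "\<And>j. j \<in> Obj J \<Longrightarrow> fobj (leg j) c = ?c j" by metis
  let ?one = "disc_cat {undefined} :: 'u cat"
  define arr where "arr C f = \<lparr>ndom = const_func C (cdom C f), ncod = const_func C (ccod C f),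
    ncomp = (\<lambda>x\<in>{undefined}. f)\<rparr>" for C :: "'u cat" and f
  have one: "?one \<in> Obj (CAT small)" by (simp add: small_singleton)
  have hom: "const_func C x \<in> hom (CAT small) ?one C" if "C \<in> Obj (CAT small)" "x \<in> cobj C" for C x
    using that one cat_functor_const[of C x] by (simp add: hom_def CAT_sel)
  have D_Obj: "ob D j \<in> Obj (CAT small)" if "j \<in> Obj J" for j
    using leg_hom[OF that] by (auto simp: hom_def CAT_sel)
  have arr_cells: "arr C f \<in> cells (CAT small) (const_func C (cdom C f)) (const_func C (ccod C f))"
    if C: "C \<in> Obj (CAT small)" and f: "f \<in> carr C" for C f
  proof -
    interpret C: category C using C by (simp add: CAT_sel)
    have "natural_transformation (arr C f)"
      using f by (intro natural_transformation.intro natural_transformation_axioms.intro)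
        (auto simp: arr_def cat_functor_const C.category_axioms)
    then show ?thesis
      using hom[of C "cdom C f"] hom[of C "ccod C f"] C f
      by (simp add: cells_def CAT_sel(3-7) hom_def) (simp add: arr_def)
  qed
  have legc: "func_comp (leg j) (const_func v x) = const_func (ob D j) (fobj (leg j) x)"
    if "j \<in> Obj J" "x \<in> cobj v" for j x using that func_comp_const[of "leg j" x] by simp
  let ?\<Gamma> = "\<lambda>j. arr (ob D j) (a j)"
  have \<Gamma>: "?\<Gamma> j \<in> cells (CAT small) (func_comp (leg j) (const_func v d)) (func_comp (leg j)
      (const_func v c))"
    if "j \<in> Obj J" for j
    using arr_cells[OF D_Obj[OF that], of "a j"] a that by (simp add: legc c d)
  have \<Gamma>u: "nattr_hcomp (nattr_id (mo D u)) (?\<Gamma> (Dom J u)) = ?\<Gamma> (Cod J u)" if u: "u \<in> Mor J" for u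
  proof -
    interpret U: cat_functor "mo D u" using u by simp
    have "func_comp (mo D u) (const_func (ob D (Dom J u)) x) = const_func (ob D (Cod J u)) (fobj (mo
        D u) x)"
      if "x \<in> cobj (ob D (Dom J u))" for x using func_comp_const[of "mo D u" x] that u by simp
    with dcu[OF u] dc u a comp D_category show ?thesis
      by (intro nattr_eqI) (auto simp: arr_def category.cat_simps nattr_hcomp_def)
  qed
  have "\<exists>!\<gamma>. \<gamma> \<in> cells (CAT small) (const_func v d) (const_func v c) \<and>
      (\<forall>j\<in>Obj J. nattr_hcomp (nattr_id (leg j)) \<gamma> = ?\<Gamma> j)"
    using lim[unfolded limit_cone_def, THEN conjunct2, THEN conjunct2,
        THEN spec[of _ ?one], THEN spec[of _ "const_func v d"], THEN spec[of _ "const_func v c"],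
        THEN spec[of _ ?\<Gamma>]] \<Gamma> \<Gamma>u hom[OF v_Obj d(1)] hom[OF v_Obj c(1)]
    by (simp add: CAT_sel(4-13))
  then obtain \<gamma> where \<gamma>: "\<gamma> \<in> cells (CAT small) (const_func v d) (const_func v c)"
      "\<And>j. j \<in> Obj J \<Longrightarrow> nattr_hcomp (nattr_id (leg j)) \<gamma> = ?\<Gamma> j"
    and \<gamma>_unique: "\<And>\<delta>. \<lbrakk>\<delta> \<in> cells (CAT small) (const_func v d) (const_func v c);
      \<And>j. j \<in> Obj J \<Longrightarrow> nattr_hcomp (nattr_id (leg j)) \<delta> = ?\<Gamma> j\<rbrakk> \<Longrightarrow> \<delta> = \<gamma>"
    by metis
  from \<gamma>(1) have \<gamma>n: "natural_transformation \<gamma>" "ndom \<gamma> = const_func v d" "ncod \<gamma> = const_func v c"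
    by (simp_all add: cells_def CAT_sel)
  interpret \<gamma>: natural_transformation \<gamma> by fact
  have \<gamma>a: "ncomp \<gamma> undefined \<in> carr v" "ccod v (ncomp \<gamma> undefined) = c"
    using \<gamma>.nattr_simps(3,5)[of undefined] \<gamma>n by simp_all
  have whisker: "ncomp (nattr_hcomp (nattr_id (leg j)) \<delta>) undefined = farr (leg j) (ncomp \<delta>
      undefined)"
    if "j \<in> Obj J" "ndom \<delta> = const_func v d" "ncod \<delta> = const_func v c"
      "ncomp \<delta> undefined \<in> carr v" "ccod v (ncomp \<delta> undefined) = c" for j \<delta>
    using that D_category[OF that(1)] c(1) by (simp add: category.cat_simps)
  show "\<exists>!e. e \<in> carr v \<and> (\<forall>j\<in>Obj J. farr (leg j) e = a j)"
  proof (rule ex1I[where a = "ncomp \<gamma> undefined"], intro conjI ballI)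
    show "farr (leg j) (ncomp \<gamma> undefined) = a j" if "j \<in> Obj J" for j
      using whisker[OF that \<gamma>n(2,3) \<gamma>a] \<gamma>(2)[OF that] by (simp add: arr_def)
  next
    fix e assume "e \<in> carr v \<and> (\<forall>j\<in>Obj J. farr (leg j) e = a j)"
    then have e: "e \<in> carr v" "\<And>j. j \<in> Obj J \<Longrightarrow> farr (leg j) e = a j" by auto
    have ed: "cdom v e = d" "ccod v e = c"
      using ex1d ex1c e d c leg_simps(3,4)[of _ e] by (metis v.cat_simps(1,2))+
    have sel: "ndom (arr v e) = const_func v d" "ncod (arr v e) = const_func v c"
      "ncomp (arr v e) undefined = e" by (simp_all add: arr_def ed)
    have "nattr_hcomp (nattr_id (leg j)) (arr v e) = ?\<Gamma> j" if j: "j \<in> Obj J" for j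
      by (rule nattr_eqI)
        (use j e ed whisker[OF j sel(1,2)] c d in \<open>auto simp: sel legc arr_def nattr_hcomp_def\<close>)
    then have "arr v e = \<gamma>"
      using \<gamma>_unique arr_cells[OF v_Obj e(1)] ed by simp
    then show "e = ncomp \<gamma> undefined" using sel(3) by simp
  qed (rule \<gamma>a)
qed

lemma arrow_ext:
  assumes lim: "arrow_limit J (ob D) (mo D) v leg"
    and e: "e \<in> carr v" "e' \<in> carr v" "\<And>j. j \<in> Obj J \<Longrightarrow> farr (leg j) e = farr (leg j) e'"
  shows "e = e'"
proof -
  have "\<exists>!x. x \<in> carr v \<and> (\<forall>j\<in>Obj J. farr (leg j) x = farr (leg j) e)"
    using e(1) by (intro lim[unfolded arrow_limit_def, THEN spec, THEN mp]) simp
  then show ?thesis using e by metis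
qed

lemma object_ext:
  assumes lim: "arrow_limit J (ob D) (mo D) v leg"
    and x: "x \<in> cobj v" "x' \<in> cobj v" "\<And>j. j \<in> Obj J \<Longrightarrow> fobj (leg j) x = fobj (leg j) x'"
  shows "x = x'"
proof -
  have "cid v x = cid v x'" by (rule arrow_ext[OF lim]) (use x in simp_all)
  then have "cdom v (cid v x) = cdom v (cid v x')" by simp
  then show ?thesis using x(1,2) by simp
qed

text \<open>
  Functors and transformations into \<open>v\<close> are obtained by lifting the values on every arrow, or the
  components; since the legs are jointly injective, functoriality, naturality and uniqueness can be
  checked after composition with them.
\<close>

lemma limit_if_arrow_limit:
  assumes lim: "arrow_limit J (ob D) (mo D) v leg"
  shows "limit_cone J (CAT small) D v leg"
proof -
  define L where "L a = (THE e. e \<in> carr v \<and> (\<forall>j\<in>Obj J. farr (leg j) e = a j))" for a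
  have L: "L a \<in> carr v" "\<And>j. j \<in> Obj J \<Longrightarrow> farr (leg j) (L a) = a j"
    if "\<And>j. j \<in> Obj J \<Longrightarrow> a j \<in> carr (ob D j)"
      "\<And>u. u \<in> Mor J \<Longrightarrow> farr (mo D u) (a (Dom J u)) = a (Cod J u)" for a
  proof -
    have "\<exists>!e. e \<in> carr v \<and> (\<forall>j\<in>Obj J. farr (leg j) e = a j)"
      by (rule lim[unfolded arrow_limit_def, THEN spec, THEN mp]) (use that in blast)
    from theI'[OF this] show "L a \<in> carr v" "\<And>j. j \<in> Obj J \<Longrightarrow> farr (leg j) (L a) = a j"
      unfolding L_def by auto
  qed
  note arrow_ext = arrow_ext[OF lim] and object_ext = object_ext[OF lim]
  have cone: "limit_diagram_cone J (CAT small) D v leg"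
    unfolding diagram_cone_iff using v_Obj leg_hom leg_commute by blast
  have one_dim: "\<exists>!h. h \<in> hom (CAT small) x v \<and> (\<forall>j\<in>Obj J. func_comp (leg j) h = \<mu> j)"
    if \<mu>: "limit_diagram_cone J (CAT small) D x \<mu>" for x \<mu>
  proof -
    from \<mu> have x: "x \<in> Obj (CAT small)" and \<mu>_hom: "\<And>j. j \<in> Obj J \<Longrightarrow> \<mu> j \<in> hom (CAT small) x (ob D
        j)"
      and \<mu>_comm: "\<And>u. u \<in> Mor J \<Longrightarrow> func_comp (mo D u) (\<mu> (Dom J u)) = \<mu> (Cod J u)"
      unfolding diagram_cone_iff by auto
    interpret x: category x using x by (simp add: CAT_sel)
    have \<mu>F: "cat_functor (\<mu> j)" "fdom (\<mu> j) = x" "fcod (\<mu> j) = ob D j" if "j \<in> Obj J" for j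
      using \<mu>_hom[OF that] by (simp_all add: hom_def CAT_sel)
    have \<mu>_simps [simp]: "c \<in> cobj x \<Longrightarrow> fobj (\<mu> j) c \<in> cobj (ob D j)"
        "f \<in> carr x \<Longrightarrow> farr (\<mu> j) f \<in> carr (ob D j)"
        "f \<in> carr x \<Longrightarrow> cdom (ob D j) (farr (\<mu> j) f) = fobj (\<mu> j) (cdom x f)"
        "f \<in> carr x \<Longrightarrow> ccod (ob D j) (farr (\<mu> j) f) = fobj (\<mu> j) (ccod x f)"
        "c \<in> cobj x \<Longrightarrow> farr (\<mu> j) (cid x c) = cid (ob D j) (fobj (\<mu> j) c)"
        "\<lbrakk>f \<in> carr x; g \<in> carr x; ccod x f = cdom x g\<rbrakk>
          \<Longrightarrow> farr (\<mu> j) (ccmp x g f) = ccmp (ob D j) (farr (\<mu> j) g) (farr (\<mu> j) f)"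
      if "j \<in> Obj J" for j c f g
      using cat_functor.functor_simps[OF \<mu>F(1)[OF that]] \<mu>F(2,3)[OF that] by simp_all
    have D\<mu>: "farr (mo D u) (farr (\<mu> (Dom J u)) f) = farr (\<mu> (Cod J u)) f"
      if "u \<in> Mor J" "f \<in> carr x" for u f
      by (metis that \<mu>_comm func_sel(8) \<mu>F(2) J.Dom_closed)
    define ha where "ha f = L (\<lambda>j. farr (\<mu> j) f)" for f
    have ha [simp]: "ha f \<in> carr v" "j \<in> Obj J \<Longrightarrow> farr (leg j) (ha f) = farr (\<mu> j) f"
      if "f \<in> carr x" for f j
      using L[of "\<lambda>j. farr (\<mu> j) f"] that D\<mu> by (simp_all add: ha_def)
    define ho where "ho c = cdom v (ha (cid x c))" for c
    have ho [simp]: "ho c \<in> cobj v" "j \<in> Obj J \<Longrightarrow> fobj (leg j) (ho c) = fobj (\<mu> j) c"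
      if "c \<in> cobj x" for c j
      using that leg_simps(3)[of j "ha (cid x c)"] \<mu>_simps(3)[of j "cid x c"] by (simp_all add:
          ho_def)
    have ha_dc [simp]: "cdom v (ha f) = ho (cdom x f)" "ccod v (ha f) = ho (ccod x f)" if "f \<in> carr
        x" for f
    proof -
      have "fobj (leg j) (cdom v (ha f)) = fobj (leg j) (ho (cdom x f))"
        "fobj (leg j) (ccod v (ha f)) = fobj (leg j) (ho (ccod x f))" if j: "j \<in> Obj J" for j
        using j \<open>f \<in> carr x\<close> leg_simps(3,4)[OF j, of "ha f"] by simp_all
      then show "cdom v (ha f) = ho (cdom x f)" "ccod v (ha f) = ho (ccod x f)"
        using that by (simp_all add: object_ext)
    qed
    define h where "h = \<lparr>fdom = x, fcod = v, fobj = restrict ho (cobj x), farr = restrict ha (carr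
        x)\<rparr>"
    have h_sel [simp]: "fdom h = x" "fcod h = v" "fobj h = restrict ho (cobj x)"
      "farr h = restrict ha (carr x)" by (simp_all add: h_def)
    have "ha (cid x c) = cid v (ho c)" if "c \<in> cobj x" for c
      by (rule arrow_ext) (use that in simp_all)
    moreover have "ha (ccmp x g f) = ccmp v (ha g) (ha f)"
      if "f \<in> carr x" "g \<in> carr x" "ccod x f = cdom x g" for f g
      by (rule arrow_ext) (use that in simp_all)
    ultimately have h: "cat_functor h"
      by (intro cat_functor.intro cat_functor_axioms.intro)
        (auto simp: x.category_axioms v.category_axioms)
    then have h_hom: "h \<in> hom (CAT small) x v" using x v_Obj by (simp add: hom_def CAT_sel)
    have "func_comp (leg j) h = \<mu> j" if j: "j \<in> Obj J" for j
      using j \<mu>F[OF j] h by (intro func_eqI) (simp_all add: cat_functor_comp)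
    moreover have "k = h" if k: "k \<in> hom (CAT small) x v" "\<forall>j\<in>Obj J. func_comp (leg j) k = \<mu> j" for
        k
    proof -
      from k have kF [simp]: "cat_functor k" "fdom k = x" "fcod k = v" by (simp_all add: hom_def
          CAT_sel)
      interpret k: cat_functor k by simp
      have ko: "fobj (leg j) (fobj k c) = fobj (\<mu> j) c" if "j \<in> Obj J" "c \<in> cobj x" for c j
        by (metis that k(2) func_sel(7) kF(2))
      have o: "fobj k c = ho c" if "c \<in> cobj x" for c
        by (rule object_ext) (use that ko k.functor_simps(1) in simp_all)
      have ka: "farr (leg j) (farr k c) = farr (\<mu> j) c" if "j \<in> Obj J" "c \<in> carr x" for c j
        by (metis that k(2) func_sel(8) kF(2))
      have "farr k c = ha c" if "c \<in> carr x" for c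
        by (rule arrow_ext) (use that ka k.functor_simps(2) in simp_all)
      with o show ?thesis using h by (intro func_eqI) simp_all
    qed
    ultimately show ?thesis using h_hom by blast
  qed
  have two_dim: "\<exists>!\<gamma>. \<gamma> \<in> cells (CAT small) h h' \<and> (\<forall>j\<in>Obj J. nattr_hcomp (nattr_id (leg j)) \<gamma> = \<Gamma>
      j)"
    if hh: "h \<in> hom (CAT small) x v" "h' \<in> hom (CAT small) x v"
      and \<Gamma>: "\<forall>j\<in>Obj J. \<Gamma> j \<in> cells (CAT small) (func_comp (leg j) h) (func_comp (leg j) h')"
        "\<forall>u\<in>Mor J. nattr_hcomp (nattr_id (mo D u)) (\<Gamma> (Dom J u)) = \<Gamma> (Cod J u)" for x h h' \<Gamma>
  proof -
    from hh have hF: "cat_functor h" "cat_functor h'" and hs [simp]: "fdom h = x" "fcod h = v"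
      "fdom h' = x" "fcod h' = v" and hM: "h \<in> Mor (CAT small)" "h' \<in> Mor (CAT small)"
      by (auto simp: hom_def CAT_sel)
    interpret h: cat_functor h by (rule hF)
    interpret h': cat_functor h' by (rule hF)
    note [simp] = h.functor_simps[simplified] h'.functor_simps[simplified]
    interpret x: category x using h.C.category_axioms by simp
    have \<Gamma>n: "natural_transformation (\<Gamma> j)" "ndom (\<Gamma> j) = func_comp (leg j) h"
      "ncod (\<Gamma> j) = func_comp (leg j) h'" if "j \<in> Obj J" for j
      using \<Gamma>(1) that by (simp_all add: cells_def CAT_sel)
    have \<Gamma>c [simp]: "ncomp (\<Gamma> j) c \<in> carr (ob D j)" "cdom (ob D j) (ncomp (\<Gamma> j) c) = fobj (leg j)
        (fobj h c)"
      "ccod (ob D j) (ncomp (\<Gamma> j) c) = fobj (leg j) (fobj h' c)" if "j \<in> Obj J" "c \<in> cobj x" for j c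
      using natural_transformation.nattr_simps(3-5)[OF \<Gamma>n(1)[OF that(1)], of c] \<Gamma>n[OF that(1)] that
          by simp_all
    have \<Gamma>u: "farr (mo D u) (ncomp (\<Gamma> (Dom J u)) c) = ncomp (\<Gamma> (Cod J u)) c"
      if u: "u \<in> Mor J" and c: "c \<in> cobj x" for u c
    proof -
      interpret U: cat_functor "mo D u" using u by simp
      interpret E: category "ob D (Cod J u)" using u D_category by simp
      have "ncomp (nattr_hcomp (nattr_id (mo D u)) (\<Gamma> (Dom J u))) c
          = farr (mo D u) (ncomp (\<Gamma> (Dom J u)) c)"
        using u c U.functor_simps(2,4)[of "ncomp (\<Gamma> (Dom J u)) c"] by (simp add: \<Gamma>n)
      then show ?thesis using \<Gamma>(2) u by simp
    qed
    define g where "g c = L (\<lambda>j. ncomp (\<Gamma> j) c)" for c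
    have g [simp]: "g c \<in> carr v" "j \<in> Obj J \<Longrightarrow> farr (leg j) (g c) = ncomp (\<Gamma> j) c"
      if "c \<in> cobj x" for c j
      using L[of "\<lambda>j. ncomp (\<Gamma> j) c"] that \<Gamma>u by (simp_all add: g_def)
    have g_dc [simp]: "cdom v (g c) = fobj h c" "ccod v (g c) = fobj h' c" if "c \<in> cobj x" for c
    proof -
      have "fobj (leg j) (cdom v (g c)) = fobj (leg j) (fobj h c)"
        "fobj (leg j) (ccod v (g c)) = fobj (leg j) (fobj h' c)" if j: "j \<in> Obj J" for j
        using j \<open>c \<in> cobj x\<close> leg_simps(3,4)[OF j, of "g c"] by simp_all
      then show "cdom v (g c) = fobj h c" "ccod v (g c) = fobj h' c"
        using that by (simp_all add: object_ext)
    qed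
    have nat: "ccmp v (farr h' f) (g (cdom x f)) = ccmp v (g (ccod x f)) (farr h f)"
      if f: "f \<in> carr x" for f
    proof (rule arrow_ext)
      fix j assume j: "j \<in> Obj J"
      show "farr (leg j) (ccmp v (farr h' f) (g (cdom x f))) = farr (leg j) (ccmp v (g (ccod x f))
          (farr h f))"
        using natural_transformation.naturality[OF \<Gamma>n(1)[OF j], of f] f j by (simp add: \<Gamma>n)
    qed (use f in simp_all)
    define \<gamma> where "\<gamma> = \<lparr>ndom = h, ncod = h', ncomp = restrict g (cobj x)\<rparr>"
    have "natural_transformation \<gamma>"
      by (intro natural_transformation.intro natural_transformation_axioms.intro)
        (auto simp: \<gamma>_def hF nat)
    then have \<gamma>: "\<gamma> \<in> cells (CAT small) h h'"
      using hM by (simp add: cells_def CAT_sel(3,6,7)) (simp add: \<gamma>_def)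
    have "nattr_hcomp (nattr_id (leg j)) \<gamma> = \<Gamma> j" if j: "j \<in> Obj J" for j
    proof (rule nattr_eqI)
      show "ncomp (\<Gamma> j) \<in> extensional (cobj (fdom (ndom (nattr_hcomp (nattr_id (leg j)) \<gamma>))))"
        using natural_transformation.ncomp_extensional[OF \<Gamma>n(1)[OF j]] \<Gamma>n[OF j] by (simp add: \<gamma>_def)
    qed (use j D_category[OF j] in \<open>simp_all add: \<gamma>_def \<Gamma>n category.cat_simps\<close>)
    moreover have "\<delta> = \<gamma>" if \<delta>: "\<delta> \<in> cells (CAT small) h h'"
      "\<forall>j\<in>Obj J. nattr_hcomp (nattr_id (leg j)) \<delta> = \<Gamma> j" for \<delta>
    proof -
      from \<delta> have \<delta>n: "natural_transformation \<delta>" "ndom \<delta> = h" "ncod \<delta> = h'"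
        by (simp_all add: cells_def CAT_sel)
      interpret \<delta>: natural_transformation \<delta> by fact
      have \<delta>c [simp]: "ncomp \<delta> c \<in> carr v" "cdom v (ncomp \<delta> c) = fobj h c" "ccod v (ncomp \<delta> c) =
          fobj h' c"
        if "c \<in> cobj x" for c
        using \<delta>.nattr_simps(3-5)[of c] \<delta>n that by simp_all
      have \<delta>\<Gamma>: "farr (leg j) (ncomp \<delta> c) = ncomp (\<Gamma> j) c" if "j \<in> Obj J" "c \<in> cobj x" for c j
      proof -
        have "ncomp (nattr_hcomp (nattr_id (leg j)) \<delta>) c = farr (leg j) (ncomp \<delta> c)"
          using that D_category[OF that(1)] \<delta>n by (simp add: category.cat_simps)
        then show ?thesis using \<delta>(2) that by simp
      qed
      have "ncomp \<delta> c = g c" if "c \<in> cobj x" for c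
        by (rule arrow_ext) (use that \<delta>\<Gamma> in simp_all)
      then show ?thesis
        using \<delta>n \<delta>.ncomp_extensional by (intro nattr_eqI[of \<delta> \<gamma>]) (auto simp: \<gamma>_def)
    qed
    ultimately show ?thesis using \<gamma> by blast
  qed
  show ?thesis
    unfolding limit_cone_def CAT_sel(4-13) using cone one_dim two_dim by blast
qed

theorem limit_cone_CAT_iff:
  "limit_cone J (CAT small) D v leg \<longleftrightarrow> arrow_limit J (ob D) (mo D) v leg"
  using arrow_limit_if_limit limit_if_arrow_limit by blast

end

section \<open>Pseudofunctors on a locally discrete domain, elementwise\<close>

definition cat_iso :: "'u cat \<Rightarrow> 'u \<Rightarrow> bool" where
  "cat_iso C f \<longleftrightarrow> f \<in> carr C \<and> (\<exists>g\<in>carr C. cdom C g = ccod C f \<and> ccod C g = cdom C f \<and>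
     ccmp C g f = cid C (cdom C f) \<and> ccmp C f g = cid C (ccod C f))"

lemma (in category) cat_iso_cid: "x \<in> cobj C \<Longrightarrow> cat_iso C (cid C x)"
  unfolding cat_iso_def by (auto intro!: bexI[where x = "cid C x"])

lemma invertible_cell_CAT_iff:
  assumes \<alpha>: "\<alpha> \<in> Cell (CAT small)"
  shows "invertible_cell (CAT small) \<alpha> \<longleftrightarrow>
    (\<forall>c\<in>cobj (fdom (ndom \<alpha>)). cat_iso (fcod (ndom \<alpha>)) (ncomp \<alpha> c))"
proof
  interpret natural_transformation \<alpha> using \<alpha> by (simp add: CAT_sel)
  let ?D = "fcod (ndom \<alpha>)" and ?C = "fdom (ndom \<alpha>)"
  {
    assume "invertible_cell (CAT small) \<alpha>"
    then obtain \<beta> where \<beta>: "natural_transformation \<beta>" "ndom \<beta> = ncod \<alpha>" "ncod \<beta> = ndom \<alpha>"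
        "nattr_vcomp \<beta> \<alpha> = nattr_id (ndom \<alpha>)" "nattr_vcomp \<alpha> \<beta> = nattr_id (ncod \<alpha>)"
      by (auto simp: invertible_cell_def cells_def CAT_sel)
    interpret \<beta>: natural_transformation \<beta> by fact
    show "\<forall>c\<in>cobj ?C. cat_iso ?D (ncomp \<alpha> c)"
    proof
      fix c assume c: "c \<in> cobj ?C"
      have "ccmp ?D (ncomp \<beta> c) (ncomp \<alpha> c) = cid ?D (fobj (ndom \<alpha>) c)"
        using arg_cong[OF \<beta>(4), of "\<lambda>\<gamma>. ncomp \<gamma> c"] c by simp
      moreover have "ccmp ?D (ncomp \<alpha> c) (ncomp \<beta> c) = cid ?D (fobj (ncod \<alpha>) c)"
        using arg_cong[OF \<beta>(5), of "\<lambda>\<gamma>. ncomp \<gamma> c"] c \<beta>(2) by simp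
      ultimately show "cat_iso ?D (ncomp \<alpha> c)"
        using c \<beta>.nattr_simps(3-5)[of c] \<beta>(2,3) unfolding cat_iso_def
        by (auto intro!: bexI[where x = "ncomp \<beta> c"])
    qed
  next
    assume "\<forall>c\<in>cobj ?C. cat_iso ?D (ncomp \<alpha> c)"
    then have "\<forall>c\<in>cobj ?C. \<exists>g. g \<in> carr ?D \<and> cdom ?D g = fobj (ncod \<alpha>) c \<and>
        ccod ?D g = fobj (ndom \<alpha>) c \<and> ccmp ?D g (ncomp \<alpha> c) = cid ?D (fobj (ndom \<alpha>) c) \<and>
        ccmp ?D (ncomp \<alpha> c) g = cid ?D (fobj (ncod \<alpha>) c)"
      unfolding cat_iso_def by auto
    then obtain b where b: "\<And>c. c \<in> cobj ?C \<Longrightarrow> b c \<in> carr ?D \<and> cdom ?D (b c) = fobj (ncod \<alpha>) c \<and>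
        ccod ?D (b c) = fobj (ndom \<alpha>) c \<and> ccmp ?D (b c) (ncomp \<alpha> c) = cid ?D (fobj (ndom \<alpha>) c) \<and>
        ccmp ?D (ncomp \<alpha> c) (b c) = cid ?D (fobj (ncod \<alpha>) c)"
      by metis
    note [simp] = G.functor_simps[simplified]
    have b_simps [simp]: "b c \<in> carr ?D" "cdom ?D (b c) = fobj (ncod \<alpha>) c"
      "ccod ?D (b c) = fobj (ndom \<alpha>) c" "ccmp ?D (b c) (ncomp \<alpha> c) = cid ?D (fobj (ndom \<alpha>) c)"
      "ccmp ?D (ncomp \<alpha> c) (b c) = cid ?D (fobj (ncod \<alpha>) c)" if "c \<in> cobj ?C" for c
      using b[OF that] by simp_all
    have nat: "ccmp ?D (farr (ndom \<alpha>) f) (b (cdom ?C f)) = ccmp ?D (b (ccod ?C f)) (farr (ncod \<alpha>)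
        f)"
      if f: "f \<in> carr ?C" for f
    proof -
      let ?a = "ncomp \<alpha> (cdom ?C f)" and ?b = "b (cdom ?C f)"
        and ?a' = "ncomp \<alpha> (ccod ?C f)" and ?b' = "b (ccod ?C f)"
      have c: "ccmp ?D ?b' (ccmp ?D ?a' z) = z" if "z \<in> carr ?D" "ccod ?D z = fobj (ndom \<alpha>) (ccod ?C
          f)" for z
        using F.D.cat_simps(11)[of z ?a' ?b'] f that by simp
      have "ccmp ?D (farr (ndom \<alpha>) f) ?b = ccmp ?D ?b' (ccmp ?D ?a' (ccmp ?D (farr (ndom \<alpha>) f) ?b))"
        using c f by simp
      also have "\<dots> = ccmp ?D ?b' (ccmp ?D (farr (ncod \<alpha>) f) (ccmp ?D ?a ?b))"
        using F.D.ccmp_cong_right[OF naturality[OF f, symmetric], of ?b] f by simp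
      also have "\<dots> = ccmp ?D ?b' (farr (ncod \<alpha>) f)" using f by simp
      finally show ?thesis .
    qed
    define \<beta> where "\<beta> = \<lparr>ndom = ncod \<alpha>, ncod = ndom \<alpha>, ncomp = restrict b (cobj ?C)\<rparr>"
    have "natural_transformation \<beta>"
      by (intro natural_transformation.intro natural_transformation_axioms.intro)
        (auto simp: \<beta>_def F.cat_functor_axioms G.cat_functor_axioms nat)
    then have \<beta>: "\<beta> \<in> cells (CAT small) (ncod \<alpha>) (ndom \<alpha>)"
      using \<alpha> by (simp add: cells_def CAT_sel(3,6,7)) (simp add: \<beta>_def)
    have "nattr_vcomp \<beta> \<alpha> = nattr_id (ndom \<alpha>)" "nattr_vcomp \<alpha> \<beta> = nattr_id (ncod \<alpha>)"
      by (rule nattr_eqI; simp add: \<beta>_def nattr_vcomp_def)+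
    with \<beta> show "invertible_cell (CAT small) \<alpha>"
      using \<alpha> unfolding invertible_cell_def CAT_sel(6-13) by blast
  }
qed

lemma locally_discreteD:
  assumes "locally_discrete K" and "\<gamma> \<in> Cell K"
  shows "\<gamma> = Idc K (Src K \<gamma>)"
  using assms by (simp add: locally_discrete_def)

lemma (in two_category) locally_discrete_Tgt:
  assumes "locally_discrete K" and "\<gamma> \<in> Cell K"
  shows "Tgt K \<gamma> = Src K \<gamma>"
  using locally_discreteD[OF assms] assms(2) by (metis Cell_simps(3) Src_closed)

lemma (in two_category) locally_discrete_cellsD:
  assumes "locally_discrete K" and "\<gamma> \<in> cells K f g"
  shows "\<gamma> = Idc K f" and "g = f" and "f \<in> Mor K"
proof -
  have c: "\<gamma> \<in> Cell K" "Src K \<gamma> = f" "Tgt K \<gamma> = g" using assms(2) by (simp_all add: cells_def)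
  show "f \<in> Mor K" using Src_closed[OF c(1)] unfolding c(2) .
  show "\<gamma> = Idc K f" "g = f"
    using locally_discrete_Tgt[OF assms(1) c(1)] locally_discreteD[OF assms(1) c(1)]
    unfolding c by blast+
qed

text \<open>
  When every 2-cell of \<open>A\<close> is an identity, a pseudo-\<open>\<F>\<close>-functor into categories amounts to its
  functors and the components of its compositors. The rules below express this. Where the
  codomain of \<open>f\<close> occurs in the category of a conclusion it is a variable \<open>y\<close> with \<open>Cod A f =
  y\<close>, so that they remain applicable when \<open>Cod A f\<close> has been rewritten to the domain of the next
  1-cell.
\<close>

locale cat_pf = pseudo_f_functor A "CAT small" F
  for A :: "('o, 'm, 'c, 'y) fcat_scheme" and small :: "'u set \<Rightarrow> bool"
    and F :: "('o, 'm, 'c, 'u cat, 'u func, 'u nattr) psfun" +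
  assumes discrete: "locally_discrete A"
begin

lemma ob_category [simp]: "x \<in> Obj A \<Longrightarrow> category (ob F x)"
  using pf_simps(1)[of x] by (simp add: CAT_sel)

lemma ob_simps [simp]:
  assumes "x \<in> Obj A"
  shows "f \<in> carr (ob F x) \<Longrightarrow> cdom (ob F x) f \<in> cobj (ob F x)"
    "f \<in> carr (ob F x) \<Longrightarrow> ccod (ob F x) f \<in> cobj (ob F x)"
    "c \<in> cobj (ob F x) \<Longrightarrow> cid (ob F x) c \<in> carr (ob F x)"
    "c \<in> cobj (ob F x) \<Longrightarrow> cdom (ob F x) (cid (ob F x) c) = c"
    "c \<in> cobj (ob F x) \<Longrightarrow> ccod (ob F x) (cid (ob F x) c) = c"
    "\<lbrakk>f \<in> carr (ob F x); g \<in> carr (ob F x); ccod (ob F x) f = cdom (ob F x) g\<rbrakk>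
      \<Longrightarrow> ccmp (ob F x) g f \<in> carr (ob F x)"
    "\<lbrakk>f \<in> carr (ob F x); g \<in> carr (ob F x); ccod (ob F x) f = cdom (ob F x) g\<rbrakk>
      \<Longrightarrow> cdom (ob F x) (ccmp (ob F x) g f) = cdom (ob F x) f"
    "\<lbrakk>f \<in> carr (ob F x); g \<in> carr (ob F x); ccod (ob F x) f = cdom (ob F x) g\<rbrakk>
      \<Longrightarrow> ccod (ob F x) (ccmp (ob F x) g f) = ccod (ob F x) g"
    "\<lbrakk>f \<in> carr (ob F x); cdom (ob F x) f = c\<rbrakk> \<Longrightarrow> ccmp (ob F x) f (cid (ob F x) c) = f"
    "\<lbrakk>f \<in> carr (ob F x); ccod (ob F x) f = c\<rbrakk> \<Longrightarrow> ccmp (ob F x) (cid (ob F x) c) f = f"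
  using category.cat_simps[OF ob_category[OF assms]] by simp_all

lemma mo_functor [simp]:
  "f \<in> Mor A \<Longrightarrow> cat_functor (mo F f)"
  "f \<in> Mor A \<Longrightarrow> fdom (mo F f) = ob F (Dom A f)"
  "f \<in> Mor A \<Longrightarrow> fcod (mo F f) = ob F (Cod A f)"
  using pf_simps(2-4)[of f] by (simp_all add: CAT_sel)

lemma mo_simps [simp]:
  assumes "f \<in> Mor A" and "Cod A f = y"
  shows "c \<in> cobj (ob F (Dom A f)) \<Longrightarrow> fobj (mo F f) c \<in> cobj (ob F y)"
    "a \<in> carr (ob F (Dom A f)) \<Longrightarrow> farr (mo F f) a \<in> carr (ob F y)"
    "a \<in> carr (ob F (Dom A f)) \<Longrightarrow> cdom (ob F y) (farr (mo F f) a) = fobj (mo F f) (cdom (ob F (Dom A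
        f)) a)"
    "a \<in> carr (ob F (Dom A f)) \<Longrightarrow> ccod (ob F y) (farr (mo F f) a) = fobj (mo F f) (ccod (ob F (Dom A
        f)) a)"
  using cat_functor.functor_simps[OF mo_functor(1)[OF assms(1)]] assms by auto

lemma mo_cid:
  "\<lbrakk>f \<in> Mor A; c \<in> cobj (ob F (Dom A f))\<rbrakk>
    \<Longrightarrow> farr (mo F f) (cid (ob F (Dom A f)) c) = cid (ob F (Cod A f)) (fobj (mo F f) c)"
  using cat_functor.functor_simps(5)[OF mo_functor(1), of f c] by simp

lemma mo_ccmp:
  "\<lbrakk>f \<in> Mor A; a \<in> carr (ob F (Dom A f)); b \<in> carr (ob F (Dom A f));
    ccod (ob F (Dom A f)) a = cdom (ob F (Dom A f)) b\<rbrakk>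
    \<Longrightarrow> farr (mo F f) (ccmp (ob F (Dom A f)) b a) = ccmp (ob F (Cod A f)) (farr (mo F f) b) (farr (mo
        F f) a)"
  using cat_functor.functor_simps(6)[OF mo_functor(1), of f a b] by simp

lemma mo_Idm: "x \<in> Obj A \<Longrightarrow> mo F (Idm A x) = func_id (ob F x)"
  using pf_simps(10)[of x] pf_simps(1)[of x] un_identity[of x] by (simp add: CAT_sel(4-13))

lemma ce_eq: "\<gamma> \<in> Cell A \<Longrightarrow> ce F \<gamma> = nattr_id (mo F (Src A \<gamma>))"
  using ce_Idc[of "Src A \<gamma>"] locally_discreteD[OF discrete, of \<gamma>] by (simp add: CAT_sel(4-13))

lemma cp_nattr [simp]:
  assumes "f \<in> Mor A" and "g \<in> Mor A" and "Cod A f = Dom A g"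
  shows "natural_transformation (cp F g f)" "ndom (cp F g f) = func_comp (mo F g) (mo F f)"
    "ncod (cp F g f) = mo F (g \<cdot>\<^bsub>A\<^esub> f)"
  using pf_simps(11-13)[OF assms] by (simp_all add: CAT_sel)

lemma cp_simps [simp]:
  assumes "f \<in> Mor A" and "g \<in> Mor A" and "Cod A f = Dom A g" and "c \<in> cobj (ob F (Dom A f))"
    and "Cod A g = z"
  shows "ncomp (cp F g f) c \<in> carr (ob F z)"
    "cdom (ob F z) (ncomp (cp F g f) c) = fobj (mo F g) (fobj (mo F f) c)"
    "ccod (ob F z) (ncomp (cp F g f) c) = fobj (mo F (g \<cdot>\<^bsub>A\<^esub> f)) c"
  using natural_transformation.nattr_simps(3-5)[OF cp_nattr(1)[OF assms(1-3)], of c] assms by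
      simp_all

lemma cp_naturality:
  assumes "f \<in> Mor A" and "g \<in> Mor A" and "Cod A f = Dom A g" and "a \<in> carr (ob F (Dom A f))"
  shows "ccmp (ob F (Cod A g)) (farr (mo F (g \<cdot>\<^bsub>A\<^esub> f)) a) (ncomp (cp F g f) (cdom (ob F (Dom A f)) a))
    = ccmp (ob F (Cod A g)) (ncomp (cp F g f) (ccod (ob F (Dom A f)) a)) (farr (mo F g) (farr (mo F
        f) a))"
  using natural_transformation.naturality[OF cp_nattr(1)[OF assms(1-3)], of a] assms by simp

lemma cp_iso:
  assumes "f \<in> Mor A" and "g \<in> Mor A" and "Cod A f = Dom A g" and "c \<in> cobj (ob F (Dom A f))"
  shows "cat_iso (ob F (Cod A g)) (ncomp (cp F g f) c)"
  using cp_invertible[of f "Dom A f" "Cod A f" g "Cod A g"] assms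
    invertible_cell_CAT_iff[OF pf_simps(11)[OF assms(1-3)]] by (simp add: hom_def)

lemma cp_inert:
  assumes "f \<in> Mor A" and "g \<in> Mor A" and "Cod A f = Dom A g" and "f \<in> inert A \<or> g \<in> inert A"
  shows "cp F g f = nattr_id (func_comp (mo F g) (mo F f))" "mo F (g \<cdot>\<^bsub>A\<^esub> f) = func_comp (mo F g) (mo
      F f)"
proof -
  show 1: "cp F g f = nattr_id (func_comp (mo F g) (mo F f))"
    using cp_identity[of f "Dom A f" "Cod A f" g "Cod A g"] assms by (simp add: hom_def
        CAT_sel(4-13))
  show "mo F (g \<cdot>\<^bsub>A\<^esub> f) = func_comp (mo F g) (mo F f)"
    using cp_nattr(3)[OF assms(1-3)] by (simp add: 1)
qed

lemma cp_associative:
  assumes "f \<in> Mor A" "g \<in> Mor A" "h \<in> Mor A" "Cod A f = Dom A g" "Cod A g = Dom A h"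
    and c: "c \<in> cobj (ob F (Dom A f))"
  shows "ccmp (ob F (Cod A h)) (ncomp (cp F h (g \<cdot>\<^bsub>A\<^esub> f)) c) (farr (mo F h) (ncomp (cp F g f) c))
    = ccmp (ob F (Cod A h)) (ncomp (cp F (h \<cdot>\<^bsub>A\<^esub> g) f) c) (ncomp (cp F h g) (fobj (mo F f) c))"
proof -
  have "nattr_vcomp (cp F h (g \<cdot>\<^bsub>A\<^esub> f)) (nattr_hcomp (nattr_id (mo F h)) (cp F g f))
      = nattr_vcomp (cp F (h \<cdot>\<^bsub>A\<^esub> g) f) (nattr_hcomp (cp F h g) (nattr_id (mo F f)))"
    using cp_assoc[of f "Dom A f" "Cod A f" g "Cod A g" h "Cod A h"] assms
    by (simp add: hom_def CAT_sel(4-13))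
  from arg_cong[OF this, of "\<lambda>\<gamma>. ncomp \<gamma> c"] show ?thesis using assms by (simp add: mo_cid)
qed

end

text \<open>
  The unit axioms follow from strictness at inert 1-cells, which include the identities; naturality
  of the compositors holds because all 2-cells of \<open>A\<close> are identities.
\<close>

lemma pseudo_f_functor_CAT_I:
  fixes A :: "('o, 'm, 'c, 'y) fcat_scheme"
    and F :: "('o, 'm, 'c, 'u cat, 'u func, 'u nattr) psfun"
  assumes A: "f_category A" and discrete: "locally_discrete A"
    and ob: "\<And>x. x \<in> Obj A \<Longrightarrow> ob F x \<in> Obj (CAT small)"
    and mo: "\<And>f. f \<in> Mor A \<Longrightarrow> cat_functor (mo F f) \<and> fdom (mo F f) = ob F (Dom A f) \<and>
      fcod (mo F f) = ob F (Cod A f)"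
    and mo_Idm: "\<And>x. x \<in> Obj A \<Longrightarrow> mo F (Idm A x) = func_id (ob F x)"
    and ce: "ce F = (\<lambda>\<gamma>\<in>Cell A. nattr_id (mo F (Src A \<gamma>)))"
    and un: "un F = (\<lambda>x\<in>Obj A. nattr_id (func_id (ob F x)))"
    and cp: "\<And>f g. \<lbrakk>f \<in> Mor A; g \<in> Mor A; Cod A f = Dom A g\<rbrakk> \<Longrightarrow> natural_transformation (cp F g f) \<and>
      ndom (cp F g f) = func_comp (mo F g) (mo F f) \<and> ncod (cp F g f) = mo F (g \<cdot>\<^bsub>A\<^esub> f)"
    and cp_iso: "\<And>f g c. \<lbrakk>f \<in> Mor A; g \<in> Mor A; Cod A f = Dom A g; c \<in> cobj (ob F (Dom A f))\<rbrakk>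
      \<Longrightarrow> cat_iso (ob F (Cod A g)) (ncomp (cp F g f) c)"
    and cp_inert: "\<And>f g c. \<lbrakk>f \<in> Mor A; g \<in> Mor A; Cod A f = Dom A g; f \<in> inert A \<or> g \<in> inert A;
      c \<in> cobj (ob F (Dom A f))\<rbrakk>
      \<Longrightarrow> ncomp (cp F g f) c = cid (ob F (Cod A g)) (fobj (mo F g) (fobj (mo F f) c))"
    and mo_inert: "\<And>f g. \<lbrakk>f \<in> Mor A; g \<in> Mor A; Cod A f = Dom A g; f \<in> inert A \<or> g \<in> inert A\<rbrakk>
      \<Longrightarrow> mo F (g \<cdot>\<^bsub>A\<^esub> f) = func_comp (mo F g) (mo F f)"
    and assoc: "\<And>f g h c. \<lbrakk>f \<in> Mor A; g \<in> Mor A; h \<in> Mor A; Cod A f = Dom A g; Cod A g = Dom A h;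
      c \<in> cobj (ob F (Dom A f))\<rbrakk> \<Longrightarrow>
      ccmp (ob F (Cod A h)) (ncomp (cp F h (g \<cdot>\<^bsub>A\<^esub> f)) c) (farr (mo F h) (ncomp (cp F g f) c))
        = ccmp (ob F (Cod A h)) (ncomp (cp F (h \<cdot>\<^bsub>A\<^esub> g) f) c) (ncomp (cp F h g) (fobj (mo F f) c))"
    and ext: "ob F \<in> extensional (Obj A)" "mo F \<in> extensional (Mor A)"
      "\<And>f g. \<not> (f \<in> Mor A \<and> g \<in> Mor A \<and> Cod A f = Dom A g) \<Longrightarrow> cp F g f = undefined"
  shows "pseudo_f_functor A (CAT small) F"
proof -
  interpret A: f_category A by fact
  interpret C: f_category "CAT small" by (rule f_category_CAT)
  note sel = CAT_sel(4-13)
  have ob_cat: "category (ob F x)" if "x \<in> Obj A" for x using ob[OF that] by (simp add: CAT_sel)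
  have mo_Mor: "mo F f \<in> Mor (CAT small)" if "f \<in> Mor A" for f
    using mo[OF that] ob that by (simp add: CAT_sel(2))
  have cp_Cell: "cp F g f \<in> Cell (CAT small)" if "f \<in> Mor A" "g \<in> Mor A" "Cod A f = Dom A g" for f g
    using cp[OF that] that mo mo_Mor C.Mor_simps(4)[of "mo F f" "mo F g"] by (simp add: CAT_sel(3)
        sel)
  have cp_nattr_id: "cp F g f = nattr_id (func_comp (mo F g) (mo F f))"
    if "f \<in> Mor A" "g \<in> Mor A" "Cod A f = Dom A g" "f \<in> inert A \<or> g \<in> inert A" for f g
    using that cp cp_inert mo mo_inert natural_transformation.ncomp_extensional[of "cp F g f"]
    by (intro nattr_eqI) simp_all
  have id_inert: "Idm A x \<in> inert A" if "x \<in> Obj A" for x using that by (rule A.inert_Idm)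
  have unit: "func_comp (mo F f) (func_id (ob F (Dom A f))) = mo F f"
    "func_comp (func_id (ob F (Cod A f))) (mo F f) = mo F f" if "f \<in> Mor A" for f
    using C.Cmp_simps(1,2)[OF mo_Mor[OF that]] mo[OF that] by (simp_all add: sel)
  have disc: "\<gamma> = Idc A f \<and> g = f \<and> f \<in> Mor A" if "\<gamma> \<in> cells A f g" for \<gamma> f g
    using A.locally_discrete_cellsD[OF discrete that] by simp
  show ?thesis
  proof (intro pseudo_f_functor.intro pseudofunctor.intro pseudofunctor_axioms.intro
      pseudo_f_functor_axioms.intro, goal_cases)
    case (6 f x y)
    then show ?case using mo by (simp add: hom_def sel mo_Mor)
  next
    case (7 \<gamma> f g)
    then have "\<gamma> \<in> Cell A" "g = f" "Src A \<gamma> = f" "f \<in> Mor A"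
      using disc[OF 7] by (simp_all add: cells_def)
    then show ?case using mo_Mor C.Cell_simps(1)[of "mo F f"] by (simp add: cells_def ce sel)
  next
    case (8 f)
    then show ?case by (simp add: ce sel)
  next
    case (9 \<gamma> f g \<delta> h)
    have "\<gamma> = Idc A f" "\<delta> = Idc A f" "f \<in> Mor A" using disc[OF 9(1)] disc[OF 9(2)] by simp_all
    then show ?case using C.Vcm_simps(1)[of "nattr_id (mo F f)" "mo F f"] mo_Mor
        C.Cell_simps(1-3)[of "mo F f"]
      by (simp add: ce sel)
  next
    case (10 x)
    then show ?case using C.Cell_simps(1)[of "func_id (ob F x)"] C.Mor_simps(1)[of "ob F x"] ob
      by (simp add: cells_def un sel mo_Idm)
  next
    case (11 x)
    then show ?case using C.invertible_Idc[of "func_id (ob F x)"] C.Mor_simps(1)[of "ob F x"] ob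
      by (simp add: un sel)
  next
    case (12 f x y g z)
    then show ?case using cp_Cell cp by (simp add: hom_def cells_def sel)
  next
    case (13 f x y g z)
    then show ?case using cp_Cell[of f g] cp[of f g] cp_iso[of f g] mo[of f] mo[of g]
      by (auto simp: hom_def invertible_cell_CAT_iff)
  next
    case (14 \<gamma> f f' \<delta> g g')
    have "\<gamma> = Idc A f" "\<delta> = Idc A g" "f \<in> Mor A" "g \<in> Mor A" "f' = f" "g' = g"
      using disc[OF 14(1)] disc[OF 14(2)] by simp_all
    moreover have "nattr_hcomp (nattr_id (mo F g)) (nattr_id (mo F f)) = nattr_id (func_comp (mo F
        g) (mo F f))"
      using C.Hcm_Idc'[of "mo F f" "mo F g"] calculation 14(3) mo_Mor mo by (simp add: sel)
    ultimately show ?case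
      using C.Vcm_simps(1,2)[of "cp F g f"] cp_Cell[of f g] cp[of f g] 14(3) by (simp add: ce sel)
  next
    case (15 f w x g y h z)
    then have [simp]: "f \<in> Mor A" "g \<in> Mor A" "h \<in> Mor A" "Dom A f = w" "Cod A f = x" "Dom A g = x"
      "Cod A g = y" "Dom A h = y" "Cod A h = z" by (simp_all add: hom_def)
    have [simp]: "w \<in> Obj A" "x \<in> Obj A" "y \<in> Obj A" "z \<in> Obj A"
      using A.Dom_closed[of f] A.Cod_closed[of f] A.Cod_closed[of g] A.Cod_closed[of h] by simp_all
    have "nattr_vcomp (cp F h (g \<cdot>\<^bsub>A\<^esub> f)) (nattr_hcomp (nattr_id (mo F h)) (cp F g f))
        = nattr_vcomp (cp F (h \<cdot>\<^bsub>A\<^esub> g) f) (nattr_hcomp (cp F h g) (nattr_id (mo F f)))"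
    proof (rule nattr_eqI)
      show "ndom (nattr_vcomp (cp F h (g \<cdot>\<^bsub>A\<^esub> f)) (nattr_hcomp (nattr_id (mo F h)) (cp F g f)))
        = ndom (nattr_vcomp (cp F (h \<cdot>\<^bsub>A\<^esub> g) f) (nattr_hcomp (cp F h g) (nattr_id (mo F f))))"
        using C.Cmp_simps(3)[of "mo F f" "mo F g" "mo F h"] cp mo mo_Mor by (simp add: sel)
    next
      fix c assume "c \<in> cobj (fdom (ndom (nattr_vcomp (cp F h (g \<cdot>\<^bsub>A\<^esub> f))
        (nattr_hcomp (nattr_id (mo F h)) (cp F g f)))))"
      then have c: "c \<in> cobj (ob F w)" using mo cp by simp
      interpret mf: cat_functor "mo F f" using mo by simp
      interpret mg: cat_functor "mo F g" using mo by simp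
      interpret mh: cat_functor "mo F h" using mo by simp
      interpret gf: natural_transformation "cp F g f" using cp by simp
      interpret hg: natural_transformation "cp F h g" using cp by simp
      have [simp]: "fdom (mo F f) = ob F w" "fcod (mo F f) = ob F x" "fdom (mo F g) = ob F x"
        "fcod (mo F g) = ob F y" "fdom (mo F h) = ob F y" "fcod (mo F h) = ob F z"
        "ndom (cp F g f) = func_comp (mo F g) (mo F f)" "ncod (cp F g f) = mo F (g \<cdot>\<^bsub>A\<^esub> f)"
        "ndom (cp F h g) = func_comp (mo F h) (mo F g)" "ncod (cp F h g) = mo F (h \<cdot>\<^bsub>A\<^esub> g)"
        using mo cp by simp_all
      have [simp]: "fobj (mo F f) c \<in> cobj (ob F x)" using mf.functor_simps(1)[of c] c by simp
      have i: "farr (mo F (h \<cdot>\<^bsub>A\<^esub> g)) (cid (ob F x) (fobj (mo F f) c))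
          = cid (ob F z) (fobj (mo F (h \<cdot>\<^bsub>A\<^esub> g)) (fobj (mo F f) c))"
        "farr (mo F g) (cid (ob F x) (fobj (mo F f) c)) = cid (ob F y) (fobj (mo F g) (fobj (mo F f)
            c))"
        "farr (mo F h) (cid (ob F y) (fobj (mo F g) (fobj (mo F f) c)))
          = cid (ob F z) (fobj (mo F h) (fobj (mo F g) (fobj (mo F f) c)))"
        using cat_functor.functor_simps(5)[of "mo F (h \<cdot>\<^bsub>A\<^esub> g)" "fobj (mo F f) c"] mo
          mg.functor_simps(5)[of "fobj (mo F f) c"] mg.functor_simps(1)[of "fobj (mo F f) c"]
          mh.functor_simps(5)[of "fobj (mo F g) (fobj (mo F f) c)"] by simp_all
      have "cdom (ob F z) (ncomp (cp F h g) (fobj (mo F f) c))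
          = fobj (mo F h) (fobj (mo F g) (fobj (mo F f) c))"
        "ncomp (cp F h g) (fobj (mo F f) c) \<in> carr (ob F z)"
        using hg.nattr_simps(3,4)[of "fobj (mo F f) c"] by simp_all
      moreover have "farr (mo F h) (ncomp (cp F g f) c) \<in> carr (ob F z)"
        "ccod (ob F z) (farr (mo F h) (ncomp (cp F g f) c)) = fobj (mo F h) (fobj (mo F (g \<cdot>\<^bsub>A\<^esub> f))
            c)"
        using mh.functor_simps(2,4)[of "ncomp (cp F g f) c"] gf.nattr_simps(3,5)[of c] c by simp_all
      moreover have "fobj (mo F (g \<cdot>\<^bsub>A\<^esub> f)) c \<in> cobj (ob F y)"
        using cat_functor.functor_simps(1)[of "mo F (g \<cdot>\<^bsub>A\<^esub> f)" c] mo c by simp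
      ultimately show "ncomp (nattr_vcomp (cp F h (g \<cdot>\<^bsub>A\<^esub> f)) (nattr_hcomp (nattr_id (mo F h)) (cp F g
          f))) c
        = ncomp (nattr_vcomp (cp F (h \<cdot>\<^bsub>A\<^esub> g) f) (nattr_hcomp (cp F h g) (nattr_id (mo F f)))) c"
        using assoc[of f g h c] c ob_cat by (simp add: i category.cat_simps)
    qed (use mo cp in \<open>simp_all add: nattr_vcomp_def\<close>)
    then show ?case by (simp add: sel)
  next
    case (16 f x y)
    then have f [simp]: "f \<in> Mor A" "Dom A f = x" "Cod A f = y" by (simp_all add: hom_def)
    have [simp]: "x \<in> Obj A" using A.Dom_closed[of f] by simp
    have e: "cp F f (Idm A x) = nattr_id (mo F f)"
      using cp_nattr_id[of "Idm A x" f] id_inert unit[of f] by (simp add: mo_Idm)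
    have i: "nattr_id (mo F f) \<in> Cell (CAT small)" using C.Cell_simps(1) mo_Mor f by (simp add: sel)
    show ?case using i C.Hcm_Idc'[of "func_id (ob F x)" "mo F f"] mo_Mor[of f] C.Mor_simps(1-3)[of
        "ob F x"]
        mo[of f] ob unit[of f] C.Vcm_simps(1)[OF i] by (simp add: sel un e)
  next
    case (17 f x y)
    then have f [simp]: "f \<in> Mor A" "Dom A f = x" "Cod A f = y" by (simp_all add: hom_def)
    have [simp]: "y \<in> Obj A" using A.Cod_closed[of f] by simp
    have e: "cp F (Idm A y) f = nattr_id (mo F f)"
      using cp_nattr_id[of f "Idm A y"] id_inert unit[of f] by (simp add: mo_Idm)
    have i: "nattr_id (mo F f) \<in> Cell (CAT small)" using C.Cell_simps(1) mo_Mor f by (simp add: sel)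
    show ?case using i C.Hcm_Idc'[of "mo F f" "func_id (ob F y)"] mo_Mor[of f] C.Mor_simps(1-3)[of
        "ob F y"]
        mo[of f] ob unit[of f] C.Vcm_simps(1)[OF i] by (simp add: sel un e)
  next
    case (22 f g)
    then show ?case using ext by blast
  next
    case (23 f)
    then show ?case using A.inert_Mor mo_Mor by (auto simp: sel)
  next
    case (24 x)
    then show ?case by (simp add: sel un)
  next
    case (25 f x y g z)
    then show ?case using cp_nattr_id[of f g] by (simp add: hom_def sel)
  qed (simp_all add: A C.f_category_axioms A.two_category_axioms C.two_category_axioms ob ext ce un)
qed

locale cat_pt = pseudo_f_transformation A "CAT small" \<alpha>
  for A :: "('o, 'm, 'c, 'y) fcat_scheme" and small :: "'u set \<Rightarrow> bool"
    and \<alpha> :: "('o, 'm, 'c, 'u cat, 'u func, 'u nattr) pstrans" +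
  assumes discrete: "locally_discrete A"
begin

sublocale F: cat_pf A small "tdom \<alpha>"
  by (intro cat_pf.intro cat_pf_axioms.intro F.pseudo_f_functor_axioms discrete)

sublocale G: cat_pf A small "tcod \<alpha>"
  by (intro cat_pf.intro cat_pf_axioms.intro G.pseudo_f_functor_axioms discrete)

lemma tcomp_functor [simp]:
  "x \<in> Obj A \<Longrightarrow> cat_functor (tcomp \<alpha> x)"
  "x \<in> Obj A \<Longrightarrow> fdom (tcomp \<alpha> x) = ob (tdom \<alpha>) x"
  "x \<in> Obj A \<Longrightarrow> fcod (tcomp \<alpha> x) = ob (tcod \<alpha>) x"
  using pn_simps(1-3)[of x] by (simp_all add: CAT_sel)

lemma tcomp_simps [simp]:
  assumes "x \<in> Obj A"
  shows "c \<in> cobj (ob (tdom \<alpha>) x) \<Longrightarrow> fobj (tcomp \<alpha> x) c \<in> cobj (ob (tcod \<alpha>) x)"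
    "a \<in> carr (ob (tdom \<alpha>) x) \<Longrightarrow> farr (tcomp \<alpha> x) a \<in> carr (ob (tcod \<alpha>) x)"
    "a \<in> carr (ob (tdom \<alpha>) x) \<Longrightarrow>
      cdom (ob (tcod \<alpha>) x) (farr (tcomp \<alpha> x) a) = fobj (tcomp \<alpha> x) (cdom (ob (tdom \<alpha>) x) a)"
    "a \<in> carr (ob (tdom \<alpha>) x) \<Longrightarrow>
      ccod (ob (tcod \<alpha>) x) (farr (tcomp \<alpha> x) a) = fobj (tcomp \<alpha> x) (ccod (ob (tdom \<alpha>) x) a)"
    "c \<in> cobj (ob (tdom \<alpha>) x) \<Longrightarrow>
      farr (tcomp \<alpha> x) (cid (ob (tdom \<alpha>) x) c) = cid (ob (tcod \<alpha>) x) (fobj (tcomp \<alpha> x) c)"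
    "\<lbrakk>a \<in> carr (ob (tdom \<alpha>) x); b \<in> carr (ob (tdom \<alpha>) x);
      ccod (ob (tdom \<alpha>) x) a = cdom (ob (tdom \<alpha>) x) b\<rbrakk>
      \<Longrightarrow> farr (tcomp \<alpha> x) (ccmp (ob (tdom \<alpha>) x) b a)
        = ccmp (ob (tcod \<alpha>) x) (farr (tcomp \<alpha> x) b) (farr (tcomp \<alpha> x) a)"
  using cat_functor.functor_simps[OF tcomp_functor(1)[OF assms]] assms by simp_all

lemma tnat_nattr [simp]:
  assumes "f \<in> Mor A"
  shows "natural_transformation (tnat \<alpha> f)"
    "ndom (tnat \<alpha> f) = func_comp (mo (tcod \<alpha>) f) (tcomp \<alpha> (Dom A f))"
    "ncod (tnat \<alpha> f) = func_comp (tcomp \<alpha> (Cod A f)) (mo (tdom \<alpha>) f)"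
  using pn_simps(4-6)[OF assms] by (simp_all add: CAT_sel)

lemma tnat_simps [simp]:
  assumes "f \<in> Mor A" and "c \<in> cobj (ob (tdom \<alpha>) (Dom A f))" and "Cod A f = y"
  shows "ncomp (tnat \<alpha> f) c \<in> carr (ob (tcod \<alpha>) y)"
    "cdom (ob (tcod \<alpha>) y) (ncomp (tnat \<alpha> f) c) = fobj (mo (tcod \<alpha>) f) (fobj (tcomp \<alpha> (Dom A f)) c)"
    "ccod (ob (tcod \<alpha>) y) (ncomp (tnat \<alpha> f) c) = fobj (tcomp \<alpha> y) (fobj (mo (tdom \<alpha>) f) c)"
  using natural_transformation.nattr_simps(3-5)[OF tnat_nattr(1)[OF assms(1)], of c] assms by auto

lemma tnat_naturality:
  assumes "f \<in> Mor A" and "a \<in> carr (ob (tdom \<alpha>) (Dom A f))"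
  shows "ccmp (ob (tcod \<alpha>) (Cod A f)) (farr (tcomp \<alpha> (Cod A f)) (farr (mo (tdom \<alpha>) f) a))
      (ncomp (tnat \<alpha> f) (cdom (ob (tdom \<alpha>) (Dom A f)) a))
    = ccmp (ob (tcod \<alpha>) (Cod A f)) (ncomp (tnat \<alpha> f) (ccod (ob (tdom \<alpha>) (Dom A f)) a))
      (farr (mo (tcod \<alpha>) f) (farr (tcomp \<alpha> (Dom A f)) a))"
  using natural_transformation.naturality[OF tnat_nattr(1)[OF assms(1)], of a] assms by simp

lemma tnat_iso:
  assumes "f \<in> Mor A" and "c \<in> cobj (ob (tdom \<alpha>) (Dom A f))"
  shows "cat_iso (ob (tcod \<alpha>) (Cod A f)) (ncomp (tnat \<alpha> f) c)"
  using pn_simps(7)[OF assms(1)] assms invertible_cell_CAT_iff[OF pn_simps(4)[OF assms(1)]] by simp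

lemma tnat_inert:
  assumes "f \<in> Mor A" and "f \<in> inert A"
  shows "tnat \<alpha> f = nattr_id (func_comp (mo (tcod \<alpha>) f) (tcomp \<alpha> (Dom A f)))"
    "func_comp (tcomp \<alpha> (Cod A f)) (mo (tdom \<alpha>) f) = func_comp (mo (tcod \<alpha>) f) (tcomp \<alpha> (Dom A f))"
proof -
  show 1: "tnat \<alpha> f = nattr_id (func_comp (mo (tcod \<alpha>) f) (tcomp \<alpha> (Dom A f)))"
    using tnat_identity[of f "Dom A f" "Cod A f"] assms by (simp add: hom_def CAT_sel(4-13))
  show "func_comp (tcomp \<alpha> (Cod A f)) (mo (tdom \<alpha>) f) = func_comp (mo (tcod \<alpha>) f) (tcomp \<alpha> (Dom A
      f))"
    using tnat_nattr(3)[OF assms(1)] by (simp add: 1)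
qed

lemma tnat_composite:
  assumes "f \<in> Mor A" "g \<in> Mor A" "Cod A f = Dom A g" and c: "c \<in> cobj (ob (tdom \<alpha>) (Dom A f))"
  shows "ccmp (ob (tcod \<alpha>) (Cod A g)) (ncomp (tnat \<alpha> (g \<cdot>\<^bsub>A\<^esub> f)) c)
      (ncomp (cp (tcod \<alpha>) g f) (fobj (tcomp \<alpha> (Dom A f)) c))
    = ccmp (ob (tcod \<alpha>) (Cod A g)) (farr (tcomp \<alpha> (Cod A g)) (ncomp (cp (tdom \<alpha>) g f) c))
      (ccmp (ob (tcod \<alpha>) (Cod A g)) (ncomp (tnat \<alpha> g) (fobj (mo (tdom \<alpha>) f) c))
        (farr (mo (tcod \<alpha>) g) (ncomp (tnat \<alpha> f) c)))"
proof -
  let ?F = "tdom \<alpha>" and ?G = "tcod \<alpha>"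
  have "nattr_vcomp (tnat \<alpha> (g \<cdot>\<^bsub>A\<^esub> f)) (nattr_hcomp (cp ?G g f) (nattr_id (tcomp \<alpha> (Dom A f))))
    = nattr_vcomp (nattr_hcomp (nattr_id (tcomp \<alpha> (Cod A g))) (cp ?F g f))
      (nattr_vcomp (nattr_hcomp (tnat \<alpha> g) (nattr_id (mo ?F f))) (nattr_hcomp (nattr_id (mo ?G g))
          (tnat \<alpha> f)))"
    using tnat_comp'[OF assms(1-3)] by (simp add: CAT_sel(4-13))
  from arg_cong[OF this, of "\<lambda>\<gamma>. ncomp \<gamma> c"] show ?thesis using assms by (simp add: F.mo_cid
      G.mo_cid)
qed

end

text \<open>
  As for functors, the unit axiom follows from strictness at inert 1-cells, and naturality in
  2-cells from their being identities.
\<close>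

lemma pseudo_f_transformation_CAT_I:
  fixes A :: "('o, 'm, 'c, 'y) fcat_scheme"
    and \<alpha> :: "('o, 'm, 'c, 'u cat, 'u func, 'u nattr) pstrans"
  assumes discrete: "locally_discrete A"
    and F: "pseudo_f_functor A (CAT small) (tdom \<alpha>)" and G: "pseudo_f_functor A (CAT small) (tcod
        \<alpha>)"
    and tcomp: "\<And>x. x \<in> Obj A \<Longrightarrow> cat_functor (tcomp \<alpha> x) \<and> fdom (tcomp \<alpha> x) = ob (tdom \<alpha>) x \<and>
      fcod (tcomp \<alpha> x) = ob (tcod \<alpha>) x"
    and tnat: "\<And>f. f \<in> Mor A \<Longrightarrow> natural_transformation (tnat \<alpha> f) \<and>
      ndom (tnat \<alpha> f) = func_comp (mo (tcod \<alpha>) f) (tcomp \<alpha> (Dom A f)) \<and>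
      ncod (tnat \<alpha> f) = func_comp (tcomp \<alpha> (Cod A f)) (mo (tdom \<alpha>) f)"
    and iso: "\<And>f c. \<lbrakk>f \<in> Mor A; c \<in> cobj (ob (tdom \<alpha>) (Dom A f))\<rbrakk>
      \<Longrightarrow> cat_iso (ob (tcod \<alpha>) (Cod A f)) (ncomp (tnat \<alpha> f) c)"
    and tnat_inert: "\<And>f c. \<lbrakk>f \<in> Mor A; f \<in> inert A; c \<in> cobj (ob (tdom \<alpha>) (Dom A f))\<rbrakk>
      \<Longrightarrow> ncomp (tnat \<alpha> f) c
        = cid (ob (tcod \<alpha>) (Cod A f)) (fobj (mo (tcod \<alpha>) f) (fobj (tcomp \<alpha> (Dom A f)) c))"
    and comp_inert: "\<And>f. \<lbrakk>f \<in> Mor A; f \<in> inert A\<rbrakk> \<Longrightarrow>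
      func_comp (tcomp \<alpha> (Cod A f)) (mo (tdom \<alpha>) f) = func_comp (mo (tcod \<alpha>) f) (tcomp \<alpha> (Dom A f))"
    and comp: "\<And>f g c. \<lbrakk>f \<in> Mor A; g \<in> Mor A; Cod A f = Dom A g; c \<in> cobj (ob (tdom \<alpha>) (Dom A f))\<rbrakk>
      \<Longrightarrow> ccmp (ob (tcod \<alpha>) (Cod A g)) (ncomp (tnat \<alpha> (g \<cdot>\<^bsub>A\<^esub> f)) c)
          (ncomp (cp (tcod \<alpha>) g f) (fobj (tcomp \<alpha> (Dom A f)) c))
        = ccmp (ob (tcod \<alpha>) (Cod A g)) (farr (tcomp \<alpha> (Cod A g)) (ncomp (cp (tdom \<alpha>) g f) c))
          (ccmp (ob (tcod \<alpha>) (Cod A g)) (ncomp (tnat \<alpha> g) (fobj (mo (tdom \<alpha>) f) c))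
            (farr (mo (tcod \<alpha>) g) (ncomp (tnat \<alpha> f) c)))"
    and ext: "tcomp \<alpha> \<in> extensional (Obj A)" "tnat \<alpha> \<in> extensional (Mor A)"
  shows "pseudo_f_transformation A (CAT small) \<alpha>"
proof -
  interpret C: two_category "CAT small" by (rule two_category_CAT)
  interpret F: cat_pf A small "tdom \<alpha>" by (intro cat_pf.intro cat_pf_axioms.intro F discrete)
  interpret G: cat_pf A small "tcod \<alpha>" by (intro cat_pf.intro cat_pf_axioms.intro G discrete)
  let ?F = "tdom \<alpha>" and ?G = "tcod \<alpha>"
  note sel = CAT_sel(4-13)
  have tcomp_Mor: "tcomp \<alpha> x \<in> Mor (CAT small)" if "x \<in> Obj A" for x
    using tcomp[OF that] F.pf_simps(1)[OF that] G.pf_simps(1)[OF that] by (simp add: CAT_sel(2))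
  have [simp]: "fdom (tcomp \<alpha> x) = ob ?F x" "fcod (tcomp \<alpha> x) = ob ?G x" if "x \<in> Obj A" for x
    using tcomp[OF that] by simp_all
  have tnat_Cell: "tnat \<alpha> f \<in> Cell (CAT small)" if f: "f \<in> Mor A" for f
    using tnat[OF f] f tcomp_Mor C.Mor_simps(4)[of "tcomp \<alpha> (Dom A f)" "mo ?G f"]
      C.Mor_simps(4)[of "mo ?F f" "tcomp \<alpha> (Cod A f)"] F.pf_simps(2)[OF f] G.pf_simps(2)[OF f]
    by (simp add: CAT_sel(3) sel)
  have tnat_id: "tnat \<alpha> f = nattr_id (func_comp (mo ?G f) (tcomp \<alpha> (Dom A f)))"
    if f: "f \<in> Mor A" "f \<in> inert A" for f
    using tnat[OF f(1)] tnat_inert[OF f] comp_inert[OF f] f(1)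
      natural_transformation.ncomp_extensional[of "tnat \<alpha> f"] by (intro nattr_eqI) simp_all
  show ?thesis
  proof (intro pseudo_f_transformation.intro pseudonatural.intro pseudonatural_axioms.intro
      pseudo_f_transformation_axioms.intro, goal_cases)
    case (5 x)
    then show ?case using tcomp_Mor by (simp add: hom_def sel)
  next
    case (6 f x y)
    then show ?case using tnat_Cell tnat by (simp add: hom_def cells_def sel)
  next
    case (7 f)
    then show ?case using tnat_Cell[of f] tnat[of f] iso[of f]
      by (simp add: invertible_cell_CAT_iff)
  next
    case (8 f x y \<gamma> g)
    then have \<gamma>: "\<gamma> = Idc A f" "g = f" and f [simp]: "f \<in> Mor A" "Dom A f = x" "Cod A f = y"
      using F.A.locally_discrete_cellsD[OF discrete] by (auto simp: hom_def)
    have [simp]: "x \<in> Obj A" "y \<in> Obj A" using F.A.Dom_closed[of f] F.A.Cod_closed[of f] by simp_all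
    have "nattr_hcomp (nattr_id (mo ?G f)) (nattr_id (tcomp \<alpha> x)) = nattr_id (func_comp (mo ?G f)
        (tcomp \<alpha> x))"
      "nattr_hcomp (nattr_id (tcomp \<alpha> y)) (nattr_id (mo ?F f)) = nattr_id (func_comp (tcomp \<alpha> y) (mo
          ?F f))"
      using C.Hcm_Idc'[of "tcomp \<alpha> x" "mo ?G f"] C.Hcm_Idc'[of "mo ?F f" "tcomp \<alpha> y"] tcomp_Mor
        F.pf_simps(2)[of f] G.pf_simps(2)[of f] by (simp_all add: sel)
    then show ?case
      using C.Vcm_simps(1,2)[of "tnat \<alpha> f"] tnat_Cell[of f] tnat[of f] F.ce_eq G.ce_eq
      by (simp add: \<gamma> sel)
  next
    case (9 x)
    then have [simp]: "x \<in> Obj A" by simp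
    have "func_comp (func_id (ob ?G x)) (tcomp \<alpha> x) = tcomp \<alpha> x"
      "func_comp (tcomp \<alpha> x) (func_id (ob ?F x)) = tcomp \<alpha> x"
      using C.Cmp_simps(1,2)[of "tcomp \<alpha> x"] tcomp_Mor[of x] by (simp_all add: sel)
    moreover have "tnat \<alpha> (Idm A x) = nattr_id (func_comp (func_id (ob ?G x)) (tcomp \<alpha> x))"
      using tnat_id[of "Idm A x"] F.A.inert_Idm[of x] G.mo_Idm[of x] by simp
    ultimately show ?case
      using C.Hcm_Idc'[of "tcomp \<alpha> x" "func_id (ob ?G x)"] C.Hcm_Idc'[of "func_id (ob ?F x)" "tcomp
          \<alpha> x"]
        tcomp_Mor[of x] C.Mor_simps(1-3)[of "ob ?F x"] C.Mor_simps(1-3)[of "ob ?G x"]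
            F.pf_simps(1)[of x]
        G.pf_simps(1)[of x] F.un_identity[of x] G.un_identity[of x] C.Cell_simps(1,2)[of "tcomp \<alpha>
            x"]
        C.Vcm_simps(1)[of "nattr_id (tcomp \<alpha> x)" "tcomp \<alpha> x"] by (simp add: sel)
  next
    case (10 f x y g z)
    then have [simp]: "f \<in> Mor A" "g \<in> Mor A" "Dom A f = x" "Cod A f = y" "Dom A g = y" "Cod A g =
        z"
      by (simp_all add: hom_def)
    have [simp]: "x \<in> Obj A" "y \<in> Obj A" "z \<in> Obj A"
      using F.A.Dom_closed[of f] F.A.Cod_closed[of f] F.A.Cod_closed[of g] by simp_all
    have [simp]: "tnat \<alpha> g \<in> Cell (CAT small)" "tnat \<alpha> f \<in> Cell (CAT small)"
      "tnat \<alpha> (g \<cdot>\<^bsub>A\<^esub> f) \<in> Cell (CAT small)" using tnat_Cell by simp_all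
    have [simp]: "Src (CAT small) (tnat \<alpha> h) = mo ?G h \<cdot>\<^bsub>CAT small\<^esub> tcomp \<alpha> (Dom A h)"
      "Tgt (CAT small) (tnat \<alpha> h) = tcomp \<alpha> (Cod A h) \<cdot>\<^bsub>CAT small\<^esub> mo ?F h" if "h \<in> Mor A" for h
      using tnat[OF that] by (simp_all add: sel)
    have [simp]: "tcomp \<alpha> w \<in> Mor (CAT small)" "Dom (CAT small) (tcomp \<alpha> w) = ob ?F w"
      "Cod (CAT small) (tcomp \<alpha> w) = ob ?G w" if "w \<in> Obj A" for w
      using tcomp_Mor[OF that] that by (simp_all add: sel)
    let ?L = "tnat \<alpha> (g \<cdot>\<^bsub>A\<^esub> f) \<bullet>\<^bsub>CAT small\<^esub> (cp ?G g f \<star>\<^bsub>CAT small\<^esub> Idc (CAT small) (tcomp \<alpha> x))"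
    let ?R = "(Idc (CAT small) (tcomp \<alpha> z) \<star>\<^bsub>CAT small\<^esub> cp ?F g f) \<bullet>\<^bsub>CAT small\<^esub>
      ((tnat \<alpha> g \<star>\<^bsub>CAT small\<^esub> Idc (CAT small) (mo ?F f)) \<bullet>\<^bsub>CAT small\<^esub>
       (Idc (CAT small) (mo ?G g) \<star>\<^bsub>CAT small\<^esub> tnat \<alpha> f))"
    have cells: "?L \<in> Cell (CAT small)" "?R \<in> Cell (CAT small)" "Src (CAT small) ?L = Src (CAT
        small) ?R"
      "Tgt (CAT small) ?L = Tgt (CAT small) ?R" by simp_all
    have "?L = ?R"
    proof (rule nattr_eqI)
      show "ncomp ?L \<in> extensional (cobj (fdom (ndom ?L)))"
        using CAT_CellD(1)[OF cells(1)] by (rule natural_transformation.ncomp_extensional)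
      show "ncomp ?R \<in> extensional (cobj (fdom (ndom ?L)))"
        using natural_transformation.ncomp_extensional[OF CAT_CellD(1)[OF cells(2)]] cells(3)
        unfolding CAT_sel(6) by simp
      fix c assume "c \<in> cobj (fdom (ndom ?L))"
      then have c: "c \<in> cobj (ob ?F x)" by (simp add: sel)
      have tc: "fobj (tcomp \<alpha> w) d \<in> cobj (ob ?G w)" if "w \<in> Obj A" "d \<in> cobj (ob ?F w)" for w d
        using cat_functor.functor_simps(1)[of "tcomp \<alpha> w" d] tcomp that by simp
      have ta: "farr (tcomp \<alpha> w) d \<in> carr (ob ?G w)"
        "cdom (ob ?G w) (farr (tcomp \<alpha> w) d) = fobj (tcomp \<alpha> w) (cdom (ob ?F w) d)"
        "ccod (ob ?G w) (farr (tcomp \<alpha> w) d) = fobj (tcomp \<alpha> w) (ccod (ob ?F w) d)"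
        if "w \<in> Obj A" "d \<in> carr (ob ?F w)" for w d
        using cat_functor.functor_simps(2-4)[of "tcomp \<alpha> w" d] tcomp that by simp_all
      have tcid: "farr (tcomp \<alpha> w) (cid (ob ?F w) d) = cid (ob ?G w) (fobj (tcomp \<alpha> w) d)"
        if "w \<in> Obj A" "d \<in> cobj (ob ?F w)" for w d
        using cat_functor.functor_simps(5)[of "tcomp \<alpha> w" d] tcomp that by simp
      have tn: "ncomp (tnat \<alpha> h) d \<in> carr (ob ?G (Cod A h))"
        "cdom (ob ?G (Cod A h)) (ncomp (tnat \<alpha> h) d) = fobj (mo ?G h) (fobj (tcomp \<alpha> (Dom A h)) d)"
        "ccod (ob ?G (Cod A h)) (ncomp (tnat \<alpha> h) d) = fobj (tcomp \<alpha> (Cod A h)) (fobj (mo ?F h) d)"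
        if "h \<in> Mor A" "d \<in> cobj (ob ?F (Dom A h))" for h d
        using natural_transformation.nattr_simps(3-5)[of "tnat \<alpha> h" d] tnat[of h] that by simp_all
      have mc: "farr (mo ?G h) (cid (ob ?G (Dom A h)) d) = cid (ob ?G (Cod A h)) (fobj (mo ?G h) d)"
        if "h \<in> Mor A" "d \<in> cobj (ob ?G (Dom A h))" for h d using G.mo_cid[of h d] that by simp
      show "ncomp ?L c = ncomp ?R c"
        using comp[of f g c] c tn[of f c] tn[of g "fobj (mo ?F f) c"] tc[of x c] tc[of y "fobj (mo
            ?F f) c"]
          tnat[of f] tnat[of g] mc[of f "fobj (tcomp \<alpha> x) c"] mc[of g "fobj (tcomp \<alpha> y) (fobj (mo ?F
              f) c)"]
          tcid[of x c] tcid[of y "fobj (mo ?F f) c"] G.mo_cid[of "g \<cdot>\<^bsub>A\<^esub> f" "fobj (tcomp \<alpha> x) c"]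
          G.mo_cid[of g "fobj (mo ?G f) (fobj (tcomp \<alpha> x) c)"] ta[of z "ncomp (cp ?F g f) c"]
        by (simp add: sel)
    qed (use cells in \<open>simp_all only: CAT_sel(6,7)\<close>)
    then show ?case by simp
  next
    case (13 f x y)
    then show ?case using tnat_id by (simp add: hom_def sel)
  qed (simp_all add: F.pseudo_f_functor_axioms G.pseudo_f_functor_axioms F.pseudofunctor_axioms
    G.pseudofunctor_axioms ext)
qed

locale cat_md = modification A "CAT small" \<Gamma>
  for A :: "('o, 'm, 'c, 'y) twocat_scheme" and small :: "'u set \<Rightarrow> bool"
    and \<Gamma> :: "('o, 'm, 'c, 'u cat, 'u func, 'u nattr) modif"
begin

lemma mcomp_nattr [simp]:
  assumes "x \<in> Obj A"
  shows "natural_transformation (mcomp \<Gamma> x)" "ndom (mcomp \<Gamma> x) = tcomp (mdom \<Gamma>) x"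
    "ncod (mcomp \<Gamma> x) = tcomp (mcod \<Gamma>) x"
  using md_simps[OF assms] by (simp_all add: CAT_sel)

lemma mdom_functor [simp]:
  "x \<in> Obj A \<Longrightarrow> cat_functor (tcomp (mdom \<Gamma>) x)"
  "x \<in> Obj A \<Longrightarrow> fdom (tcomp (mdom \<Gamma>) x) = ob (tdom (mdom \<Gamma>)) x"
  "x \<in> Obj A \<Longrightarrow> fcod (tcomp (mdom \<Gamma>) x) = ob (tcod (mdom \<Gamma>)) x"
  using S.pn_simps(1-3)[of x] by (simp_all add: CAT_sel)

lemma mcomp_simps [simp]:
  assumes "x \<in> Obj A" and "c \<in> cobj (ob (tdom (mdom \<Gamma>)) x)"
  shows "ncomp (mcomp \<Gamma> x) c \<in> carr (ob (tcod (mdom \<Gamma>)) x)"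
    "cdom (ob (tcod (mdom \<Gamma>)) x) (ncomp (mcomp \<Gamma> x) c) = fobj (tcomp (mdom \<Gamma>) x) c"
    "ccod (ob (tcod (mdom \<Gamma>)) x) (ncomp (mcomp \<Gamma> x) c) = fobj (tcomp (mcod \<Gamma>) x) c"
  using natural_transformation.nattr_simps(3-5)[OF mcomp_nattr(1)[OF assms(1)], of c] assms
  by simp_all

lemma mcomp_naturality:
  assumes "x \<in> Obj A" and "a \<in> carr (ob (tdom (mdom \<Gamma>)) x)"
  shows "ccmp (ob (tcod (mdom \<Gamma>)) x) (farr (tcomp (mcod \<Gamma>) x) a)
      (ncomp (mcomp \<Gamma> x) (cdom (ob (tdom (mdom \<Gamma>)) x) a))
    = ccmp (ob (tcod (mdom \<Gamma>)) x) (ncomp (mcomp \<Gamma> x) (ccod (ob (tdom (mdom \<Gamma>)) x) a))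
      (farr (tcomp (mdom \<Gamma>) x) a)"
  using natural_transformation.naturality[OF mcomp_nattr(1)[OF assms(1)], of a] assms by simp

end

text \<open>
  For transformations between pseudofunctors on a locally discrete domain, the modification axiom
  is an equation between arrows.
\<close>

lemma modification_axiom_iff:
  fixes A :: "('o, 'm, 'c, 'y) fcat_scheme"
    and \<alpha> \<beta> :: "('o, 'm, 'c, 'u cat, 'u func, 'u nattr) pstrans"
  assumes \<alpha>: "cat_pt A small \<alpha>" and \<beta>: "cat_pt A small \<beta>"
    and eq: "tdom \<beta> = tdom \<alpha>" "tcod \<beta> = tcod \<alpha>"
    and G: "\<And>x. x \<in> Obj A \<Longrightarrow> natural_transformation (G x) \<and> ndom (G x) = tcomp \<alpha> x \<and>
      ncod (G x) = tcomp \<beta> x"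
    and f: "f \<in> Mor A"
  shows "(G (Cod A f) \<star>\<^bsub>CAT small\<^esub> Idc (CAT small) (mo (tdom \<alpha>) f)) \<bullet>\<^bsub>CAT small\<^esub> tnat \<alpha> f
      = tnat \<beta> f \<bullet>\<^bsub>CAT small\<^esub> (Idc (CAT small) (mo (tcod \<alpha>) f) \<star>\<^bsub>CAT small\<^esub> G (Dom A f)) \<longleftrightarrow>
    (\<forall>c\<in>cobj (ob (tdom \<alpha>) (Dom A f)).
      ccmp (ob (tcod \<alpha>) (Cod A f)) (ncomp (G (Cod A f)) (fobj (mo (tdom \<alpha>) f) c)) (ncomp (tnat \<alpha> f)
          c)
      = ccmp (ob (tcod \<alpha>) (Cod A f)) (ncomp (tnat \<beta> f) c) (farr (mo (tcod \<alpha>) f) (ncomp (G (Dom A f))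
          c)))"
    (is "?L = ?R \<longleftrightarrow> (\<forall>c\<in>?X. ?l c = ?r c)")
proof -
  interpret \<alpha>: cat_pt A small \<alpha> by fact
  interpret \<beta>: cat_pt A small \<beta> by fact
  note [simp] = eq
  obtain x y where xy: "Dom A f = x" "Cod A f = y" by blast
  have [simp]: "f \<in> Mor A" "x \<in> Obj A" "y \<in> Obj A" "Dom A f = x" "Cod A f = y"
    using \<alpha>.F.A.Dom_closed[OF f] \<alpha>.F.A.Cod_closed[OF f] f xy by simp_all
  have [simp]: "ndom (G w) = tcomp \<alpha> w" "ncod (G w) = tcomp \<beta> w" if "w \<in> Obj A" for w
    using G[OF that] by simp_all
  have Gc [simp]: "ncomp (G w) c \<in> carr (ob (tcod \<alpha>) w)"
    "cdom (ob (tcod \<alpha>) w) (ncomp (G w) c) = fobj (tcomp \<alpha> w) c"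
    "ccod (ob (tcod \<alpha>) w) (ncomp (G w) c) = fobj (tcomp \<beta> w) c"
    if "w \<in> Obj A" "c \<in> cobj (ob (tdom \<alpha>) w)" for w c
    using natural_transformation.nattr_simps(3-5)[of "G w" c] G[OF that(1)] that by simp_all
  have [simp]: "cat_functor (tcomp \<beta> w)" "fdom (tcomp \<beta> w) = ob (tdom \<alpha>) w"
    "fcod (tcomp \<beta> w) = ob (tcod \<alpha>) w" "c \<in> cobj (ob (tdom \<alpha>) w) \<Longrightarrow> fobj (tcomp \<beta> w) c \<in> cobj (ob
        (tcod \<alpha>) w)"
    if "w \<in> Obj A" for w c using \<beta>.tcomp_functor[OF that] \<beta>.tcomp_simps(1)[of w c] that by simp_all
  have [simp]: "ndom (tnat \<beta> f) = func_comp (mo (tcod \<alpha>) f) (tcomp \<beta> x)"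
    "ncod (tnat \<beta> f) = func_comp (tcomp \<beta> y) (mo (tdom \<alpha>) f)"
    using \<beta>.tnat_nattr(2,3)[of f] by simp_all
  have [simp]: "ncomp (tnat \<beta> f) c \<in> carr (ob (tcod \<alpha>) y)"
    "cdom (ob (tcod \<alpha>) y) (ncomp (tnat \<beta> f) c) = fobj (mo (tcod \<alpha>) f) (fobj (tcomp \<beta> x) c)"
    if "c \<in> cobj (ob (tdom \<alpha>) x)" for c
    using \<beta>.tnat_simps(1,2)[of f c y] that by simp_all
  have cid: "farr (mo (tcod \<alpha>) f) (cid (ob (tcod \<alpha>) x) c) = cid (ob (tcod \<alpha>) y) (fobj (mo (tcod \<alpha>)
      f) c)"
    if "c \<in> cobj (ob (tcod \<alpha>) x)" for c using \<alpha>.G.mo_cid[of f c] that by simp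
  have cid': "farr (tcomp \<alpha> y) (cid (ob (tdom \<alpha>) y) c) = cid (ob (tcod \<alpha>) y) (fobj (tcomp \<alpha> y) c)"
    if "c \<in> cobj (ob (tdom \<alpha>) y)" for c using \<alpha>.tcomp_simps(5)[of y c] that by simp
  have L: "ncomp ?L c = ?l c" and R: "ncomp ?R c = ?r c" if c: "c \<in> ?X" for c
  proof -
    have [simp]: "c \<in> cobj (ob (tdom \<alpha>) x)" using c by simp
    show "ncomp ?L c = ?l c" by (simp add: CAT_sel(4-13) cid')
    have "ccmp (ob (tcod \<alpha>) y) (cid (ob (tcod \<alpha>) y) (fobj (mo (tcod \<alpha>) f) (fobj (tcomp \<beta> x) c)))
        (farr (mo (tcod \<alpha>) f) (ncomp (G x) c)) = farr (mo (tcod \<alpha>) f) (ncomp (G x) c)"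
      by (rule \<alpha>.G.ob_simps(10)) simp_all
    then show "ncomp ?R c = ?r c" by (simp add: CAT_sel(4-13))
  qed
  show ?thesis
  proof
    assume "?L = ?R"
    then have "\<forall>c\<in>?X. ncomp ?L c = ncomp ?R c" by simp
    then show "\<forall>c\<in>?X. ?l c = ?r c" using L R by simp
  next
    assume "\<forall>c\<in>?X. ?l c = ?r c"
    then have "\<forall>c\<in>?X. ncomp ?L c = ncomp ?R c" using L R by simp
    then show "?L = ?R" by (intro nattr_eqI) (simp_all add: CAT_sel(4-13))
  qed
qed

lemma modification_CAT_I:
  fixes A :: "('o, 'm, 'c, 'y) fcat_scheme"
  assumes \<alpha>: "cat_pt A small (mdom \<Gamma>)" and \<beta>: "cat_pt A small (mcod \<Gamma>)"
    and eq: "tdom (mcod \<Gamma>) = tdom (mdom \<Gamma>)" "tcod (mcod \<Gamma>) = tcod (mdom \<Gamma>)"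
    and G: "\<And>x. x \<in> Obj A \<Longrightarrow> natural_transformation (mcomp \<Gamma> x) \<and>
      ndom (mcomp \<Gamma> x) = tcomp (mdom \<Gamma>) x \<and> ncod (mcomp \<Gamma> x) = tcomp (mcod \<Gamma>) x"
    and nat: "\<And>f c. \<lbrakk>f \<in> Mor A; c \<in> cobj (ob (tdom (mdom \<Gamma>)) (Dom A f))\<rbrakk> \<Longrightarrow>
      ccmp (ob (tcod (mdom \<Gamma>)) (Cod A f)) (ncomp (mcomp \<Gamma> (Cod A f)) (fobj (mo (tdom (mdom \<Gamma>)) f)
          c))
        (ncomp (tnat (mdom \<Gamma>) f) c)
      = ccmp (ob (tcod (mdom \<Gamma>)) (Cod A f)) (ncomp (tnat (mcod \<Gamma>) f) c)
        (farr (mo (tcod (mdom \<Gamma>)) f) (ncomp (mcomp \<Gamma> (Dom A f)) c))"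
    and ext: "mcomp \<Gamma> \<in> extensional (Obj A)"
  shows "modification A (CAT small) \<Gamma>"
proof -
  interpret \<alpha>: cat_pt A small "mdom \<Gamma>" by fact
  interpret \<beta>: cat_pt A small "mcod \<Gamma>" by fact
  show ?thesis
  proof (intro modification.intro modification_axioms.intro, goal_cases)
    case (5 x)
    then show ?case using G[OF 5] \<alpha>.pn_simps(1)[OF 5] \<beta>.pn_simps(1)[OF 5]
      by (simp add: cells_def CAT_sel(3,6,7))
  next
    case (6 f x y)
    then have f: "f \<in> Mor A" "Dom A f = x" "Cod A f = y" by (simp_all add: hom_def)
    then show ?case using modification_axiom_iff[OF \<alpha> \<beta> eq G f(1)] nat[OF f(1)] by auto
  qed (simp_all add: \<alpha>.pseudonatural_axioms \<beta>.pseudonatural_axioms eq ext)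
qed

lemma modification_CAT_D:
  fixes A :: "('o, 'm, 'c, 'y) fcat_scheme"
  assumes \<Gamma>: "modification A (CAT small) \<Gamma>"
    and \<alpha>: "cat_pt A small (mdom \<Gamma>)" and \<beta>: "cat_pt A small (mcod \<Gamma>)"
    and fc: "f \<in> Mor A" "c \<in> cobj (ob (tdom (mdom \<Gamma>)) (Dom A f))"
  shows "ccmp (ob (tcod (mdom \<Gamma>)) (Cod A f)) (ncomp (mcomp \<Gamma> (Cod A f)) (fobj (mo (tdom (mdom \<Gamma>)) f)
      c))
        (ncomp (tnat (mdom \<Gamma>) f) c)
      = ccmp (ob (tcod (mdom \<Gamma>)) (Cod A f)) (ncomp (tnat (mcod \<Gamma>) f) c)
        (farr (mo (tcod (mdom \<Gamma>)) f) (ncomp (mcomp \<Gamma> (Dom A f)) c))"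
proof -
  interpret \<Gamma>: cat_md A small \<Gamma> using \<Gamma> by (simp add: cat_md_def)
  have "\<forall>c\<in>cobj (ob (tdom (mdom \<Gamma>)) (Dom A f)).
    ccmp (ob (tcod (mdom \<Gamma>)) (Cod A f)) (ncomp (mcomp \<Gamma> (Cod A f)) (fobj (mo (tdom (mdom \<Gamma>)) f) c))
        (ncomp (tnat (mdom \<Gamma>) f) c)
      = ccmp (ob (tcod (mdom \<Gamma>)) (Cod A f)) (ncomp (tnat (mcod \<Gamma>) f) c)
        (farr (mo (tcod (mdom \<Gamma>)) f) (ncomp (mcomp \<Gamma> (Dom A f)) c))"
    using \<Gamma>.mcomp_natural'[OF fc(1)] \<Gamma>.tdom_parallel \<Gamma>.tcod_parallel
    by (intro modification_axiom_iff[OF \<alpha> \<beta> _ _ _ fc(1), THEN iffD1]) simp_all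
  then show ?thesis using fc(2) by blast
qed

section \<open>Pseudo-models in categories, elementwise\<close>

lemma cone_simps:
  fixes A :: "('o, 'm, 'c, 'z) fcat_scheme" and S :: "('o, 'm, 'c, 'i, 'j, 'k) cone"
  assumes A: "f_category A" and S: "is_cone A S"
  shows "vertex S \<in> Obj A" and "two_category (shape S)"
    and "j \<in> Obj (shape S) \<Longrightarrow> ob (legs S) j \<in> inert A \<and> ob (legs S) j \<in> Mor A \<and>
      Dom A (ob (legs S) j) = vertex S"
    and "u \<in> Mor (shape S) \<Longrightarrow> \<exists>h. mo (legs S) u
        = (ob (legs S) (Dom (shape S) u), h, ob (legs S) (Cod (shape S) u)) \<and> h \<in> inert A \<and> h \<in> Mor
            A \<and>
      Dom A h = Cod A (ob (legs S) (Dom (shape S) u)) \<and> Cod A h = Cod A (ob (legs S) (Cod (shape S)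
          u)) \<and>
      h \<cdot>\<^bsub>A\<^esub> ob (legs S) (Dom (shape S) u) = ob (legs S) (Cod (shape S) u)"
    and "\<sigma> \<in> Cell (shape S) \<Longrightarrow> \<exists>\<gamma>. ce (legs S) \<sigma>
        = (ob (legs S) (Dom (shape S) (Src (shape S) \<sigma>)), \<gamma>, ob (legs S) (Cod (shape S) (Src (shape
            S) \<sigma>))) \<and>
      \<gamma> \<in> Cell A \<and> Src A \<gamma> = triangle (mo (legs S) (Src (shape S) \<sigma>)) \<and>
      Tgt A \<gamma> = triangle (mo (legs S) (Tgt (shape S) \<sigma>))"
proof -
  interpret A: f_category A by fact
  interpret L: strict_twofunctor "shape S" "coslice (inert_part A) (vertex S)" "legs S"
    using S by (simp add: is_cone_def)
  show "vertex S \<in> Obj A" "two_category (shape S)"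
    using S L.A.two_category_axioms by (simp_all add: is_cone_def)
  show ob: "ob (legs S) j \<in> inert A \<and> ob (legs S) j \<in> Mor A \<and> Dom A (ob (legs S) j) = vertex S"
    if "j \<in> Obj (shape S)" for j
    using L.F_simps(1)[OF that] A.inert_Mor by (auto simp: coslice_sel inert_part_def)
  show mo: "\<exists>h. mo (legs S) u
        = (ob (legs S) (Dom (shape S) u), h, ob (legs S) (Cod (shape S) u)) \<and> h \<in> inert A \<and> h \<in> Mor
            A \<and>
      Dom A h = Cod A (ob (legs S) (Dom (shape S) u)) \<and> Cod A h = Cod A (ob (legs S) (Cod (shape S)
          u)) \<and>
      h \<cdot>\<^bsub>A\<^esub> ob (legs S) (Dom (shape S) u) = ob (legs S) (Cod (shape S) u)"
    if "u \<in> Mor (shape S)" for u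
    using L.F_simps(2-4)[OF that] A.inert_Mor
    by (cases "mo (legs S) u") (auto simp: coslice_sel inert_part_def)
  show "\<exists>\<gamma>. ce (legs S) \<sigma>
        = (ob (legs S) (Dom (shape S) (Src (shape S) \<sigma>)), \<gamma>, ob (legs S) (Cod (shape S) (Src (shape
            S) \<sigma>))) \<and>
      \<gamma> \<in> Cell A \<and> Src A \<gamma> = triangle (mo (legs S) (Src (shape S) \<sigma>)) \<and>
      Tgt A \<gamma> = triangle (mo (legs S) (Tgt (shape S) \<sigma>))"
    if \<sigma>: "\<sigma> \<in> Cell (shape S)" for \<sigma>
  proof -
    obtain f \<gamma> g where e: "ce (legs S) \<sigma> = (f, \<gamma>, g)" by (cases "ce (legs S) \<sigma>") auto
    note s = L.F_simps(5-7)[OF \<sigma>, unfolded e coslice_sel(6,7)]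
    obtain h where h: "mo (legs S) (Src (shape S) \<sigma>)
        = (ob (legs S) (Dom (shape S) (Src (shape S) \<sigma>)), h, ob (legs S) (Cod (shape S) (Src (shape
            S) \<sigma>)))"
      using mo[OF L.A.Src_closed[OF \<sigma>]] by blast
    have "\<gamma> \<in> Cell A" using s(1) by (simp add: coslice_sel(3)) (simp add: inert_part_def)
    moreover have "Src A \<gamma> = triangle (mo (legs S) (Src (shape S) \<sigma>))"
      "Tgt A \<gamma> = triangle (mo (legs S) (Tgt (shape S) \<sigma>))"
      by (simp_all flip: s(2,3) add: triangle_def) (simp_all add: inert_part_def)
    ultimately show ?thesis using e s(2) h by simp
  qed
qed

text \<open>
  The legs of a cone are inert, and on inert 1-cells compositors are identities; so the image of a
  cone is a strictly commuting cone of categories, to which the description of limits applies.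
\<close>

lemma limit_cone_iff_arrow_limit:
  fixes A :: "('o, 'm, 'c, 'y) fcat_scheme" and S :: "('o, 'm, 'c, 'i, 'j, 'k) cone"
    and F :: "('o, 'm, 'c, 'u cat, 'u func, 'u nattr) psfun"
  assumes "universe small" and F: "pseudo_f_functor A (CAT small) F" and "locally_discrete A"
    and S: "is_cone A S"
  shows "limit_cone (shape S) (CAT small) (image_diagram A F S) (ob F (vertex S))
      (\<lambda>j. mo F (ob (legs S) j)) \<longleftrightarrow>
    arrow_limit (shape S) (\<lambda>j. ob F (Cod A (ob (legs S) j))) (\<lambda>u. mo F (triangle (mo (legs S) u)))
      (ob F (vertex S)) (\<lambda>j. mo F (ob (legs S) j))"
proof -
  interpret F: cat_pf A small F by (intro cat_pf.intro cat_pf_axioms.intro assms)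
  interpret universe small by fact
  note c = cone_simps[OF F.A.f_category_axioms S]
  interpret J: two_category "shape S" by (rule c(2))
  have leg: "func_comp (mo F (triangle (mo (legs S) u))) (mo F (ob (legs S) (Dom (shape S) u)))
      = mo F (ob (legs S) (Cod (shape S) u))" if u: "u \<in> Mor (shape S)" for u
    using c(4)[OF u] c(3)[OF J.Dom_closed[OF u]]
      F.cp_inert(2)[of "ob (legs S) (Dom (shape S) u)" "triangle (mo (legs S) u)"]
    by (auto simp: triangle_def)
  interpret cat_cone small "shape S" "image_diagram A F S" "ob F (vertex S)" "\<lambda>j. mo F (ob (legs S)
      j)"
  proof (unfold_locales, goal_cases)
    case (1 u)
    from c(4)[OF 1] c(3)[OF J.Dom_closed[OF 1]] c(3)[OF J.Cod_closed[OF 1]] show ?case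
      by (auto simp: image_diagram_def triangle_def hom_def)
  next
    case (2 \<sigma>)
    from c(5)[OF 2] show ?case
      by (auto simp: image_diagram_def triangle_def F.ce_eq)
  next
    case 3
    then show ?case using c(1) by simp
  next
    case (4 j)
    from c(3)[OF 4] show ?case by (simp add: image_diagram_def hom_def)
  next
    case (5 u)
    from leg[OF 5] show ?case by (simp add: image_diagram_def)
  qed
  show ?thesis using limit_cone_CAT_iff by (simp add: image_diagram_def)
qed

lemma pseudo_model_CAT_iff:
  fixes A :: "('o, 'm, 'c, 'i, 'j, 'k) fsketch"
    and F :: "('o, 'm, 'c, 'u cat, 'u func, 'u nattr) psfun"
  assumes "universe small" and "f_sketch A" and "locally_discrete A"
  shows "pseudo_model A (CAT small) F \<longleftrightarrow> pseudo_f_functor A (CAT small) F \<and>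
    (\<forall>S\<in>marked A. arrow_limit (shape S) (\<lambda>j. ob F (Cod A (ob (legs S) j)))
      (\<lambda>u. mo F (triangle (mo (legs S) u))) (ob F (vertex S)) (\<lambda>j. mo F (ob (legs S) j)))"
  using limit_cone_iff_arrow_limit[OF assms(1) _ assms(3)] f_sketch.marked_cone[OF assms(2)]
  unfolding pseudo_model_def by blast

section \<open>The sketch of elements\<close>

lemma elements_sel:
  "Obj (elements A M) = {(x, s). x \<in> Obj A \<and> s \<in> el M x}"
  "Mor (elements A M) = {(f, s). f \<in> Mor A \<and> s \<in> el M (Dom A f)}"
  "Cell (elements A M) = {(\<gamma>, s). \<gamma> \<in> Cell A \<and> s \<in> el M (Dom A (Src A \<gamma>))}"
  "Dom (elements A M) (f, s) = (Dom A f, s)" "Cod (elements A M) (f, s) = (Cod A f, act M f s)"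
  "Src (elements A M) (\<gamma>, s) = (Src A \<gamma>, s)" "Tgt (elements A M) (\<gamma>, s) = (Tgt A \<gamma>, s)"
  "Idm (elements A M) (x, s) = (Idm A x, s)" "Idc (elements A M) (f, s) = (Idc A f, s)"
  "(g, t) \<cdot>\<^bsub>elements A M\<^esub> (f, s) = (g \<cdot>\<^bsub>A\<^esub> f, s)"
  "(\<delta>, t) \<bullet>\<^bsub>elements A M\<^esub> (\<gamma>, s) = (\<delta> \<bullet>\<^bsub>A\<^esub> \<gamma>, s)"
  "(\<delta>, t) \<star>\<^bsub>elements A M\<^esub> (\<gamma>, s) = (\<delta> \<star>\<^bsub>A\<^esub> \<gamma>, s)"
  "inert (elements A M) = {(f, s). f \<in> inert A \<and> s \<in> el M (Dom A f)}"
  "marked (elements A M) = {S. is_cone (elements_fcat A M) S \<and> project_cone S \<in> marked A}"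
  by (simp_all add: elements_def elements_fcat_def fcat.extend_def fsketch.fields_def)

lemma is_cone_elements_iff: "is_cone (elements A M) S \<longleftrightarrow> is_cone (elements_fcat A M) S"
proof -
  have "coslice (inert_part (elements A M)) v = coslice (inert_part (elements_fcat A M)) v" for v
    by (simp add: coslice_def inert_part_def elements_def fcat.extend_def Let_def hom_def)
  moreover have "Obj (elements A M) = Obj (elements_fcat A M)"
    by (simp add: elements_def fcat.extend_def)
  ultimately show ?thesis by (simp add: is_cone_def)
qed

lemma strict_twofunctor_restrict:
  assumes "strict_twofunctor A B F"
  shows "strict_twofunctor A B \<lparr>ob = restrict (ob F) (Obj A), mo = restrict (mo F) (Mor A),
    ce = restrict (ce F) (Cell A)\<rparr>"
proof -
  interpret strict_twofunctor A B F by fact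
  show ?thesis
    by (rule strict_twofunctorI) (simp_all add: A.two_category_axioms B.two_category_axioms)
qed

locale sketch_model = universe small + A: f_sketch A
  for small :: "'u set \<Rightarrow> bool" and A :: "('o, 'm, 'c, 'i, 'j, 'k) fsketch" +
  fixes M :: "('o, 'm, 'u) setfun"
  assumes discrete: "locally_discrete A" and model: "set_model small A M"
begin

abbreviation El :: "('o \<times> 'u, 'm \<times> 'u, 'c \<times> 'u, 'i, 'j, 'k) fsketch" where
  "El \<equiv> elements A M"

lemma universe_small: "universe small" by unfold_locales

lemma M_simps [simp]:
  "x \<in> Obj A \<Longrightarrow> small (el M x)"
  "\<lbrakk>f \<in> Mor A; s \<in> el M (Dom A f); Cod A f = y\<rbrakk> \<Longrightarrow> act M f s \<in> el M y"
  "\<lbrakk>x \<in> Obj A; s \<in> el M x\<rbrakk> \<Longrightarrow> act M (Idm A x) s = s"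
  "\<lbrakk>f \<in> Mor A; g \<in> Mor A; Cod A f = Dom A g; s \<in> el M (Dom A f)\<rbrakk>
    \<Longrightarrow> act M (g \<cdot>\<^bsub>A\<^esub> f) s = act M g (act M f s)"
proof -
  interpret set_functor small A M using model by (simp add: set_model_def)
  show "x \<in> Obj A \<Longrightarrow> small (el M x)" by (rule el_small)
  show "\<lbrakk>f \<in> Mor A; s \<in> el M (Dom A f); Cod A f = y\<rbrakk> \<Longrightarrow> act M f s \<in> el M y"
    using act_closed[of f "Dom A f" y] by (auto simp: hom_def)
  show "\<lbrakk>x \<in> Obj A; s \<in> el M x\<rbrakk> \<Longrightarrow> act M (Idm A x) s = s" by (rule act_Idm)
  show "\<lbrakk>f \<in> Mor A; g \<in> Mor A; Cod A f = Dom A g; s \<in> el M (Dom A f)\<rbrakk>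
    \<Longrightarrow> act M (g \<cdot>\<^bsub>A\<^esub> f) s = act M g (act M f s)"
    using act_Cmp[of f "Dom A f" "Cod A f" g "Cod A g"] by (auto simp: hom_def)
qed

lemma Tgt_eq_Src [simp]: "\<gamma> \<in> Cell A \<Longrightarrow> Tgt A \<gamma> = Src A \<gamma>"
  using A.locally_discrete_Tgt[OF discrete] .

lemma Cell_eq_Idc: "\<gamma> \<in> Cell A \<Longrightarrow> \<gamma> = Idc A (Src A \<gamma>)"
  using locally_discreteD[OF discrete] .

text \<open>
  The source and target of a 2-cell \<open>(\<gamma>, s)\<close> have the same codomain because \<open>\<gamma>\<close> is an identity, so
  both act in the same way on \<open>s\<close>.
\<close>

lemma two_category_El: "two_category El"
  by (rule two_categoryI, unfold split_paired_all)
    (auto simp: elements_sel A.interchange')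

lemma f_category_El: "f_category El"
  using A.inert_Mor A.inert_Idm A.inert_Cmp two_category_El
  by (intro f_category.intro f_category_axioms.intro) (auto simp: elements_sel subset_iff)

sublocale El: f_category El by (rule f_category_El)

lemma discrete_El: "locally_discrete El"
  unfolding locally_discrete_def using Cell_eq_Idc by (auto simp: elements_sel)

lemma f_sketch_El: "f_sketch El"
  by (intro f_sketch.intro f_sketch_axioms.intro f_category_El)
    (simp add: elements_sel is_cone_elements_iff)

definition lift_triangle :: "'u \<Rightarrow> 'm \<times> 'b \<times> 'm \<Rightarrow> ('m \<times> 'u) \<times> ('b \<times> 'u) \<times> ('m \<times> 'u)" where
  "lift_triangle s t = ((fst t, s), (triangle t, act M (fst t) s), (snd (snd t), s))"

lemma lift_triangle_simp [simp]: "lift_triangle s (f, h, g) = ((f, s), (h, act M f s), (g, s))"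
  by (simp add: lift_triangle_def triangle_def)

lemma project_lift_triangle [simp]: "map_prod fst (map_prod fst fst) (lift_triangle s t) = t"
  by (cases t) simp

text \<open>
  The unique cone of the category of elements with vertex \<open>(vertex S, s)\<close> that lies over \<open>S\<close>: an
  element determines its images along all legs.
\<close>

definition lift_cone ::
  "('o, 'm, 'c, 'i, 'j, 'k) cone \<Rightarrow> 'u \<Rightarrow> ('o \<times> 'u, 'm \<times> 'u, 'c \<times> 'u, 'i, 'j, 'k) cone" where
  "lift_cone S s = \<lparr>vertex = (vertex S, s), shape = shape S,
     legs = \<lparr>ob = (\<lambda>j\<in>Obj (shape S). (ob (legs S) j, s)),
       mo = (\<lambda>u\<in>Mor (shape S). lift_triangle s (mo (legs S) u)),
       ce = (\<lambda>\<sigma>\<in>Cell (shape S). lift_triangle s (ce (legs S) \<sigma>))\<rparr>\<rparr>"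

lemma strict_twofunctor_lift:
  assumes s: "s \<in> el M v"
  shows "strict_twofunctor (coslice (inert_part A) v) (coslice (inert_part El) (v, s))
    \<lparr>ob = (\<lambda>f. (f, s)), mo = lift_triangle s, ce = lift_triangle s\<rparr>"
proof -
  have i: "f \<in> Mor A" if "f \<in> inert A" for f using that A.inert_Mor by blast
  have A: "two_category (coslice (inert_part A) v)" and E: "two_category (coslice (inert_part El)
      (v, s))"
    by (intro two_category.two_category_coslice A.two_category_inert_part
        El.two_category_inert_part)+
  have act: "act M h (act M f s) = act M (h \<cdot>\<^bsub>A\<^esub> f) s"
    if "f \<in> inert A" "h \<in> inert A" "Dom A f = v" "Dom A h = Cod A f" for f h
    using that i s by simp
  show ?thesis
    by (rule strict_twofunctorI, unfold split_paired_all)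
      (use s A E in \<open>auto simp: coslice_sel inert_part_def elements_sel i act[symmetric]
        simp del: A.Cmp_simps(3)\<close>)
qed

lemma lift_cone_marked:
  assumes S: "S \<in> marked A" and s: "s \<in> el M (vertex S)"
  shows "lift_cone S s \<in> marked El"
proof -
  have c: "is_cone A S" using S by (rule A.marked_cone)
  interpret L: strict_twofunctor "shape S" "coslice (inert_part A) (vertex S)" "legs S"
    using c by (simp add: is_cone_def)
  have "is_cone El (lift_cone S s)"
    using strict_twofunctor_restrict[OF strict_twofunctor_comp[OF L.strict_twofunctor_axioms
        strict_twofunctor_lift[OF s]]] c s
    by (auto simp: is_cone_def lift_cone_def twofun_comp_def elements_sel comp_def)
  moreover have "project_cone (lift_cone S s) = S"
  proof -
    have "(\<lambda>j\<in>Obj (shape S). fst ((\<lambda>j\<in>Obj (shape S). (ob (legs S) j, s)) j)) = ob (legs S)"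
      using c by (intro extensionalityI[of _ "Obj (shape S)"]) (auto simp: is_cone_def)
    moreover have "(\<lambda>u\<in>Mor (shape S). map_prod fst (map_prod fst fst)
          ((\<lambda>u\<in>Mor (shape S). lift_triangle s (mo (legs S) u)) u)) = mo (legs S)"
      "(\<lambda>\<sigma>\<in>Cell (shape S). map_prod fst (map_prod fst fst)
          ((\<lambda>\<sigma>\<in>Cell (shape S). lift_triangle s (ce (legs S) \<sigma>)) \<sigma>)) = ce (legs S)"
      using c by (auto simp: is_cone_def intro!: extensionalityI[of _ "Mor (shape S)"]
        extensionalityI[of _ "Cell (shape S)"])
    ultimately show ?thesis by (simp add: project_cone_def lift_cone_def)
  qed
  ultimately show ?thesis using S by (simp add: elements_sel is_cone_elements_iff)
qed

section \<open>The set-valued model as a pseudo-model\<close>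

text \<open>
  A compatible family of elements is a cone whose vertex is a one-element set.
\<close>

lemma set_limit:
  assumes S: "S \<in> marked A"
    and t: "\<And>j. j \<in> Obj (shape S) \<Longrightarrow> t j \<in> el M (Cod A (ob (legs S) j))"
      "\<And>u. u \<in> Mor (shape S) \<Longrightarrow> act M (triangle (mo (legs S) u)) (t (Dom (shape S) u)) = t (Cod
          (shape S) u)"
  shows "\<exists>!s. s \<in> el M (vertex S) \<and> (\<forall>j\<in>Obj (shape S). act M (ob (legs S) j) s = t j)"
proof -
  let ?X = "{undefined} :: 'u set"
  have "set_limit_cone small A M S" using model S by (simp add: set_model_def)
  from this[unfolded set_limit_cone_def, THEN spec[of _ ?X], THEN spec[of _ "\<lambda>j _. t j"]]
  have "\<exists>!h. h \<in> ?X \<rightarrow>\<^sub>E el M (vertex S) \<and>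
      (\<forall>j\<in>Obj (shape S). \<forall>y\<in>?X. act M (ob (legs S) j) (h y) = t j)"
    using t small_singleton by auto
  then obtain h where h: "h \<in> ?X \<rightarrow>\<^sub>E el M (vertex S)" "\<forall>j\<in>Obj (shape S). act M (ob (legs S) j) (h
      undefined) = t j"
    and unique: "\<And>h'. \<lbrakk>h' \<in> ?X \<rightarrow>\<^sub>E el M (vertex S); \<forall>j\<in>Obj (shape S). act M (ob (legs S) j) (h'
        undefined) = t j\<rbrakk>
      \<Longrightarrow> h' = h"
    by (rule ex1E) (simp, blast)
  show ?thesis
  proof (rule ex1I[of _ "h undefined"])
    show "h undefined \<in> el M (vertex S) \<and> (\<forall>j\<in>Obj (shape S). act M (ob (legs S) j) (h undefined) = t
        j)"
      using h by auto
    fix s assume "s \<in> el M (vertex S) \<and> (\<forall>j\<in>Obj (shape S). act M (ob (legs S) j) s = t j)"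
    then have "(\<lambda>y\<in>?X. s) = h" by (intro unique) auto
    from fun_cong[OF this, of undefined] show "s = h undefined" by simp
  qed
qed

lemma disc_sel [simp]:
  "x \<in> Obj A \<Longrightarrow> ob (disc A M) x = disc_cat (el M x)"
  "f \<in> Mor A \<Longrightarrow> fdom (mo (disc A M) f) = disc_cat (el M (Dom A f))"
  "f \<in> Mor A \<Longrightarrow> fcod (mo (disc A M) f) = disc_cat (el M (Cod A f))"
  "\<lbrakk>f \<in> Mor A; s \<in> el M (Dom A f)\<rbrakk> \<Longrightarrow> fobj (mo (disc A M) f) s = act M f s"
  "\<lbrakk>f \<in> Mor A; s \<in> el M (Dom A f)\<rbrakk> \<Longrightarrow> farr (mo (disc A M) f) s = act M f s"
  "\<lbrakk>f \<in> Mor A; g \<in> Mor A; Cod A f = Dom A g\<rbrakk> \<Longrightarrow> cp (disc A M) g f = nattr_id (mo (disc A M) (g \<cdot>\<^bsub>A\<^esub>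
      f))"
  by (simp_all add: disc_def disc_func_def Let_def)

lemma cat_iso_disc: "s \<in> X \<Longrightarrow> cat_iso (disc_cat X) s"
  by (auto simp: cat_iso_def)

lemma cat_functor_disc: "f \<in> Mor A \<Longrightarrow> cat_functor (mo (disc A M) f)"
  by (intro cat_functor.intro cat_functor_axioms.intro)
    (auto simp: category_disc_cat, simp_all add: disc_def disc_func_def Let_def)

lemma pseudo_f_functor_disc: "pseudo_f_functor A (CAT small) (disc A M)"
proof -
  have id: "mo (disc A M) (Idm A x) = func_id (disc_cat (el M x))" if "x \<in> Obj A" for x
    using that by (intro func_eqI) (simp_all add: cat_functor_disc cat_functor_id category_disc_cat)
  have comp: "mo (disc A M) (g \<cdot>\<^bsub>A\<^esub> f) = func_comp (mo (disc A M) g) (mo (disc A M) f)"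
    if "f \<in> Mor A" "g \<in> Mor A" "Cod A f = Dom A g" for f g
    using that by (intro func_eqI) (simp_all add: cat_functor_disc cat_functor_comp)
  show ?thesis
    by (rule pseudo_f_functor_CAT_I)
      (auto simp: A.f_category_axioms discrete cat_functor_disc id comp cat_functor_comp
        natural_transformation_id cat_iso_disc,
        auto simp: disc_def Let_def)
qed

lemma pseudo_model_disc: "pseudo_model A (CAT small) (disc A M)"
  unfolding pseudo_model_CAT_iff[OF universe_small A.f_sketch_axioms discrete]
proof (intro conjI ballI pseudo_f_functor_disc)
  fix S assume S: "S \<in> marked A"
  let ?J = "shape S"
  note c = cone_simps[OF A.f_category_axioms A.marked_cone[OF S]]
  interpret J: two_category ?J by (rule c(2))
  show "arrow_limit ?J (\<lambda>j. ob (disc A M) (Cod A (ob (legs S) j)))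
      (\<lambda>u. mo (disc A M) (triangle (mo (legs S) u))) (ob (disc A M) (vertex S))
      (\<lambda>j. mo (disc A M) (ob (legs S) j))"
    unfolding arrow_limit_def
  proof (intro allI impI, elim conjE)
    fix a assume a: "\<forall>j\<in>Obj ?J. a j \<in> carr (ob (disc A M) (Cod A (ob (legs S) j)))"
      and comp: "\<forall>u\<in>Mor ?J. farr (mo (disc A M) (triangle (mo (legs S) u))) (a (Dom ?J u)) = a (Cod
          ?J u)"
    have a': "a j \<in> el M (Cod A (ob (legs S) j))" if "j \<in> Obj ?J" for j
      using bspec[OF a that] c(3)[OF that] by simp
    have "act M (triangle (mo (legs S) u)) (a (Dom ?J u)) = a (Cod ?J u)" if u: "u \<in> Mor ?J" for u
      using comp u c(4)[OF u] a'[OF J.Dom_closed[OF u]] by (auto simp: triangle_def)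
    with a' have "\<exists>!s. s \<in> el M (vertex S) \<and> (\<forall>j\<in>Obj ?J. act M (ob (legs S) j) s = a j)"
      by (rule set_limit[OF S])
    moreover have "s \<in> el M (vertex S) \<and> (\<forall>j\<in>Obj ?J. act M (ob (legs S) j) s = a j) \<longleftrightarrow>
        s \<in> carr (ob (disc A M) (vertex S)) \<and> (\<forall>j\<in>Obj ?J. farr (mo (disc A M) (ob (legs S) j)) s = a
            j)" for s
      using c(1,3) by auto
    ultimately show "\<exists>!e. e \<in> carr (ob (disc A M) (vertex S)) \<and>
      (\<forall>j\<in>Obj ?J. farr (mo (disc A M) (ob (legs S) j)) e = a j)" by simp
  qed
qed

end

section \<open>The slice over a discrete pseudo-model\<close>

text \<open>
  A 1-cell \<open>p\<close> from \<open>N\<close> to the discrete pseudo-model assigns to every object of every category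
  \<open>N x\<close> a grade in \<open>M x\<close>. Grades are constant along arrows, and the functor \<open>N f\<close> changes them
  by \<open>M f\<close>: the components of the naturality cell of \<open>p\<close> at \<open>f\<close> are arrows of a discrete
  category, hence identities.
\<close>

locale over_disc = sketch_model small A M + cat_pt A small p
  for small :: "'u set \<Rightarrow> bool" and A :: "('o, 'm, 'c, 'i, 'j, 'k) fsketch"
    and M :: "('o, 'm, 'u) setfun" and p :: "('o, 'm, 'c, 'u cat, 'u func, 'u nattr) pstrans" +
  assumes tcod_disc: "tcod p = disc A M"
begin

lemma ob_tcod [simp]: "x \<in> Obj A \<Longrightarrow> ob (tcod p) x = disc_cat (el M x)"
  by (simp add: tcod_disc)

lemma grade_closed [simp]:
  "\<lbrakk>x \<in> Obj A; c \<in> cobj (ob (tdom p) x)\<rbrakk> \<Longrightarrow> fobj (tcomp p x) c \<in> el M x"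
  using tcomp_simps(1)[of x c] by simp

lemma grade_arr:
  assumes "x \<in> Obj A" and "a \<in> carr (ob (tdom p) x)"
  shows "farr (tcomp p x) a = fobj (tcomp p x) (cdom (ob (tdom p) x) a)"
    "fobj (tcomp p x) (ccod (ob (tdom p) x) a) = fobj (tcomp p x) (cdom (ob (tdom p) x) a)"
  using tcomp_simps(2-4)[OF assms] assms by simp_all

declare grade_arr(2) [simp]

lemma grade_mo [simp]:
  assumes "f \<in> Mor A" and "c \<in> cobj (ob (tdom p) (Dom A f))" and "Cod A f = y"
  shows "fobj (tcomp p y) (fobj (mo (tdom p) f) c) = act M f (fobj (tcomp p (Dom A f)) c)"
proof -
  have "Dom A f \<in> Obj A" "y \<in> Obj A" using assms by auto
  then show ?thesis using tnat_simps[OF assms] assms by (simp add: tcod_disc)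
qed

lemma tnat_disc:
  assumes "f \<in> Mor A" and "c \<in> cobj (ob (tdom p) (Dom A f))"
  shows "ncomp (tnat p f) c = act M f (fobj (tcomp p (Dom A f)) c)"
proof -
  have "Dom A f \<in> Obj A" "Cod A f \<in> Obj A" using assms by auto
  then show ?thesis using tnat_simps(1,2)[OF assms refl] assms by (simp add: tcod_disc)
qed

end

text \<open>
  A 1-cell into a discrete pseudo-model is determined by its action on objects: cells of a discrete
  category are identities.
\<close>

lemma over_disc_eqI:
  assumes "over_disc small A M p" and "over_disc small A M q" and dom: "tdom p = tdom q"
    and eq: "\<And>x c. \<lbrakk>x \<in> Obj A; c \<in> cobj (ob (tdom p) x)\<rbrakk> \<Longrightarrow> fobj (tcomp p x) c = fobj (tcomp q x) c"
  shows "p = q"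
proof -
  interpret p: over_disc small A M p by fact
  interpret q: over_disc small A M q by fact
  note [simp] = dom
  have cod: "tcod p = tcod q" using p.tcod_disc q.tcod_disc by simp
  have comp: "tcomp p x = tcomp q x" if x: "x \<in> Obj A" for x
  proof -
    have "farr (tcomp p x) a = farr (tcomp q x) a" if "a \<in> carr (ob (tdom q) x)" for a
      using p.grade_arr(1)[OF x, of a] q.grade_arr(1)[OF x, of a] eq[OF x] that x by simp
    then show ?thesis
      using x eq p.tcomp_functor[OF x] q.tcomp_functor[OF x] cod by (intro func_eqI) simp_all
  qed
  have nat: "tnat p f = tnat q f" if f: "f \<in> Mor A" for f
  proof (rule nattr_eqI)
    have [simp]: "Dom A f \<in> Obj A" "Cod A f \<in> Obj A" using f by auto
    show "ndom (tnat p f) = ndom (tnat q f)" "ncod (tnat p f) = ncod (tnat q f)"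
      using p.tnat_nattr[OF f] q.tnat_nattr[OF f] comp cod by simp_all
    show "ncomp (tnat p f) \<in> extensional (cobj (fdom (ndom (tnat p f))))"
      using natural_transformation.ncomp_extensional[OF p.tnat_nattr(1)[OF f]] .
    show "ncomp (tnat q f) \<in> extensional (cobj (fdom (ndom (tnat p f))))"
      using natural_transformation.ncomp_extensional[OF q.tnat_nattr(1)[OF f]]
        p.tnat_nattr[OF f] q.tnat_nattr[OF f] comp cod by simp
    fix c assume "c \<in> cobj (fdom (ndom (tnat p f)))"
    then have "c \<in> cobj (ob (tdom p) (Dom A f))"
      using p.tnat_nattr(2)[OF f] f p.tcomp_functor(2)[of "Dom A f"] by simp
    then show "ncomp (tnat p f) c = ncomp (tnat q f) c"
      using p.tnat_disc[OF f] q.tnat_disc[OF f] eq[of "Dom A f" c] by simp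
  qed
  show ?thesis
    using comp nat p.tcomp_extensional q.tcomp_extensional p.tnat_extensional q.tnat_extensional cod
    by (intro pstrans_eqI[where X = "Obj A" and Y = "Mor A"]) simp_all
qed

context sketch_model
begin

abbreviation Ps where "Ps \<equiv> PsMod A (CAT small)"

abbreviation Sl where "Sl \<equiv> slice Ps (disc A M)"

lemma Ps_Mor: "h \<in> Mor Ps \<Longrightarrow> cat_pt A small h"
  using discrete by (simp add: PsMod_sel cat_pt_def cat_pt_axioms_def)

lemma Sl_Obj_iff: "p \<in> Obj Sl \<longleftrightarrow> p \<in> Mor Ps \<and> tcod p = disc A M"
  by (simp add: slice_sel PsMod_sel(5))

lemma Sl_over_disc: "p \<in> Obj Sl \<Longrightarrow> over_disc small A M p"
  using Ps_Mor[of p] sketch_model_axioms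
  by (simp add: Sl_Obj_iff over_disc_def over_disc_axioms_def)

lemma Sl_Mor_iff:
  "(p, h, q) \<in> Mor Sl \<longleftrightarrow> p \<in> Obj Sl \<and> q \<in> Obj Sl \<and> h \<in> Mor Ps \<and> tdom h = tdom p \<and>
    tcod h = tdom q \<and> (\<forall>x\<in>Obj A. \<forall>c\<in>cobj (ob (tdom p) x).
      fobj (tcomp q x) (fobj (tcomp h x) c) = fobj (tcomp p x) c)"
proof -
  interpret Ps: two_category Ps by (rule two_category_PsMod)
  have "pstrans_comp A (CAT small) q h = p \<longleftrightarrow> (\<forall>x\<in>Obj A. \<forall>c\<in>cobj (ob (tdom p) x).
      fobj (tcomp q x) (fobj (tcomp h x) c) = fobj (tcomp p x) c)"
    if p: "p \<in> Obj Sl" and q: "q \<in> Obj Sl" and h: "h \<in> Mor Ps" "tdom h = tdom p" "tcod h = tdom q"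
  proof -
    interpret h: cat_pt A small h using h(1) by (rule Ps_Mor)
    have comp: "fobj (tcomp (pstrans_comp A (CAT small) q h) x) c = fobj (tcomp q x) (fobj (tcomp h
        x) c)"
      if "x \<in> Obj A" "c \<in> cobj (ob (tdom p) x)" for x c
      using that h.tcomp_functor(2)[of x] h(2) by (simp add: CAT_sel)
    have "pstrans_comp A (CAT small) q h \<in> Obj Sl"
      using Ps.Mor_simps(4)[of h q] p q h by (simp add: Sl_Obj_iff PsMod_sel(4,5,10))
    note eqI = over_disc_eqI[OF Sl_over_disc[OF this] Sl_over_disc[OF p]]
    show ?thesis
    proof
      assume "pstrans_comp A (CAT small) q h = p"
      with comp show "\<forall>x\<in>Obj A. \<forall>c\<in>cobj (ob (tdom p) x).
          fobj (tcomp q x) (fobj (tcomp h x) c) = fobj (tcomp p x) c" by metis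
    next
      assume *: "\<forall>x\<in>Obj A. \<forall>c\<in>cobj (ob (tdom p) x).
          fobj (tcomp q x) (fobj (tcomp h x) c) = fobj (tcomp p x) c"
      show "pstrans_comp A (CAT small) q h = p"
      proof (rule eqI)
        show "tdom (pstrans_comp A (CAT small) q h) = tdom p" using h(2) by simp
        fix x c assume xc: "x \<in> Obj A" "c \<in> cobj (ob (tdom (pstrans_comp A (CAT small) q h)) x)"
        then have c: "c \<in> cobj (ob (tdom p) x)" using h(2) by simp
        show "fobj (tcomp (pstrans_comp A (CAT small) q h) x) c = fobj (tcomp p x) c"
          unfolding comp[OF xc(1) c] using * xc(1) c by blast
      qed
    qed
  qed
  note key = this
  show ?thesis
  proof
    assume "(p, h, q) \<in> Mor Sl"
    then have "p \<in> Obj Sl" "q \<in> Obj Sl" "h \<in> Mor Ps" "tdom h = tdom p" "tcod h = tdom q"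
      "pstrans_comp A (CAT small) q h = p" by (simp_all add: slice_sel(1,2) PsMod_sel(4,5,10))
    with key show "p \<in> Obj Sl \<and> q \<in> Obj Sl \<and> h \<in> Mor Ps \<and> tdom h = tdom p \<and> tcod h = tdom q \<and>
      (\<forall>x\<in>Obj A. \<forall>c\<in>cobj (ob (tdom p) x). fobj (tcomp q x) (fobj (tcomp h x) c) = fobj (tcomp p x)
          c)"
      by blast
  next
    assume *: "p \<in> Obj Sl \<and> q \<in> Obj Sl \<and> h \<in> Mor Ps \<and> tdom h = tdom p \<and> tcod h = tdom q \<and>
      (\<forall>x\<in>Obj A. \<forall>c\<in>cobj (ob (tdom p) x). fobj (tcomp q x) (fobj (tcomp h x) c) = fobj (tcomp p x)
          c)"
    with key have "pstrans_comp A (CAT small) q h = p" by blast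
    with * show "(p, h, q) \<in> Mor Sl" by (simp add: slice_sel(1,2) PsMod_sel(4,5,10))
  qed
qed

text \<open>
  A modification between parallel 1-cells of the slice is a 2-cell of the slice, as its whiskering
  with \<open>q\<close> takes values in discrete categories.
\<close>

lemma Sl_Cell_iff:
  "(p, \<Gamma>, q) \<in> Cell Sl \<longleftrightarrow> \<Gamma> \<in> Cell Ps \<and> (p, mdom \<Gamma>, q) \<in> Mor Sl \<and> (p, mcod \<Gamma>, q) \<in> Mor Sl"
proof -
  interpret Ps: two_category Ps by (rule two_category_PsMod)
  have "Idc Ps q \<star>\<^bsub>Ps\<^esub> \<Gamma> = Idc Ps p"
    if \<Gamma>: "\<Gamma> \<in> Cell Ps" and d: "(p, mdom \<Gamma>, q) \<in> Mor Sl" and c: "(p, mcod \<Gamma>, q) \<in> Mor Sl"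
  proof -
    interpret \<Gamma>: cat_md A small \<Gamma> using \<Gamma> by (simp add: cat_md_def PsMod_sel)
    interpret q: over_disc small A M q using d Sl_over_disc by (simp add: Sl_Mor_iff)
    interpret p: over_disc small A M p using d Sl_over_disc by (simp add: Sl_Mor_iff)
    have e: "pstrans_comp A (CAT small) q (mdom \<Gamma>) = p" "pstrans_comp A (CAT small) q (mcod \<Gamma>) = p"
      "tdom (mdom \<Gamma>) = tdom p" "tcod (mdom \<Gamma>) = tdom q" "q \<in> Mor Ps"
      using d c by (simp_all add: slice_sel PsMod_sel(4,5,10))
    have tp: "tcomp p x = func_comp (tcomp q x) (tcomp (mdom \<Gamma>) x)"
      "tcomp p x = func_comp (tcomp q x) (tcomp (mcod \<Gamma>) x)" if "x \<in> Obj A" for x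
      using arg_cong[OF e(1), of "\<lambda>p. tcomp p x"] arg_cong[OF e(2), of "\<lambda>p. tcomp p x"] that
      by (simp_all add: CAT_sel(10))
    have "nattr_hcomp (nattr_id (tcomp q x)) (mcomp \<Gamma> x) = nattr_id (tcomp p x)" if x: "x \<in> Obj A"
        for x
    proof (rule nattr_eqI)
      fix a assume "a \<in> cobj (fdom (ndom (nattr_hcomp (nattr_id (tcomp q x)) (mcomp \<Gamma> x))))"
      then have a: "a \<in> cobj (ob (tdom p) x)" using x e(3) by simp
      have "fobj (tcomp q x) (fobj (tcomp (mdom \<Gamma>) x) a) = fobj (tcomp p x) a"
        "fobj (tcomp q x) (fobj (tcomp (mcod \<Gamma>) x) a) = fobj (tcomp p x) a"
        using d c x a by (simp_all add: Sl_Mor_iff)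
      note g = this
      let ?\<gamma> = "ncomp (mcomp \<Gamma> x) a"
      have \<gamma>: "?\<gamma> \<in> carr (ob (tdom q) x)" "cdom (ob (tdom q) x) ?\<gamma> = fobj (tcomp (mdom \<Gamma>) x) a"
        "ccod (ob (tdom q) x) ?\<gamma> = fobj (tcomp (mcod \<Gamma>) x) a"
        using \<Gamma>.mcomp_simps[OF x, of a] a e(3,4) by simp_all
      have "fobj (tcomp (mcod \<Gamma>) x) a \<in> cobj (ob (tdom q) x)"
        using q.F.ob_simps(2)[OF x \<gamma>(1)] \<gamma>(3) by simp
      moreover have "farr (tcomp q x) ?\<gamma> = fobj (tcomp p x) a"
        using q.grade_arr(1)[OF x \<gamma>(1)] \<gamma>(2) g(1) by simp
      moreover have "fobj (tcomp p x) a \<in> el M x" using p.grade_closed[OF x a] .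
      ultimately show "ncomp (nattr_hcomp (nattr_id (tcomp q x)) (mcomp \<Gamma> x)) a = ncomp (nattr_id
          (tcomp p x)) a"
        using x a e(3) g(2) \<gamma>(1) by simp
    qed (use x tp[OF x] e(3) in \<open>simp_all\<close>)
    then show ?thesis
      by (intro modif_eqI[where X = "Obj A"]) (simp_all add: PsMod_sel(9,12) e CAT_sel(4-13))
  qed
  then show ?thesis by (auto simp: slice_sel(3) PsMod_sel(6,7))
qed

end

section \<open>Fibres\<close>

text \<open>
  Membership of an arrow is decided by its domain; this is the full subcategory on the objects of
  grade \<open>s\<close> whenever \<open>P\<close> is constant along arrows.
\<close>

definition fib :: "'u cat \<Rightarrow> ('u \<Rightarrow> 'u) \<Rightarrow> 'u \<Rightarrow> 'u cat" where
  "fib C P s = \<lparr>cobj = {c \<in> cobj C. P c = s}, carr = {a \<in> carr C. P (cdom C a) = s},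
     cdom = restrict (cdom C) {a \<in> carr C. P (cdom C a) = s},
     ccod = restrict (ccod C) {a \<in> carr C. P (cdom C a) = s},
     cid = restrict (cid C) {c \<in> cobj C. P c = s},
     ccmp = (\<lambda>b a. if a \<in> carr C \<and> P (cdom C a) = s \<and> b \<in> carr C \<and> P (cdom C b) = s \<and>
       ccod C a = cdom C b then ccmp C b a else undefined)\<rparr>"

lemma fib_sel [simp]:
  "cobj (fib C P s) = {c \<in> cobj C. P c = s}" "carr (fib C P s) = {a \<in> carr C. P (cdom C a) = s}"
  "\<lbrakk>a \<in> carr C; P (cdom C a) = s\<rbrakk> \<Longrightarrow> cdom (fib C P s) a = cdom C a"
  "\<lbrakk>a \<in> carr C; P (cdom C a) = s\<rbrakk> \<Longrightarrow> ccod (fib C P s) a = ccod C a"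
  "\<lbrakk>c \<in> cobj C; P c = s\<rbrakk> \<Longrightarrow> cid (fib C P s) c = cid C c"
  "\<lbrakk>a \<in> carr C; P (cdom C a) = s; b \<in> carr C; P (cdom C b) = s; ccod C a = cdom C b\<rbrakk>
    \<Longrightarrow> ccmp (fib C P s) b a = ccmp C b a"
  by (simp_all add: fib_def)

lemma category_fib:
  assumes "category C" and P: "\<And>a. a \<in> carr C \<Longrightarrow> P (ccod C a) = P (cdom C a)"
  shows "category (fib C P s)"
proof -
  interpret category C by fact
  show ?thesis
    by unfold_locales (auto simp: P, auto simp: fib_def)
qed

lemma fib_Obj:
  assumes "universe small" and "C \<in> Obj (CAT small)"
    and "\<And>a. a \<in> carr C \<Longrightarrow> P (ccod C a) = P (cdom C a)"
  shows "fib C P s \<in> Obj (CAT small)"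
  using assms category_fib[of C P s] universe.small_subset[OF assms(1)] by (auto simp: CAT_sel)

definition res_func :: "'u cat \<Rightarrow> 'u cat \<Rightarrow> 'u func \<Rightarrow> 'u func" where
  "res_func C D F = \<lparr>fdom = C, fcod = D, fobj = restrict (fobj F) (cobj C), farr = restrict (farr F)
      (carr C)\<rparr>"

definition res_nattr :: "'u func \<Rightarrow> 'u func \<Rightarrow> 'u nattr \<Rightarrow> 'u nattr" where
  "res_nattr F G \<alpha> = \<lparr>ndom = F, ncod = G, ncomp = restrict (ncomp \<alpha>) (cobj (fdom F))\<rparr>"

lemma res_sel [simp]:
  "fdom (res_func C D F) = C" "fcod (res_func C D F) = D"
  "c \<in> cobj C \<Longrightarrow> fobj (res_func C D F) c = fobj F c" "a \<in> carr C \<Longrightarrow> farr (res_func C D F) a = farr F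
      a"
  "ndom (res_nattr F' G' \<alpha>) = F'" "ncod (res_nattr F' G' \<alpha>) = G'"
  "c \<in> cobj (fdom F') \<Longrightarrow> ncomp (res_nattr F' G' \<alpha>) c = ncomp \<alpha> c"
  "cobj (fdom F') = X \<Longrightarrow> ncomp (res_nattr F' G' \<alpha>) \<in> extensional X"
  by (auto simp: res_func_def res_nattr_def)

lemma cat_functor_res:
  assumes F: "cat_functor F" "fdom F = C" "fcod F = D" and "category (fib C P s)" and "category (fib
      D Q t)"
    and PQ: "\<And>c. \<lbrakk>c \<in> cobj C; P c = s\<rbrakk> \<Longrightarrow> Q (fobj F c) = t"
    and P: "\<And>a. a \<in> carr C \<Longrightarrow> P (ccod C a) = P (cdom C a)"
  shows "cat_functor (res_func (fib C P s) (fib D Q t) F)"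
proof -
  interpret F: cat_functor F by fact
  note [simp] = F.functor_simps[unfolded F(2,3)] F.C.cat_simps[unfolded F(2)] P PQ
  have [simp]: "Q (cdom D (farr F a)) = t" if "a \<in> carr C" "P (cdom C a) = s" for a
    using that by simp
  show ?thesis
    by (intro cat_functor.intro cat_functor_axioms.intro)
      (auto simp: assms(4,5), auto simp: res_func_def)
qed

lemma natural_transformation_res:
  assumes \<alpha>: "natural_transformation \<alpha>" "fdom (ndom \<alpha>) = C" "fcod (ndom \<alpha>) = D"
    and F: "cat_functor F" "fdom F = fib C P s" "fcod F = fib D Q t"
    and G: "cat_functor G" "fdom G = fib C P s" "fcod G = fib D Q t"
    and P: "\<And>a. a \<in> carr C \<Longrightarrow> P (ccod C a) = P (cdom C a)"
    and Q: "\<And>a. a \<in> carr D \<Longrightarrow> Q (ccod D a) = Q (cdom D a)"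
    and FG: "\<And>c. \<lbrakk>c \<in> cobj C; P c = s\<rbrakk> \<Longrightarrow> fobj F c = fobj (ndom \<alpha>) c \<and> fobj G c = fobj (ncod \<alpha>) c"
      "\<And>a. \<lbrakk>a \<in> carr C; P (cdom C a) = s\<rbrakk> \<Longrightarrow> farr F a = farr (ndom \<alpha>) a \<and> farr G a = farr (ncod \<alpha>) a"
  shows "natural_transformation (res_nattr F G \<alpha>)"
proof -
  interpret \<alpha>: natural_transformation \<alpha> by fact
  interpret F: cat_functor F by fact
  interpret G: cat_functor G by fact
  note [simp] = \<alpha>.nattr_simps[unfolded \<alpha>(2,3)] \<alpha>.F.C.cat_simps(1,2)[unfolded \<alpha>(2)] P
  have q: "Q (fobj (ndom \<alpha>) c) = t" "Q (fobj (ncod \<alpha>) c) = t" if "c \<in> cobj C" "P c = s" for c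
    using F.functor_simps(1)[of c] G.functor_simps(1)[of c] F G FG(1) that by simp_all
  have a: "farr (ndom \<alpha>) a \<in> carr D" "cdom D (farr (ndom \<alpha>) a) = fobj (ndom \<alpha>) (cdom C a)"
      "ccod D (farr (ndom \<alpha>) a) = fobj (ndom \<alpha>) (ccod C a)" "farr (ncod \<alpha>) a \<in> carr D"
      "cdom D (farr (ncod \<alpha>) a) = fobj (ncod \<alpha>) (cdom C a)" if "a \<in> carr C" for a
    using \<alpha>.F.functor_simps(2-4)[of a] \<alpha>.G.functor_simps(2-4)[of a] \<alpha>(2,3) that by simp_all
  show ?thesis
  proof (intro natural_transformation.intro natural_transformation_axioms.intro, goal_cases)
    case (8 f)
    then have f: "f \<in> carr C" "P (cdom C f) = s" using F by simp_all
    then show ?case using \<alpha>.naturality[of f] \<alpha>(2,3) F FG q a by simp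
  qed (use F G FG q in \<open>simp_all\<close>)
qed

lemma cat_iso_fib:
  assumes "cat_iso D f" and "category D" and "Q (cdom D f) = t"
    and Q: "\<And>a. a \<in> carr D \<Longrightarrow> Q (ccod D a) = Q (cdom D a)"
  shows "cat_iso (fib D Q t) f"
proof -
  interpret category D by fact
  obtain g where g: "g \<in> carr D" "cdom D g = ccod D f" "ccod D g = cdom D f"
    "ccmp D g f = cid D (cdom D f)" "ccmp D f g = cid D (ccod D f)" and f: "f \<in> carr D"
    using assms(1) by (auto simp: cat_iso_def)
  have q: "Q (ccod D f) = t" using Q[OF f] assms(3) by simp
  show ?thesis
    unfolding cat_iso_def
    by (intro conjI bexI[of _ g]) (use f g q assms(3) in simp_all)
qed

context sketch_model
begin

definition fibre_cat ::
  "('o, 'm, 'c, 'u cat, 'u func, 'u nattr) pstrans \<Rightarrow> 'o \<times> 'u \<Rightarrow> 'u cat" where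
  "fibre_cat p = (\<lambda>e\<in>Obj El. fib (ob (tdom p) (fst e)) (fobj (tcomp p (fst e))) (snd e))"

definition fibre_func ::
  "('o, 'm, 'c, 'u cat, 'u func, 'u nattr) pstrans \<Rightarrow> 'm \<times> 'u \<Rightarrow> 'u func" where
  "fibre_func p = (\<lambda>\<phi>\<in>Mor El. res_func (fibre_cat p (Dom El \<phi>)) (fibre_cat p (Cod El \<phi>)) (mo (tdom
      p) (fst \<phi>)))"

definition fibre_ob :: "('o, 'm, 'c, 'u cat, 'u func, 'u nattr) pstrans
    \<Rightarrow> ('o \<times> 'u, 'm \<times> 'u, 'c \<times> 'u, 'u cat, 'u func, 'u nattr) psfun" where
  "fibre_ob p = \<lparr>ob = fibre_cat p, mo = fibre_func p,
     ce = (\<lambda>\<gamma>\<in>Cell El. nattr_id (fibre_func p (Src El \<gamma>))),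
     un = (\<lambda>e\<in>Obj El. nattr_id (func_id (fibre_cat p e))),
     cp = (\<lambda>\<psi> \<phi>. if \<phi> \<in> Mor El \<and> \<psi> \<in> Mor El \<and> Cod El \<phi> = Dom El \<psi>
       then res_nattr (func_comp (fibre_func p \<psi>) (fibre_func p \<phi>)) (fibre_func p (\<psi> \<cdot>\<^bsub>El\<^esub> \<phi>))
         (cp (tdom p) (fst \<psi>) (fst \<phi>)) else undefined)\<rparr>"

lemma fibre_ob_sel [simp]:
  "ob (fibre_ob p) = fibre_cat p" "mo (fibre_ob p) = fibre_func p"
  "\<lbrakk>f \<in> Mor A; g \<in> Mor A; Cod A f = Dom A g; s \<in> el M (Dom A f); t = act M f s\<rbrakk> \<Longrightarrow>
    cp (fibre_ob p) (g, t) (f, s) = res_nattr (func_comp (fibre_func p (g, t)) (fibre_func p (f,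
        s)))
      (fibre_func p (g \<cdot>\<^bsub>A\<^esub> f, s)) (cp (tdom p) g f)"
  by (simp_all add: fibre_ob_def elements_sel)

lemma fibre_cat_simp [simp]:
  "\<lbrakk>x \<in> Obj A; s \<in> el M x\<rbrakk> \<Longrightarrow> fibre_cat p (x, s) = fib (ob (tdom p) x) (fobj (tcomp p x)) s"
  by (simp add: fibre_cat_def elements_sel)

lemma fibre_func_simp:
  "\<lbrakk>f \<in> Mor A; s \<in> el M (Dom A f)\<rbrakk> \<Longrightarrow>
    fibre_func p (f, s) = res_func (fib (ob (tdom p) (Dom A f)) (fobj (tcomp p (Dom A f))) s)
      (fib (ob (tdom p) (Cod A f)) (fobj (tcomp p (Cod A f))) (act M f s)) (mo (tdom p) f)"
  by (simp add: fibre_func_def elements_sel)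

lemma fibre_func_sel [simp]:
  assumes "f \<in> Mor A" "s \<in> el M (Dom A f)"
  shows "fdom (fibre_func p (f, s)) = fib (ob (tdom p) (Dom A f)) (fobj (tcomp p (Dom A f))) s"
    "fcod (fibre_func p (f, s)) = fib (ob (tdom p) (Cod A f)) (fobj (tcomp p (Cod A f))) (act M f
        s)"
    "\<lbrakk>c \<in> cobj (ob (tdom p) (Dom A f)); fobj (tcomp p (Dom A f)) c = s\<rbrakk>
      \<Longrightarrow> fobj (fibre_func p (f, s)) c = fobj (mo (tdom p) f) c"
    "\<lbrakk>a \<in> carr (ob (tdom p) (Dom A f)); fobj (tcomp p (Dom A f)) (cdom (ob (tdom p) (Dom A f)) a) =
        s\<rbrakk>
      \<Longrightarrow> farr (fibre_func p (f, s)) a = farr (mo (tdom p) f) a"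
  using assms by (simp_all add: fibre_func_simp)

end

context over_disc
begin

lemma category_fibre [simp]:
  "x \<in> Obj A \<Longrightarrow> category (fib (ob (tdom p) x) (fobj (tcomp p x)) s)"
  by (simp add: category_fib)

lemma fibre_func_functor [simp]:
  assumes "f \<in> Mor A" "s \<in> el M (Dom A f)"
  shows "cat_functor (fibre_func p (f, s))"
  unfolding fibre_func_simp[OF assms] by (rule cat_functor_res) (use assms in simp_all)

lemma fibre_func_comp:
  assumes "f \<in> Mor A" "g \<in> Mor A" "Cod A f = Dom A g" "s \<in> el M (Dom A f)" "f \<in> inert A \<or> g \<in> inert
      A"
  shows "fibre_func p (g \<cdot>\<^bsub>A\<^esub> f, s) = func_comp (fibre_func p (g, act M f s)) (fibre_func p (f, s))"
proof -
  note m = F.cp_inert(2)[OF assms(1-3,5)]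
  show ?thesis
    by (rule func_eqI) (use assms in \<open>simp_all add: cat_functor_comp m\<close>)
qed

lemma pseudo_f_functor_fibre: "pseudo_f_functor El (CAT small) (fibre_ob p)"
proof (rule pseudo_f_functor_CAT_I[OF El.f_category_axioms discrete_El], unfold split_paired_all,
    goal_cases)
  case (1 x s)
  then show ?case using F.pf_simps(1)[of x] by (simp add: elements_sel fib_Obj[OF universe_small])
next
  case (2 f s)
  then show ?case by (simp add: elements_sel)
next
  case (3 x s)
  then have x: "x \<in> Obj A" "s \<in> el M x" by (simp_all add: elements_sel)
  have "fibre_func p (Idm A x, s) = func_id (fibre_cat p (x, s))"
    by (rule func_eqI) (use x F.mo_Idm[of x] in \<open>simp_all add: cat_functor_id\<close>)
  then show ?case by (simp add: elements_sel)
next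
  case 4
  then show ?case by (simp add: fibre_ob_def)
next
  case 5
  then show ?case by (simp add: fibre_ob_def)
next
  case (6 f s g t)
  then have c: "f \<in> Mor A" "g \<in> Mor A" "Cod A f = Dom A g" "s \<in> el M (Dom A f)" "t = act M f s"
    by (simp_all add: elements_sel)
  let ?FG = "func_comp (fibre_func p (g, t)) (fibre_func p (f, s))"
  have F: "cat_functor ?FG" "fdom ?FG = fib (ob (tdom p) (Dom A f)) (fobj (tcomp p (Dom A f))) s"
    "fcod ?FG = fib (ob (tdom p) (Cod A g)) (fobj (tcomp p (Cod A g))) (act M g (act M f s))"
    using c by (simp_all add: cat_functor_comp)
  have "natural_transformation (res_nattr ?FG (fibre_func p (g \<cdot>\<^bsub>A\<^esub> f, s)) (cp (tdom p) g f))"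
    by (rule natural_transformation_res[OF F.cp_nattr(1) _ _ F, of f g]) (use c in simp_all)
  then show ?case using c by (simp add: elements_sel)
next
  case (7 f s g t c)
  then have c: "f \<in> Mor A" "g \<in> Mor A" "Cod A f = Dom A g" "s \<in> el M (Dom A f)" "t = act M f s"
    "c \<in> cobj (ob (tdom p) (Dom A f))" "fobj (tcomp p (Dom A f)) c = s"
    by (simp_all add: elements_sel)
  have "cat_iso (fib (ob (tdom p) (Cod A g)) (fobj (tcomp p (Cod A g))) (act M g (act M f s)))
      (ncomp (cp (tdom p) g f) c)"
    by (rule cat_iso_fib[OF F.cp_iso]) (use c in simp_all)
  then show ?case using c by (simp add: elements_sel)
next
  case (8 f s g t c)
  then have c: "f \<in> Mor A" "g \<in> Mor A" "Cod A f = Dom A g" "s \<in> el M (Dom A f)" "t = act M f s"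
    "c \<in> cobj (ob (tdom p) (Dom A f))" "fobj (tcomp p (Dom A f)) c = s" "f \<in> inert A \<or> g \<in> inert A"
    by (auto simp add: elements_sel)
  show ?case using c F.cp_inert(1)[of f g] by (simp add: elements_sel)
next
  case (9 f s g t)
  then have c: "f \<in> Mor A" "g \<in> Mor A" "Cod A f = Dom A g" "s \<in> el M (Dom A f)" "t = act M f s"
    "f \<in> inert A \<or> g \<in> inert A" by (auto simp add: elements_sel)
  show ?case using c fibre_func_comp[of f g s] by (simp add: elements_sel)
next
  case (10 f s g t h r c)
  then have c: "f \<in> Mor A" "g \<in> Mor A" "h \<in> Mor A" "Cod A f = Dom A g" "Cod A g = Dom A h"
    "s \<in> el M (Dom A f)" "t = act M f s" "r = act M g (act M f s)"
    "c \<in> cobj (ob (tdom p) (Dom A f))" "fobj (tcomp p (Dom A f)) c = s"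
    by (simp_all add: elements_sel)
  show ?case using c F.cp_associative[of f g h c] by (simp add: elements_sel)
next
  case 13
  then show ?case unfolding fibre_ob_def by auto
qed (simp_all add: fibre_cat_def fibre_func_def fibre_ob_def)

text \<open>
  A compatible family of arrows in the fibres along a marked cone with vertex \<open>(v, s)\<close> is one
  along the projected cone, and lifts uniquely to an arrow of the pseudo-model over \<open>v\<close>. This
  arrow lies in the fibre over \<open>s\<close>: its grade and \<open>s\<close> have the same images under the legs, and
  \<open>M\<close> sends the projected cone to a limit cone of sets.
\<close>

lemma pseudo_model_fibre:
  assumes N: "pseudo_model A (CAT small) (tdom p)"
  shows "pseudo_model El (CAT small) (fibre_ob p)"
  unfolding pseudo_model_CAT_iff[OF universe_small f_sketch_El discrete_El]
proof (intro conjI ballI pseudo_f_functor_fibre)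
  fix S assume S: "S \<in> marked El"
  let ?J = "shape S" and ?S = "project_cone S"
  note c = cone_simps[OF El.f_category_axioms f_sketch.marked_cone[OF f_sketch_El S]]
  have S': "?S \<in> marked A" using S by (simp add: elements_sel)
  interpret J: two_category ?J by (rule c(2))
  obtain v s where v: "vertex S = (v, s)" by (cases "vertex S") auto
  have vs: "v \<in> Obj A" "s \<in> el M v" using c(1) by (simp_all add: v elements_sel)
  define l where "l j = fst (ob (legs S) j)" for j
  have leg: "ob (legs S) j = (l j, s)" and l: "l j \<in> Mor A" "Dom A (l j) = v" if "j \<in> Obj ?J" for j
    using c(3)[OF that] by (cases "ob (legs S) j"; simp add: v elements_sel l_def)+
  define k where "k u = fst (triangle (mo (legs S) u))" for u
  have tri: "triangle (mo (legs S) u) = (k u, act M (l (Dom ?J u)) s)"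
    and k: "k u \<in> Mor A" "Dom A (k u) = Cod A (l (Dom ?J u))" "Cod A (k u) = Cod A (l (Cod ?J u))"
      "act M (k u) (act M (l (Dom ?J u)) s) = act M (l (Cod ?J u)) s" if u: "u \<in> Mor ?J" for u
  proof -
    obtain h r where "mo (legs S) u = ((l (Dom ?J u), s), (h, r), (l (Cod ?J u), s))"
      and "(h, r) \<in> Mor El" "Dom El (h, r) = Cod El (l (Dom ?J u), s)"
        "Cod El (h, r) = Cod El (l (Cod ?J u), s)"
      using c(4)[OF u] leg[OF J.Dom_closed[OF u]] leg[OF J.Cod_closed[OF u]] by auto
    then show "triangle (mo (legs S) u) = (k u, act M (l (Dom ?J u)) s)"
      "k u \<in> Mor A" "Dom A (k u) = Cod A (l (Dom ?J u))" "Cod A (k u) = Cod A (l (Cod ?J u))"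
      "act M (k u) (act M (l (Dom ?J u)) s) = act M (l (Cod ?J u)) s"
      by (simp_all add: triangle_def k_def elements_sel)
  qed
  have S'_sel: "vertex ?S = v" "shape ?S = ?J" "\<And>j. j \<in> Obj ?J \<Longrightarrow> ob (legs ?S) j = l j"
    "\<And>u. u \<in> Mor ?J \<Longrightarrow> triangle (mo (legs ?S) u) = k u"
    by (simp_all add: project_cone_def v l_def k_def triangle_def)
  let ?N = "tdom p"
  have lim: "arrow_limit ?J (\<lambda>j. ob ?N (Cod A (ob (legs ?S) j))) (\<lambda>u. mo ?N (triangle (mo (legs ?S)
      u)))
      (ob ?N v) (\<lambda>j. mo ?N (ob (legs ?S) j))"
    using N S' unfolding pseudo_model_CAT_iff[OF universe_small A.f_sketch_axioms discrete]
    by (metis S'_sel(1,2))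
  show "arrow_limit ?J (\<lambda>j. ob (fibre_ob p) (Cod El (ob (legs S) j)))
      (\<lambda>u. mo (fibre_ob p) (triangle (mo (legs S) u))) (ob (fibre_ob p) (vertex S))
      (\<lambda>j. mo (fibre_ob p) (ob (legs S) j))"
    unfolding arrow_limit_def
  proof (intro allI impI, elim conjE)
    fix a assume a: "\<forall>j\<in>Obj ?J. a j \<in> carr (ob (fibre_ob p) (Cod El (ob (legs S) j)))"
      and comp: "\<forall>u\<in>Mor ?J. farr (mo (fibre_ob p) (triangle (mo (legs S) u))) (a (Dom ?J u)) = a
          (Cod ?J u)"
    have a': "a j \<in> carr (ob ?N (Cod A (l j)))"
      "fobj (tcomp p (Cod A (l j))) (cdom (ob ?N (Cod A (l j))) (a j)) = act M (l j) s" if "j \<in> Obj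
          ?J" for j
      using bspec[OF a that] leg[OF that] l[OF that] vs by (simp_all add: elements_sel)
    have comp': "farr (mo ?N (k u)) (a (Dom ?J u)) = a (Cod ?J u)" if u: "u \<in> Mor ?J" for u
      using bspec[OF comp u] tri[OF u] k[OF u] a'[OF J.Dom_closed[OF u]] l[OF J.Dom_closed[OF u]] vs
          by simp
    have "\<exists>!e. e \<in> carr (ob ?N v) \<and> (\<forall>j\<in>Obj ?J. farr (mo ?N (ob (legs ?S) j)) e = a j)"
      by (rule lim[unfolded arrow_limit_def, THEN spec, THEN mp]) (use a' comp' in \<open>simp add:
          S'_sel\<close>)
    then have ex1: "\<exists>!e. e \<in> carr (ob ?N v) \<and> (\<forall>j\<in>Obj ?J. farr (mo ?N (l j)) e = a j)"
      by (simp add: S'_sel cong: ball_cong)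
    \<comment> \<open>the grade of a lift and \<open>s\<close> solve the same lifting problem for elements of \<open>M\<close>\<close>
    have in_fibre: "fobj (tcomp p v) (cdom (ob ?N v) e) = s"
      if e: "e \<in> carr (ob ?N v)" "\<forall>j\<in>Obj ?J. farr (mo ?N (l j)) e = a j" for e
    proof -
      let ?t = "fobj (tcomp p v) (cdom (ob ?N v) e)"
      have t: "?t \<in> el M v" using e(1) vs by simp
      have "act M (l j) ?t = act M (l j) s" if j: "j \<in> Obj ?J" for j
      proof -
        have "cdom (ob ?N (Cod A (l j))) (a j) = fobj (mo ?N (l j)) (cdom (ob ?N v) e)"
          using bspec[OF e(2) j] F.mo_simps(3)[OF l(1)[OF j] refl, of e] e(1) l(2)[OF j] by simp
        then show ?thesis
          using a'(2)[OF j] l[OF j] e(1) vs by simp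
      qed
      moreover have "\<exists>!r. r \<in> el M (vertex ?S) \<and> (\<forall>j\<in>Obj (shape ?S). act M (ob (legs ?S) j) r = act
          M (l j) s)"
        by (rule set_limit[OF S']) (use l k vs J.Dom_closed in \<open>simp_all add: S'_sel\<close>)
      then have "\<exists>!r. r \<in> el M v \<and> (\<forall>j\<in>Obj ?J. act M (l j) r = act M (l j) s)"
        by (simp add: S'_sel cong: ball_cong)
      ultimately show ?thesis using t vs(2) by blast
    qed
    have iff: "e \<in> carr (ob (fibre_ob p) (vertex S)) \<and> (\<forall>j\<in>Obj ?J. farr (mo (fibre_ob p) (ob (legs
        S) j)) e = a j)
      \<longleftrightarrow> e \<in> carr (ob ?N v) \<and> (\<forall>j\<in>Obj ?J. farr (mo ?N (l j)) e = a j)" for e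
    proof -
      have "farr (mo (fibre_ob p) (ob (legs S) j)) e = farr (mo ?N (l j)) e"
        if "e \<in> carr (ob ?N v)" "fobj (tcomp p v) (cdom (ob ?N v) e) = s" "j \<in> Obj ?J" for j
        using that l[OF that(3)] leg[OF that(3)] vs by simp
      then show ?thesis using in_fibre[of e] vs by (auto simp: v)
    qed
    show "\<exists>!e. e \<in> carr (ob (fibre_ob p) (vertex S)) \<and>
        (\<forall>j\<in>Obj ?J. farr (mo (fibre_ob p) (ob (legs S) j)) e = a j)"
      unfolding iff by (rule ex1)
  qed
qed

end

section \<open>Fibres of transformations and modifications\<close>

lemma ncomp_tnat_comp:
  fixes A :: "('o, 'm, 'c, 'y) fcat_scheme"
  assumes "cat_pt A small \<alpha>" and "cat_pt A small \<beta>" and [simp]: "tcod \<alpha> = tdom \<beta>"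
    and f: "f \<in> Mor A" and c: "c \<in> cobj (ob (tdom \<alpha>) (Dom A f))"
  shows "ncomp (tnat (pstrans_comp A (CAT small) \<beta> \<alpha>) f) c
    = ccmp (ob (tcod \<beta>) (Cod A f)) (farr (tcomp \<beta> (Cod A f)) (ncomp (tnat \<alpha> f) c))
      (ncomp (tnat \<beta> f) (fobj (tcomp \<alpha> (Dom A f)) c))"
proof -
  interpret \<alpha>: cat_pt A small \<alpha> by fact
  interpret \<beta>: cat_pt A small \<beta> by fact
  obtain x y where xy: "Dom A f = x" "Cod A f = y" by blast
  have [simp]: "f \<in> Mor A" "x \<in> Obj A" "y \<in> Obj A" "Dom A f = x" "Cod A f = y"
    using \<alpha>.F.A.Dom_closed[OF f] \<alpha>.F.A.Cod_closed[OF f] f xy by simp_all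
  have a: "fobj (tcomp \<alpha> x) c \<in> cobj (ob (tdom \<beta>) x)" using \<alpha>.tcomp_simps(1)[of x c] c by simp
  have t: "ncomp (tnat \<alpha> f) c \<in> carr (ob (tdom \<beta>) y)"
    "ccod (ob (tdom \<beta>) y) (ncomp (tnat \<alpha> f) c) = fobj (tcomp \<alpha> y) (fobj (mo (tdom \<alpha>) f) c)"
    "fobj (tcomp \<alpha> y) (fobj (mo (tdom \<alpha>) f) c) \<in> cobj (ob (tdom \<beta>) y)"
    using \<alpha>.tnat_simps(1,3)[of f c y] \<alpha>.tcomp_simps(1)[of y "fobj (mo (tdom \<alpha>) f) c"] c by simp_all
  have i: "farr (mo (tcod \<beta>) f) (cid (ob (tcod \<beta>) x) (fobj (tcomp \<beta> x) (fobj (tcomp \<alpha> x) c)))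
    = cid (ob (tcod \<beta>) y) (fobj (mo (tcod \<beta>) f) (fobj (tcomp \<beta> x) (fobj (tcomp \<alpha> x) c)))"
    using \<beta>.G.mo_cid[of f "fobj (tcomp \<beta> x) (fobj (tcomp \<alpha> x) c)"] a by simp
  show ?thesis
    using c a t by (simp add: CAT_sel(4-13) i)
qed

text \<open>A 1-cell of the slice is a transformation that preserves grades, so it restricts to fibres.\<close>

locale over_disc_mor = p: over_disc small A M p + q: over_disc small A M q + h: cat_pt A small h
  for small :: "'u set \<Rightarrow> bool" and A :: "('o, 'm, 'c, 'i, 'j, 'k) fsketch"
    and M :: "('o, 'm, 'u) setfun" and p h q :: "('o, 'm, 'c, 'u cat, 'u func, 'u nattr) pstrans" +
  assumes tdom_h: "tdom h = tdom p" and tcod_h: "tcod h = tdom q"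
    and grade_h: "\<lbrakk>x \<in> Obj A; c \<in> cobj (ob (tdom p) x)\<rbrakk>
      \<Longrightarrow> fobj (tcomp q x) (fobj (tcomp h x) c) = fobj (tcomp p x) c"
begin

declare grade_h [simp] tdom_h [simp] tcod_h [simp]

lemmas h_simps [simp] = h.tcomp_functor[unfolded tdom_h tcod_h] h.tcomp_simps[unfolded tdom_h
    tcod_h]
  h.tnat_nattr[unfolded tdom_h tcod_h] h.tnat_simps[unfolded tdom_h tcod_h]

end

context sketch_model
begin

lemma Sl_over_disc_mor: "(p, h, q) \<in> Mor Sl \<Longrightarrow> over_disc_mor small A M p h q"
  using Sl_over_disc[of p] Sl_over_disc[of q] Ps_Mor[of h]
  by (simp add: Sl_Mor_iff over_disc_mor_def over_disc_mor_axioms_def)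

definition fibre_tcomp :: "('o, 'm, 'c, 'u cat, 'u func, 'u nattr) pstrans
    \<Rightarrow> ('o, 'm, 'c, 'u cat, 'u func, 'u nattr) pstrans
    \<Rightarrow> ('o, 'm, 'c, 'u cat, 'u func, 'u nattr) pstrans \<Rightarrow> 'o \<times> 'u \<Rightarrow> 'u func" where
  "fibre_tcomp p h q = (\<lambda>e\<in>Obj El. res_func (fibre_cat p e) (fibre_cat q e) (tcomp h (fst e)))"

definition fibre_tr :: "('o, 'm, 'c, 'u cat, 'u func, 'u nattr) pstrans
    \<Rightarrow> ('o, 'm, 'c, 'u cat, 'u func, 'u nattr) pstrans
    \<Rightarrow> ('o, 'm, 'c, 'u cat, 'u func, 'u nattr) pstrans
    \<Rightarrow> ('o \<times> 'u, 'm \<times> 'u, 'c \<times> 'u, 'u cat, 'u func, 'u nattr) pstrans" where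
  "fibre_tr p h q = \<lparr>tdom = fibre_ob p, tcod = fibre_ob q, tcomp = fibre_tcomp p h q,
     tnat = (\<lambda>\<phi>\<in>Mor El. res_nattr (func_comp (fibre_func q \<phi>) (fibre_tcomp p h q (Dom El \<phi>)))
       (func_comp (fibre_tcomp p h q (Cod El \<phi>)) (fibre_func p \<phi>)) (tnat h (fst \<phi>)))\<rparr>"

definition fibre_md :: "('o, 'm, 'c, 'u cat, 'u func, 'u nattr) pstrans
    \<Rightarrow> ('o, 'm, 'c, 'u cat, 'u func, 'u nattr) modif
    \<Rightarrow> ('o, 'm, 'c, 'u cat, 'u func, 'u nattr) pstrans
    \<Rightarrow> ('o \<times> 'u, 'm \<times> 'u, 'c \<times> 'u, 'u cat, 'u func, 'u nattr) modif" where
  "fibre_md p \<Gamma> q = \<lparr>mdom = fibre_tr p (mdom \<Gamma>) q, mcod = fibre_tr p (mcod \<Gamma>) q,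
     mcomp = (\<lambda>e\<in>Obj El. res_nattr (fibre_tcomp p (mdom \<Gamma>) q e) (fibre_tcomp p (mcod \<Gamma>) q e)
       (mcomp \<Gamma> (fst e)))\<rparr>"

lemma fibre_tcomp_simp:
  "\<lbrakk>x \<in> Obj A; s \<in> el M x\<rbrakk> \<Longrightarrow> fibre_tcomp p h q (x, s)
    = res_func (fib (ob (tdom p) x) (fobj (tcomp p x)) s) (fib (ob (tdom q) x) (fobj (tcomp q x)) s)
        (tcomp h x)"
  by (simp add: fibre_tcomp_def elements_sel)

lemma fibre_tcomp_sel [simp]:
  assumes "x \<in> Obj A" "s \<in> el M x"
  shows "fdom (fibre_tcomp p h q (x, s)) = fib (ob (tdom p) x) (fobj (tcomp p x)) s"
    "fcod (fibre_tcomp p h q (x, s)) = fib (ob (tdom q) x) (fobj (tcomp q x)) s"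
    "\<lbrakk>c \<in> cobj (ob (tdom p) x); fobj (tcomp p x) c = s\<rbrakk> \<Longrightarrow> fobj (fibre_tcomp p h q (x, s)) c = fobj
        (tcomp h x) c"
    "\<lbrakk>a \<in> carr (ob (tdom p) x); fobj (tcomp p x) (cdom (ob (tdom p) x) a) = s\<rbrakk>
      \<Longrightarrow> farr (fibre_tcomp p h q (x, s)) a = farr (tcomp h x) a"
  using assms by (simp_all add: fibre_tcomp_simp)

lemma fibre_tr_sel [simp]:
  "tdom (fibre_tr p h q) = fibre_ob p" "tcod (fibre_tr p h q) = fibre_ob q"
  "tcomp (fibre_tr p h q) = fibre_tcomp p h q"
  "\<lbrakk>f \<in> Mor A; s \<in> el M (Dom A f)\<rbrakk> \<Longrightarrow> tnat (fibre_tr p h q) (f, s)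
    = res_nattr (func_comp (fibre_func q (f, s)) (fibre_tcomp p h q (Dom A f, s)))
       (func_comp (fibre_tcomp p h q (Cod A f, act M f s)) (fibre_func p (f, s))) (tnat h f)"
  "tnat (fibre_tr p h q) \<in> extensional (Mor El)"
  by (simp_all add: fibre_tr_def elements_sel)

lemma fibre_md_sel [simp]:
  "mdom (fibre_md p \<Gamma> q) = fibre_tr p (mdom \<Gamma>) q" "mcod (fibre_md p \<Gamma> q) = fibre_tr p (mcod \<Gamma>) q"
  "\<lbrakk>x \<in> Obj A; s \<in> el M x\<rbrakk> \<Longrightarrow> mcomp (fibre_md p \<Gamma> q) (x, s)
    = res_nattr (fibre_tcomp p (mdom \<Gamma>) q (x, s)) (fibre_tcomp p (mcod \<Gamma>) q (x, s)) (mcomp \<Gamma> x)"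
  "mcomp (fibre_md p \<Gamma> q) \<in> extensional (Obj El)"
  by (simp_all add: fibre_md_def elements_sel)

end

context over_disc_mor
begin

lemma fibre_tcomp_functor [simp]:
  assumes "x \<in> Obj A" "s \<in> el M x"
  shows "cat_functor (p.fibre_tcomp p h q (x, s))"
  unfolding p.fibre_tcomp_simp[OF assms] by (rule cat_functor_res) (use assms in simp_all)

lemma pseudo_f_transformation_fibre: "pseudo_f_transformation p.El (CAT small) (p.fibre_tr p h q)"
proof (rule pseudo_f_transformation_CAT_I[OF p.discrete_El], unfold split_paired_all, goal_cases)
  case 1
  then show ?case using p.pseudo_f_functor_fibre by simp
next
  case 2
  then show ?case using q.pseudo_f_functor_fibre by simp
next
  case (3 x s)
  then show ?case by (simp add: elements_sel)
next
  case (4 f s)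
  then have c: "f \<in> Mor A" "s \<in> el M (Dom A f)" by (simp_all add: elements_sel)
  have "natural_transformation (res_nattr (func_comp (p.fibre_func q (f, s)) (p.fibre_tcomp p h q
      (Dom A f, s)))
       (func_comp (p.fibre_tcomp p h q (Cod A f, act M f s)) (p.fibre_func p (f, s))) (tnat h f))"
    by (rule natural_transformation_res[where C = "ob (tdom p) (Dom A f)" and P = "fobj (tcomp p
        (Dom A f))"
          and s = s and D = "ob (tdom q) (Cod A f)" and Q = "fobj (tcomp q (Cod A f))" and t = "act
              M f s"])
      (use c in \<open>simp_all add: cat_functor_comp\<close>)
  then show ?case using c by (simp add: elements_sel)
next
  case (5 f s c)
  then have c: "f \<in> Mor A" "s \<in> el M (Dom A f)" "c \<in> cobj (ob (tdom p) (Dom A f))"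
    "fobj (tcomp p (Dom A f)) c = s" by (simp_all add: elements_sel)
  have "cat_iso (fib (ob (tdom q) (Cod A f)) (fobj (tcomp q (Cod A f))) (act M f s)) (ncomp (tnat h
      f) c)"
    by (rule cat_iso_fib) (use c h.tnat_iso[of f c] in simp_all)
  then show ?case using c by (simp add: elements_sel)
next
  case (6 f s c)
  then have c: "f \<in> Mor A" "s \<in> el M (Dom A f)" "c \<in> cobj (ob (tdom p) (Dom A f))"
    "fobj (tcomp p (Dom A f)) c = s" "f \<in> inert A" by (simp_all add: elements_sel)
  show ?case using c h.tnat_inert(1)[of f] by (simp add: elements_sel)
next
  case (7 f s)
  then have c: "f \<in> Mor A" "s \<in> el M (Dom A f)" "f \<in> inert A" by (simp_all add: elements_sel)
  have e: "fobj (tcomp h (Cod A f)) (fobj (mo (tdom p) f) c) = fobj (mo (tdom q) f) (fobj (tcomp h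
      (Dom A f)) c)"
    if "c \<in> cobj (ob (tdom p) (Dom A f))" for c
    using arg_cong[OF h.tnat_inert(2)[OF c(1,3)], of "\<lambda>F. fobj F c"] that c by simp
  have e': "farr (tcomp h (Cod A f)) (farr (mo (tdom p) f) c) = farr (mo (tdom q) f) (farr (tcomp h
      (Dom A f)) c)"
    if "c \<in> carr (ob (tdom p) (Dom A f))" for c
    using arg_cong[OF h.tnat_inert(2)[OF c(1,3)], of "\<lambda>F. farr F c"] that c by simp
  have "func_comp (p.fibre_tcomp p h q (Cod A f, act M f s)) (p.fibre_func p (f, s))
      = func_comp (p.fibre_func q (f, s)) (p.fibre_tcomp p h q (Dom A f, s))"
    by (rule func_eqI) (use c in \<open>simp_all add: cat_functor_comp e e'\<close>)
  then show ?case using c by (simp add: elements_sel)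
next
  case (8 f s g t c)
  then have c: "f \<in> Mor A" "g \<in> Mor A" "Cod A f = Dom A g" "s \<in> el M (Dom A f)" "t = act M f s"
    "c \<in> cobj (ob (tdom p) (Dom A f))" "fobj (tcomp p (Dom A f)) c = s"
    by (simp_all add: elements_sel)
  show ?case using c h.tnat_composite[of f g c] by (simp add: elements_sel)
next
  case 9
  then show ?case by (simp add: p.fibre_tcomp_def)
next
  case 10
  then show ?case by simp
qed

end

context sketch_model
begin

abbreviation PsE where "PsE \<equiv> PsMod El (CAT small)"

lemma PsE_Mor: "h \<in> Mor PsE \<Longrightarrow> cat_pt El small h"
  using discrete_El by (simp add: PsMod_sel cat_pt_def cat_pt_axioms_def)

lemma fibre_ob_PsE: "p \<in> Obj Sl \<Longrightarrow> fibre_ob p \<in> Obj PsE"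
  using over_disc.pseudo_model_fibre[OF Sl_over_disc] unfolding Sl_Obj_iff PsMod_sel(1,2) by blast

lemma fibre_tr_PsE: "(p, h, q) \<in> Mor Sl \<Longrightarrow> fibre_tr p h q \<in> Mor PsE"
  using over_disc_mor.pseudo_f_transformation_fibre[OF Sl_over_disc_mor] fibre_ob_PsE[of p]
      fibre_ob_PsE[of q]
  by (simp add: PsMod_sel Sl_Mor_iff)

lemma fibre_md_PsE:
  assumes c: "(p, \<Gamma>, q) \<in> Cell Sl"
  shows "fibre_md p \<Gamma> q \<in> Cell PsE"
proof -
  have m: "(p, mdom \<Gamma>, q) \<in> Mor Sl" "(p, mcod \<Gamma>, q) \<in> Mor Sl" "\<Gamma> \<in> Cell Ps"
    using c by (simp_all add: Sl_Cell_iff)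
  interpret d: over_disc_mor small A M p "mdom \<Gamma>" q using m(1) by (rule Sl_over_disc_mor)
  interpret c: over_disc_mor small A M p "mcod \<Gamma>" q using m(2) by (rule Sl_over_disc_mor)
  have md: "modification A (CAT small) \<Gamma>" using m(3) by (simp add: PsMod_sel)
  interpret \<Gamma>: cat_md A small \<Gamma> using md by (simp add: cat_md_def)
  note [simp] = \<Gamma>.mcomp_nattr \<Gamma>.mcomp_simps[unfolded d.tdom_h d.tcod_h]
  note nat = modification_CAT_D[OF md d.h.cat_pt_axioms c.h.cat_pt_axioms, unfolded d.tdom_h
      d.tcod_h]
  have "modification El (CAT small) (fibre_md p \<Gamma> q)"
  proof (rule modification_CAT_I, unfold split_paired_all, goal_cases)
    case 1
    then show ?case using PsE_Mor[OF fibre_tr_PsE[OF m(1)]] by simp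
  next
    case 2
    then show ?case using PsE_Mor[OF fibre_tr_PsE[OF m(2)]] by simp
  next
    case (5 x s)
    then have x: "x \<in> Obj A" "s \<in> el M x" by (simp_all add: elements_sel)
    have "natural_transformation (res_nattr (fibre_tcomp p (mdom \<Gamma>) q (x, s)) (fibre_tcomp p (mcod
        \<Gamma>) q (x, s)) (mcomp \<Gamma> x))"
      by (rule natural_transformation_res[where C = "ob (tdom p) x" and P = "fobj (tcomp p x)"
          and s = s and D = "ob (tdom q) x" and Q = "fobj (tcomp q x)" and t = s])
        (use x in simp_all)
    then show ?case using x by simp
  next
    case (6 f s c)
    then have c: "f \<in> Mor A" "s \<in> el M (Dom A f)" "c \<in> cobj (ob (tdom p) (Dom A f))"
      "fobj (tcomp p (Dom A f)) c = s" by (simp_all add: elements_sel)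
    show ?case using nat[OF c(1,3)] c by (simp add: elements_sel)
  qed simp_all
  then show ?thesis using fibre_tr_PsE[OF m(1)] fibre_tr_PsE[OF m(2)] by (simp add: PsMod_sel(3))
qed

end

lemma cat_pt_eqI:
  fixes A :: "('o, 'm, 'c, 'y) fcat_scheme"
  assumes "cat_pt A small \<alpha>" and "cat_pt A small \<beta>"
    and dom: "tdom \<alpha> = tdom \<beta>" and cod: "tcod \<alpha> = tcod \<beta>"
    and o: "\<And>x c. \<lbrakk>x \<in> Obj A; c \<in> cobj (ob (tdom \<beta>) x)\<rbrakk> \<Longrightarrow> fobj (tcomp \<alpha> x) c = fobj (tcomp \<beta> x) c"
    and a: "\<And>x a. \<lbrakk>x \<in> Obj A; a \<in> carr (ob (tdom \<beta>) x)\<rbrakk> \<Longrightarrow> farr (tcomp \<alpha> x) a = farr (tcomp \<beta> x) a"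
    and n: "\<And>f c. \<lbrakk>f \<in> Mor A; c \<in> cobj (ob (tdom \<beta>) (Dom A f))\<rbrakk>
      \<Longrightarrow> ncomp (tnat \<alpha> f) c = ncomp (tnat \<beta> f) c"
  shows "\<alpha> = \<beta>"
proof -
  interpret \<alpha>: cat_pt A small \<alpha> by fact
  interpret \<beta>: cat_pt A small \<beta> by fact
  have comp: "tcomp \<alpha> x = tcomp \<beta> x" if x: "x \<in> Obj A" for x
    using x o[OF x] a[OF x] \<alpha>.tcomp_functor[OF x] \<beta>.tcomp_functor[OF x] dom cod
    by (intro func_eqI) simp_all
  have nat: "tnat \<alpha> f = tnat \<beta> f" if f: "f \<in> Mor A" for f
  proof -
    have o: "Dom A f \<in> Obj A" "Cod A f \<in> Obj A" using f by auto
    have d: "ndom (tnat \<alpha> f) = ndom (tnat \<beta> f)" "ncod (tnat \<alpha> f) = ncod (tnat \<beta> f)"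
      using \<alpha>.tnat_nattr[OF f] \<beta>.tnat_nattr[OF f] comp[OF o(1)] comp[OF o(2)] dom cod by simp_all
    have D: "fdom (ndom (tnat \<beta> f)) = ob (tdom \<beta>) (Dom A f)"
      using \<beta>.tnat_nattr(2)[OF f] \<beta>.tcomp_functor(2)[OF o(1)] by simp
    show ?thesis
      by (rule nattr_eqI[OF d])
        (use natural_transformation.ncomp_extensional[OF \<alpha>.tnat_nattr(1)[OF f]]
          natural_transformation.ncomp_extensional[OF \<beta>.tnat_nattr(1)[OF f]] n[OF f] d D in
              simp_all)
  qed
  show ?thesis
    using comp nat \<alpha>.tcomp_extensional \<beta>.tcomp_extensional \<alpha>.tnat_extensional \<beta>.tnat_extensional dom
        cod
    by (intro pstrans_eqI[where X = "Obj A" and Y = "Mor A"]) simp_all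
qed

lemma cat_md_eqI:
  fixes A :: "('o, 'm, 'c, 'y) twocat_scheme"
  assumes "modification A (CAT small) \<Gamma>" and "modification A (CAT small) \<Delta>"
    and d: "mdom \<Gamma> = mdom \<Delta>" "mcod \<Gamma> = mcod \<Delta>"
    and n: "\<And>x c. \<lbrakk>x \<in> Obj A; c \<in> cobj (ob (tdom (mdom \<Delta>)) x)\<rbrakk>
      \<Longrightarrow> ncomp (mcomp \<Gamma> x) c = ncomp (mcomp \<Delta> x) c"
  shows "\<Gamma> = \<Delta>"
proof -
  interpret \<Gamma>: cat_md A small \<Gamma> using assms by (simp add: cat_md_def)
  interpret \<Delta>: cat_md A small \<Delta> using assms by (simp add: cat_md_def)
  have "mcomp \<Gamma> x = mcomp \<Delta> x" if x: "x \<in> Obj A" for x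
    using x \<Gamma>.mcomp_nattr[OF x] \<Delta>.mcomp_nattr[OF x] d n[OF x] \<Delta>.mdom_functor(2)[OF x]
      natural_transformation.ncomp_extensional[OF \<Gamma>.mcomp_nattr(1)[OF x]]
      natural_transformation.ncomp_extensional[OF \<Delta>.mcomp_nattr(1)[OF x]]
    by (intro nattr_eqI) simp_all
  then show ?thesis
    using d \<Gamma>.mcomp_extensional \<Delta>.mcomp_extensional by (intro modif_eqI[where X = "Obj A"]) simp_all
qed

section \<open>Taking fibres is a strict 2-functor\<close>

context sketch_model
begin

definition fibre_functor where
  "fibre_functor = \<lparr>ob = fibre_ob, mo = (\<lambda>(p, h, q). fibre_tr p h q), ce = (\<lambda>(p, \<Gamma>, q). fibre_md p \<Gamma>
      q)\<rparr>"

lemma fibre_functor_sel [simp]: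
  "ob fibre_functor = fibre_ob" "mo fibre_functor (p, h, q) = fibre_tr p h q"
  "ce fibre_functor (p, \<Gamma>, q) = fibre_md p \<Gamma> q"
  by (simp_all add: fibre_functor_def)

sublocale Ps: two_category Ps by (rule two_category_PsMod)
sublocale PsE: two_category PsE by (rule two_category_PsMod)
sublocale Sl: two_category Sl by (rule Ps.two_category_slice)

lemma fibre_tr_id:
  assumes p: "p \<in> Obj Sl"
  shows "fibre_tr p (Idm Ps (tdom p)) p = Idm PsE (fibre_ob p)"
proof (rule cat_pt_eqI)
  interpret p: over_disc small A M p using p by (rule Sl_over_disc)
  have "(p, Idm Ps (tdom p), p) \<in> Mor Sl"
    using Sl.Mor_simps(1)[OF p] by (simp add: slice_sel(8) PsMod_sel(4))
  then show "cat_pt El small (fibre_tr p (Idm Ps (tdom p)) p)"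
    by (intro PsE_Mor fibre_tr_PsE)
  show "cat_pt El small (Idm PsE (fibre_ob p))"
    by (intro PsE_Mor PsE.Mor_simps(1) fibre_ob_PsE p)
  note [simp] = PsMod_sel(8) CAT_sel(8,9) elements_sel
  show "fobj (tcomp (fibre_tr p (Idm Ps (tdom p)) p) x) c = fobj (tcomp (Idm PsE (fibre_ob p)) x) c"
    if "x \<in> Obj El" "c \<in> cobj (ob (tdom (Idm PsE (fibre_ob p))) x)" for x c
    using that by (cases x) simp
  show "farr (tcomp (fibre_tr p (Idm Ps (tdom p)) p) x) c = farr (tcomp (Idm PsE (fibre_ob p)) x) c"
    if "x \<in> Obj El" "c \<in> carr (ob (tdom (Idm PsE (fibre_ob p))) x)" for x c
    using that by (cases x) simp
  show "ncomp (tnat (fibre_tr p (Idm Ps (tdom p)) p) f) c = ncomp (tnat (Idm PsE (fibre_ob p)) f) c"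
    if "f \<in> Mor El" "c \<in> cobj (ob (tdom (Idm PsE (fibre_ob p))) (Dom El f))" for f c
    using that by (cases f) simp
qed (simp_all add: PsMod_sel(8))

lemma fibre_tr_comp:
  assumes h: "(p, h, q) \<in> Mor Sl" and k: "(q, k, r) \<in> Mor Sl"
  shows "fibre_tr p (pstrans_comp A (CAT small) k h) r
    = pstrans_comp El (CAT small) (fibre_tr q k r) (fibre_tr p h q)"
proof (rule cat_pt_eqI)
  interpret h: over_disc_mor small A M p h q using h by (rule Sl_over_disc_mor)
  interpret k: over_disc_mor small A M q k r using k by (rule Sl_over_disc_mor)
  have "(p, pstrans_comp A (CAT small) k h, r) \<in> Mor Sl"
    using Sl.Mor_simps(4)[OF h k] by (simp add: slice_sel(4,5,10) PsMod_sel(10))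
  then show "cat_pt El small (fibre_tr p (pstrans_comp A (CAT small) k h) r)"
    by (intro PsE_Mor fibre_tr_PsE)
  show "cat_pt El small (pstrans_comp El (CAT small) (fibre_tr q k r) (fibre_tr p h q))"
    using PsE.Mor_simps(4)[OF fibre_tr_PsE[OF h] fibre_tr_PsE[OF k]]
    by (intro PsE_Mor) (simp add: PsMod_sel(4,5,10))
  note [simp] = CAT_sel(10)
  show "fobj (tcomp (fibre_tr p (pstrans_comp A (CAT small) k h) r) x) c
    = fobj (tcomp (pstrans_comp El (CAT small) (fibre_tr q k r) (fibre_tr p h q)) x) c"
    if "x \<in> Obj El" "c \<in> cobj (ob (tdom (pstrans_comp El (CAT small) (fibre_tr q k r) (fibre_tr p h
        q))) x)" for x c
  proof (cases x)
    case (Pair y s)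
    then show ?thesis using that by (simp add: elements_sel)
  qed
  show "farr (tcomp (fibre_tr p (pstrans_comp A (CAT small) k h) r) x) c
    = farr (tcomp (pstrans_comp El (CAT small) (fibre_tr q k r) (fibre_tr p h q)) x) c"
    if "x \<in> Obj El" "c \<in> carr (ob (tdom (pstrans_comp El (CAT small) (fibre_tr q k r) (fibre_tr p h
        q))) x)" for x c
  proof (cases x)
    case (Pair y s)
    then show ?thesis using that by (simp add: elements_sel)
  qed
  show "ncomp (tnat (fibre_tr p (pstrans_comp A (CAT small) k h) r) \<phi>) c
    = ncomp (tnat (pstrans_comp El (CAT small) (fibre_tr q k r) (fibre_tr p h q)) \<phi>) c"
    if \<phi>: "\<phi> \<in> Mor El" "c \<in> cobj (ob (tdom (pstrans_comp El (CAT small) (fibre_tr q k r) (fibre_tr p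
        h q))) (Dom El \<phi>))" for \<phi> c
  proof (cases \<phi>)
    case (Pair f s)
    with \<phi> have f: "f \<in> Mor A" "s \<in> el M (Dom A f)" and c: "c \<in> cobj (ob (tdom p) (Dom A f))"
      "fobj (tcomp p (Dom A f)) c = s" by (simp_all add: elements_sel)
    have "ncomp (tnat (pstrans_comp A (CAT small) k h) f) c
      = ccmp (ob (tdom r) (Cod A f)) (farr (tcomp k (Cod A f)) (ncomp (tnat h f) c))
        (ncomp (tnat k f) (fobj (tcomp h (Dom A f)) c))"
      using ncomp_tnat_comp[OF h.h.cat_pt_axioms k.h.cat_pt_axioms, of f c] f c by simp
    moreover have "ncomp (tnat (pstrans_comp El (CAT small) (fibre_tr q k r) (fibre_tr p h q)) (f,
        s)) c
      = ccmp (ob (tdom r) (Cod A f)) (farr (tcomp k (Cod A f)) (ncomp (tnat h f) c))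
        (ncomp (tnat k f) (fobj (tcomp h (Dom A f)) c))"
      using ncomp_tnat_comp[OF PsE_Mor[OF fibre_tr_PsE[OF h]] PsE_Mor[OF fibre_tr_PsE[OF k]], of
          "(f, s)" c] f c
      by (simp add: elements_sel del: pstrans_comp_sel)
    ultimately show ?thesis using Pair f c by (simp del: pstrans_comp_sel)
  qed
qed simp_all

lemma PsE_Cell: "\<Gamma> \<in> Cell PsE \<Longrightarrow> modification El (CAT small) \<Gamma>"
  by (simp add: PsMod_sel)

text \<open>
  All compositions are given by formulas in the values at objects and arrows, and restriction to
  fibres does not change these values.
\<close>

theorem strict_twofunctor_fibre: "strict_twofunctor Sl PsE fibre_functor"
proof (rule strict_twofunctorI[OF Sl.two_category_axioms PsE.two_category_axioms], goal_cases)
  case (1 p)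
  then show ?case using fibre_ob_PsE[OF 1] fibre_tr_id[OF 1] by (simp add: slice_sel(8)
      PsMod_sel(4))
next
  case (2 t)
  obtain p h q where t: "t = (p, h, q)" by (cases t) auto
  have m: "(p, h, q) \<in> Mor Sl" using 2 t by simp
  interpret h: over_disc_mor small A M p h q using m by (rule Sl_over_disc_mor)
  have "fibre_md p (Idc Ps h) q = Idc PsE (fibre_tr p h q)"
  proof (rule cat_md_eqI)
    show "modification El (CAT small) (fibre_md p (Idc Ps h) q)"
      using Sl.Cell_simps(1)[OF m] by (intro PsE_Cell fibre_md_PsE) (simp add: slice_sel(9))
    show "modification El (CAT small) (Idc PsE (fibre_tr p h q))"
      using fibre_tr_PsE[OF m] by (intro PsE_Cell PsE.Cell_simps(1))
    show "ncomp (mcomp (fibre_md p (Idc Ps h) q) x) c = ncomp (mcomp (Idc PsE (fibre_tr p h q)) x)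
        c"
      if "x \<in> Obj El" "c \<in> cobj (ob (tdom (mdom (Idc PsE (fibre_tr p h q)))) x)" for x c
    proof (cases x)
      case (Pair y s)
      then show ?thesis using that by (simp add: elements_sel PsMod_sel(9) CAT_sel(9))
    qed
  qed (simp_all add: PsMod_sel(9))
  then show ?case using fibre_tr_PsE[OF m] by (simp add: t slice_sel(4,5,9) PsMod_sel(4,5))
next
  case (3 t)
  obtain p \<Gamma> q where t: "t = (p, \<Gamma>, q)" by (cases t) auto
  then show ?case using fibre_md_PsE[of p \<Gamma> q] 3 by (simp add: slice_sel(6,7) PsMod_sel(6,7))
next
  case (4 t u)
  obtain p h q where t: "t = (p, h, q)" by (cases t) auto
  obtain q' k r where u: "u = (q', k, r)" by (cases u) auto
  show ?case using 4 fibre_tr_comp[of p h q k r] by (simp add: t u slice_sel(4,5,10) PsMod_sel(10))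
next
  case (5 t u)
  obtain p \<Gamma> q where t: "t = (p, \<Gamma>, q)" by (cases t) auto
  obtain p' \<Delta> q' where u: "u = (p', \<Delta>, q')" by (cases u) auto
  have e: "p' = p" "q' = q" "mcod \<Gamma> = mdom \<Delta>" and cl: "(p, \<Gamma>, q) \<in> Cell Sl" "(p, \<Delta>, q) \<in> Cell Sl"
    using 5 by (simp_all add: t u slice_sel(6,7) PsMod_sel(6,7))
  have m: "(p, mdom \<Gamma>, q) \<in> Mor Sl" "(p, mdom \<Delta>, q) \<in> Mor Sl" using cl by (simp_all add:
      Sl_Cell_iff)
  interpret g: over_disc_mor small A M p "mdom \<Gamma>" q using m(1) by (rule Sl_over_disc_mor)
  interpret d: over_disc_mor small A M p "mdom \<Delta>" q using m(2) by (rule Sl_over_disc_mor)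
  interpret \<Gamma>: cat_md A small \<Gamma> using cl(1) by (simp add: Sl_Cell_iff PsMod_sel cat_md_def)
  note G = fibre_md_PsE[OF cl(1)] and D = fibre_md_PsE[OF cl(2)]
  have "fibre_md p (\<Delta> \<bullet>\<^bsub>Ps\<^esub> \<Gamma>) q = fibre_md p \<Delta> q \<bullet>\<^bsub>PsE\<^esub> fibre_md p \<Gamma> q"
  proof (rule cat_md_eqI)
    show "modification El (CAT small) (fibre_md p (\<Delta> \<bullet>\<^bsub>Ps\<^esub> \<Gamma>) q)"
      using Sl.Cell_simps(4)[OF cl] e
      by (intro PsE_Cell fibre_md_PsE) (simp add: slice_sel(6,7,11) PsMod_sel(6,7))
    show "modification El (CAT small) (fibre_md p \<Delta> q \<bullet>\<^bsub>PsE\<^esub> fibre_md p \<Gamma> q)"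
      using PsE.Cell_simps(4)[OF G D] e by (intro PsE_Cell) (simp add: PsMod_sel(6,7))
    show "ncomp (mcomp (fibre_md p (\<Delta> \<bullet>\<^bsub>Ps\<^esub> \<Gamma>) q) x) c
        = ncomp (mcomp (fibre_md p \<Delta> q \<bullet>\<^bsub>PsE\<^esub> fibre_md p \<Gamma> q) x) c"
      if "x \<in> Obj El" "c \<in> cobj (ob (tdom (mdom (fibre_md p \<Delta> q \<bullet>\<^bsub>PsE\<^esub> fibre_md p \<Gamma> q))) x)" for x c
    proof (cases x)
      case (Pair y s)
      then show ?thesis
        using that e \<Gamma>.mcomp_simps[unfolded g.tdom_h g.tcod_h, of y c]
          cat_md.mcomp_simps[of A small \<Delta> y c] cl(2)
        by (simp add: elements_sel PsMod_sel(11) CAT_sel(11) Sl_Cell_iff PsMod_sel(3) cat_md_def)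
    qed
  qed (simp_all add: PsMod_sel(11))
  then show ?case using e by (simp add: t u slice_sel(11))
next
  case (6 t u)
  obtain p \<Gamma> q where t: "t = (p, \<Gamma>, q)" by (cases t) auto
  obtain q' \<Delta> r where u: "u = (q', \<Delta>, r)" by (cases u) auto
  have e: "q' = q" and cl: "(p, \<Gamma>, q) \<in> Cell Sl" "(q, \<Delta>, r) \<in> Cell Sl"
    using 6 by (simp_all add: t u slice_sel(4-7) PsMod_sel(6,7))
  have m: "(p, mdom \<Gamma>, q) \<in> Mor Sl" "(p, mcod \<Gamma>, q) \<in> Mor Sl" "(q, mdom \<Delta>, r) \<in> Mor Sl" "(q, mcod \<Delta>,
      r) \<in> Mor Sl"
    using cl by (simp_all add: Sl_Cell_iff)
  interpret g: over_disc_mor small A M p "mdom \<Gamma>" q using m(1) by (rule Sl_over_disc_mor)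
  interpret g': over_disc_mor small A M p "mcod \<Gamma>" q using m(2) by (rule Sl_over_disc_mor)
  interpret d: over_disc_mor small A M q "mdom \<Delta>" r using m(3) by (rule Sl_over_disc_mor)
  interpret \<Gamma>: cat_md A small \<Gamma> using cl(1) by (simp add: Sl_Cell_iff PsMod_sel cat_md_def)
  interpret \<Delta>: cat_md A small \<Delta> using cl(2) by (simp add: Sl_Cell_iff PsMod_sel cat_md_def)
  note G = fibre_md_PsE[OF cl(1)] and D = fibre_md_PsE[OF cl(2)]
  have "fibre_md p (\<Delta> \<star>\<^bsub>Ps\<^esub> \<Gamma>) r = fibre_md q \<Delta> r \<star>\<^bsub>PsE\<^esub> fibre_md p \<Gamma> q"
  proof (rule cat_md_eqI)
    show "modification El (CAT small) (fibre_md p (\<Delta> \<star>\<^bsub>Ps\<^esub> \<Gamma>) r)"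
      using Sl.Cell_simps(7)[OF cl] by (intro PsE_Cell fibre_md_PsE) (simp add: slice_sel(4-7,12))
    show "modification El (CAT small) (fibre_md q \<Delta> r \<star>\<^bsub>PsE\<^esub> fibre_md p \<Gamma> q)"
      using PsE.Cell_simps(7)[OF G D] by (intro PsE_Cell) (simp add: PsMod_sel(4-7))
    show "ncomp (mcomp (fibre_md p (\<Delta> \<star>\<^bsub>Ps\<^esub> \<Gamma>) r) x) c
        = ncomp (mcomp (fibre_md q \<Delta> r \<star>\<^bsub>PsE\<^esub> fibre_md p \<Gamma> q) x) c"
      if "x \<in> Obj El" "c \<in> cobj (ob (tdom (mdom (fibre_md q \<Delta> r \<star>\<^bsub>PsE\<^esub> fibre_md p \<Gamma> q))) x)" for x c
    proof (cases x)
      case (Pair y s)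
      then have y: "y \<in> Obj A" "s \<in> el M y" and c: "c \<in> cobj (ob (tdom p) y)" "fobj (tcomp p y) c =
          s"
        using that by (simp_all add: elements_sel PsMod_sel(12))
      note n = \<Gamma>.mcomp_simps[unfolded g.tdom_h g.tcod_h, OF y(1) c(1)]
      have c': "fobj (tcomp (mcod \<Gamma>) y) c \<in> cobj (ob (tdom q) y)" using y c by simp
      note n' = \<Delta>.mcomp_simps[unfolded d.tdom_h d.tcod_h, OF y(1) c'] \<Delta>.mcomp_nattr[OF y(1)]
      show ?thesis
        using y c n c' n' g.h_simps(4)[of y c] g'.h_simps(4)[of y c] \<Gamma>.mcomp_nattr[OF y(1)]
        by (simp add: Pair elements_sel PsMod_sel(12) CAT_sel(12))
    qed
  qed (simp_all add: PsMod_sel(12) fibre_tr_comp[OF m(1,3)] fibre_tr_comp[OF m(2,4)])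
  then show ?case using e by (simp add: t u slice_sel(12))
qed

end

section \<open>Taking fibres is fully faithful\<close>

context sketch_model
begin

text \<open>Every object of the category over \<open>x\<close> lies in the fibre over its own grade.\<close>

lemma fibre_tr_faithful:
  assumes h: "(p, h, q) \<in> Mor Sl" and h': "(p, h', q) \<in> Mor Sl"
    and eq: "fibre_tr p h q = fibre_tr p h' q"
  shows "h = h'"
proof -
  interpret h: over_disc_mor small A M p h q using h by (rule Sl_over_disc_mor)
  interpret h': over_disc_mor small A M p h' q using h' by (rule Sl_over_disc_mor)
  show ?thesis
  proof (rule cat_pt_eqI[OF h.h.cat_pt_axioms h'.h.cat_pt_axioms])
    show "fobj (tcomp h x) c = fobj (tcomp h' x) c" if "x \<in> Obj A" "c \<in> cobj (ob (tdom h') x)" for x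
        c
      using arg_cong[OF eq, of "\<lambda>k. fobj (tcomp k (x, fobj (tcomp p x) c)) c"] that by simp
    show "farr (tcomp h x) a = farr (tcomp h' x) a" if "x \<in> Obj A" "a \<in> carr (ob (tdom h') x)" for x
        a
      using arg_cong[OF eq, of "\<lambda>k. farr (tcomp k (x, fobj (tcomp p x) (cdom (ob (tdom p) x) a)))
          a"] that
      by simp
    show "ncomp (tnat h f) c = ncomp (tnat h' f) c" if "f \<in> Mor A" "c \<in> cobj (ob (tdom h') (Dom A
        f))" for f c
      using arg_cong[OF eq, of "\<lambda>k. ncomp (tnat k (f, fobj (tcomp p (Dom A f)) c)) c"] that by simp
  qed simp_all
qed

lemma fibre_md_faithful:
  assumes \<Gamma>: "(p, \<Gamma>, q) \<in> Cell Sl" and \<Delta>: "(p, \<Delta>, q) \<in> Cell Sl"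
    and d: "mdom \<Gamma> = mdom \<Delta>" "mcod \<Gamma> = mcod \<Delta>" and eq: "fibre_md p \<Gamma> q = fibre_md p \<Delta> q"
  shows "\<Gamma> = \<Delta>"
proof -
  have "(p, mdom \<Delta>, q) \<in> Mor Sl" using \<Delta> by (simp add: Sl_Cell_iff)
  then interpret h: over_disc_mor small A M p "mdom \<Delta>" q by (rule Sl_over_disc_mor)
  show ?thesis
  proof (rule cat_md_eqI[OF _ _ d])
    show "modification A (CAT small) \<Gamma>" "modification A (CAT small) \<Delta>"
      using \<Gamma> \<Delta> by (simp_all add: Sl_Cell_iff PsMod_sel)
    show "ncomp (mcomp \<Gamma> x) c = ncomp (mcomp \<Delta> x) c"
      if "x \<in> Obj A" "c \<in> cobj (ob (tdom (mdom \<Delta>)) x)" for x c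
      using arg_cong[OF eq, of "\<lambda>k. ncomp (mcomp k (x, fobj (tcomp p x) c)) c"] that by simp
  qed
qed

end

lemma cat_iso_fibD:
  assumes iso: "cat_iso (fib D Q t) f" and "category D"
    and Q: "\<And>a. a \<in> carr D \<Longrightarrow> Q (ccod D a) = Q (cdom D a)"
  shows "cat_iso D f"
proof -
  have f: "f \<in> carr D" "Q (cdom D f) = t" using iso by (simp_all add: cat_iso_def)
  have q: "Q (ccod D f) = t" using Q[OF f(1)] f(2) by simp
  obtain g where "g \<in> carr (fib D Q t)" "cdom (fib D Q t) g = ccod (fib D Q t) f"
    "ccod (fib D Q t) g = cdom (fib D Q t) f"
    "ccmp (fib D Q t) g f = cid (fib D Q t) (cdom (fib D Q t) f)"
    "ccmp (fib D Q t) f g = cid (fib D Q t) (ccod (fib D Q t) f)"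
    using iso unfolding cat_iso_def by blast
  then have "g \<in> carr D" "cdom D g = ccod D f" "ccod D g = cdom D f" "ccmp D g f = cid D (cdom D f)"
    "ccmp D f g = cid D (ccod D f)"
    using f q category.cat_simps(1,2)[OF assms(2) f(1)] by simp_all
  with f(1) show ?thesis unfolding cat_iso_def by blast
qed

text \<open>
  A transformation \<open>k\<close> between the families of fibres of \<open>p\<close> and \<open>q\<close> is glued to a transformation
  between the total pseudo-models: at an object in the fibre over \<open>s\<close>, the component of \<open>k\<close> at \<open>s\<close>
  is used.
\<close>

locale fibre_pt = p: over_disc small A M p + q: over_disc small A M q
  for small :: "'u set \<Rightarrow> bool" and A :: "('o, 'm, 'c, 'i, 'j, 'k) fsketch"
    and M :: "('o, 'm, 'u) setfun" and p q :: "('o, 'm, 'c, 'u cat, 'u func, 'u nattr) pstrans"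
    and k :: "('o \<times> 'u, 'm \<times> 'u, 'c \<times> 'u, 'u cat, 'u func, 'u nattr) pstrans" +
  assumes cat_pt_k: "cat_pt p.El small k" and tdom_k: "tdom k = p.fibre_ob p"
    and tcod_k: "tcod k = p.fibre_ob q"
begin

sublocale k: cat_pt p.El small k by (rule cat_pt_k)

definition glue_comp :: "'o \<Rightarrow> 'u func" where
  "glue_comp = (\<lambda>x\<in>Obj A. \<lparr>fdom = ob (tdom p) x, fcod = ob (tdom q) x,
     fobj = (\<lambda>c\<in>cobj (ob (tdom p) x). fobj (tcomp k (x, fobj (tcomp p x) c)) c),
     farr = (\<lambda>a\<in>carr (ob (tdom p) x). farr (tcomp k (x, fobj (tcomp p x) (cdom (ob (tdom p) x) a)))
         a)\<rparr>)"

definition glue_nat :: "'m \<Rightarrow> 'u nattr" where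
  "glue_nat = (\<lambda>f\<in>Mor A. \<lparr>ndom = func_comp (mo (tdom q) f) (glue_comp (Dom A f)),
     ncod = func_comp (glue_comp (Cod A f)) (mo (tdom p) f),
     ncomp = (\<lambda>c\<in>cobj (ob (tdom p) (Dom A f)). ncomp (tnat k (f, fobj (tcomp p (Dom A f)) c)) c)\<rparr>)"

definition glue :: "('o, 'm, 'c, 'u cat, 'u func, 'u nattr) pstrans" where
  "glue = \<lparr>tdom = tdom p, tcod = tdom q, tcomp = glue_comp, tnat = glue_nat\<rparr>"

lemma glue_sel [simp]:
  "tdom glue = tdom p" "tcod glue = tdom q" "tcomp glue = glue_comp" "tnat glue = glue_nat"
  by (simp_all add: glue_def)

lemma glue_comp_sel [simp]:
  assumes "x \<in> Obj A"
  shows "fdom (glue_comp x) = ob (tdom p) x" "fcod (glue_comp x) = ob (tdom q) x"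
    "c \<in> cobj (ob (tdom p) x) \<Longrightarrow> fobj (glue_comp x) c = fobj (tcomp k (x, fobj (tcomp p x) c)) c"
    "a \<in> carr (ob (tdom p) x) \<Longrightarrow>
      farr (glue_comp x) a = farr (tcomp k (x, fobj (tcomp p x) (cdom (ob (tdom p) x) a))) a"
  using assms by (simp_all add: glue_comp_def)

lemma glue_nat_sel [simp]:
  assumes "f \<in> Mor A"
  shows "ndom (glue_nat f) = func_comp (mo (tdom q) f) (glue_comp (Dom A f))"
    "ncod (glue_nat f) = func_comp (glue_comp (Cod A f)) (mo (tdom p) f)"
    "c \<in> cobj (ob (tdom p) (Dom A f)) \<Longrightarrow>
      ncomp (glue_nat f) c = ncomp (tnat k (f, fobj (tcomp p (Dom A f)) c)) c"
  using assms by (simp_all add: glue_nat_def)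

lemma k_obj [simp]:
  assumes "x \<in> Obj A" "c \<in> cobj (ob (tdom p) x)" "fobj (tcomp p x) c = s"
  shows "fobj (tcomp k (x, s)) c \<in> cobj (ob (tdom q) x)" "fobj (tcomp q x) (fobj (tcomp k (x, s)) c)
      = s"
    "farr (tcomp k (x, s)) (cid (ob (tdom p) x) c) = cid (ob (tdom q) x) (fobj (tcomp k (x, s)) c)"
proof -
  have x: "(x, s) \<in> Obj p.El" and s: "s \<in> el M x" using assms by (auto simp: elements_sel)
  show 1: "fobj (tcomp k (x, s)) c \<in> cobj (ob (tdom q) x)" "fobj (tcomp q x) (fobj (tcomp k (x, s))
      c) = s"
    using k.tcomp_simps(1)[OF x, of c] s assms by (simp_all add: tdom_k tcod_k)
  show "farr (tcomp k (x, s)) (cid (ob (tdom p) x) c) = cid (ob (tdom q) x) (fobj (tcomp k (x, s))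
      c)"
    using k.tcomp_simps(5)[OF x, of c] s assms 1 by (simp add: tdom_k tcod_k)
qed

lemma k_arr [simp]:
  assumes "x \<in> Obj A" "a \<in> carr (ob (tdom p) x)" "fobj (tcomp p x) (cdom (ob (tdom p) x) a) = s"
  shows "farr (tcomp k (x, s)) a \<in> carr (ob (tdom q) x)"
    "cdom (ob (tdom q) x) (farr (tcomp k (x, s)) a) = fobj (tcomp k (x, s)) (cdom (ob (tdom p) x)
        a)"
    "ccod (ob (tdom q) x) (farr (tcomp k (x, s)) a) = fobj (tcomp k (x, s)) (ccod (ob (tdom p) x)
        a)"
proof -
  have x: "(x, s) \<in> Obj p.El" and s: "s \<in> el M x" using assms by (auto simp: elements_sel)
  have 1: "farr (tcomp k (x, s)) a \<in> carr (ob (tdom q) x)"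
    "fobj (tcomp q x) (cdom (ob (tdom q) x) (farr (tcomp k (x, s)) a)) = s"
    using k.tcomp_simps(2)[OF x, of a] s assms by (simp_all add: tdom_k tcod_k)
  then show "farr (tcomp k (x, s)) a \<in> carr (ob (tdom q) x)"
    "cdom (ob (tdom q) x) (farr (tcomp k (x, s)) a) = fobj (tcomp k (x, s)) (cdom (ob (tdom p) x)
        a)"
    "ccod (ob (tdom q) x) (farr (tcomp k (x, s)) a) = fobj (tcomp k (x, s)) (ccod (ob (tdom p) x)
        a)"
    using k.tcomp_simps(3,4)[OF x, of a] s assms by (simp_all add: tdom_k tcod_k)
qed

lemma k_ccmp:
  assumes "x \<in> Obj A" "a \<in> carr (ob (tdom p) x)" "b \<in> carr (ob (tdom p) x)"
    "ccod (ob (tdom p) x) a = cdom (ob (tdom p) x) b" "fobj (tcomp p x) (cdom (ob (tdom p) x) a) =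
        s"
  shows "farr (tcomp k (x, s)) (ccmp (ob (tdom p) x) b a)
    = ccmp (ob (tdom q) x) (farr (tcomp k (x, s)) b) (farr (tcomp k (x, s)) a)"
proof -
  have x: "(x, s) \<in> Obj p.El" and s: "s \<in> el M x" using assms by (auto simp: elements_sel)
  have "fobj (tcomp p x) (cdom (ob (tdom p) x) b) = s"
    using p.grade_arr(2)[OF assms(1,2)] assms(4,5) by simp
  then show ?thesis
    using k.tcomp_simps(6)[OF x, of a b] s assms by (simp add: tdom_k tcod_k)
qed

lemma k_nat [simp]:
  assumes "f \<in> Mor A" "c \<in> cobj (ob (tdom p) (Dom A f))" "fobj (tcomp p (Dom A f)) c = s" "Cod A f =
      y"
  shows "ncomp (tnat k (f, s)) c \<in> carr (ob (tdom q) y)"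
    "cdom (ob (tdom q) y) (ncomp (tnat k (f, s)) c) = fobj (mo (tdom q) f) (fobj (tcomp k (Dom A f,
        s)) c)"
    "ccod (ob (tdom q) y) (ncomp (tnat k (f, s)) c)
      = fobj (tcomp k (y, act M f s)) (fobj (mo (tdom p) f) c)"
proof -
  have x: "(f, s) \<in> Mor p.El" and s: "s \<in> el M (Dom A f)" using assms by (auto simp: elements_sel)
  note n = k.tnat_simps[OF x _ refl, of c, unfolded elements_sel(4,5) tdom_k tcod_k]
  have 1: "ncomp (tnat k (f, s)) c \<in> carr (ob (tdom q) y)"
    "fobj (tcomp q y) (cdom (ob (tdom q) y) (ncomp (tnat k (f, s)) c)) = act M f s"
    using n(1) s assms by auto
  then show "ncomp (tnat k (f, s)) c \<in> carr (ob (tdom q) y)"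
    "cdom (ob (tdom q) y) (ncomp (tnat k (f, s)) c) = fobj (mo (tdom q) f) (fobj (tcomp k (Dom A f,
        s)) c)"
    "ccod (ob (tdom q) y) (ncomp (tnat k (f, s)) c)
      = fobj (tcomp k (y, act M f s)) (fobj (mo (tdom p) f) c)"
    using n(2,3) s assms by auto
qed

lemma glue_comp_functor [simp]:
  assumes "x \<in> Obj A"
  shows "cat_functor (glue_comp x)"
proof -
  have "farr (glue_comp x) (ccmp (ob (tdom p) x) b a) = ccmp (ob (tdom q) x) (farr (glue_comp x) b)
      (farr (glue_comp x) a)"
    if "a \<in> carr (ob (tdom p) x)" "b \<in> carr (ob (tdom p) x)" "ccod (ob (tdom p) x) a = cdom (ob
        (tdom p) x) b" for a b
    using k_ccmp[OF assms that refl] p.grade_arr(2)[OF assms that(1)] that assms by simp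
  then show ?thesis
    using assms by (intro cat_functor.intro cat_functor_axioms.intro) (simp_all, simp_all add:
        glue_comp_def)
qed

lemma glue_nat_nattr [simp]:
  assumes f: "f \<in> Mor A"
  shows "natural_transformation (glue_nat f)"
proof -
  have o [simp]: "Dom A f \<in> Obj A" "Cod A f \<in> Obj A" using f by auto
  show ?thesis
  proof (intro natural_transformation.intro natural_transformation_axioms.intro, goal_cases)
    case (8 a)
    then have a: "a \<in> carr (ob (tdom p) (Dom A f))" using f by simp
    let ?s = "fobj (tcomp p (Dom A f)) (cdom (ob (tdom p) (Dom A f)) a)"
    have "(f, ?s) \<in> Mor p.El" using f a by (simp add: elements_sel)
    from k.tnat_naturality[OF this, unfolded elements_sel(4,5) tdom_k tcod_k, of a]
    show ?case using f a by simp
  next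
    case 9
    then show ?case using f by (simp add: glue_nat_def)
  qed (use f in \<open>simp_all add: cat_functor_comp\<close>)
qed

lemma pseudo_f_transformation_glue: "pseudo_f_transformation A (CAT small) glue"
proof (rule pseudo_f_transformation_CAT_I[OF p.discrete], goal_cases)
  case 1
  then show ?case by (simp add: p.F.pseudo_f_functor_axioms)
next
  case 2
  then show ?case by (simp add: q.F.pseudo_f_functor_axioms)
next
  case (5 f c)
  let ?s = "fobj (tcomp p (Dom A f)) c"
  have o: "Dom A f \<in> Obj A" "Cod A f \<in> Obj A" using 5 by auto
  have f: "(f, ?s) \<in> Mor p.El" "?s \<in> el M (Dom A f)" using 5 o by (simp_all add: elements_sel)
  have "cat_iso (fib (ob (tdom q) (Cod A f)) (fobj (tcomp q (Cod A f))) (act M f ?s)) (ncomp (tnat k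
      (f, ?s)) c)"
    using k.tnat_iso[OF f(1), of c] 5 o f(2) by (simp add: elements_sel(4,5) tdom_k tcod_k)
  from cat_iso_fibD[OF this] show ?case using 5 o by simp
next
  case (6 f c)
  let ?s = "fobj (tcomp p (Dom A f)) c"
  have o: "Dom A f \<in> Obj A" "Cod A f \<in> Obj A" using 6 by auto
  have f: "(f, ?s) \<in> Mor p.El" "(f, ?s) \<in> inert p.El" "?s \<in> el M (Dom A f)" using 6 o by (simp_all
      add: elements_sel)
  have d: "fdom (tcomp k (Dom A f, ?s)) = fib (ob (tdom p) (Dom A f)) (fobj (tcomp p (Dom A f))) ?s"
    using k.tcomp_functor(2)[of "(Dom A f, ?s)"] f o by (simp add: elements_sel(1) tdom_k)
  from k.tnat_inert(1)[OF f(1,2)] show ?case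
    using 6 o f(3) d by (simp add: elements_sel(4,5) tdom_k tcod_k)
next
  case (7 f)
  have o: "Dom A f \<in> Obj A" "Cod A f \<in> Obj A" using 7 by auto
  have e: "func_comp (tcomp k (Cod A f, act M f s)) (p.fibre_func p (f, s)) = func_comp
      (p.fibre_func q (f, s)) (tcomp k (Dom A f, s))"
    and d: "fdom (tcomp k (Dom A f, s)) = fib (ob (tdom p) (Dom A f)) (fobj (tcomp p (Dom A f))) s"
    if "s \<in> el M (Dom A f)" for s
    using k.tnat_inert(2)[of "(f, s)"] that 7 k.tcomp_functor(2)[of "(Dom A f, s)"] o
    by (simp_all add: elements_sel tdom_k tcod_k)
  have eo: "fobj (tcomp k (Cod A f, act M f s)) (fobj (mo (tdom p) f) c) = fobj (mo (tdom q) f)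
      (fobj (tcomp k (Dom A f, s)) c)"
    if "c \<in> cobj (ob (tdom p) (Dom A f))" "s = fobj (tcomp p (Dom A f)) c" for c s
    using arg_cong[OF e[of s], of "\<lambda>F. fobj F c"] d[of s] that 7 o by simp
  have ea: "farr (tcomp k (Cod A f, act M f s)) (farr (mo (tdom p) f) a) = farr (mo (tdom q) f)
      (farr (tcomp k (Dom A f, s)) a)"
    if "a \<in> carr (ob (tdom p) (Dom A f))" "s = fobj (tcomp p (Dom A f)) (cdom (ob (tdom p) (Dom A
        f)) a)" for a s
    using arg_cong[OF e[of s], of "\<lambda>F. farr F a"] d[of s] that 7 o by simp
  have "func_comp (glue_comp (Cod A f)) (mo (tdom p) f) = func_comp (mo (tdom q) f) (glue_comp (Dom
      A f))"
    by (rule func_eqI) (use 7 o eo ea in \<open>simp_all add: cat_functor_comp\<close>)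
  then show ?case by simp
next
  case (8 f g c)
  then have c: "f \<in> Mor A" "g \<in> Mor A" "Cod A f = Dom A g" "c \<in> cobj (ob (tdom p) (Dom A f))" by
      simp_all
  let ?s = "fobj (tcomp p (Dom A f)) c"
  have o: "Dom A f \<in> Obj A" "Dom A g \<in> Obj A" "Cod A g \<in> Obj A" using c by auto
  have f: "(f, ?s) \<in> Mor p.El" "(g, act M f ?s) \<in> Mor p.El" "?s \<in> el M (Dom A f)" using c o by
      (simp_all add: elements_sel)
  have "Cod p.El (f, ?s) = Dom p.El (g, act M f ?s)" "c \<in> cobj (ob (tdom k) (Dom p.El (f, ?s)))"
    using c o f(3) by (simp_all add: elements_sel(4,5) tdom_k)
  from k.tnat_composite[OF f(1,2) this] show ?case
    using c o f(3) by (simp add: elements_sel(4,5,10) tdom_k tcod_k)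
qed (simp_all, simp_all add: glue_comp_def glue_nat_def)

end

context sketch_model
begin

lemma fibre_tr_full:
  assumes p: "p \<in> Obj Sl" and q: "q \<in> Obj Sl"
    and k: "k \<in> Mor PsE" "tdom k = fibre_ob p" "tcod k = fibre_ob q"
  shows "\<exists>h. (p, h, q) \<in> Mor Sl \<and> fibre_tr p h q = k"
proof -
  interpret fibre_pt small A M p q k
    using Sl_over_disc[OF p] Sl_over_disc[OF q] PsE_Mor[OF k(1)] k(2,3)
    by (simp add: fibre_pt_def fibre_pt_axioms_def)
  have "glue \<in> Mor Ps"
    using pseudo_f_transformation_glue p q by (simp add: PsMod_sel Sl_Obj_iff)
  then have m: "(p, glue, q) \<in> Mor Sl" using p q by (simp add: Sl_Mor_iff)
  interpret h: over_disc_mor small A M p glue q using m by (rule Sl_over_disc_mor)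
  have "fibre_tr p glue q = k"
  proof (rule cat_pt_eqI[OF PsE_Mor[OF fibre_tr_PsE[OF m]] PsE_Mor[OF k(1)]])
    show "fobj (tcomp (fibre_tr p glue q) x) c = fobj (tcomp k x) c"
      if "x \<in> Obj El" "c \<in> cobj (ob (tdom k) x)" for x c
      using that by (cases x) (auto simp: elements_sel k(2))
    show "farr (tcomp (fibre_tr p glue q) x) c = farr (tcomp k x) c"
      if "x \<in> Obj El" "c \<in> carr (ob (tdom k) x)" for x c
      using that by (cases x) (auto simp: elements_sel k(2))
    show "ncomp (tnat (fibre_tr p glue q) f) c = ncomp (tnat k f) c"
      if "f \<in> Mor El" "c \<in> cobj (ob (tdom k) (Dom El f))" for f c
      using that by (cases f) (auto simp: elements_sel k(2))
  qed (simp_all add: k)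
  with m show ?thesis by blast
qed

text \<open>As for 1-cells, the component at an object is taken from the fibre over its grade.\<close>

lemma fibre_md_full:
  assumes h: "(p, h, q) \<in> Mor Sl" and h': "(p, h', q) \<in> Mor Sl"
    and \<Delta>: "\<Delta> \<in> Cell PsE" "mdom \<Delta> = fibre_tr p h q" "mcod \<Delta> = fibre_tr p h' q"
  shows "\<exists>\<Gamma>. (p, \<Gamma>, q) \<in> Cell Sl \<and> mdom \<Gamma> = h \<and> mcod \<Gamma> = h' \<and> fibre_md p \<Gamma> q = \<Delta>"
proof -
  interpret h: over_disc_mor small A M p h q using h by (rule Sl_over_disc_mor)
  interpret h': over_disc_mor small A M p h' q using h' by (rule Sl_over_disc_mor)
  have md: "modification El (CAT small) \<Delta>" using \<Delta>(1) by (rule PsE_Cell)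
  interpret \<Delta>: cat_md El small \<Delta> using md by (simp add: cat_md_def)
  let ?P = "\<lambda>x. fobj (tcomp p x)"
  define G where "G = (\<lambda>x\<in>Obj A. \<lparr>ndom = tcomp h x, ncod = tcomp h' x,
    ncomp = (\<lambda>c\<in>cobj (ob (tdom p) x). ncomp (mcomp \<Delta> (x, ?P x c)) c)\<rparr>)"
  have G_sel [simp]: "ndom (G x) = tcomp h x" "ncod (G x) = tcomp h' x"
    "c \<in> cobj (ob (tdom p) x) \<Longrightarrow> ncomp (G x) c = ncomp (mcomp \<Delta> (x, ?P x c)) c" if "x \<in> Obj A" for x
        c
    using that by (simp_all add: G_def)
  define \<Gamma> where "\<Gamma> = \<lparr>mdom = h, mcod = h', mcomp = G\<rparr>"
  have \<Gamma>_sel [simp]: "mdom \<Gamma> = h" "mcod \<Gamma> = h'" "mcomp \<Gamma> = G" by (simp_all add: \<Gamma>_def)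
  have \<Delta>_simps [simp]: "ncomp (mcomp \<Delta> (x, s)) c \<in> carr (ob (tdom q) x)"
    "cdom (ob (tdom q) x) (ncomp (mcomp \<Delta> (x, s)) c) = fobj (tcomp h x) c"
    "ccod (ob (tdom q) x) (ncomp (mcomp \<Delta> (x, s)) c) = fobj (tcomp h' x) c"
    if "x \<in> Obj A" "c \<in> cobj (ob (tdom p) x)" "?P x c = s" for x c s
  proof -
    have x: "(x, s) \<in> Obj El" and s: "s \<in> el M x" using that by (auto simp: elements_sel)
    note n = \<Delta>.mcomp_simps[OF x, of c, unfolded \<Delta>(2,3)]
    have 1: "ncomp (mcomp \<Delta> (x, s)) c \<in> carr (ob (tdom q) x)"
      "fobj (tcomp q x) (cdom (ob (tdom q) x) (ncomp (mcomp \<Delta> (x, s)) c)) = s"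
      using n(1) s that by auto
    then show "ncomp (mcomp \<Delta> (x, s)) c \<in> carr (ob (tdom q) x)"
      "cdom (ob (tdom q) x) (ncomp (mcomp \<Delta> (x, s)) c) = fobj (tcomp h x) c"
      "ccod (ob (tdom q) x) (ncomp (mcomp \<Delta> (x, s)) c) = fobj (tcomp h' x) c"
      using n(2,3) s that by auto
  qed
  have G_nattr: "natural_transformation (G x)" if x: "x \<in> Obj A" for x
  proof (intro natural_transformation.intro natural_transformation_axioms.intro, goal_cases)
    case (8 a)
    then have a: "a \<in> carr (ob (tdom p) x)" using x by simp
    let ?s = "?P x (cdom (ob (tdom p) x) a)"
    have xs: "(x, ?s) \<in> Obj El" "?s \<in> el M x" using x a by (simp_all add: elements_sel)
    have "a \<in> carr (ob (tdom (mdom \<Delta>)) (x, ?s))" using a x xs(2) by (simp add: \<Delta>(2))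
    from \<Delta>.mcomp_naturality[OF xs(1) this] show ?case using x a xs(2) by (simp add: \<Delta>(2,3))
  next
    case 9
    then show ?case using x by (simp add: G_def)
  qed (use x in simp_all)
  have "modification A (CAT small) \<Gamma>"
  proof (rule modification_CAT_I, goal_cases)
    case 1
    then show ?case using h.h.cat_pt_axioms by simp
  next
    case 2
    then show ?case using h'.h.cat_pt_axioms by simp
  next
    case (6 f c)
    then have c: "f \<in> Mor A" "c \<in> cobj (ob (tdom p) (Dom A f))" by simp_all
    let ?s = "?P (Dom A f) c"
    have o: "Dom A f \<in> Obj A" "Cod A f \<in> Obj A" using c by auto
    have f: "(f, ?s) \<in> Mor El" "?s \<in> el M (Dom A f)" using c o by (simp_all add: elements_sel)
    have "cat_pt El small (mdom \<Delta>)" "cat_pt El small (mcod \<Delta>)"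
      using PsE_Mor[OF fibre_tr_PsE[OF h]] PsE_Mor[OF fibre_tr_PsE[OF h']] by (simp_all add: \<Delta>(2,3))
    moreover have "c \<in> cobj (ob (tdom (mdom \<Delta>)) (Dom El (f, ?s)))"
      using c o f(2) by (simp add: \<Delta>(2) elements_sel(4))
    ultimately show ?case
      using modification_CAT_D[OF md _ _ f(1)] c o f(2) by (simp add: \<Delta>(2,3) elements_sel(4,5))
  qed (simp_all add: G_nattr, simp add: G_def)
  then have c: "(p, \<Gamma>, q) \<in> Cell Sl" using h h' by (simp add: Sl_Cell_iff PsMod_sel(3)) (simp add:
      Sl_Mor_iff)
  moreover have "fibre_md p \<Gamma> q = \<Delta>"
  proof (rule cat_md_eqI[OF PsE_Cell[OF fibre_md_PsE[OF c]] md])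
    show "ncomp (mcomp (fibre_md p \<Gamma> q) x) c = ncomp (mcomp \<Delta> x) c"
      if "x \<in> Obj El" "c \<in> cobj (ob (tdom (mdom \<Delta>)) x)" for x c
      using that by (cases x) (auto simp: elements_sel \<Delta>(2))
  qed (simp_all add: \<Delta>)
  ultimately show ?thesis using \<Gamma>_sel by blast
qed

end

section \<open>Isomorphisms that are strictly natural\<close>

text \<open>Functors that commute strictly with all functors and all compositors of \<open>F\<close> and \<open>G\<close>.\<close>

definition strict_family where
  "strict_family A F G \<theta> \<longleftrightarrow>
     (\<forall>x\<in>Obj A. cat_functor (\<theta> x) \<and> fdom (\<theta> x) = ob F x \<and> fcod (\<theta> x) = ob G x) \<and>
     (\<forall>f\<in>Mor A. func_comp (\<theta> (Cod A f)) (mo F f) = func_comp (mo G f) (\<theta> (Dom A f))) \<and>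
     (\<forall>f\<in>Mor A. \<forall>g\<in>Mor A. Cod A f = Dom A g \<longrightarrow> (\<forall>c\<in>cobj (ob F (Dom A f)).
        farr (\<theta> (Cod A g)) (ncomp (cp F g f) c) = ncomp (cp G g f) (fobj (\<theta> (Dom A f)) c)))"

definition strict_trans where
  "strict_trans A F G \<theta> = \<lparr>tdom = F, tcod = G, tcomp = restrict \<theta> (Obj A),
     tnat = (\<lambda>f\<in>Mor A. nattr_id (func_comp (mo G f) (\<theta> (Dom A f))))\<rparr>"

lemma strict_trans_sel [simp]:
  "tdom (strict_trans A F G \<theta>) = F" "tcod (strict_trans A F G \<theta>) = G"
  "x \<in> Obj A \<Longrightarrow> tcomp (strict_trans A F G \<theta>) x = \<theta> x"
  "f \<in> Mor A \<Longrightarrow> tnat (strict_trans A F G \<theta>) f = nattr_id (func_comp (mo G f) (\<theta> (Dom A f)))"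
  by (simp_all add: strict_trans_def)

lemma strict_trans_pseudo:
  fixes A :: "('o, 'm, 'c, 'y) fcat_scheme"
  assumes F: "cat_pf A small F" and G: "cat_pf A small G" and \<theta>: "strict_family A F G \<theta>"
  shows "pseudo_f_transformation A (CAT small) (strict_trans A F G \<theta>)"
proof -
  interpret F: cat_pf A small F by fact
  interpret G: cat_pf A small G by fact
  have t: "cat_functor (\<theta> x)" "fdom (\<theta> x) = ob F x" "fcod (\<theta> x) = ob G x" if "x \<in> Obj A" for x
    using \<theta> that by (simp_all add: strict_family_def)
  have n: "func_comp (\<theta> (Cod A f)) (mo F f) = func_comp (mo G f) (\<theta> (Dom A f))" if "f \<in> Mor A" for f
    using \<theta> that by (simp add: strict_family_def)
  have m: "farr (\<theta> (Cod A g)) (ncomp (cp F g f) c) = ncomp (cp G g f) (fobj (\<theta> (Dom A f)) c)"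
    if "f \<in> Mor A" "g \<in> Mor A" "Cod A f = Dom A g" "c \<in> cobj (ob F (Dom A f))" for f g c
    using \<theta> that unfolding strict_family_def by blast
  have to: "fobj (\<theta> x) c \<in> cobj (ob G x)" if "x \<in> Obj A" "c \<in> cobj (ob F x)" for x c
    using cat_functor.functor_simps(1)[OF t(1)[OF that(1)], of c] t that by simp
  have no: "fobj (\<theta> (Cod A f)) (fobj (mo F f) c) = fobj (mo G f) (fobj (\<theta> (Dom A f)) c)"
    if "f \<in> Mor A" "c \<in> cobj (ob F (Dom A f))" for f c
    using arg_cong[OF n[OF that(1)], of "\<lambda>H. fobj H c"] that t by simp
  show ?thesis
  proof (rule pseudo_f_transformation_CAT_I[OF F.discrete], goal_cases)
    case (4 f)
    then show ?case using n[OF 4] t by (simp add: natural_transformation_id cat_functor_comp)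
  next
    case (5 f c)
    then show ?case using t to category.cat_iso_cid[of "ob G (Cod A f)"] by simp
  next
    case (8 f g c)
    then have c: "f \<in> Mor A" "g \<in> Mor A" "Cod A f = Dom A g" "c \<in> cobj (ob F (Dom A f))" by simp_all
    have o: "Dom A f \<in> Obj A" "Dom A g \<in> Obj A" "Cod A g \<in> Obj A" "Dom A (g \<cdot>\<^bsub>A\<^esub> f) = Dom A f"
      "Cod A (g \<cdot>\<^bsub>A\<^esub> f) = Cod A g" using c by auto
    have i: "farr (mo G g) (cid (ob G (Dom A g)) (fobj (mo G f) (fobj (\<theta> (Dom A f)) c)))
        = cid (ob G (Cod A g)) (fobj (mo G g) (fobj (mo G f) (fobj (\<theta> (Dom A f)) c)))"
      using G.mo_cid[of g "fobj (mo G f) (fobj (\<theta> (Dom A f)) c)"] c o to by simp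
    show ?case using c o to t m[OF c] no[OF c(1,4)] no[OF c(2), of "fobj (mo F f) c"] i by simp
  qed (use F.pseudo_f_functor_axioms G.pseudo_f_functor_axioms t to n in
      \<open>simp_all\<close>, simp_all add: strict_trans_def)
qed

lemma strict_family_inverse:
  fixes A :: "('o, 'm, 'c, 'y) fcat_scheme"
  assumes F: "cat_pf A small F" and G: "cat_pf A small G" and \<theta>: "strict_family A F G \<theta>"
    and \<theta>': "\<And>x. x \<in> Obj A \<Longrightarrow> cat_functor (\<theta>' x) \<and> fdom (\<theta>' x) = ob G x \<and> fcod (\<theta>' x) = ob F x"
    and inv: "\<And>x. x \<in> Obj A \<Longrightarrow> func_comp (\<theta>' x) (\<theta> x) = func_id (ob F x)"
      "\<And>x. x \<in> Obj A \<Longrightarrow> func_comp (\<theta> x) (\<theta>' x) = func_id (ob G x)"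
  shows "strict_family A G F \<theta>'"
proof -
  interpret F: cat_pf A small F by fact
  interpret G: cat_pf A small G by fact
  have t: "cat_functor (\<theta> x)" "fdom (\<theta> x) = ob F x" "fcod (\<theta> x) = ob G x" if "x \<in> Obj A" for x
    using \<theta> that by (simp_all add: strict_family_def)
  have n: "func_comp (\<theta> (Cod A f)) (mo F f) = func_comp (mo G f) (\<theta> (Dom A f))" if "f \<in> Mor A" for f
    using \<theta> that by (simp add: strict_family_def)
  have m: "farr (\<theta> (Cod A g)) (ncomp (cp F g f) c) = ncomp (cp G g f) (fobj (\<theta> (Dom A f)) c)"
    if "f \<in> Mor A" "g \<in> Mor A" "Cod A f = Dom A g" "c \<in> cobj (ob F (Dom A f))" for f g c
    using \<theta> that unfolding strict_family_def by blast
  have no: "fobj (\<theta> (Cod A f)) (fobj (mo F f) c) = fobj (mo G f) (fobj (\<theta> (Dom A f)) c)"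
    if "f \<in> Mor A" "c \<in> cobj (ob F (Dom A f))" for f c
    using arg_cong[OF n[OF that(1)], of "\<lambda>H. fobj H c"] that t by simp
  have na: "farr (\<theta> (Cod A f)) (farr (mo F f) c) = farr (mo G f) (farr (\<theta> (Dom A f)) c)"
    if "f \<in> Mor A" "c \<in> carr (ob F (Dom A f))" for f c
    using arg_cong[OF n[OF that(1)], of "\<lambda>H. farr H c"] that t by simp
  have t': "fobj (\<theta>' x) c \<in> cobj (ob F x)" "fobj (\<theta> x) (fobj (\<theta>' x) c) = c"
    if "x \<in> Obj A" "c \<in> cobj (ob G x)" for x c
    using cat_functor.functor_simps(1)[of "\<theta>' x" c] \<theta>'[OF that(1)] that
      arg_cong[OF inv(2)[OF that(1)], of "\<lambda>H. fobj H c"] by simp_all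
  have ta': "farr (\<theta>' x) c \<in> carr (ob F x)" "farr (\<theta> x) (farr (\<theta>' x) c) = c"
    if "x \<in> Obj A" "c \<in> carr (ob G x)" for x c
    using cat_functor.functor_simps(2)[of "\<theta>' x" c] \<theta>'[OF that(1)] that
      arg_cong[OF inv(2)[OF that(1)], of "\<lambda>H. farr H c"] by simp_all
  have r: "fobj (\<theta>' x) (fobj (\<theta> x) c) = c" if "x \<in> Obj A" "c \<in> cobj (ob F x)" for x c
    using arg_cong[OF inv(1)[OF that(1)], of "\<lambda>H. fobj H c"] that t by simp
  have ra: "farr (\<theta>' x) (farr (\<theta> x) c) = c" if "x \<in> Obj A" "c \<in> carr (ob F x)" for x c
    using arg_cong[OF inv(1)[OF that(1)], of "\<lambda>H. farr H c"] that t by simp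
  have "func_comp (\<theta>' (Cod A f)) (mo G f) = func_comp (mo F f) (\<theta>' (Dom A f))" if f: "f \<in> Mor A" for
      f
  proof -
    have o: "Dom A f \<in> Obj A" "Cod A f \<in> Obj A" using f by auto
    have "fobj (\<theta>' (Cod A f)) (fobj (mo G f) c) = fobj (mo F f) (fobj (\<theta>' (Dom A f)) c)"
      if "c \<in> cobj (ob G (Dom A f))" for c
      using no[OF f, of "fobj (\<theta>' (Dom A f)) c"] t'[OF o(1) that] r[OF o(2), of "fobj (mo F f) (fobj
          (\<theta>' (Dom A f)) c)"] f
      by simp
    moreover have "farr (\<theta>' (Cod A f)) (farr (mo G f) c) = farr (mo F f) (farr (\<theta>' (Dom A f)) c)"
      if "c \<in> carr (ob G (Dom A f))" for c
      using na[OF f, of "farr (\<theta>' (Dom A f)) c"] ta'[OF o(1) that] ra[OF o(2), of "farr (mo F f)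
          (farr (\<theta>' (Dom A f)) c)"] f
      by simp
    ultimately show ?thesis
      by (intro func_eqI) (use f o \<theta>' in \<open>simp_all add: cat_functor_comp\<close>)
  qed
  moreover have "farr (\<theta>' (Cod A g)) (ncomp (cp G g f) c) = ncomp (cp F g f) (fobj (\<theta>' (Dom A f))
      c)"
    if c: "f \<in> Mor A" "g \<in> Mor A" "Cod A f = Dom A g" "c \<in> cobj (ob G (Dom A f))" for f g c
  proof -
    have o: "Dom A f \<in> Obj A" "Cod A g \<in> Obj A" using c by auto
    show ?thesis
      using m[OF c(1-3), of "fobj (\<theta>' (Dom A f)) c"] t'[OF o(1) c(4)]
        ra[OF o(2), of "ncomp (cp F g f) (fobj (\<theta>' (Dom A f)) c)"] c by simp
  qed
  ultimately show ?thesis using \<theta>' by (simp add: strict_family_def)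
qed

lemma strict_trans_inverse:
  fixes A :: "('o, 'm, 'c, 'i, 'j, 'k) fsketch"
  assumes A: "locally_discrete A" and F: "F \<in> Obj (PsMod A (CAT small))" and G: "G \<in> Obj (PsMod A
      (CAT small))"
    and \<theta>: "strict_family A F G \<theta>" and \<theta>': "strict_family A G F \<theta>'"
    and inv: "\<And>x. x \<in> Obj A \<Longrightarrow> func_comp (\<theta>' x) (\<theta> x) = func_id (ob F x)"
  shows "strict_trans A F G \<theta> \<in> hom (PsMod A (CAT small)) F G"
    and "pstrans_comp A (CAT small) (strict_trans A G F \<theta>') (strict_trans A F G \<theta>) = Idm (PsMod A
        (CAT small)) F"
proof -
  interpret P: two_category "PsMod A (CAT small)" by (rule two_category_PsMod)
  have FG: "cat_pf A small F" "cat_pf A small G"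
    using F G A by (simp_all add: PsMod_sel pseudo_model_def cat_pf_def cat_pf_axioms_def)
  interpret F: cat_pf A small F by (rule FG)
  interpret G: cat_pf A small G by (rule FG)
  have h: "strict_trans A F G \<theta> \<in> hom (PsMod A (CAT small)) F G"
    "strict_trans A G F \<theta>' \<in> hom (PsMod A (CAT small)) G F"
    using strict_trans_pseudo[OF FG \<theta>] strict_trans_pseudo[OF FG(2,1) \<theta>'] F G
    by (simp_all add: hom_def PsMod_sel)
  show "strict_trans A F G \<theta> \<in> hom (PsMod A (CAT small)) F G" by (rule h)
  have pt: "cat_pt A small \<alpha>" if "\<alpha> \<in> Mor (PsMod A (CAT small))" for \<alpha>
    using that A by (simp add: PsMod_sel cat_pt_def cat_pt_axioms_def)
  have t: "cat_functor (\<theta> x)" "fdom (\<theta> x) = ob F x" "fcod (\<theta> x) = ob G x" if "x \<in> Obj A" for x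
    using \<theta> that by (simp_all add: strict_family_def)
  have t': "cat_functor (\<theta>' x)" "fdom (\<theta>' x) = ob G x" "fcod (\<theta>' x) = ob F x" if "x \<in> Obj A" for x
    using \<theta>' that by (simp_all add: strict_family_def)
  have to: "fobj (\<theta> x) c \<in> cobj (ob G x)" if "x \<in> Obj A" "c \<in> cobj (ob F x)" for x c
    using cat_functor.functor_simps(1)[OF t(1)[OF that(1)], of c] t that by simp
  have r: "fobj (\<theta>' x) (fobj (\<theta> x) c) = c" if "x \<in> Obj A" "c \<in> cobj (ob F x)" for x c
    using arg_cong[OF inv[OF that(1)], of "\<lambda>H. fobj H c"] that t by simp
  have n': "fobj (\<theta>' (Cod A f)) (fobj (mo G f) c) = fobj (mo F f) (fobj (\<theta>' (Dom A f)) c)"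
    if "f \<in> Mor A" "c \<in> cobj (ob G (Dom A f))" for f c
  proof -
    have "func_comp (\<theta>' (Cod A f)) (mo G f) = func_comp (mo F f) (\<theta>' (Dom A f))"
      using \<theta>' that(1) by (simp add: strict_family_def)
    from arg_cong[OF this, of "\<lambda>H. fobj H c"] show ?thesis using that t' by simp
  qed
  show "pstrans_comp A (CAT small) (strict_trans A G F \<theta>') (strict_trans A F G \<theta>) = Idm (PsMod A
      (CAT small)) F"
  proof (rule cat_pt_eqI)
    show "cat_pt A small (pstrans_comp A (CAT small) (strict_trans A G F \<theta>') (strict_trans A F G
        \<theta>))"
      using P.Cmp_hom[OF h] by (intro pt) (simp add: hom_def PsMod_sel(10))
    show "cat_pt A small (Idm (PsMod A (CAT small)) F)" by (intro pt P.Mor_simps(1) F)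
    show "fobj (tcomp (pstrans_comp A (CAT small) (strict_trans A G F \<theta>') (strict_trans A F G \<theta>)) x)
        c
      = fobj (tcomp (Idm (PsMod A (CAT small)) F) x) c"
      if "x \<in> Obj A" "c \<in> cobj (ob (tdom (Idm (PsMod A (CAT small)) F)) x)" for x c
      using that by (simp add: PsMod_sel(8) CAT_sel(8,10) inv)
    show "farr (tcomp (pstrans_comp A (CAT small) (strict_trans A G F \<theta>') (strict_trans A F G \<theta>)) x)
        c
      = farr (tcomp (Idm (PsMod A (CAT small)) F) x) c"
      if "x \<in> Obj A" "c \<in> carr (ob (tdom (Idm (PsMod A (CAT small)) F)) x)" for x c
      using that by (simp add: PsMod_sel(8) CAT_sel(8,10) inv)
    show "ncomp (tnat (pstrans_comp A (CAT small) (strict_trans A G F \<theta>') (strict_trans A F G \<theta>)) f)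
        c
      = ncomp (tnat (Idm (PsMod A (CAT small)) F) f) c"
      if c: "f \<in> Mor A" "c \<in> cobj (ob (tdom (Idm (PsMod A (CAT small)) F)) (Dom A f))" for f c
    proof -
      have fc: "c \<in> cobj (ob F (Dom A f))" and o: "Dom A f \<in> Obj A" "Cod A f \<in> Obj A"
        using c by (auto simp: PsMod_sel(8))
      have "farr (\<theta>' (Cod A f)) (cid (ob G (Cod A f)) (fobj (mo G f) (fobj (\<theta> (Dom A f)) c)))
          = cid (ob F (Cod A f)) (fobj (mo F f) c)"
        using cat_functor.functor_simps(5)[OF t'(1)[OF o(2)], of "fobj (mo G f) (fobj (\<theta> (Dom A f))
            c)"]
          t'[OF o(2)] n'[OF c(1), of "fobj (\<theta> (Dom A f)) c"] r[OF o(1) fc] to[OF o(1) fc] c(1) by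
              simp
      then show ?thesis
        using ncomp_tnat_comp[OF pt pt, of "strict_trans A F G \<theta>" "strict_trans A G F \<theta>'" f c] h
            c(1) fc o
          t t' to[OF o(1) fc] r[OF o(1) fc]
        by (simp add: hom_def PsMod_sel(8) CAT_sel(9) del: pstrans_comp_sel)
    qed
  qed (simp_all add: PsMod_sel(8))
qed

lemma strict_iso:
  fixes A :: "('o, 'm, 'c, 'i, 'j, 'k) fsketch"
  assumes A: "locally_discrete A" and F: "F \<in> Obj (PsMod A (CAT small))" and G: "G \<in> Obj (PsMod A
      (CAT small))"
    and \<theta>: "strict_family A F G \<theta>"
    and \<theta>': "\<And>x. x \<in> Obj A \<Longrightarrow> cat_functor (\<theta>' x) \<and> fdom (\<theta>' x) = ob G x \<and> fcod (\<theta>' x) = ob F x"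
    and inv: "\<And>x. x \<in> Obj A \<Longrightarrow> func_comp (\<theta>' x) (\<theta> x) = func_id (ob F x)"
      "\<And>x. x \<in> Obj A \<Longrightarrow> func_comp (\<theta> x) (\<theta>' x) = func_id (ob G x)"
  shows "\<exists>e\<in>hom (PsMod A (CAT small)) F G. invertible_mor (PsMod A (CAT small)) e"
proof -
  have FG: "cat_pf A small F" "cat_pf A small G"
    using F G A by (simp_all add: PsMod_sel pseudo_model_def cat_pf_def cat_pf_axioms_def)
  have i: "strict_family A G F \<theta>'" by (rule strict_family_inverse[OF FG \<theta> \<theta>' inv])
  note 1 = strict_trans_inverse[OF A F G \<theta> i inv(1)] and 2 = strict_trans_inverse[OF A G F i \<theta>
      inv(2)]
  have "invertible_mor (PsMod A (CAT small)) (strict_trans A F G \<theta>)"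
    unfolding invertible_mor_def
    using 1 2 by (auto simp: hom_def PsMod_sel(4,5,10) intro!: bexI[of _ "strict_trans A G F \<theta>'"])
  with 1(1) show ?thesis by blast
qed

section \<open>Taking fibres is essentially surjective\<close>

text \<open>
  As the type of elements is infinite, pairs can be encoded in it; this is how coproducts of
  categories are formed inside a fixed type.
\<close>

definition pairing :: "'u \<times> 'u \<Rightarrow> 'u" where
  "pairing = (SOME f. inj f)"

definition tag :: "'u \<Rightarrow> 'u \<Rightarrow> 'u" where
  "tag s c = pairing (s, c)"

definition tag_of :: "'u \<Rightarrow> 'u" where
  "tag_of u = fst (inv pairing u)"

definition untag :: "'u \<Rightarrow> 'u" where
  "untag u = snd (inv pairing u)"

context universe
begin

lemma inj_pairing: "inj (pairing :: 'u \<times> 'u \<Rightarrow> 'u)"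
proof -
  obtain X :: "'u set" where "infinite X" using small_infinite by blast
  then have "infinite (UNIV :: 'u set)" using finite_subset[OF subset_UNIV] by auto
  from card_of_Times_same_infinite[OF this]
  obtain f :: "'u \<times> 'u \<Rightarrow> 'u" where "bij_betw f (UNIV \<times> UNIV) UNIV"
    unfolding card_of_ordIso[symmetric] by blast
  then have "inj f" by (simp add: bij_betw_def)
  then show ?thesis unfolding pairing_def by (rule someI[where P = inj])
qed

lemma tag_simps [simp]:
  fixes s c :: 'u
  shows "tag_of (tag s c) = s" "untag (tag s c) = c" "tag s c = tag s' c' \<longleftrightarrow> s = s' \<and> c = c'"
  using inj_pairing by (auto simp: tag_def tag_of_def untag_def inj_eq)

end

text \<open>
  The total pseudo-model of a family \<open>F\<close> indexed by the elements of \<open>M\<close> is the coproduct of the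
  categories \<open>F (x, s)\<close> over all \<open>s \<in> M x\<close>, whose objects and arrows are tagged by \<open>s\<close>.
\<close>

locale element_family = sketch_model small A M
  for small :: "'u set \<Rightarrow> bool" and A :: "('o, 'm, 'c, 'i, 'j, 'k) fsketch"
    and M :: "('o, 'm, 'u) setfun" +
  fixes F :: "('o \<times> 'u, 'm \<times> 'u, 'c \<times> 'u, 'u cat, 'u func, 'u nattr) psfun"
  assumes model_F: "F \<in> Obj (PsMod (elements A M) (CAT small))"
begin

lemma cat_pf_F: "cat_pf El small F"
  using model_F discrete_El by (simp add: PsMod_sel pseudo_model_def cat_pf_def cat_pf_axioms_def)

sublocale F: cat_pf El small F by (rule cat_pf_F)

declare elements_sel(1,2,4,5,8,10) [simp]

definition total :: "'o \<Rightarrow> 'u cat" where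
  "total x = \<lparr>cobj = (\<Union>s\<in>el M x. tag s ` cobj (ob F (x, s))),
     carr = (\<Union>s\<in>el M x. tag s ` carr (ob F (x, s))),
     cdom = (\<lambda>u\<in>(\<Union>s\<in>el M x. tag s ` carr (ob F (x, s))). tag (tag_of u) (cdom (ob F (x, tag_of u))
         (untag u))),
     ccod = (\<lambda>u\<in>(\<Union>s\<in>el M x. tag s ` carr (ob F (x, s))). tag (tag_of u) (ccod (ob F (x, tag_of u))
         (untag u))),
     cid = (\<lambda>u\<in>(\<Union>s\<in>el M x. tag s ` cobj (ob F (x, s))). tag (tag_of u) (cid (ob F (x, tag_of u))
         (untag u))),
     ccmp = (\<lambda>b a. if \<exists>s\<in>el M x. \<exists>a'\<in>carr (ob F (x, s)). \<exists>b'\<in>carr (ob F (x, s)).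
         a = tag s a' \<and> b = tag s b' \<and> ccod (ob F (x, s)) a' = cdom (ob F (x, s)) b'
       then tag (tag_of a) (ccmp (ob F (x, tag_of a)) (untag b) (untag a)) else undefined)\<rparr>"

lemma total_mem [simp]:
  "tag s c \<in> cobj (total x) \<longleftrightarrow> s \<in> el M x \<and> c \<in> cobj (ob F (x, s))"
  "tag s c \<in> carr (total x) \<longleftrightarrow> s \<in> el M x \<and> c \<in> carr (ob F (x, s))"
  by (auto simp: total_def)

lemma total_cobjE: "\<lbrakk>u \<in> cobj (total x); \<And>s c. \<lbrakk>u = tag s c; s \<in> el M x; c \<in> cobj (ob F (x, s))\<rbrakk> \<Longrightarrow>
    thesis\<rbrakk> \<Longrightarrow> thesis"
  by (auto simp: total_def)

lemma total_carrE: "\<lbrakk>u \<in> carr (total x); \<And>s c. \<lbrakk>u = tag s c; s \<in> el M x; c \<in> carr (ob F (x, s))\<rbrakk> \<Longrightarrow>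
    thesis\<rbrakk> \<Longrightarrow> thesis"
  by (auto simp: total_def)

lemma total_ops [simp]:
  "\<lbrakk>s \<in> el M x; a \<in> carr (ob F (x, s))\<rbrakk> \<Longrightarrow> cdom (total x) (tag s a) = tag s (cdom (ob F (x, s)) a)"
  "\<lbrakk>s \<in> el M x; a \<in> carr (ob F (x, s))\<rbrakk> \<Longrightarrow> ccod (total x) (tag s a) = tag s (ccod (ob F (x, s)) a)"
  "\<lbrakk>s \<in> el M x; c \<in> cobj (ob F (x, s))\<rbrakk> \<Longrightarrow> cid (total x) (tag s c) = tag s (cid (ob F (x, s)) c)"
  "\<lbrakk>s \<in> el M x; a \<in> carr (ob F (x, s)); b \<in> carr (ob F (x, s)); ccod (ob F (x, s)) a = cdom (ob F
      (x, s)) b\<rbrakk>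
    \<Longrightarrow> ccmp (total x) (tag s b) (tag s a) = tag s (ccmp (ob F (x, s)) b a)"
  by (auto simp: total_def)

lemma total_composableE:
  assumes "f \<in> carr (total x)" "g \<in> carr (total x)" "ccod (total x) f = cdom (total x) g"
  obtains s a b where "f = tag s a" "g = tag s b" "s \<in> el M x" "a \<in> carr (ob F (x, s))"
    "b \<in> carr (ob F (x, s))" "ccod (ob F (x, s)) a = cdom (ob F (x, s)) b"
proof -
  from assms(1) obtain s a where f: "f = tag s a" "s \<in> el M x" "a \<in> carr (ob F (x, s))" by (rule
      total_carrE)
  from assms(2) obtain t b where g: "g = tag t b" "t \<in> el M x" "b \<in> carr (ob F (x, t))" by (rule
      total_carrE)
  have "t = s \<and> ccod (ob F (x, s)) a = cdom (ob F (x, t)) b" using assms(3) f g by auto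
  with f g show thesis by (intro that[of s a b]) auto
qed

lemma category_total [simp]:
  assumes x: "x \<in> Obj A"
  shows "category (total x)"
proof (unfold_locales, goal_cases)
  case (1 f)
  then show ?case by (rule total_carrE) (use x in simp)
next
  case (2 f)
  then show ?case by (rule total_carrE) (use x in simp)
next
  case (3 c)
  then show ?case by (rule total_cobjE) (use x in simp)
next
  case (4 c)
  then show ?case by (rule total_cobjE) (use x in simp)
next
  case (5 c)
  then show ?case by (rule total_cobjE) (use x in simp)
next
  case (6 f g)
  then show ?case by (rule total_composableE) (use x in simp)
next
  case (7 f g)
  then show ?case by (rule total_composableE) (use x in simp)
next
  case (8 f g)
  then show ?case by (rule total_composableE) (use x in simp)
next
  case (9 f)
  then show ?case by (rule total_carrE) (use x in simp)
next
  case (10 f)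
  then show ?case by (rule total_carrE) (use x in simp)
next
  case (11 f g h)
  obtain s a b where f: "f = tag s a" "g = tag s b" "s \<in> el M x" "a \<in> carr (ob F (x, s))"
    "b \<in> carr (ob F (x, s))" "ccod (ob F (x, s)) a = cdom (ob F (x, s)) b"
    using total_composableE[OF 11(1,2,4)] by metis
  obtain t b' d where h: "g = tag t b'" "h = tag t d" "d \<in> carr (ob F (x, t))"
    "ccod (ob F (x, t)) b' = cdom (ob F (x, t)) d"
    using total_composableE[OF 11(2,3,5)] by metis
  have "category (ob F (x, s))" using x f(3) by simp
  from category.cat_simps(11)[OF this f(4,5), of d] show ?case using f h x by simp
next
  case (15 f g)
  have "\<not> (\<exists>s\<in>el M x. \<exists>a\<in>carr (ob F (x, s)). \<exists>b\<in>carr (ob F (x, s)).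
      f = tag s a \<and> g = tag s b \<and> ccod (ob F (x, s)) a = cdom (ob F (x, s)) b)"
    using 15 by (metis total_mem(2) total_ops(1,2))
  then show ?case unfolding total_def by (simp only: cat.simps if_False)
qed (simp_all add: total_def)

lemma total_Obj [simp]:
  assumes x: "x \<in> Obj A"
  shows "total x \<in> Obj (CAT small)"
proof -
  have "small (cobj (ob F (x, s)))" "small (carr (ob F (x, s)))" if "s \<in> el M x" for s
    using F.pf_simps(1)[of "(x, s)"] x that by (simp_all add: CAT_sel)
  then have "small (cobj (total x))" "small (carr (total x))"
    using x by (simp_all add: total_def small_Union small_image)
  then show ?thesis using x by (simp add: CAT_sel)
qed

definition total_func :: "'m \<Rightarrow> 'u func" where
  "total_func = (\<lambda>f\<in>Mor A. \<lparr>fdom = total (Dom A f), fcod = total (Cod A f),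
     fobj = (\<lambda>u\<in>cobj (total (Dom A f)). tag (act M f (tag_of u)) (fobj (mo F (f, tag_of u)) (untag
         u))),
     farr = (\<lambda>u\<in>carr (total (Dom A f)). tag (act M f (tag_of u)) (farr (mo F (f, tag_of u)) (untag
         u)))\<rparr>)"

definition total_model :: "('o, 'm, 'c, 'u cat, 'u func, 'u nattr) psfun" where
  "total_model = \<lparr>ob = restrict total (Obj A), mo = total_func,
     ce = (\<lambda>\<gamma>\<in>Cell A. nattr_id (total_func (Src A \<gamma>))),
     un = (\<lambda>x\<in>Obj A. nattr_id (func_id (total x))),
     cp = (\<lambda>g f. if f \<in> Mor A \<and> g \<in> Mor A \<and> Cod A f = Dom A g
       then \<lparr>ndom = func_comp (total_func g) (total_func f), ncod = total_func (g \<cdot>\<^bsub>A\<^esub> f),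
         ncomp = (\<lambda>u\<in>cobj (total (Dom A f)). tag (act M (g \<cdot>\<^bsub>A\<^esub> f) (tag_of u))
           (ncomp (cp F (g, act M f (tag_of u)) (f, tag_of u)) (untag u)))\<rparr>
       else undefined)\<rparr>"

lemma total_func_sel [simp]:
  assumes "f \<in> Mor A"
  shows "fdom (total_func f) = total (Dom A f)" "fcod (total_func f) = total (Cod A f)"
    "\<lbrakk>s \<in> el M (Dom A f); c \<in> cobj (ob F (Dom A f, s))\<rbrakk>
      \<Longrightarrow> fobj (total_func f) (tag s c) = tag (act M f s) (fobj (mo F (f, s)) c)"
    "\<lbrakk>s \<in> el M (Dom A f); a \<in> carr (ob F (Dom A f, s))\<rbrakk>
      \<Longrightarrow> farr (total_func f) (tag s a) = tag (act M f s) (farr (mo F (f, s)) a)"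
  using assms by (simp_all add: total_func_def)

lemma total_model_sel [simp]:
  "x \<in> Obj A \<Longrightarrow> ob total_model x = total x" "mo total_model = total_func"
  "\<lbrakk>f \<in> Mor A; g \<in> Mor A; Cod A f = Dom A g\<rbrakk> \<Longrightarrow> ndom (cp total_model g f) = func_comp (total_func g)
      (total_func f)"
  "\<lbrakk>f \<in> Mor A; g \<in> Mor A; Cod A f = Dom A g\<rbrakk> \<Longrightarrow> ncod (cp total_model g f) = total_func (g \<cdot>\<^bsub>A\<^esub> f)"
  "\<lbrakk>f \<in> Mor A; g \<in> Mor A; Cod A f = Dom A g; s \<in> el M (Dom A f); c \<in> cobj (ob F (Dom A f, s))\<rbrakk>
    \<Longrightarrow> ncomp (cp total_model g f) (tag s c)
      = tag (act M g (act M f s)) (ncomp (cp F (g, act M f s) (f, s)) c)"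
  "\<lbrakk>f \<in> Mor A; g \<in> Mor A; Cod A f = Dom A g\<rbrakk>
    \<Longrightarrow> ncomp (cp total_model g f) \<in> extensional (cobj (total (Dom A f)))"
  by (simp_all add: total_model_def)

lemma F_cid:
  assumes "f \<in> Mor A" "s \<in> el M (Dom A f)" "c \<in> cobj (ob F (Dom A f, s))"
  shows "farr (mo F (f, s)) (cid (ob F (Dom A f, s)) c) = cid (ob F (Cod A f, act M f s)) (fobj (mo
      F (f, s)) c)"
  using F.mo_cid[of "(f, s)" c] assms by simp

lemma F_ccmp:
  assumes "f \<in> Mor A" "s \<in> el M (Dom A f)" "a \<in> carr (ob F (Dom A f, s))" "b \<in> carr (ob F (Dom A f,
      s))"
    "ccod (ob F (Dom A f, s)) a = cdom (ob F (Dom A f, s)) b"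
  shows "farr (mo F (f, s)) (ccmp (ob F (Dom A f, s)) b a)
    = ccmp (ob F (Cod A f, act M f s)) (farr (mo F (f, s)) b) (farr (mo F (f, s)) a)"
  using F.mo_ccmp[of "(f, s)" a b] assms by simp

lemma total_func_functor [simp]:
  assumes f: "f \<in> Mor A"
  shows "cat_functor (total_func f)"
proof -
  have o [simp]: "Dom A f \<in> Obj A" "Cod A f \<in> Obj A" using f by auto
  show ?thesis
  proof (intro cat_functor.intro cat_functor_axioms.intro, goal_cases)
    case (8 a b)
    then have "a \<in> carr (total (Dom A f))" "b \<in> carr (total (Dom A f))"
      "ccod (total (Dom A f)) a = cdom (total (Dom A f)) b" using f by simp_all
    then obtain s a' b' where "a = tag s a'" "b = tag s b'" "s \<in> el M (Dom A f)"
      "a' \<in> carr (ob F (Dom A f, s))" "b' \<in> carr (ob F (Dom A f, s))"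
      "ccod (ob F (Dom A f, s)) a' = cdom (ob F (Dom A f, s)) b'" by (rule total_composableE)
    then show ?case using f F_ccmp[of f s a' b'] by simp
  next
    case 9
    then show ?case using f by (simp add: total_func_def)
  next
    case 10
    then show ?case using f by (simp add: total_func_def)
  qed (use f F_cid in \<open>auto elim!: total_cobjE total_carrE\<close>)
qed

lemma pseudo_f_functor_total: "pseudo_f_functor A (CAT small) total_model"
proof (rule pseudo_f_functor_CAT_I[OF A.f_category_axioms discrete], goal_cases)
  case (3 x)
  have "fobj (total_func (Idm A x)) u = u" if "u \<in> cobj (total x)" for u
    using that 3 F.mo_Idm[of "(x, s)" for s] by (auto elim!: total_cobjE)
  moreover have "farr (total_func (Idm A x)) u = u" if "u \<in> carr (total x)" for u
    using that 3 F.mo_Idm[of "(x, s)" for s] by (auto elim!: total_carrE)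
  ultimately have "total_func (Idm A x) = func_id (total x)"
    by (intro func_eqI) (use 3 in \<open>simp_all add: cat_functor_id\<close>)
  then show ?case using 3 by simp
next
  case 4
  then show ?case by (simp add: total_model_def)
next
  case 5
  then show ?case by (auto simp: total_model_def)
next
  case (6 f g)
  have o [simp]: "Dom A f \<in> Obj A" "Dom A g \<in> Obj A" "Cod A g \<in> Obj A" using 6 by auto
  have "natural_transformation (cp total_model g f)"
  proof (intro natural_transformation.intro natural_transformation_axioms.intro, goal_cases)
    case (8 a)
    with 6 obtain s a' where a: "a = tag s a'" "s \<in> el M (Dom A f)" "a' \<in> carr (ob F (Dom A f, s))"
      by (auto elim: total_carrE)
    show ?case using 6 a F.cp_naturality[of "(f, s)" "(g, act M f s)" a'] by simp
  qed (use 6 in \<open>auto simp: cat_functor_comp elim!: total_cobjE total_carrE\<close>)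
  then show ?case using 6 by simp
next
  case (7 f g u)
  have o [simp]: "Dom A f \<in> Obj A" "Dom A g \<in> Obj A" "Cod A g \<in> Obj A" using 7 by auto
  from 7 obtain s c where u: "u = tag s c" "s \<in> el M (Dom A f)" "c \<in> cobj (ob F (Dom A f, s))"
    by (auto elim: total_cobjE)
  let ?t = "act M g (act M f s)" and ?i = "ncomp (cp F (g, act M f s) (f, s)) c"
  let ?D = "ob F (Cod A g, ?t)"
  have t: "?t \<in> el M (Cod A g)" using 7 u by simp
  then have "category ?D" by simp
  then interpret D: category ?D .
  obtain j where i: "?i \<in> carr ?D" and j: "j \<in> carr ?D" "cdom ?D j = ccod ?D ?i" "ccod ?D j = cdom
      ?D ?i"
    "ccmp ?D j ?i = cid ?D (cdom ?D ?i)" "ccmp ?D ?i j = cid ?D (ccod ?D ?i)"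
    using F.cp_iso[of "(f, s)" "(g, act M f s)" c] 7 u unfolding cat_iso_def by auto
  have "cat_iso (total (Cod A g)) (tag ?t ?i)"
    unfolding cat_iso_def
    by (intro conjI bexI[of _ "tag ?t j"])
      (use t i j D.cat_simps(1,2)[OF i] in \<open>simp_all del: F.cp_simps\<close>)
  then show ?case using 7 u by simp
next
  case (8 f g u)
  have o [simp]: "Dom A f \<in> Obj A" "Dom A g \<in> Obj A" "Cod A g \<in> Obj A" using 8 by auto
  from 8 obtain s c where u: "u = tag s c" "s \<in> el M (Dom A f)" "c \<in> cobj (ob F (Dom A f, s))"
    by (auto elim: total_cobjE)
  have "(f, s) \<in> inert El \<or> (g, act M f s) \<in> inert El" using 8 u by (auto simp: elements_sel(13))
  then show ?case using 8 u F.cp_inert(1)[of "(f, s)" "(g, act M f s)"] by simp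
next
  case (9 f g)
  have o [simp]: "Dom A f \<in> Obj A" "Dom A g \<in> Obj A" "Cod A g \<in> Obj A" using 9 by auto
  have m: "mo F (g \<cdot>\<^bsub>A\<^esub> f, s) = func_comp (mo F (g, act M f s)) (mo F (f, s))" if "s \<in> el M (Dom A f)"
      for s
    using F.cp_inert(2)[of "(f, s)" "(g, act M f s)"] 9 that by (auto simp: elements_sel(13))
  have "total_func (g \<cdot>\<^bsub>A\<^esub> f) = func_comp (total_func g) (total_func f)"
    by (rule func_eqI) (use 9 m in \<open>auto simp: cat_functor_comp elim!: total_cobjE total_carrE\<close>)
  then show ?case by simp
next
  case (10 f g h u)
  have o [simp]: "Dom A f \<in> Obj A" "Dom A g \<in> Obj A" "Dom A h \<in> Obj A" "Cod A h \<in> Obj A" using 10 by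
      auto
  from 10 obtain s c where u: "u = tag s c" "s \<in> el M (Dom A f)" "c \<in> cobj (ob F (Dom A f, s))"
    by (auto elim: total_cobjE)
  show ?case using 10(1-5) u F.cp_associative[of "(f, s)" "(g, act M f s)" "(h, act M g (act M f
      s))" c]
    by simp
next
  case 13
  then show ?case unfolding total_model_def by auto
qed (auto, auto simp: total_model_def total_func_def)

end

context element_family
begin

text \<open>
  Since \<open>M\<close> sends the marked cone \<open>S\<close> to a limit, the tags of a compatible family of arrows come
  from a unique element \<open>s\<close> over the vertex. The untagged family is then compatible along the
  cone that lies over \<open>S\<close> and starts at \<open>s\<close>, which is marked; so \<open>F\<close> sends it to a limit and the
  family lifts uniquely in the summand of \<open>s\<close>.
\<close>

lemma pseudo_model_total: "pseudo_model A (CAT small) total_model"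
  unfolding pseudo_model_CAT_iff[OF universe_small A.f_sketch_axioms discrete]
proof (intro conjI ballI pseudo_f_functor_total)
  fix S assume S: "S \<in> marked A"
  let ?J = "shape S"
  note c = cone_simps[OF A.f_category_axioms A.marked_cone[OF S]]
  interpret J: two_category ?J by (rule c(2))
  define l where "l = ob (legs S)"
  define k where "k u = triangle (mo (legs S) u)" for u
  let ?v = "vertex S"
  have v: "?v \<in> Obj A" by (rule c(1))
  have l: "l j \<in> Mor A" "Dom A (l j) = ?v" "Cod A (l j) \<in> Obj A" if "j \<in> Obj ?J" for j
    using c(3)[OF that] by (simp_all add: l_def)
  have k: "mo (legs S) u = (l (Dom ?J u), k u, l (Cod ?J u))" "k u \<in> Mor A"
    "Dom A (k u) = Cod A (l (Dom ?J u))" "Cod A (k u) = Cod A (l (Cod ?J u))"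
    "k u \<cdot>\<^bsub>A\<^esub> l (Dom ?J u) = l (Cod ?J u)" if "u \<in> Mor ?J" for u
    using c(4)[OF that] by (auto simp: l_def k_def triangle_def)
  show "arrow_limit ?J (\<lambda>j. ob total_model (Cod A (ob (legs S) j)))
      (\<lambda>u. mo total_model (triangle (mo (legs S) u))) (ob total_model ?v) (\<lambda>j. mo total_model (ob
          (legs S) j))"
    unfolding arrow_limit_def l_def[symmetric] k_def[symmetric]
  proof (intro allI impI, elim conjE)
    fix a assume a: "\<forall>j\<in>Obj ?J. a j \<in> carr (ob total_model (Cod A (l j)))"
      and comp: "\<forall>u\<in>Mor ?J. farr (mo total_model (k u)) (a (Dom ?J u)) = a (Cod ?J u)"
    define t where "t j = tag_of (a j)" for j
    define b where "b j = untag (a j)" for j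
    have tb: "a j = tag (t j) (b j)" "t j \<in> el M (Cod A (l j))" "b j \<in> carr (ob F (Cod A (l j), t
        j))"
      if j: "j \<in> Obj ?J" for j
    proof -
      have "a j \<in> carr (total (Cod A (l j)))" using bspec[OF a j] l[OF j] by simp
      then obtain s d where "a j = tag s d" "s \<in> el M (Cod A (l j))" "d \<in> carr (ob F (Cod A (l j),
          s))"
        by (rule total_carrE)
      then show "a j = tag (t j) (b j)" "t j \<in> el M (Cod A (l j))" "b j \<in> carr (ob F (Cod A (l j), t
          j))"
        by (simp_all add: t_def b_def)
    qed
    have comp': "act M (k u) (t (Dom ?J u)) = t (Cod ?J u)"
      "farr (mo F (k u, t (Dom ?J u))) (b (Dom ?J u)) = b (Cod ?J u)" if u: "u \<in> Mor ?J" for u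
      using bspec[OF comp u] tb[OF J.Dom_closed[OF u]] tb[OF J.Cod_closed[OF u]] k[OF u] by simp_all
    have "\<exists>!s. s \<in> el M ?v \<and> (\<forall>j\<in>Obj ?J. act M (ob (legs S) j) s = t j)"
      by (rule set_limit[OF S]) (use tb comp' in \<open>simp_all flip: l_def k_def\<close>)
    then have ex1_s: "\<exists>!s. s \<in> el M ?v \<and> (\<forall>j\<in>Obj ?J. act M (l j) s = t j)" by (simp add: l_def)
    then obtain s where s: "s \<in> el M ?v" "\<And>j. j \<in> Obj ?J \<Longrightarrow> act M (l j) s = t j" by blast
    let ?S = "lift_cone S s"
    have lift: "vertex ?S = (?v, s)" "shape ?S = ?J" "\<And>j. j \<in> Obj ?J \<Longrightarrow> ob (legs ?S) j = (l j, s)"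
      "\<And>u. u \<in> Mor ?J \<Longrightarrow> triangle (mo (legs ?S) u) = (k u, t (Dom ?J u))"
      using k(1) s(2) by (simp_all add: lift_cone_def l_def triangle_def)
    have "arrow_limit (shape ?S) (\<lambda>j. ob F (Cod El (ob (legs ?S) j))) (\<lambda>u. mo F (triangle (mo (legs
        ?S) u)))
        (ob F (vertex ?S)) (\<lambda>j. mo F (ob (legs ?S) j))"
      using model_F lift_cone_marked[OF S s(1)] unfolding PsMod_sel(1)
        pseudo_model_CAT_iff[OF universe_small f_sketch_El discrete_El] by blast
    then have "(\<forall>j\<in>Obj ?J. b j \<in> carr (ob F (Cod El (l j, s)))) \<and>
        (\<forall>u\<in>Mor ?J. farr (mo F (k u, t (Dom ?J u))) (b (Dom ?J u)) = b (Cod ?J u)) \<longrightarrow>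
        (\<exists>!e. e \<in> carr (ob F (?v, s)) \<and> (\<forall>j\<in>Obj ?J. farr (mo F (l j, s)) e = b j))"
      unfolding arrow_limit_def lift(1,2) by (simp add: lift(3,4) cong: ball_cong)
    then have ex1_e: "\<exists>!e. e \<in> carr (ob F (?v, s)) \<and> (\<forall>j\<in>Obj ?J. farr (mo F (l j, s)) e = b j)"
      using tb(3) comp'(2) s(2) by simp
    then obtain e where e: "e \<in> carr (ob F (?v, s))" "\<And>j. j \<in> Obj ?J \<Longrightarrow> farr (mo F (l j, s)) e = b j"
      by blast
    show "\<exists>!e. e \<in> carr (ob total_model ?v) \<and> (\<forall>j\<in>Obj ?J. farr (mo total_model (l j)) e = a j)"
    proof (rule ex1I[of _ "tag s e"])
      show "tag s e \<in> carr (ob total_model ?v) \<and> (\<forall>j\<in>Obj ?J. farr (mo total_model (l j)) (tag s e) =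
          a j)"
        using e s v l tb(1) by simp
      fix e' assume e': "e' \<in> carr (ob total_model ?v) \<and> (\<forall>j\<in>Obj ?J. farr (mo total_model (l j)) e'
          = a j)"
      then have "e' \<in> carr (total ?v)" using v by simp
      then obtain s' d where d: "e' = tag s' d" "s' \<in> el M ?v" "d \<in> carr (ob F (?v, s'))" by (rule
          total_carrE)
      have h: "act M (l j) s' = t j" "farr (mo F (l j, s')) d = b j" if j: "j \<in> Obj ?J" for j
      proof -
        have "farr (total_func (l j)) (tag s' d) = tag (t j) (b j)" using e' j d(1) tb(1)[OF j] by
            simp
        then show "act M (l j) s' = t j" "farr (mo F (l j, s')) d = b j" using d l[OF j] by simp_all
      qed
      have "s' = s" using ex1_s d(2) h(1) s by blast
      moreover have "d = e" using ex1_e d(3) h(2) e unfolding \<open>s' = s\<close> by blast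
      ultimately show "e' = tag s e" using d(1) by simp
    qed
  qed
qed

definition grade_func :: "'o \<Rightarrow> 'u func" where
  "grade_func x = \<lparr>fdom = total x, fcod = disc_cat (el M x), fobj = restrict tag_of (cobj (total
      x)),
     farr = restrict tag_of (carr (total x))\<rparr>"

lemma grade_func_sel [simp]:
  "fdom (grade_func x) = total x" "fcod (grade_func x) = disc_cat (el M x)"
  "\<lbrakk>s \<in> el M x; c \<in> cobj (ob F (x, s))\<rbrakk> \<Longrightarrow> fobj (grade_func x) (tag s c) = s"
  "\<lbrakk>s \<in> el M x; a \<in> carr (ob F (x, s))\<rbrakk> \<Longrightarrow> farr (grade_func x) (tag s a) = s"
  by (simp_all add: grade_func_def)

lemma grade_func_functor:
  assumes x: "x \<in> Obj A"
  shows "cat_functor (grade_func x)"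
proof (intro cat_functor.intro cat_functor_axioms.intro, goal_cases)
  case (3 u)
  then have "u \<in> cobj (total x)" by simp
  then show ?case by (rule total_cobjE) (use x in simp)
next
  case (4 u)
  then have "u \<in> carr (total x)" by simp
  then show ?case by (rule total_carrE) (use x in simp)
next
  case (5 u)
  then have "u \<in> carr (total x)" by simp
  then show ?case by (rule total_carrE) (use x in simp)
next
  case (6 u)
  then have "u \<in> carr (total x)" by simp
  then show ?case by (rule total_carrE) (use x in simp)
next
  case (7 u)
  then have "u \<in> cobj (total x)" by simp
  then show ?case by (rule total_cobjE) (use x in simp)
next
  case (8 f g)
  then have "f \<in> carr (total x)" "g \<in> carr (total x)" "ccod (total x) f = cdom (total x) g" by
      simp_all
  then show ?case by (rule total_composableE) (use x in simp)
qed (use x in \<open>simp_all add: category_disc_cat\<close>, simp_all add: grade_func_def)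

lemma strict_family_grade: "strict_family A total_model (disc A M) grade_func"
  unfolding strict_family_def
proof (intro conjI ballI impI)
  fix f assume f: "f \<in> Mor A"
  then have o: "Dom A f \<in> Obj A" "Cod A f \<in> Obj A" by auto
  have "fobj (grade_func (Cod A f)) (fobj (total_func f) u) = act M f (fobj (grade_func (Dom A f))
      u)"
    "fobj (grade_func (Dom A f)) u \<in> el M (Dom A f)" if "u \<in> cobj (total (Dom A f))" for u
    by (rule total_cobjE[OF that]; use f o in simp)+
  moreover have "farr (grade_func (Cod A f)) (farr (total_func f) u) = act M f (farr (grade_func
      (Dom A f)) u)"
    "farr (grade_func (Dom A f)) u \<in> el M (Dom A f)" if "u \<in> carr (total (Dom A f))" for u
    by (rule total_carrE[OF that]; use f o in simp)+
  ultimately show "func_comp (grade_func (Cod A f)) (mo total_model f)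
      = func_comp (mo (disc A M) f) (grade_func (Dom A f))"
    by (intro func_eqI) (use f o in \<open>simp_all add: cat_functor_comp grade_func_functor
        cat_functor_disc\<close>)
next
  fix f g u assume f: "f \<in> Mor A" "g \<in> Mor A" "Cod A f = Dom A g" and u: "u \<in> cobj (ob total_model
      (Dom A f))"
  then have o: "Dom A f \<in> Obj A" "Cod A g \<in> Obj A" by auto
  then have "u \<in> cobj (total (Dom A f))" using u by simp
  then show "farr (grade_func (Cod A g)) (ncomp (cp total_model g f) u)
      = ncomp (cp (disc A M) g f) (fobj (grade_func (Dom A f)) u)"
    by (rule total_cobjE) (use f o in simp)
qed (simp_all add: grade_func_functor)

text \<open>Reading off the tag is strictly natural, so it defines a 1-cell to the discrete pseudo-model.\<close>

definition grading :: "('o, 'm, 'c, 'u cat, 'u func, 'u nattr) pstrans" where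
  "grading = strict_trans A total_model (disc A M) grade_func"

lemma grading_Sl: "grading \<in> Obj Sl"
proof -
  have "pseudo_f_transformation A (CAT small) grading"
    unfolding grading_def using pseudo_f_functor_total pseudo_f_functor_disc discrete
        strict_family_grade
    by (intro strict_trans_pseudo) (simp_all add: cat_pf_def cat_pf_axioms_def)
  then show ?thesis
    using pseudo_model_total pseudo_model_disc by (simp add: Sl_Obj_iff PsMod_sel(2)) (simp add:
        grading_def)
qed

lemma tdom_grading [simp]: "tdom grading = total_model"
  by (simp add: grading_def)

lemma tcomp_grading [simp]: "x \<in> Obj A \<Longrightarrow> tcomp grading x = grade_func x"
  by (simp add: grading_def)

lemma fibre_grading [simp]:
  assumes "x \<in> Obj A" "s \<in> el M x"
  shows "fibre_cat grading (x, s) = fib (total x) (fobj (grade_func x)) s"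
    "c \<in> cobj (ob F (x, s)) \<Longrightarrow> tag s c \<in> cobj (fib (total x) (fobj (grade_func x)) s)"
    "a \<in> carr (ob F (x, s)) \<Longrightarrow> tag s a \<in> carr (fib (total x) (fobj (grade_func x)) s)"
  using assms by (simp_all add: grading_def)

lemma fibre_gradingE:
  assumes "x \<in> Obj A" "s \<in> el M x"
  shows "\<lbrakk>u \<in> cobj (fib (total x) (fobj (grade_func x)) s);
      \<And>c. \<lbrakk>u = tag s c; c \<in> cobj (ob F (x, s))\<rbrakk> \<Longrightarrow> thesis\<rbrakk> \<Longrightarrow> thesis"
    and "\<lbrakk>u \<in> carr (fib (total x) (fobj (grade_func x)) s);
      \<And>a. \<lbrakk>u = tag s a; a \<in> carr (ob F (x, s))\<rbrakk> \<Longrightarrow> thesis\<rbrakk> \<Longrightarrow> thesis"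
  using assms by (auto elim!: total_cobjE total_carrE)

definition untag_func :: "'o \<times> 'u \<Rightarrow> 'u func" where
  "untag_func e = \<lparr>fdom = fibre_cat grading e, fcod = ob F e,
     fobj = restrict untag (cobj (fibre_cat grading e)), farr = restrict untag (carr (fibre_cat
         grading e))\<rparr>"

definition tag_func :: "'o \<times> 'u \<Rightarrow> 'u func" where
  "tag_func e = \<lparr>fdom = ob F e, fcod = fibre_cat grading e,
     fobj = restrict (tag (snd e)) (cobj (ob F e)), farr = restrict (tag (snd e)) (carr (ob F e))\<rparr>"

lemma untag_func_sel [simp]:
  "fdom (untag_func e) = fibre_cat grading e" "fcod (untag_func e) = ob F e"
  "\<lbrakk>x \<in> Obj A; s \<in> el M x; c \<in> cobj (ob F (x, s))\<rbrakk> \<Longrightarrow> fobj (untag_func (x, s)) (tag s c) = c"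
  "\<lbrakk>x \<in> Obj A; s \<in> el M x; a \<in> carr (ob F (x, s))\<rbrakk> \<Longrightarrow> farr (untag_func (x, s)) (tag s a) = a"
  by (simp_all add: untag_func_def)

lemma tag_func_sel [simp]:
  "fdom (tag_func e) = ob F e" "fcod (tag_func e) = fibre_cat grading e"
  "c \<in> cobj (ob F (x, s)) \<Longrightarrow> fobj (tag_func (x, s)) c = tag s c"
  "a \<in> carr (ob F (x, s)) \<Longrightarrow> farr (tag_func (x, s)) a = tag s a"
  by (simp_all add: tag_func_def)

sublocale grading: over_disc small A M grading
  using grading_Sl by (rule Sl_over_disc)

lemma category_fibre_grading [simp]:
  "x \<in> Obj A \<Longrightarrow> category (fib (total x) (fobj (grade_func x)) s)"
  using grading.category_fibre[of x s] by simp

lemma tag_func_functor: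
  assumes "x \<in> Obj A" "s \<in> el M x"
  shows "cat_functor (tag_func (x, s))"
  by (intro cat_functor.intro cat_functor_axioms.intro)
    (use assms in \<open>simp_all\<close>, simp_all add: tag_func_def)

lemma untag_func_functor:
  assumes xs: "x \<in> Obj A" "s \<in> el M x"
  shows "cat_functor (untag_func (x, s))"
proof (intro cat_functor.intro cat_functor_axioms.intro, goal_cases)
  case (3 u)
  then have "u \<in> cobj (fib (total x) (fobj (grade_func x)) s)" using xs by simp
  then show ?case by (rule fibre_gradingE(1)[OF xs]) (use xs in simp)
next
  case (4 u)
  then have "u \<in> carr (fib (total x) (fobj (grade_func x)) s)" using xs by simp
  then show ?case by (rule fibre_gradingE(2)[OF xs]) (use xs in simp)
next
  case (5 u)
  then have "u \<in> carr (fib (total x) (fobj (grade_func x)) s)" using xs by simp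
  then show ?case by (rule fibre_gradingE(2)[OF xs]) (use xs in simp)
next
  case (6 u)
  then have "u \<in> carr (fib (total x) (fobj (grade_func x)) s)" using xs by simp
  then show ?case by (rule fibre_gradingE(2)[OF xs]) (use xs in simp)
next
  case (7 u)
  then have "u \<in> cobj (fib (total x) (fobj (grade_func x)) s)" using xs by simp
  then show ?case by (rule fibre_gradingE(1)[OF xs]) (use xs in simp)
next
  case (8 u w)
  then have m: "u \<in> carr (fib (total x) (fobj (grade_func x)) s)" "w \<in> carr (fib (total x) (fobj
      (grade_func x)) s)"
    using xs by simp_all
  obtain a where a: "u = tag s a" "a \<in> carr (ob F (x, s))" by (rule fibre_gradingE(2)[OF xs m(1)])
  obtain b where b: "w = tag s b" "b \<in> carr (ob F (x, s))" by (rule fibre_gradingE(2)[OF xs m(2)])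
  have "ccod (ob F (x, s)) a = cdom (ob F (x, s)) b" using 8(3) a b xs by simp
  then show ?case using a b xs by simp
qed (use xs in \<open>simp_all\<close>, simp_all add: untag_func_def)

lemma strict_family_untag: "strict_family El (fibre_ob grading) F untag_func"
  unfolding strict_family_def
proof (intro conjI ballI impI)
  fix e assume "e \<in> Obj El"
  then show "cat_functor (untag_func e)" by (cases e) (simp add: untag_func_functor)
next
  fix \<phi> assume \<phi>: "\<phi> \<in> Mor El"
  obtain f s where fs: "\<phi> = (f, s)" by (cases \<phi>)
  have f: "f \<in> Mor A" "s \<in> el M (Dom A f)" and o: "Dom A f \<in> Obj A" "Cod A f \<in> Obj A"
    using \<phi> by (auto simp: fs)
  let ?D = "fib (total (Dom A f)) (fobj (grade_func (Dom A f))) s"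
  have "fobj (untag_func (Cod A f, act M f s)) (fobj (fibre_func grading (f, s)) u)
      = fobj (mo F (f, s)) (fobj (untag_func (Dom A f, s)) u)" if "u \<in> cobj ?D" for u
    by (rule fibre_gradingE(1)[OF o(1) f(2) that]) (use f o in simp)
  moreover have "farr (untag_func (Cod A f, act M f s)) (farr (fibre_func grading (f, s)) u)
      = farr (mo F (f, s)) (farr (untag_func (Dom A f, s)) u)" if "u \<in> carr ?D" for u
    by (rule fibre_gradingE(2)[OF o(1) f(2) that]) (use f o in simp)
  ultimately have "func_comp (untag_func (Cod A f, act M f s)) (fibre_func grading (f, s))
      = func_comp (mo F (f, s)) (untag_func (Dom A f, s))"
    by (intro func_eqI)
      (use f o in \<open>simp_all add: cat_functor_comp untag_func_functor grading.fibre_func_functor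
        del: fib_sel(1,2)\<close>)
  then show "func_comp (untag_func (Cod El \<phi>)) (mo (fibre_ob grading) \<phi>) = func_comp (mo F \<phi>)
      (untag_func (Dom El \<phi>))"
    by (simp add: fs)
next
  fix \<phi> \<psi> u assume "\<phi> \<in> Mor El" "\<psi> \<in> Mor El" "Cod El \<phi> = Dom El \<psi>"
    and u: "u \<in> cobj (ob (fibre_ob grading) (Dom El \<phi>))"
  then obtain f g s where fs: "\<phi> = (f, s)" "\<psi> = (g, act M f s)" and f: "f \<in> Mor A" "g \<in> Mor A"
    "Cod A f = Dom A g" "s \<in> el M (Dom A f)" by (cases \<phi>; cases \<psi>) auto
  have o: "Dom A f \<in> Obj A" "Dom A g \<in> Obj A" "Cod A g \<in> Obj A" using f by auto
  have "u \<in> cobj (fib (total (Dom A f)) (fobj (grade_func (Dom A f))) s)" using u fs f o by simp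
  then show "farr (untag_func (Cod El \<psi>)) (ncomp (cp (fibre_ob grading) \<psi> \<phi>) u)
      = ncomp (cp F \<psi> \<phi>) (fobj (untag_func (Dom El \<phi>)) u)"
    by (rule fibre_gradingE(1)[OF o(1) f(4)]) (use f o fs in simp)
qed simp_all

text \<open>Fibres of the coproduct are its summands, up to removing the tags.\<close>

lemma fibre_grading_iso: "\<exists>e\<in>hom PsE (fibre_ob grading) F. invertible_mor PsE e"
  \<comment> \<open>the inverse attaches the tag\<close>
proof (rule strict_iso[OF discrete_El fibre_ob_PsE[OF grading_Sl] model_F strict_family_untag,
      where \<theta>' = tag_func], goal_cases)
  case (1 e)
  then show ?case by (cases e) (simp add: tag_func_functor)
next
  case (2 e)
  obtain x s where e: "e = (x, s)" by (cases e)
  have xs: "x \<in> Obj A" "s \<in> el M x" using 2 by (simp_all add: e)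
  let ?D = "fib (total x) (fobj (grade_func x)) s"
  have "fobj (tag_func (x, s)) (fobj (untag_func (x, s)) u) = u" if "u \<in> cobj ?D" for u
    by (rule fibre_gradingE(1)[OF xs that]) (use xs in simp)
  moreover have "farr (tag_func (x, s)) (farr (untag_func (x, s)) u) = u" if "u \<in> carr ?D" for u
    by (rule fibre_gradingE(2)[OF xs that]) (use xs in simp)
  ultimately have "func_comp (tag_func (x, s)) (untag_func (x, s)) = func_id ?D"
    by (intro func_eqI)
      (use xs in \<open>simp_all add: cat_functor_comp cat_functor_id untag_func_functor tag_func_functor
        del: fib_sel(1,2)\<close>)
  then show ?case using xs by (simp add: e)
next
  case (3 e)
  obtain x s where e: "e = (x, s)" by (cases e)
  have xs: "x \<in> Obj A" "s \<in> el M x" using 3 by (simp_all add: e)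
  have "func_comp (untag_func (x, s)) (tag_func (x, s)) = func_id (ob F (x, s))"
    by (intro func_eqI)
      (use xs in \<open>simp_all add: cat_functor_comp cat_functor_id untag_func_functor
          tag_func_functor\<close>)
  then show ?case by (simp add: e)
qed

end

section \<open>The equivalence\<close>

context sketch_model
begin

theorem equivalent_slice_elements: "equivalent_twocats Sl PsE"
proof (rule equivalent_twocats_if_ff_eso[OF strict_twofunctor_fibre], goal_cases)
  case (1 f f')
  obtain p h q where f: "f = (p, h, q)" by (cases f) auto
  obtain p' h' q' where f': "f' = (p', h', q')" by (cases f') auto
  show ?case using 1 fibre_tr_faithful[of p h q h'] by (simp add: f f' slice_sel(4,5))
next
  case (2 p q k)
  then show ?case using fibre_tr_full[of p q k]
    by (force simp: hom_def PsMod_sel(4,5) slice_sel(4,5))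
next
  case (3 \<gamma> \<gamma>')
  obtain p \<Gamma> q where g: "\<gamma> = (p, \<Gamma>, q)" by (cases \<gamma>) auto
  obtain p' \<Gamma>' q' where g': "\<gamma>' = (p', \<Gamma>', q')" by (cases \<gamma>') auto
  show ?case using 3 fibre_md_faithful[of p \<Gamma> q \<Gamma>'] by (simp add: g g' slice_sel(6,7)
      PsMod_sel(6,7))
next
  case (4 f f' \<kappa>)
  obtain p h q where f: "f = (p, h, q)" by (cases f) auto
  obtain p' h' q' where f': "f' = (p', h', q')" by (cases f') auto
  have e: "p' = p" "q' = q" using 4 by (simp_all add: f f' slice_sel(4,5))
  obtain \<Gamma> where "(p, \<Gamma>, q) \<in> Cell Sl" "mdom \<Gamma> = h" "mcod \<Gamma> = h'" "fibre_md p \<Gamma> q = \<kappa>"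
    using 4 fibre_md_full[of p h q h' \<kappa>] by (auto simp: f f' e cells_def PsMod_sel(6,7))
  then show ?case
    by (intro bexI[of _ "(p, \<Gamma>, q)"]) (simp_all add: cells_def f f' e slice_sel(6,7) PsMod_sel(6,7))
next
  case (5 F)
  interpret element_family small A M F by unfold_locales (rule 5)
  show ?case using grading_Sl fibre_grading_iso by auto
qed

end

theorem theorem3p13:
  fixes small :: "'u set \<Rightarrow> bool"
    and A :: "('o, 'm, 'c, 'i, 'j, 'k) fsketch"
    and M :: "('o, 'm, 'u) setfun"
  assumes "universe small"
    and "f_sketch A"
    and "locally_discrete A"
    and "set_model small A M"
  shows "equivalent_twocats
           (slice (PsMod A (CAT small)) (disc A M))
           (PsMod (elements A M) (CAT small))"
proof -
  interpret sketch_model small A M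
    by (intro sketch_model.intro sketch_model_axioms.intro assms)
  show ?thesis by (rule equivalent_slice_elements)
qed

end
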